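(* Let $X$ be a complex analytic manifold and ${\mathscr F}$ a coherent ${\mathscr O}$-module on $X$. If ${\mathscr F}$ is a reflexive sheaf, then the map $${\mathcal C}\in{\rm Hom}_{\mathscr O}\big({\mathscr F},\Omega^k\otimes_{\mathscr O}{\mathscr F}\big)\mapsto C\in\Gamma\big(X,\Omega^k\otimes_{\mathscr O}{\mathscr End}({\mathscr F})\big)$$ is a bijective correspondence.
   Context: ${\mathscr O}$ is the sheaf of holomorphic functions on $X$ and $\Omega^k$ the sheaf of holomorphic $k$-forms. Let $Z$ be the singularity set of ${\mathscr F}$ (the closed analytic set outside which ${\mathscr F}$ is locally free). The map ${\mathcal C}\mapsto C$ is defined as follows: restrict ${\mathcal C}$ to $X\setminus Z$; since ${\mathscr F}|_{X\setminus Z}$ is locally free, the natural isomorphism $\Omega^k\otimes_{\mathscr O}{\mathscr End}({\mathscr F})\simeq{\mathscr Hom}_{\mathscr O}({\mathscr F},\Omega^k\otimes_{\mathscr O}{\mathscr F})$ on $X\setminus Z$ (sending $\alpha\otimes f$ to $\sigma\mapsto\alpha\otimes f(\sigma)$) gives an element of $\Gamma(X\setminus Z,\Omega^k\otimes_{\mathscr O}{\mathscr End}({\mathscr F}))$; and $C$ is the element of $\Gamma(X,\Omega^k\otimes_{\mathscr O}{\mathscr End}({\mathscr F}))$ corresponding to it under the restriction isomorphism $\Gamma(X,\Omega^k\otimes_{\mathscr O}{\mathscr End}({\mathscr F}))\simeq\Gamma(X\setminus Z,\Omega^k\otimes_{\mathscr O}{\mathscr End}({\mathscr F}))$. *)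

theory Defs
  imports
    "HOL-Analysis.Analysis"
    "HOL-Algebra.Free_Abelian_Groups"
    "HOL-Algebra.Module"
    "HOL-Combinatorics.Permutations"
begin

section \<open>Complex analytic manifolds\<close>

text \<open>
  Complex \<open>n\<close>-space is realised as a subspace of \<open>nat \<Rightarrow> complex\<close> with the product topology
  (compare \<open>Euclidean_space\<close>), so that \<open>n\<close> is a term, \<open>n = 0\<close> is allowed, and charts on
  different components may have different dimensions.
\<close>

definition complex_space :: "nat \<Rightarrow> (nat \<Rightarrow> complex) set" where
  "complex_space n = {z. \<forall>i\<ge>n. z i = 0}"

definition partial_deriv :: "nat \<Rightarrow> ((nat \<Rightarrow> complex) \<Rightarrow> complex) \<Rightarrow> (nat \<Rightarrow> complex) \<Rightarrow> complex" where
  "partial_deriv i g z = deriv (\<lambda>t. g (z(i := t))) (z i)"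

text \<open>
  Meant for \<open>S\<close> relatively open in \<open>complex_space n\<close>: then \<open>z(i := t)\<close> stays in \<open>S\<close> for \<open>t\<close> near \<open>z i\<close>,
  and values of \<open>g\<close> outside \<open>S\<close> do not matter.
\<close>

definition holomorphic_several ::
    "nat \<Rightarrow> (nat \<Rightarrow> complex) set \<Rightarrow> ((nat \<Rightarrow> complex) \<Rightarrow> complex) \<Rightarrow> bool" where
  "holomorphic_several n S g \<longleftrightarrow>
     continuous_on S g \<and>
     (\<forall>z\<in>S. \<forall>i<n. (\<lambda>t. g (z(i := t))) field_differentiable at (z i))"

record 'p chart =
  chart_dim :: nat
  chart_dom :: "'p set"
  chart_map :: "'p \<Rightarrow> nat \<Rightarrow> complex"

definition chart_inv :: "'p chart \<Rightarrow> (nat \<Rightarrow> complex) \<Rightarrow> 'p" where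
  "chart_inv c = inv_into (chart_dom c) (chart_map c)"

definition is_chart :: "'p topology \<Rightarrow> 'p chart \<Rightarrow> bool" where
  "is_chart X c \<longleftrightarrow>
     openin X (chart_dom c) \<and>
     openin (top_of_set (complex_space (chart_dim c))) (chart_map c ` chart_dom c) \<and>
     homeomorphic_map (subtopology X (chart_dom c)) (top_of_set (chart_map c ` chart_dom c))
       (chart_map c)"

definition complex_manifold :: "'p topology \<Rightarrow> 'p chart set \<Rightarrow> bool" where
  "complex_manifold X \<A> \<longleftrightarrow>
     Hausdorff_space X \<and> second_countable X \<and>
     (\<forall>c\<in>\<A>. is_chart X c) \<and>
     (\<Union>c\<in>\<A>. chart_dom c) = topspace X \<and>
     (\<forall>c\<in>\<A>. \<forall>d\<in>\<A>. \<forall>j<chart_dim d.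
        holomorphic_several (chart_dim c) (chart_map c ` (chart_dom c \<inter> chart_dom d))
          (\<lambda>z. chart_map d (chart_inv c z) j))"

section \<open>Sheaves of modules\<close>

definition opens_in :: "'p topology \<Rightarrow> 'p set \<Rightarrow> 'p set set" where
  "opens_in X U = {V. openin X V \<and> V \<subseteq> U}"

text \<open>
  \<open>restr F U V\<close> is the restriction map from \<open>U\<close> to \<open>V\<close>.  Values of \<open>sections\<close> and \<open>restr\<close> at sets
  that are not open are irrelevant.
\<close>

record ('p, 'm, 's) presheaf =
  sections :: "'p set \<Rightarrow> 's"
  restr :: "'p set \<Rightarrow> 'p set \<Rightarrow> 'm \<Rightarrow> 'm"

type_synonym ('p, 'r) ring_presheaf = "('p, 'r, 'r ring) presheaf"
type_synonym ('p, 'r, 'm) module_presheaf = "('p, 'm, ('r, 'm) module) presheaf"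

definition module_hom :: "'r ring \<Rightarrow> ('r, 'm) module \<Rightarrow> ('r, 'l) module \<Rightarrow> ('m \<Rightarrow> 'l) set" where
  "module_hom R M N =
     {h \<in> carrier M \<rightarrow>\<^sub>E carrier N.
        (\<forall>x\<in>carrier M. \<forall>y\<in>carrier M. h (x \<oplus>\<^bsub>M\<^esub> y) = h x \<oplus>\<^bsub>N\<^esub> h y) \<and>
        (\<forall>r\<in>carrier R. \<forall>x\<in>carrier M. h (r \<odot>\<^bsub>M\<^esub> x) = r \<odot>\<^bsub>N\<^esub> h x)}"

definition presheaf_of_modules ::
    "'p topology \<Rightarrow> ('p, 'r) ring_presheaf \<Rightarrow> ('p, 'r, 'm) module_presheaf \<Rightarrow> bool" where
  "presheaf_of_modules X \<O> F \<longleftrightarrow>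
     (\<forall>U. openin X U \<longrightarrow> module (sections \<O> U) (sections F U)) \<and>
     (\<forall>U V. openin X U \<and> openin X V \<and> V \<subseteq> U \<longrightarrow>
        restr F U V \<in> carrier (sections F U) \<rightarrow> carrier (sections F V) \<and>
        (\<forall>s\<in>carrier (sections F U). \<forall>t\<in>carrier (sections F U).
           restr F U V (s \<oplus>\<^bsub>sections F U\<^esub> t)
             = restr F U V s \<oplus>\<^bsub>sections F V\<^esub> restr F U V t) \<and>
        (\<forall>r\<in>carrier (sections \<O> U). \<forall>s\<in>carrier (sections F U).
           restr F U V (r \<odot>\<^bsub>sections F U\<^esub> s)
             = restr \<O> U V r \<odot>\<^bsub>sections F V\<^esub> restr F U V s)) \<and>
     (\<forall>U. openin X U \<longrightarrow> (\<forall>s\<in>carrier (sections F U). restr F U U s = s)) \<and>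
     (\<forall>U V W. openin X U \<and> openin X V \<and> openin X W \<and> W \<subseteq> V \<and> V \<subseteq> U \<longrightarrow>
        (\<forall>s\<in>carrier (sections F U). restr F V W (restr F U V s) = restr F U W s))"

definition sheaf_of_modules ::
    "'p topology \<Rightarrow> ('p, 'r) ring_presheaf \<Rightarrow> ('p, 'r, 'm) module_presheaf \<Rightarrow> bool" where
  "sheaf_of_modules X \<O> F \<longleftrightarrow>
     presheaf_of_modules X \<O> F \<and>
     (\<forall>\<U> s. (\<forall>U\<in>\<U>. openin X U \<and> s U \<in> carrier (sections F U)) \<and>
        (\<forall>U\<in>\<U>. \<forall>V\<in>\<U>. restr F U (U \<inter> V) (s U) = restr F V (U \<inter> V) (s V)) \<longrightarrow>
        (\<exists>!t. t \<in> carrier (sections F (\<Union>\<U>)) \<and> (\<forall>U\<in>\<U>. restr F (\<Union>\<U>) U t = s U)))"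

text \<open>
  \<open>sheaf_hom X \<O> F G U\<close> is the set of morphisms of \<open>\<O>\<close>-modules from \<open>F\<close> to \<open>G\<close>, both restricted
  to \<open>U\<close>.  A morphism is a family of maps indexed by the open subsets of \<open>U\<close>, undefined elsewhere,
  so that equal morphisms are equal as functions.
\<close>

definition sheaf_hom ::
    "'p topology \<Rightarrow> ('p, 'r) ring_presheaf \<Rightarrow> ('p, 'r, 'm) module_presheaf \<Rightarrow>
     ('p, 'r, 'l) module_presheaf \<Rightarrow> 'p set \<Rightarrow> ('p set \<Rightarrow> 'm \<Rightarrow> 'l) set" where
  "sheaf_hom X \<O> F G U =
     {\<phi> \<in> (\<Pi>\<^sub>E V\<in>opens_in X U. module_hom (sections \<O> V) (sections F V) (sections G V)).
        \<forall>V\<in>opens_in X U. \<forall>W\<in>opens_in X V. \<forall>s\<in>carrier (sections F V).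
          \<phi> W (restr F V W s) = restr G V W (\<phi> V s)}"

text \<open>In the modules below the ring operations \<open>mult\<close> and \<open>one\<close> of the record play no role.\<close>

definition hom_sheaf ::
    "'p topology \<Rightarrow> ('p, 'r) ring_presheaf \<Rightarrow> ('p, 'r, 'm) module_presheaf \<Rightarrow>
     ('p, 'r, 'l) module_presheaf \<Rightarrow> ('p, 'r, 'p set \<Rightarrow> 'm \<Rightarrow> 'l) module_presheaf" where
  "hom_sheaf X \<O> F G =
     \<lparr>sections = (\<lambda>U.
        \<lparr>carrier = sheaf_hom X \<O> F G U, mult = undefined, one = undefined,
         zero = (\<lambda>V\<in>opens_in X U. \<lambda>s\<in>carrier (sections F V). \<zero>\<^bsub>sections G V\<^esub>),
         add = (\<lambda>\<phi> \<psi>. \<lambda>V\<in>opens_in X U. \<lambda>s\<in>carrier (sections F V).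
                  \<phi> V s \<oplus>\<^bsub>sections G V\<^esub> \<psi> V s),
         smult = (\<lambda>r \<phi>. \<lambda>V\<in>opens_in X U. \<lambda>s\<in>carrier (sections F V).
                  restr \<O> U V r \<odot>\<^bsub>sections G V\<^esub> \<phi> V s)\<rparr>),
      restr = (\<lambda>U V \<phi>. restrict \<phi> (opens_in X V))\<rparr>"

abbreviation end_sheaf ::
    "'p topology \<Rightarrow> ('p, 'r) ring_presheaf \<Rightarrow> ('p, 'r, 'm) module_presheaf \<Rightarrow>
     ('p, 'r, 'p set \<Rightarrow> 'm \<Rightarrow> 'm) module_presheaf" where
  "end_sheaf X \<O> F \<equiv> hom_sheaf X \<O> F F"

definition structure_module :: "('p, 'r) ring_presheaf \<Rightarrow> ('p, 'r, 'r) module_presheaf" where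
  "structure_module \<O> =
     \<lparr>sections = (\<lambda>U.
        \<lparr>carrier = carrier (sections \<O> U), mult = mult (sections \<O> U), one = one (sections \<O> U),
         zero = zero (sections \<O> U), add = add (sections \<O> U), smult = mult (sections \<O> U)\<rparr>),
      restr = restr \<O>\<rparr>"

definition free_sheaf :: "('p, 'r) ring_presheaf \<Rightarrow> nat \<Rightarrow> ('p, 'r, nat \<Rightarrow> 'r) module_presheaf" where
  "free_sheaf \<O> n =
     \<lparr>sections = (\<lambda>U.
        \<lparr>carrier = {..<n} \<rightarrow>\<^sub>E carrier (sections \<O> U), mult = undefined, one = undefined,
         zero = (\<lambda>i\<in>{..<n}. \<zero>\<^bsub>sections \<O> U\<^esub>),
         add = (\<lambda>a b. \<lambda>i\<in>{..<n}. a i \<oplus>\<^bsub>sections \<O> U\<^esub> b i),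
         smult = (\<lambda>r a. \<lambda>i\<in>{..<n}. r \<otimes>\<^bsub>sections \<O> U\<^esub> a i)\<rparr>),
      restr = (\<lambda>U V a. \<lambda>i\<in>{..<n}. restr \<O> U V (a i))\<rparr>"

definition kernel_sheaf ::
    "('p, 'r, 'm) module_presheaf \<Rightarrow> ('p, 'r, 'l) module_presheaf \<Rightarrow> ('p set \<Rightarrow> 'm \<Rightarrow> 'l) \<Rightarrow>
     ('p, 'r, 'm) module_presheaf" where
  "kernel_sheaf F G \<phi> =
     \<lparr>sections = (\<lambda>U. (sections F U)
        \<lparr>carrier := {s \<in> carrier (sections F U). \<phi> U s = \<zero>\<^bsub>sections G U\<^esub>}\<rparr>),
      restr = restr F\<rparr>"

definition sheaf_surjective ::
    "'p topology \<Rightarrow> ('p, 'r, 'm) module_presheaf \<Rightarrow> ('p, 'r, 'l) module_presheaf \<Rightarrow> 'p set \<Rightarrow>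
     ('p set \<Rightarrow> 'm \<Rightarrow> 'l) \<Rightarrow> bool" where
  "sheaf_surjective X F G U \<phi> \<longleftrightarrow>
     (\<forall>V\<in>opens_in X U. \<forall>t\<in>carrier (sections G V). \<forall>x\<in>V.
        \<exists>W\<in>opens_in X V. x \<in> W \<and> (\<exists>s\<in>carrier (sections F W). \<phi> W s = restr G V W t))"

definition finite_type_on ::
    "'p topology \<Rightarrow> ('p, 'r) ring_presheaf \<Rightarrow> 'p set \<Rightarrow> ('p, 'r, 'm) module_presheaf \<Rightarrow> bool" where
  "finite_type_on X \<O> U F \<longleftrightarrow>
     (\<forall>x\<in>U. \<exists>V\<in>opens_in X U. x \<in> V \<and>
        (\<exists>n. \<exists>\<phi>\<in>sheaf_hom X \<O> (free_sheaf \<O> n) F V. sheaf_surjective X (free_sheaf \<O> n) F V \<phi>))"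

definition coherent_sheaf ::
    "'p topology \<Rightarrow> ('p, 'r) ring_presheaf \<Rightarrow> ('p, 'r, 'm) module_presheaf \<Rightarrow> bool" where
  "coherent_sheaf X \<O> F \<longleftrightarrow>
     sheaf_of_modules X \<O> F \<and>
     finite_type_on X \<O> (topspace X) F \<and>
     (\<forall>U n. \<forall>\<phi>\<in>sheaf_hom X \<O> (free_sheaf \<O> n) F U. openin X U \<longrightarrow>
        finite_type_on X \<O> U (kernel_sheaf (free_sheaf \<O> n) F \<phi>))"

definition dual_sheaf ::
    "'p topology \<Rightarrow> ('p, 'r) ring_presheaf \<Rightarrow> ('p, 'r, 'm) module_presheaf \<Rightarrow>
     ('p, 'r, 'p set \<Rightarrow> 'm \<Rightarrow> 'r) module_presheaf" where
  "dual_sheaf X \<O> F = hom_sheaf X \<O> F (structure_module \<O>)"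

definition bidual_map ::
    "'p topology \<Rightarrow> ('p, 'r) ring_presheaf \<Rightarrow> ('p, 'r, 'm) module_presheaf \<Rightarrow> 'p set \<Rightarrow>
     'm \<Rightarrow> 'p set \<Rightarrow> ('p set \<Rightarrow> 'm \<Rightarrow> 'r) \<Rightarrow> 'r" where
  "bidual_map X \<O> F U s =
     (\<lambda>V\<in>opens_in X U. \<lambda>\<phi>\<in>carrier (sections (dual_sheaf X \<O> F) V). \<phi> V (restr F U V s))"

definition reflexive_sheaf ::
    "'p topology \<Rightarrow> ('p, 'r) ring_presheaf \<Rightarrow> ('p, 'r, 'm) module_presheaf \<Rightarrow> bool" where
  "reflexive_sheaf X \<O> F \<longleftrightarrow>
     (\<forall>U. openin X U \<longrightarrow>
        bij_betw (bidual_map X \<O> F U) (carrier (sections F U))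
          (carrier (sections (dual_sheaf X \<O> (dual_sheaf X \<O> F)) U)))"

definition free_on ::
    "'p topology \<Rightarrow> ('p, 'r) ring_presheaf \<Rightarrow> ('p, 'r, 'm) module_presheaf \<Rightarrow> 'p set \<Rightarrow> bool" where
  "free_on X \<O> F U \<longleftrightarrow>
     (\<exists>n. \<exists>\<phi>\<in>sheaf_hom X \<O> (free_sheaf \<O> n) F U. \<forall>V\<in>opens_in X U.
        bij_betw (\<phi> V) (carrier (sections (free_sheaf \<O> n) V)) (carrier (sections F V)))"

definition singularity_set ::
    "'p topology \<Rightarrow> ('p, 'r) ring_presheaf \<Rightarrow> ('p, 'r, 'm) module_presheaf \<Rightarrow> 'p set" where
  "singularity_set X \<O> F = {x \<in> topspace X. \<nexists>U. openin X U \<and> x \<in> U \<and> free_on X \<O> F U}"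

section \<open>Tensor products\<close>

text \<open>
  The tensor product of modules is the free abelian group on pairs modulo the subgroup generated
  by the bilinearity relations; its elements are cosets.
\<close>

type_synonym ('a, 'b) tensor = "(('a \<times> 'b) \<Rightarrow>\<^sub>0 int) set"

definition tensor_relations ::
    "'r ring \<Rightarrow> ('r, 'a) module \<Rightarrow> ('r, 'b) module \<Rightarrow> (('a \<times> 'b) \<Rightarrow>\<^sub>0 int) set" where
  "tensor_relations R M N =
     generate (free_Abelian_group (carrier M \<times> carrier N))
       ({frag_of (a \<oplus>\<^bsub>M\<^esub> a', b) - frag_of (a, b) - frag_of (a', b) | a a' b.
           a \<in> carrier M \<and> a' \<in> carrier M \<and> b \<in> carrier N} \<union>
        {frag_of (a, b \<oplus>\<^bsub>N\<^esub> b') - frag_of (a, b) - frag_of (a, b') | a b b'.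
           a \<in> carrier M \<and> b \<in> carrier N \<and> b' \<in> carrier N} \<union>
        {frag_of (r \<odot>\<^bsub>M\<^esub> a, b) - frag_of (a, r \<odot>\<^bsub>N\<^esub> b) | r a b.
           r \<in> carrier R \<and> a \<in> carrier M \<and> b \<in> carrier N})"

text \<open>
  The additive map between tensor products sending the class of a pair \<open>p\<close> to the class of \<open>g p\<close>;
  \<open>R\<close>, \<open>M\<close>, \<open>N\<close> describe the target.  It is used only where \<open>g\<close> preserves the relations, so that
  all cosets in the union coincide.
\<close>

definition tensor_map ::
    "'r ring \<Rightarrow> ('r, 'c) module \<Rightarrow> ('r, 'd) module \<Rightarrow> ('a \<times> 'b \<Rightarrow> 'c \<times> 'd) \<Rightarrow>
     ('a, 'b) tensor \<Rightarrow> ('c, 'd) tensor" where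
  "tensor_map R M N g T =
     (\<Union>w\<in>T. tensor_relations R M N #>\<^bsub>free_Abelian_group (carrier M \<times> carrier N)\<^esub>
        frag_extend (\<lambda>p. frag_of (g p)) w)"

definition tensor_module ::
    "'r ring \<Rightarrow> ('r, 'a) module \<Rightarrow> ('r, 'b) module \<Rightarrow> ('r, ('a, 'b) tensor) module" where
  "tensor_module R M N =
     (let Q = free_Abelian_group (carrier M \<times> carrier N) Mod tensor_relations R M N in
      \<lparr>carrier = carrier Q, mult = undefined, one = undefined,
       zero = one Q, add = mult Q,
       smult = (\<lambda>r. tensor_map R M N (\<lambda>(a, b). (r \<odot>\<^bsub>M\<^esub> a, b)))\<rparr>)"

definition tensor_presheaf ::
    "('p, 'r) ring_presheaf \<Rightarrow> ('p, 'r, 'a) module_presheaf \<Rightarrow> ('p, 'r, 'b) module_presheaf \<Rightarrow>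
     ('p, 'r, ('a, 'b) tensor) module_presheaf" where
  "tensor_presheaf \<O> A B =
     \<lparr>sections = (\<lambda>U. tensor_module (sections \<O> U) (sections A U) (sections B U)),
      restr = (\<lambda>U V. tensor_map (sections \<O> V) (sections A V) (sections B V)
                 (\<lambda>(a, b). (restr A U V a, restr B U V b)))\<rparr>"

text \<open>
  Sheafification: sections over \<open>U\<close> are the functions assigning to each point a germ of the presheaf
  there, locally given by sections of the presheaf.  A germ is an equivalence class of pairs of a
  neighbourhood and a section; operations on germs are unions over representatives, all of which
  give the same germ.
\<close>

type_synonym ('p, 'm) germ = "('p set \<times> 'm) set"

definition germ ::
    "'p topology \<Rightarrow> ('p, 'r, 'm) module_presheaf \<Rightarrow> 'p \<Rightarrow> 'p set \<Rightarrow> 'm \<Rightarrow> ('p, 'm) germ" where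
  "germ X P x U s =
     {(V, t). openin X V \<and> x \<in> V \<and> t \<in> carrier (sections P V) \<and>
        (\<exists>W\<in>opens_in X (U \<inter> V). x \<in> W \<and> restr P U W s = restr P V W t)}"

definition sheafify ::
    "'p topology \<Rightarrow> ('p, 'r) ring_presheaf \<Rightarrow> ('p, 'r, 'm) module_presheaf \<Rightarrow>
     ('p, 'r, 'p \<Rightarrow> ('p, 'm) germ) module_presheaf" where
  "sheafify X \<O> P =
     \<lparr>sections = (\<lambda>U.
        \<lparr>carrier = {s \<in> extensional U. \<forall>x\<in>U. \<exists>V\<in>opens_in X U. x \<in> V \<and>
                      (\<exists>t\<in>carrier (sections P V). \<forall>y\<in>V. s y = germ X P y V t)},
         mult = undefined, one = undefined,
         zero = (\<lambda>x\<in>U. germ X P x U \<zero>\<^bsub>sections P U\<^esub>),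
         add = (\<lambda>s t. \<lambda>x\<in>U. \<Union>(V, a)\<in>s x. \<Union>(W, b)\<in>t x.
                  germ X P x (V \<inter> W)
                    (restr P V (V \<inter> W) a \<oplus>\<^bsub>sections P (V \<inter> W)\<^esub> restr P W (V \<inter> W) b)),
         smult = (\<lambda>r s. \<lambda>x\<in>U. \<Union>(V, a)\<in>s x.
                  germ X P x (U \<inter> V)
                    (restr \<O> U (U \<inter> V) r \<odot>\<^bsub>sections P (U \<inter> V)\<^esub> restr P V (U \<inter> V) a))\<rparr>),
      restr = (\<lambda>U V s. restrict s V)\<rparr>"

definition tensor_sheaf ::
    "'p topology \<Rightarrow> ('p, 'r) ring_presheaf \<Rightarrow> ('p, 'r, 'a) module_presheaf \<Rightarrow>
     ('p, 'r, 'b) module_presheaf \<Rightarrow> ('p, 'r, 'p \<Rightarrow> ('p, ('a, 'b) tensor) germ) module_presheaf"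
  where "tensor_sheaf X \<O> A B = sheafify X \<O> (tensor_presheaf \<O> A B)"

text \<open>
  The natural map from sections over \<open>U\<close> of \<open>A \<otimes> End F\<close> to morphisms \<open>F \<rightarrow> A \<otimes> F\<close> over \<open>U\<close>,
  \<open>\<alpha> \<otimes> f \<mapsto> (\<sigma> \<mapsto> \<alpha> \<otimes> f \<sigma>)\<close>, computed germ by germ.
\<close>

definition tensor_end_to_hom ::
    "'p topology \<Rightarrow> ('p, 'r) ring_presheaf \<Rightarrow> ('p, 'r, 'a) module_presheaf \<Rightarrow>
     ('p, 'r, 'm) module_presheaf \<Rightarrow> 'p set \<Rightarrow>
     ('p \<Rightarrow> ('p, ('a, 'p set \<Rightarrow> 'm \<Rightarrow> 'm) tensor) germ) \<Rightarrow>
     'p set \<Rightarrow> 'm \<Rightarrow> 'p \<Rightarrow> ('p, ('a, 'm) tensor) germ" where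
  "tensor_end_to_hom X \<O> A F U c =
     (\<lambda>V\<in>opens_in X U. \<lambda>\<sigma>\<in>carrier (sections F V). \<lambda>x\<in>V. \<Union>(W, T)\<in>c x.
        germ X (tensor_presheaf \<O> A F) x (V \<inter> W)
          (tensor_map (sections \<O> (V \<inter> W)) (sections A (V \<inter> W)) (sections F (V \<inter> W))
            (\<lambda>(\<alpha>, f). (\<alpha>, f (V \<inter> W) (restr F V (V \<inter> W) \<sigma>)))
            (restr (tensor_presheaf \<O> A (end_sheaf X \<O> F)) W (V \<inter> W) T)))"

text \<open>
  The two inverses are that of the natural isomorphism on the complement \<open>Y\<close> of the singularity
  set, where \<open>F\<close> is locally free, and that of the restriction isomorphism from \<open>X\<close> to \<open>Y\<close>, which
  is available for a reflexive coherent \<open>F\<close> and locally free \<open>A\<close>.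
\<close>

definition hom_to_tensor_end ::
    "'p topology \<Rightarrow> ('p, 'r) ring_presheaf \<Rightarrow> ('p, 'r, 'a) module_presheaf \<Rightarrow>
     ('p, 'r, 'm) module_presheaf \<Rightarrow>
     ('p set \<Rightarrow> 'm \<Rightarrow> 'p \<Rightarrow> ('p, ('a, 'm) tensor) germ) \<Rightarrow>
     'p \<Rightarrow> ('p, ('a, 'p set \<Rightarrow> 'm \<Rightarrow> 'm) tensor) germ" where
  "hom_to_tensor_end X \<O> A F \<C> =
     (let E = tensor_sheaf X \<O> A (end_sheaf X \<O> F);
          H = hom_sheaf X \<O> F (tensor_sheaf X \<O> A F);
          Y = topspace X - singularity_set X \<O> F;
          D = the_inv_into (carrier (sections E Y)) (tensor_end_to_hom X \<O> A F Y)
                (restr H (topspace X) Y \<C>)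
      in the_inv_into (carrier (sections E (topspace X))) (restr E (topspace X) Y) D)"

section \<open>Holomorphic functions and forms\<close>

definition holomorphic_sheaf ::
    "'p topology \<Rightarrow> 'p chart set \<Rightarrow> ('p, 'p \<Rightarrow> complex) ring_presheaf" where
  "holomorphic_sheaf X \<A> =
     \<lparr>sections = (\<lambda>U.
        \<lparr>carrier = {f \<in> extensional U. \<forall>c\<in>\<A>.
            holomorphic_several (chart_dim c) (chart_map c ` (U \<inter> chart_dom c)) (f \<circ> chart_inv c)},
         mult = (\<lambda>f g. \<lambda>x\<in>U. f x * g x), one = (\<lambda>x\<in>U. 1),
         zero = (\<lambda>x\<in>U. 0), add = (\<lambda>f g. \<lambda>x\<in>U. f x + g x)\<rparr>),
      restr = (\<lambda>U V f. restrict f V)\<rparr>"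

definition multi_indices :: "nat \<Rightarrow> nat \<Rightarrow> nat list set" where
  "multi_indices n k = {l. length l = k \<and> set l \<subseteq> {..<n}}"

definition transition_jacobian :: "'p chart \<Rightarrow> 'p chart \<Rightarrow> nat \<Rightarrow> nat \<Rightarrow> 'p \<Rightarrow> complex" where
  "transition_jacobian c d j i x =
     partial_deriv i (\<lambda>z. chart_map d (chart_inv c z) j) (chart_map c x)"

text \<open>
  A holomorphic \<open>k\<close>-form \<open>\<omega>\<close> is given by its components in all charts of the atlas:
  \<open>\<omega> c l x\<close> is the value at \<open>x\<close> of the form on the coordinate vector fields of the chart \<open>c\<close>
  with indices \<open>l\<close>.  The last condition is the transformation law of covariant tensor fields.
\<close>

definition holomorphic_forms ::
    "'p topology \<Rightarrow> 'p chart set \<Rightarrow> nat \<Rightarrow> 'p set \<Rightarrow> ('p chart \<Rightarrow> nat list \<Rightarrow> 'p \<Rightarrow> complex) set" where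
  "holomorphic_forms X \<A> k U =
     {\<omega> \<in> (\<Pi>\<^sub>E c\<in>\<A>. \<Pi>\<^sub>E l\<in>multi_indices (chart_dim c) k. extensional (U \<inter> chart_dom c)).
        (\<forall>c\<in>\<A>. \<forall>l\<in>multi_indices (chart_dim c) k.
           holomorphic_several (chart_dim c) (chart_map c ` (U \<inter> chart_dom c))
             (\<omega> c l \<circ> chart_inv c) \<and>
           (\<forall>p x. p permutes {..<k} \<and> x \<in> U \<inter> chart_dom c \<longrightarrow>
              \<omega> c (permute_list p l) x = of_int (sign p) * \<omega> c l x)) \<and>
        (\<forall>c\<in>\<A>. \<forall>d\<in>\<A>. \<forall>l\<in>multi_indices (chart_dim c) k. \<forall>x\<in>U \<inter> chart_dom c \<inter> chart_dom d.
           \<omega> c l x = (\<Sum>m\<in>multi_indices (chart_dim d) k.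
             \<omega> d m x * (\<Prod>q<k. transition_jacobian c d (m ! q) (l ! q) x)))}"

definition form_sheaf ::
    "'p topology \<Rightarrow> 'p chart set \<Rightarrow> nat \<Rightarrow>
     ('p, 'p \<Rightarrow> complex, 'p chart \<Rightarrow> nat list \<Rightarrow> 'p \<Rightarrow> complex) module_presheaf" where
  "form_sheaf X \<A> k =
     \<lparr>sections = (\<lambda>U.
        \<lparr>carrier = holomorphic_forms X \<A> k U, mult = undefined, one = undefined,
         zero = (\<lambda>c\<in>\<A>. \<lambda>l\<in>multi_indices (chart_dim c) k. \<lambda>x\<in>U \<inter> chart_dom c. 0),
         add = (\<lambda>\<omega> \<eta>. \<lambda>c\<in>\<A>. \<lambda>l\<in>multi_indices (chart_dim c) k. \<lambda>x\<in>U \<inter> chart_dom c.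
                  \<omega> c l x + \<eta> c l x),
         smult = (\<lambda>f \<omega>. \<lambda>c\<in>\<A>. \<lambda>l\<in>multi_indices (chart_dim c) k. \<lambda>x\<in>U \<inter> chart_dom c.
                  f x * \<omega> c l x)\<rparr>),
      restr = (\<lambda>U V \<omega>. \<lambda>c\<in>\<A>. \<lambda>l\<in>multi_indices (chart_dim c) k.
                 restrict (\<omega> c l) (V \<inter> chart_dom c))\<rparr>"

end

theory Submission
  imports Defs "HOL-Complex_Analysis.Complex_Analysis"
begin

text \<open>
  The natural map from \<open>\<Omega> \<otimes> End F\<close> to \<open>Hom(F, \<Omega> \<otimes> F)\<close> is an isomorphism over every open set, because \<open>\<Omega>\<close>
  is locally free; for this a finite dual basis of \<open>\<Omega>\<close> over each chart suffices.  So only the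
  restriction from \<open>X\<close> to the complement \<open>Y\<close> of the singular set has to be bijective on both sides.
  For \<open>Hom(F, \<Omega> \<otimes> F)\<close> this reduces to \<open>F\<close>, and as \<open>F\<close> is the dual of its dual, to extending
  holomorphic functions from \<open>V \<inter> Y\<close> to \<open>V\<close>.

  By coherence the singular set is locally contained in a proper hypersurface.  If a function did
  not extend across a set \<open>Z'\<close> of singular points, then, by passing to iterated partial derivatives
  of an equation of the hypersurface, \<open>Z'\<close> would lie near one of its points in a smooth
  hypersurface \<open>g = 0\<close>.  If \<open>Z'\<close> is not all of that hypersurface, Cauchy's integral in the direction
  transversal to it extends the function.  Otherwise \<open>F\<close> is singular along the whole of \<open>g = 0\<close>,
  which is impossible: \<open>F\<close> is torsion-free, so a nonzero relation between a minimal number of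
  generators can be divided by powers of \<open>g\<close> until it eliminates a generator somewhere on \<open>g = 0\<close>.
\<close>

text \<open>The usual argument quotes two facts: a torsion-free coherent sheaf is locally free
  outside codimension two, and Hartogs' theorem. Dimension of analytic sets is avoided here by a
  dichotomy at one well chosen point: it is enough to extend a function past a single point of the
  set where it fails to extend, since this already contradicts the maximality of its domain. Both
  branches rest on one construction, Cauchy's integral over a circle transversal to
  \<open>g = 0\<close>. It yields the extension and also the quotients by powers of
  \<open>g\<close>; its bounds show that a nonzero function cannot be divided for ever, so the
  division of a relation stops. The restriction map for \<Omega> \<otimes> End F is never treated
  directly. The natural map commutes with restriction and is bijective over both \<open>X\<close>
  and \<open>Y\<close>, so that map inherits bijectivity from the one for Hom(F, \<Omega> \<otimes>
  F). This is also what makes the two inverses in the definition of the correspondence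
  meaningful.\<close>

abbreviation "hol \<equiv> holomorphic_several"
abbreviation "jac \<equiv> transition_jacobian"
abbreviation "Sc \<equiv> sections"
abbreviation "sec P U \<equiv> carrier (sections P U)"

section \<open>Holomorphic functions of several variables\<close>

abbreviation cs_open :: "nat => (nat => complex) set => bool" where
 "cs_open n S \<equiv> openin (top_of_set (complex_space n)) S"

text \<open>The radius varies with the coordinate because the cylinders below keep a fixed radius in
  one direction while the others shrink.\<close>

definition polydisc :: "nat => (nat => complex) => (nat => real) => (nat => complex) set" where
 "polydisc n x r = {z \<in> complex_space n. \<forall>j<n. dist (x j) (z j) < r j}"

lemma cs_openE:
 assumes "cs_open n S"
 obtains T where "open T" "S = complex_space n \<inter> T"
 using assms by (auto simp: openin_open)

lemma cs_open_subset: "cs_open n S ==> S \<subseteq> complex_space n"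
 using openin_imp_subset by blast

lemma continuous_on_coord:
 fixes f :: "'a::topological_space => nat => complex"
 shows "continuous_on S f ==> continuous_on S (%x. f x i)"
 by (rule continuous_on_product_then_coordinatewise)

lemma continuous_on_fun_upd [continuous_intros]:
 fixes f :: "'a::topological_space => nat => complex"
 assumes "continuous_on S f" "continuous_on S g"
 shows "continuous_on S (%x. (f x)(i := g x))"
proof (rule continuous_on_coordinatewise_then_product)
 fix j show "continuous_on S (%x. ((f x)(i := g x)) j)"
  using assms(2) continuous_on_coord[OF assms(1), of j] by (cases "j = i") simp_all
qed

lemma complex_space_upd: "z \<in> complex_space n ==> i < n ==> z(i := t) \<in> complex_space n"
 by (auto simp: complex_space_def)

lemma cs_open_polydisc: "cs_open n (polydisc n x r)"
proof -
 have "open {z :: nat => complex. \<forall>j\<in>{..<n}. dist (x j) (z j) < r j}"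
 proof -
  have "open {z :: nat => complex. dist (x j) (z j) < r j}" for j
   by (intro open_Collect_less continuous_intros continuous_on_product_coordinates)
  then have "open (\<Inter>j\<in>{..<n}. {z :: nat => complex. dist (x j) (z j) < r j})"
   by (intro open_INT) auto
  moreover have "(\<Inter>j\<in>{..<n}. {z. dist (x j) (z j) < r j}) = {z. \<forall>j\<in>{..<n}. dist (x j) (z j) < r j}"
   by auto
  ultimately show ?thesis by simp
 qed
 then show ?thesis unfolding openin_open polydisc_def
  by (intro exI[of _ "{z. \<forall>j\<in>{..<n}. dist (x j) (z j) < r j}"]) auto
qed

lemma polydisc_center: "x \<in> complex_space n ==> (!!j. j < n ==> r j > 0) ==> x \<in> polydisc n x r"
 by (auto simp: polydisc_def)

lemma polydisc_upd: "z \<in> polydisc n x r ==> i < n ==> dist (x i) t < r i ==> z(i := t) \<in> polydisc n x r"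
 by (auto simp: polydisc_def complex_space_def)

lemma polydisc_upd_iff:
 "z \<in> polydisc n x r ==> i < n ==> z(i := t) \<in> polydisc n x r \<longleftrightarrow> t \<in> ball (x i) (r i)"
 by (auto simp: polydisc_def complex_space_def)

lemma polydisc_mono: "(!!j. j < n ==> r j \<le> s j) ==> polydisc n x r \<subseteq> polydisc n x s"
 by (force simp: polydisc_def)

lemma polydisc_subset: "polydisc n x r \<subseteq> complex_space n"
 by (auto simp: polydisc_def)

text \<open>Basic open sets of the product topology constrain finitely many coordinates. Those from
  \<open>n\<close> on are 0 throughout \<open>complex_space n\<close>, so only the first
  \<open>n\<close> need a radius, and one common radius suffices.\<close>

lemma polydisc_nbhd:
 assumes "cs_open n S" "x \<in> S"
 obtains e where "e > 0" "polydisc n x (%_. e) \<subseteq> S"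
proof -
 obtain T where T: "open T" "S = complex_space n \<inter> T" using assms(1) by (rule cs_openE)
 have "openin (product_topology (\<lambda>i::nat. euclidean :: complex topology) UNIV) T"
  using T(1) by (simp add: open_fun_def)
 moreover have "x \<in> T" using T assms by auto
 ultimately obtain U where U: "finite {i. U i ~= UNIV}" "!!i. open (U i)" "!!i. x i \<in> U i" "Pi UNIV U \<subseteq> T"
  unfolding openin_product_topology_alt by (force simp: PiE_UNIV_domain)
 have "\<exists>e>0. ball (x i) e \<subseteq> U i" for i
  using U(2,3) open_contains_ball by blast
 then obtain e where e: "!!i. e i > 0" "!!i. ball (x i) (e i) \<subseteq> U i" by metis
 \<comment> \<open>The 1 keeps the minimum over a nonempty set when \<open>n = 0\<close>.\<close>
 define d where "d = Min (insert 1 (e ` {..<n}))"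
 have d: "d > 0" "!!i. i < n ==> d \<le> e i" unfolding d_def using e(1) by (auto intro: Min_le)
 have "polydisc n x (%_. d) \<subseteq> S"
 proof
  fix z assume z: "z \<in> polydisc n x (%_. d)"
  have "z i \<in> U i" for i
  proof (cases "i < n")
   case True
   then have "dist (x i) (z i) < e i" using z d(2)[OF True] by (auto simp: polydisc_def)
   then show ?thesis using e(2)[of i] by auto
  next
   case False
   then have "z i = 0" "x i = 0" using z assms(2) T(2) by (auto simp: polydisc_def complex_space_def)
   then show ?thesis using U(3)[of i] by simp
  qed
  then show "z \<in> S" using U(4) z T(2) by (auto simp: polydisc_def)
 qed
 with d(1) show thesis using that by blast
qed

lemma cs_open_slice:
 assumes "cs_open n S" "z \<in> complex_space n" "i < n"
 shows "open {t. z(i := t) \<in> S}"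
proof -
 obtain T where T: "open T" "S = complex_space n \<inter> T" using assms(1) by (rule cs_openE)
 have "continuous_on UNIV (%t. z(i := t))" by (intro continuous_intros)
 then have "open ((%t. z(i := t)) -` T)" using T(1) open_vimage by blast
 moreover have "{t. z(i := t) \<in> S} = (%t. z(i := t)) -` T"
  using T(2) assms complex_space_upd by auto
 ultimately show ?thesis by simp
qed

section \<open>Holomorphic functions of several variables: locality and algebra\<close>

lemma hol_continuous: "hol n S f ==> continuous_on S f"
 by (simp add: holomorphic_several_def)

lemma hol_slice:
 assumes "hol n S f" "cs_open n S" "z \<in> complex_space n" "i < n"
 shows "(%t. f (z(i := t))) holomorphic_on {t. z(i := t) \<in> S}"
proof -
 have "(%t. f (z(i := t))) field_differentiable at t" if "z(i := t) \<in> S" for t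
 proof -
  have "(%s. f ((z(i := t))(i := s))) field_differentiable at ((z(i := t)) i)"
   using assms(1,4) that unfolding holomorphic_several_def by blast
  then show ?thesis by simp
 qed
 then show ?thesis using cs_open_slice[OF assms(2-4)]
  by (simp add: holomorphic_on_def field_differentiable_at_within)
qed

lemma holomorphic_severalI:
 assumes "cs_open n S" "continuous_on S f"
  "!!z i. z \<in> S ==> i < n ==> \<exists>T. open T \<and> z i \<in> T \<and> (%t. f (z(i := t))) holomorphic_on T"
 shows "hol n S f"
 unfolding holomorphic_several_def using assms(2,3)
 by (meson holomorphic_on_imp_differentiable_at)

lemma hol_subset:
 "hol n S f ==> T \<subseteq> S ==> hol n T f"
 unfolding holomorphic_several_def by (meson continuous_on_subset subset_iff)

lemma hol_empty [simp]: "hol n {} f"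
 by (simp add: holomorphic_several_def)

lemma eventually_slice:
 assumes "cs_open n S" "z \<in> S" "i < n"
 shows "\<forall>\<^sub>F t in nhds (z i). z(i := t) \<in> S"
proof -
 have "z \<in> complex_space n" using assms cs_open_subset by blast
 then have "open {t. z(i := t) \<in> S}" using assms cs_open_slice by blast
 moreover have "z i \<in> {t. z(i := t) \<in> S}" using assms(2) by simp
 ultimately show ?thesis using eventually_nhds_in_open by fastforce
qed

text \<open>The slice derivative at \<open>z\<close> looks at the points \<open>z(i := t)\<close>
  with \<open>t\<close> near \<open>z i\<close>, and these stay in the relatively open set
  \<open>S\<close>; values outside do not enter.\<close>

lemma hol_cong:
 assumes "hol n S f" "cs_open n S" "!!z. z \<in> S ==> f z = g z"
 shows "hol n S g"
proof -
 have "continuous_on S g"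
  using assms by (metis continuous_on_cong hol_continuous)
 moreover have "(%t. g (z(i := t))) field_differentiable at (z i)" if "z \<in> S" "i < n" for z i
 proof -
  have "\<forall>\<^sub>F t in nhds (z i). f (z(i := t)) = g (z(i := t))"
   using eventually_slice[OF assms(2) that] by eventually_elim (use assms(3) in auto)
  moreover have "(%t. f (z(i := t))) field_differentiable at (z i)"
   using assms(1) that by (auto simp: holomorphic_several_def)
  ultimately show ?thesis
   unfolding field_differentiable_def using DERIV_cong_ev by metis
 qed
 ultimately show ?thesis by (auto simp: holomorphic_several_def)
qed

lemma hol_local:
 assumes "cs_open n S"
  "!!x. x \<in> S ==> \<exists>T. cs_open n T \<and> x \<in> T \<and> hol n T f"
 shows "hol n S f"
proof -
 have "continuous_on S f"
  unfolding continuous_on_topological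
 proof (intro ballI allI impI)
  fix x B assume x: "x \<in> S" "open B" "f x \<in> B"
  obtain T where T: "cs_open n T" "x \<in> T" "hol n T f" using assms(2) x by blast
  obtain T' where T': "open T'" "T = complex_space n \<inter> T'" using T(1) by (rule cs_openE)
  have "\<exists>A. open A \<and> x \<in> A \<and> (\<forall>y\<in>T. y \<in> A --> f y \<in> B)"
   using hol_continuous[OF T(3)] T(2) x unfolding continuous_on_topological by blast
  then obtain A where A: "open A" "x \<in> A" "\<forall>y\<in>T. y \<in> A --> f y \<in> B" by blast
  show "\<exists>A. open A \<and> x \<in> A \<and> (\<forall>y\<in>S. y \<in> A --> f y \<in> B)"
   using A T T' cs_open_subset[OF assms(1)] by (intro exI[of _ "A \<inter> T'"]) auto
 qed
 then show ?thesis using assms(2) unfolding holomorphic_several_def by blast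
qed

lemma hol_const [intro]: "hol n S (%_. c)"
 by (simp add: holomorphic_several_def)

lemma hol_coord: "hol n S (%z. z j)"
proof -
 have "continuous_on S (\<lambda>z::nat => complex. z j)"
  by (rule continuous_on_subset[OF continuous_on_product_coordinates]) simp
 moreover have "(%t. (z(i := t)) j) field_differentiable at (z i)" for z :: "nat => complex" and i
  by (cases "j = i") (simp_all add: field_differentiable_ident)
 ultimately show ?thesis by (auto simp: holomorphic_several_def)
qed

lemma hol_add:
 "hol n S f ==> hol n S g ==> hol n S (%z. f z + g z)"
 unfolding holomorphic_several_def by (auto intro!: continuous_on_add field_differentiable_add)

lemma hol_diff:
 "hol n S f ==> hol n S g ==> hol n S (%z. f z - g z)"
 unfolding holomorphic_several_def by (auto intro!: continuous_on_diff field_differentiable_diff)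

lemma hol_mult:
 "hol n S f ==> hol n S g ==> hol n S (%z. f z * g z)"
 unfolding holomorphic_several_def by (auto intro!: continuous_on_mult field_differentiable_mult)

lemma hol_divide:
 "hol n S f ==> hol n S g ==> (!!z. z \<in> S ==> g z ~= 0) ==>
  hol n S (%z. f z / g z)"
 unfolding holomorphic_several_def by (auto intro!: continuous_on_divide field_differentiable_divide)

lemma hol_power:
 "hol n S f ==> hol n S (%z. f z ^ k)"
 by (induction k) (auto intro: hol_mult)

lemma hol_sum:
 "(!!i. i \<in> I ==> hol n S (f i)) ==> hol n S (%z. \<Sum>i\<in>I. f i z)"
 by (induction I rule: infinite_finite_induct) (auto intro: hol_add)

lemma hol_prod:
 "(!!i. i \<in> I ==> hol n S (f i)) ==> hol n S (%z. \<Prod>i\<in>I. f i z)"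
 by (induction I rule: infinite_finite_induct) (auto intro: hol_mult)

section \<open>Cauchy integrals with parameters\<close>

lemma continuous_on_contour_integral_circlepath:
 fixes F :: "'a::topological_space => complex => complex" and a :: complex and \<rho> :: real
 assumes "continuous_on (U \<times> sphere a \<rho>) (\<lambda>(w, \<zeta>). F w \<zeta>)" "\<rho> \<ge> 0"
 shows "continuous_on U (%w. contour_integral (circlepath a \<rho>) (F w))"
proof -
 \<comment> \<open>The factor after the integrand is the derivative of the parametrised
   circle.\<close>
 let ?g = "%w t. F w (circlepath a \<rho> t) * (2 * of_real pi * \<i> * of_real \<rho> * exp (2 * of_real pi * \<i> * of_real t))"
 have cc: "continuous_on UNIV (circlepath a \<rho>)"
  unfolding circlepath_def part_circlepath_def linepath_def by (intro continuous_intros)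
 have "continuous_on (U \<times> cbox 0 1) (%(w, t). ?g w t)"
  unfolding split_beta
 proof (intro continuous_on_mult continuous_intros)
  have "continuous_on (U \<times> cbox 0 1) ((\<lambda>(w, \<zeta>). F w \<zeta>) \<circ> (%p. (fst p, circlepath a \<rho> (snd p))))"
  proof (rule continuous_on_compose)
   show "continuous_on (U \<times> cbox 0 1) (%p. (fst p, circlepath a \<rho> (snd p)))"
    by (intro continuous_intros continuous_on_compose2[OF cc]) auto
   have "circlepath a \<rho> t \<in> sphere a \<rho>" if "t \<in> {0..1}" for t
    using path_image_circlepath[of a \<rho>] assms(2) that unfolding path_image_def by fastforce
   then show "continuous_on ((%p. (fst p, circlepath a \<rho> (snd p))) ` (U \<times> cbox 0 1)) (\<lambda>(w, \<zeta>). F w \<zeta>)"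
    by (intro continuous_on_subset[OF assms(1)]) auto
  qed
  then show "continuous_on (U \<times> cbox 0 1) (%p. F (fst p) (circlepath a \<rho> (snd p)))"
   by (simp add: o_def)
 qed
 then have "continuous_on U (%w. integral (cbox 0 1) (?g w))"
  by (rule integral_continuous_on_param)
 moreover have "contour_integral (circlepath a \<rho>) (F w) = integral (cbox 0 1) (?g w)" for w
  by (simp add: contour_integral_integral vector_derivative_circlepath)
 ultimately show ?thesis by simp
qed

text \<open>Morera's theorem: the integral of \<open>?h\<close> over a triangle may be exchanged
  with the integral over the circle, and for each fixed \<open>\<zeta>\<close> the inner triangle
  integral vanishes by Cauchy's theorem.\<close>

lemma holomorphic_contour_integral_circlepath:
 assumes "continuous_on (T \<times> sphere a \<rho>) (\<lambda>(w, \<zeta>). F w \<zeta>)" "\<rho> \<ge> 0" "open T"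
  "!!\<zeta>. \<zeta> \<in> sphere a \<rho> ==> (%w. F w \<zeta>) holomorphic_on T"
 shows "(%w. contour_integral (circlepath a \<rho>) (F w)) holomorphic_on T"
proof -
 let ?c = "circlepath a \<rho>"
 let ?h = "%w. contour_integral ?c (F w)"
 have cont: "continuous_on T ?h"
  by (rule continuous_on_contour_integral_circlepath[OF assms(1,2)])
 have pc: "path_image ?c = sphere a \<rho>" using assms(2) by simp
 have swap: "contour_integral (linepath p q) ?h =
   contour_integral ?c (%\<zeta>. contour_integral (linepath p q) (%w. F w \<zeta>))"
  and ci: "(%\<zeta>. contour_integral (linepath p q) (%w. F w \<zeta>)) contour_integrable_on ?c"
  if pq: "closed_segment p q \<subseteq> T" for p q
 proof -
  have cF: "continuous_on (path_image (linepath p q) \<times> path_image ?c) (\<lambda>(y1, y2). F y1 y2)"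
   unfolding pc using pq by (intro continuous_on_subset[OF assms(1)]) auto
  have cv: "continuous_on {0..1} (%t. vector_derivative ?c (at t))"
   unfolding vector_derivative_circlepath by (intro continuous_intros)
  show "contour_integral (linepath p q) ?h =
   contour_integral ?c (%\<zeta>. contour_integral (linepath p q) (%w. F w \<zeta>))"
   by (rule contour_integral_swap[OF cF _ _ _ cv]) (auto intro!: continuous_intros)
  \<comment> \<open>The edge integrals must be integrable over the circle before the three of them
    can be added under one circle integral; continuity in \<open>\<zeta>\<close> gives this.\<close>
  have sw: "continuous_on (sphere a \<rho> \<times> cbox 0 1) (\<lambda>(\<zeta>, t). F (linepath p q t) \<zeta> * (q - p))"
   unfolding split_beta
  proof (intro continuous_on_mult continuous_intros)
   have "continuous_on (sphere a \<rho> \<times> cbox 0 1) ((\<lambda>(w, \<zeta>). F w \<zeta>) \<circ> (%p'. (linepath p q (snd p'), fst p')))"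
   proof (rule continuous_on_compose)
    show "continuous_on (sphere a \<rho> \<times> cbox 0 1) (%p'. (linepath p q (snd p'), fst p'))"
     unfolding linepath_def by (intro continuous_intros)
    have "linepath p q t \<in> T" if "t \<in> {0..1}" for t using pq that linepath_in_path by blast
    then show "continuous_on ((%p'. (linepath p q (snd p'), fst p')) ` (sphere a \<rho> \<times> cbox 0 1)) (\<lambda>(w, \<zeta>). F w \<zeta>)"
     by (intro continuous_on_subset[OF assms(1)]) auto
   qed
   then show "continuous_on (sphere a \<rho> \<times> cbox 0 1) (%p'. F (linepath p q (snd p')) (fst p'))"
    by (simp add: o_def)
  qed
  have "continuous_on (sphere a \<rho>) (%\<zeta>. integral (cbox 0 1) (%t. F (linepath p q t) \<zeta> * (q - p)))"
   by (rule integral_continuous_on_param[OF sw])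
  then have cL: "continuous_on (sphere a \<rho>) (%\<zeta>. contour_integral (linepath p q) (%w. F w \<zeta>))"
   by (simp add: contour_integral_integral)
  have "continuous_on {0..1} ?c"
   by (metis path_def path_circlepath)
  moreover have "?c ` {0..1} \<subseteq> sphere a \<rho>" using pc by (simp add: path_image_def)
  ultimately have "continuous_on {0..1} (%t. contour_integral (linepath p q) (%w. F w (?c t)))"
   by (rule continuous_on_compose2[OF cL])
  then show "(%\<zeta>. contour_integral (linepath p q) (%w. F w \<zeta>)) contour_integrable_on ?c"
   unfolding contour_integrable_on
   by (intro integrable_continuous_real continuous_on_mult cv)
 qed
 have "?h analytic_on T"
 proof (rule Morera_triangle[OF cont assms(3)], intro impI)
  fix p q s assume hull: "convex hull {p, q, s} \<subseteq> T"
  have seg: "closed_segment p q \<subseteq> T" "closed_segment q s \<subseteq> T" "closed_segment s p \<subseteq> T"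
   by (rule subset_trans[OF closed_segment_subset_convex_hull hull]; simp add: hull_inc)+
  let ?L = "%p q \<zeta>. contour_integral (linepath p q) (%w. F w \<zeta>)"
  have zero: "?L p q \<zeta> + ?L q s \<zeta> + ?L s p \<zeta> = 0" if z: "\<zeta> \<in> sphere a \<rho>" for \<zeta>
  proof -
   have h: "(%w. F w \<zeta>) holomorphic_on (convex hull {p, q, s})"
    using assms(4)[OF z] hull holomorphic_on_subset by blast
   then have "((%w. F w \<zeta>) has_contour_integral 0) (linepath p q +++ linepath q s +++ linepath s p)"
    by (rule Cauchy_theorem_triangle)
   then show ?thesis
    using has_chain_integral_chain_integral3 by blast
  qed
  have "contour_integral (linepath p q) ?h + contour_integral (linepath q s) ?h + contour_integral (linepath s p) ?h
    = contour_integral ?c (%\<zeta>. ?L p q \<zeta> + ?L q s \<zeta> + ?L s p \<zeta>)"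
   using swap[OF seg(1)] swap[OF seg(2)] swap[OF seg(3)] ci[OF seg(1)] ci[OF seg(2)] ci[OF seg(3)]
   by (simp add: contour_integral_add contour_integrable_add)
  also have "\<dots> = contour_integral ?c (%_. 0)"
   by (rule contour_integral_eq) (use zero assms(2) in auto)
  finally show "contour_integral (linepath p q) ?h + contour_integral (linepath q s) ?h + contour_integral (linepath s p) ?h = 0"
   by simp
 qed
 then show ?thesis using analytic_imp_holomorphic by blast
qed

lemma hol_contour_integral:
 assumes "cs_open n D" "\<rho> \<ge> 0" "continuous_on (D \<times> sphere a \<rho>) (\<lambda>(z, \<zeta>). F z \<zeta>)"
  "!!\<zeta>. \<zeta> \<in> sphere a \<rho> ==> hol n D (%z. F z \<zeta>)"
 shows "hol n D (%z. contour_integral (circlepath a \<rho>) (F z))"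
proof (rule holomorphic_severalI[OF assms(1)])
 show "continuous_on D (%z. contour_integral (circlepath a \<rho>) (F z))"
  by (rule continuous_on_contour_integral_circlepath[OF assms(3,2)])
 fix z i assume z: "z \<in> D" "i < n"
 have zc: "z \<in> complex_space n" using z cs_open_subset[OF assms(1)] by auto
 let ?T = "{t. z(i := t) \<in> D}"
 have T: "open ?T" using cs_open_slice[OF assms(1) zc z(2)] .
 have "(%t. contour_integral (circlepath a \<rho>) (F (z(i := t)))) holomorphic_on ?T"
 proof (rule holomorphic_contour_integral_circlepath[OF _ assms(2) T])
  have "continuous_on (?T \<times> sphere a \<rho>) ((\<lambda>(z, \<zeta>). F z \<zeta>) \<circ> (%p. (z(i := fst p), snd p)))"
  proof (rule continuous_on_compose)
   show "continuous_on (?T \<times> sphere a \<rho>) (%p. (z(i := fst p), snd p))"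
    by (intro continuous_intros)
   show "continuous_on ((%p. (z(i := fst p), snd p)) ` (?T \<times> sphere a \<rho>)) (\<lambda>(z, \<zeta>). F z \<zeta>)"
    by (rule continuous_on_subset[OF assms(3)]) auto
  qed
  then show "continuous_on (?T \<times> sphere a \<rho>) (\<lambda>(w, \<zeta>). F (z(i := w)) \<zeta>)"
   by (simp add: o_def split_beta)
  show "(%w. F (z(i := w)) \<zeta>) holomorphic_on ?T" if "\<zeta> \<in> sphere a \<rho>" for \<zeta>
   by (rule hol_slice[OF assms(4)[OF that] assms(1) zc z(2)])
 qed
 then show "\<exists>T. open T \<and> z i \<in> T \<and> (%t. contour_integral (circlepath a \<rho>) (F (z(i := t)))) holomorphic_on T"
  using T z(1) by (intro exI[of _ ?T]) auto
qed

text \<open>Cauchy's formula for the difference quotient of the slice of \<open>f\<close> between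
  \<open>a\<close> and \<open>b\<close>. Unlike the quotient itself it makes sense for
  \<open>a = b\<close>, is continuous there and gives the derivative.\<close>

definition diff_quot :: "nat => complex => real => ((nat => complex) => complex) =>
  (nat => complex) => complex => complex => complex" where
 "diff_quot i c \<rho> f z a b =
   contour_integral (circlepath c \<rho>) (%\<zeta>. f (z(i := \<zeta>)) / ((\<zeta> - a) * (\<zeta> - b))) / (2 * of_real pi * \<i>)"

lemma tendsto_funI:
 fixes f :: "'a => nat => complex"
 assumes "!!j. ((%t. f t j) \<longlongrightarrow> x j) F"
 shows "(f \<longlongrightarrow> x) F"
 using assms unfolding limitin_canonical_iff[symmetric] euclidean_product_topology[symmetric] limitin_componentwise
 by simp

lemma continuous_on_upd_pair:
 fixes f :: "(nat => complex) => complex"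
 assumes "continuous_on S f" "!!z \<zeta>. z \<in> D ==> \<zeta> \<in> C ==> z(i := \<zeta>) \<in> S"
 shows "continuous_on (D \<times> C) (%p. f ((fst p)(i := snd p)))"
proof -
 have "continuous_on (D \<times> C) (%p. (fst p)(i := snd p))"
  by (intro continuous_on_fun_upd continuous_on_fst continuous_on_snd continuous_on_id)
 then show ?thesis using assms by (auto intro: continuous_on_compose2[OF assms(1)])
qed

lemma slice_cball_holomorphic:
 assumes "cs_open n S" "hol n S f" "z \<in> complex_space n" "i < n"
  "!!\<zeta>. \<zeta> \<in> cball c \<rho> ==> z(i := \<zeta>) \<in> S"
 shows "(%\<zeta>. f (z(i := \<zeta>))) holomorphic_on cball c \<rho>"
 by (rule holomorphic_on_subset[OF hol_slice[OF assms(2,1,3,4)]]) (use assms(5) in auto)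

text \<open>Partial fractions: \<open>1 / ((\<zeta> - a) * (\<zeta> - b))\<close> is the difference
  of the two Cauchy kernels divided by \<open>a - b\<close>.\<close>

lemma diff_quot:
 assumes "cs_open n S" "hol n S f" "z \<in> complex_space n" "i < n"
  "!!\<zeta>. \<zeta> \<in> cball c \<rho> ==> z(i := \<zeta>) \<in> S" and ab: "a \<in> ball c \<rho>" "b \<in> ball c \<rho>"
 shows "f (z(i := a)) - f (z(i := b)) = (a - b) * diff_quot i c \<rho> f z a b"
proof (cases "a = b")
 case False
 have h: "(%\<zeta>. f (z(i := \<zeta>))) holomorphic_on cball c \<rho>"
  by (rule slice_cball_holomorphic[OF assms(1-5)])
 have r: "\<rho> > 0" using ab(1) by (meson mem_ball not_less order.trans zero_le_dist)
 have C: "((%u. f (z(i := u)) / (u - w)) has_contour_integral (2 * of_real pi * \<i> * f (z(i := w)))) (circlepath c \<rho>)"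
  if "w \<in> ball c \<rho>" for w
  by (rule Cauchy_integral_circlepath_simple[OF h]) (use that in \<open>auto simp: dist_norm norm_minus_commute\<close>)
 have "((%u. (f (z(i := u)) / (u - a) - f (z(i := u)) / (u - b)) / (a - b)) has_contour_integral
   ((2 * of_real pi * \<i> * f (z(i := a)) - 2 * of_real pi * \<i> * f (z(i := b))) / (a - b))) (circlepath c \<rho>)"
  by (intro has_contour_integral_div has_contour_integral_diff C ab)
 then have "((%u. f (z(i := u)) / ((u - a) * (u - b))) has_contour_integral
   ((2 * of_real pi * \<i> * f (z(i := a)) - 2 * of_real pi * \<i> * f (z(i := b))) / (a - b))) (circlepath c \<rho>)"
 proof (rule has_contour_integral_eq)
  fix u assume "u \<in> path_image (circlepath c \<rho>)"
  then have "u ~= a" "u ~= b" using r ab by auto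
  then show "(f (z(i := u)) / (u - a) - f (z(i := u)) / (u - b)) / (a - b) = f (z(i := u)) / ((u - a) * (u - b))"
   using False by (simp add: divide_simps) (simp add: algebra_simps)
 qed
 then show ?thesis using False
  unfolding diff_quot_def by (simp add: contour_integral_unique divide_simps) (simp add: algebra_simps)
qed simp

lemma diff_quot_diag:
 assumes "cs_open n S" "hol n S f" "z \<in> complex_space n" "i < n"
  "!!\<zeta>. \<zeta> \<in> cball c \<rho> ==> z(i := \<zeta>) \<in> S" and a: "z i \<in> ball c \<rho>"
 shows "diff_quot i c \<rho> f z (z i) (z i) = partial_deriv i f z"
proof -
 have h: "(%\<zeta>. f (z(i := \<zeta>))) holomorphic_on cball c \<rho>"
  by (rule slice_cball_holomorphic[OF assms(1-5)])
 have "continuous_on (cball c \<rho>) (%\<zeta>. f (z(i := \<zeta>)))" "(%\<zeta>. f (z(i := \<zeta>))) holomorphic_on ball c \<rho>"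
  using h holomorphic_on_imp_continuous_on holomorphic_on_subset ball_subset_cball by blast+
 then have "((%\<zeta>. f (z(i := \<zeta>))) has_field_derivative
   (1 / (2 * of_real pi * \<i>)) * contour_integral (circlepath c \<rho>) (%u. f (z(i := u)) / (u - z i)^2)) (at (z i))"
  using Cauchy_derivative_integral_circlepath(2)[of c \<rho> "%\<zeta>. f (z(i := \<zeta>))" "z i"] a
  by auto
 then show ?thesis
  unfolding diff_quot_def partial_deriv_def by (simp add: DERIV_imp_deriv power2_eq_square)
qed

text \<open>Joint continuity in the base point and in both ends is what the chain rule takes from
  Cauchy's formula.\<close>

lemma continuous_on_diff_quot:
 fixes \<rho> :: real
 assumes "continuous_on S f" "\<rho> \<ge> 0" "!!z \<zeta>. z \<in> D ==> \<zeta> \<in> sphere c \<rho> ==> z(i := \<zeta>) \<in> S"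
 shows "continuous_on (D \<times> ball c \<rho> \<times> ball c \<rho>) (%(z, a, b). diff_quot i c \<rho> f z a b)"
proof -
 let ?U = "D \<times> ball c \<rho> \<times> ball c \<rho>"
 have "continuous_on (?U \<times> sphere c \<rho>)
   (\<lambda>(p, \<zeta>). f ((fst p)(i := \<zeta>)) / ((\<zeta> - fst (snd p)) * (\<zeta> - snd (snd p))))"
  unfolding split_beta
 proof (intro continuous_on_divide continuous_intros ballI)
  have "continuous_on (?U \<times> sphere c \<rho>) (%x. (fst (fst x))(i := snd x))"
   by (intro continuous_on_fun_upd continuous_on_fst continuous_on_snd continuous_on_id)
  then show "continuous_on (?U \<times> sphere c \<rho>) (%x. f ((fst (fst x))(i := snd x)))"
   using assms(3) by (auto intro: continuous_on_compose2[OF assms(1)])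
 qed auto
 then have "continuous_on ?U (%p. contour_integral (circlepath c \<rho>)
    (%\<zeta>. f ((fst p)(i := \<zeta>)) / ((\<zeta> - fst (snd p)) * (\<zeta> - snd (snd p)))))"
  by (rule continuous_on_contour_integral_circlepath) fact
 then have "continuous_on ?U (%p. diff_quot i c \<rho> f (fst p) (fst (snd p)) (snd (snd p)))"
  unfolding diff_quot_def by (intro continuous_intros) auto
 then show ?thesis by (simp add: split_beta)
qed

text \<open>Half the radius of a polydisc contained in \<open>S\<close> leaves room for closed discs
  in every coordinate direction.\<close>

lemma polydisc_room:
 assumes "cs_open n S" "x \<in> S"
 obtains e where "e > 0" "polydisc n x (%_. e) \<subseteq> S"
  "!!z i \<zeta>. z \<in> polydisc n x (%_. e) ==> i < n ==> \<zeta> \<in> cball (x i) e ==> z(i := \<zeta>) \<in> S"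
proof -
 obtain d where d: "d > 0" "polydisc n x (%_. d) \<subseteq> S" using polydisc_nbhd assms by blast
 show thesis
 proof
  show "d / 2 > 0" using d by simp
  show "polydisc n x (%_. d / 2) \<subseteq> S" using d polydisc_mono[of n "%_. d/2" "%_. d" x] by auto
  fix z i \<zeta> assume *: "z \<in> polydisc n x (%_. d / 2)" "i < n" "\<zeta> \<in> cball (x i) (d / 2)"
  then have "z \<in> polydisc n x (%_. d)" using d polydisc_mono[of n "%_. d/2" "%_. d" x] by auto
  then have "z(i := \<zeta>) \<in> polydisc n x (%_. d)"
   by (rule polydisc_upd) (use * d in auto)
  then show "z(i := \<zeta>) \<in> S" using d by auto
 qed
qed

text \<open>Near \<open>x\<close> the derivative is Cauchy's integral over the fixed circle about
  \<open>x i\<close>. The integrand depends holomorphically on \<open>z\<close>, hence so does the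
  integral; a circle about \<open>z i\<close> would move with the point.\<close>

lemma hol_partial_deriv:
 assumes "cs_open n S" "hol n S f" "i < n"
 shows "hol n S (partial_deriv i f)"
proof (rule hol_local[OF assms(1)])
 fix x assume x: "x \<in> S"
 obtain e where e: "e > 0" "polydisc n x (%_. e) \<subseteq> S"
  "!!z i \<zeta>. z \<in> polydisc n x (%_. e) ==> i < n ==> \<zeta> \<in> cball (x i) e ==> z(i := \<zeta>) \<in> S"
  using polydisc_room[OF assms(1) x] by metis
 let ?D = "polydisc n x (%_. e)"
 have ne: "\<zeta> ~= z i" if "z \<in> ?D" "\<zeta> \<in> sphere (x i) e" for z \<zeta>
  using that assms(3) by (auto simp: polydisc_def)
 have "hol n ?D (%z. contour_integral (circlepath (x i) e)
     (%\<zeta>. f (z(i := \<zeta>)) / ((\<zeta> - z i) * (\<zeta> - z i))) / (2 * of_real pi * \<i>))"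
 proof (rule hol_divide[OF hol_contour_integral[OF cs_open_polydisc] hol_const])
  show "continuous_on (?D \<times> sphere (x i) e) (\<lambda>(z, \<zeta>). f (z(i := \<zeta>)) / ((\<zeta> - z i) * (\<zeta> - z i)))"
   unfolding split_beta
  proof (rule continuous_on_divide[OF _ continuous_on_mult[OF continuous_on_diff continuous_on_diff]];
    (intro continuous_on_snd continuous_on_id ballI)?)
   show "continuous_on (?D \<times> sphere (x i) e) (%p. f ((fst p)(i := snd p)))"
    by (rule continuous_on_upd_pair[OF hol_continuous[OF assms(2)]])
      (use e assms in auto)
   show "continuous_on (?D \<times> sphere (x i) e) (%p. fst p i)"
    "continuous_on (?D \<times> sphere (x i) e) (%p. fst p i)"
    by (intro continuous_on_coord continuous_intros)+
   show "(snd p - fst p i) * (snd p - fst p i) ~= 0" if "p \<in> ?D \<times> sphere (x i) e" for p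
    using ne[of "fst p" "snd p"] that by auto
  qed
  fix \<zeta> assume z: "\<zeta> \<in> sphere (x i) e"
  have up: "z(i := \<zeta>) \<in> S" if "z \<in> ?D" for z using e(3)[OF that assms(3)] z by auto
  have "hol n ?D (%z. f (z(i := \<zeta>)))"
  proof (rule holomorphic_severalI[OF cs_open_polydisc])
   show "continuous_on ?D (%z. f (z(i := \<zeta>)))"
    by (rule continuous_on_compose2[OF hol_continuous[OF assms(2)]])
      (use up in \<open>auto intro!: continuous_on_fun_upd continuous_on_id continuous_on_const\<close>)
   fix z j assume zj: "z \<in> ?D" "j < n"
   show "\<exists>T. open T \<and> z j \<in> T \<and> (%t. f (z(j := t, i := \<zeta>))) holomorphic_on T"
   proof (cases "j = i")
    case True then show ?thesis by (intro exI[of _ UNIV]) auto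
   next
    case False
    have c: "z(i := \<zeta>) \<in> complex_space n" using up[OF zj(1)] cs_open_subset[OF assms(1)] by auto
    have "(%t. f ((z(i := \<zeta>))(j := t))) holomorphic_on {t. z(i := \<zeta>, j := t) \<in> S}"
     by (rule hol_slice[OF assms(2,1) c zj(2)])
    moreover have "open {t. z(i := \<zeta>, j := t) \<in> S}" by (rule cs_open_slice[OF assms(1) c zj(2)])
    moreover have "z(i := \<zeta>, j := z j) = z(i := \<zeta>)" using False by auto
    ultimately show ?thesis using False up[OF zj(1)]
     by (intro exI[of _ "{t. z(i := \<zeta>, j := t) \<in> S}"]) (auto simp: fun_upd_twist)
   qed
  qed
  then show "hol n ?D (%z. f (z(i := \<zeta>)) / ((\<zeta> - z i) * (\<zeta> - z i)))"
   using ne[OF _ z] by (intro hol_divide hol_mult hol_diff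
    hol_const hol_coord) auto
 qed (use e in auto)
 then have "hol n ?D (partial_deriv i f)"
 proof (rule hol_cong[OF _ cs_open_polydisc])
  fix z assume z: "z \<in> ?D"
  have "diff_quot i (x i) e f z (z i) (z i) = partial_deriv i f z"
   by (rule diff_quot_diag[OF assms(1,2) _ assms(3)])
     (use z e(3)[OF z assms(3)] assms(3) polydisc_subset[of n x "%_. e"] in \<open>auto simp: polydisc_def\<close>)
  then show "contour_integral (circlepath (x i) e)
     (%\<zeta>. f (z(i := \<zeta>)) / ((\<zeta> - z i) * (\<zeta> - z i))) / (2 * of_real pi * \<i>) = partial_deriv i f z"
   by (simp add: diff_quot_def)
 qed
 moreover have "x \<in> ?D" using x cs_open_subset[OF assms(1)] e(1) by (auto intro: polydisc_center)
 ultimately show "\<exists>T. cs_open n T \<and> x \<in> T \<and> hol n T (partial_deriv i f)"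
  using cs_open_polydisc by blast
qed

text \<open>A product rule at a zero of \<open>u\<close>, where continuity of \<open>q\<close> is
  enough. It is applied with \<open>q\<close> a difference quotient along a curve, whose continuity
  is all that is available.\<close>

lemma has_field_derivative_mult_continuous:
 fixes u q :: "complex => complex"
 assumes "(u has_field_derivative u') (at t)" "u t = 0" "isCont q t"
 shows "((%s. u s * q s) has_field_derivative u' * q t) (at t)"
proof -
 have "((%s. (u s - u t) / (s - t)) \<longlongrightarrow> u') (at t)"
  using assms(1) by (simp add: has_field_derivative_iff)
 then have "((%s. (u s - u t) / (s - t) * q s) \<longlongrightarrow> u' * q t) (at t)"
  using assms(3) by (intro tendsto_mult) (auto simp: isCont_def)
 then show ?thesis using assms(2) by (simp add: has_field_derivative_iff)
qed

text \<open>Holomorphy is defined by continuity and separate differentiability, so total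
  differentiability has to be produced. The change of \<open>f\<close> along the curve telescopes
  into changes of one coordinate at a time, each an increment times a continuous difference
  quotient.\<close>

lemma hol_chain:
 assumes S: "cs_open n S" "hol n S f" and T: "open T" "t0 \<in> T"
  and \<gamma>: "!!t. t \<in> T ==> \<gamma> t \<in> complex_space n" "\<gamma> t0 \<in> S"
  and d: "!!j. j < n ==> ((%t. \<gamma> t j) has_field_derivative \<gamma>' j) (at t0)"
 shows "((%t. f (\<gamma> t)) has_field_derivative (\<Sum>j<n. partial_deriv j f (\<gamma> t0) * \<gamma>' j)) (at t0)"
proof -
 define x where "x = \<gamma> t0"
 \<comment> \<open>Interpolates between the constant \<open>x\<close> for \<open>m = 0\<close> and
   the curve for \<open>m = n\<close>.\<close>
 define h where "h m t = (%j. if j < m then \<gamma> t j else x j)" for m t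
 have x: "x \<in> complex_space n" using \<gamma>(1) T(2) by (simp add: x_def)
 obtain e where e: "e > 0" "polydisc n x (%_. e) \<subseteq> S"
  "!!z i \<zeta>. z \<in> polydisc n x (%_. e) ==> i < n ==> \<zeta> \<in> cball (x i) e ==> z(i := \<zeta>) \<in> S"
  using polydisc_room[OF S(1) \<gamma>(2)] unfolding x_def by metis
 let ?D = "polydisc n x (%_. e)"
 have cont: "isCont (%t. \<gamma> t j) t0" if "j < n" for j using d[OF that] DERIV_isCont by blast
 have near: "\<forall>\<^sub>F t in nhds t0. t \<in> T \<and> (\<forall>j\<in>{..<n}. \<gamma> t j \<in> ball (x j) e)"
 proof (intro eventually_conj eventually_ball_finite ballI)
  fix j assume j: "j \<in> {..<n}"
  have "((%t. \<gamma> t j) \<longlongrightarrow> x j) (nhds t0)" using cont[of j] j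
   by (simp add: continuous_at tendsto_nhds_iff x_def)
  then show "\<forall>\<^sub>F t in nhds t0. \<gamma> t j \<in> ball (x j) e"
   by (rule topological_tendstoD) (use e in auto)
 qed (use T eventually_nhds_in_open in auto)
 then obtain T' where T': "open T'" "t0 \<in> T'"
  "!!t j. t \<in> T' ==> j < n ==> \<gamma> t j \<in> ball (x j) e" "T' \<subseteq> T"
  unfolding eventually_nhds by fast
 have hD: "h m t \<in> ?D" if "t \<in> T'" "m \<le> n" for m t
  using T'(3)[OF that(1)] x e(1) that unfolding h_def polydisc_def complex_space_def by auto
 have main: "m \<le> n ==> ((%t. f (h m t)) has_field_derivative (\<Sum>j<m. partial_deriv j f x * \<gamma>' j)) (at t0)" for m
 proof (induction m)
  case 0
  then show ?case by (simp add: h_def)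
 next
  case (Suc m)
  have m: "m < n" using Suc.prems by simp
  let ?q = "%t. diff_quot m (x m) e f (h m t) (\<gamma> t m) (x m)"
  have eq: "f (h (Suc m) t) = f (h m t) + (\<gamma> t m - x m) * ?q t" if t: "t \<in> T'" for t
  proof -
   have "f ((h m t)(m := \<gamma> t m)) - f ((h m t)(m := x m)) = (\<gamma> t m - x m) * ?q t"
    by (rule diff_quot[OF S _ m])
      (use hD[OF t, of m] m e T'(3)[OF t m] polydisc_subset[of n x "%_. e"] in auto)
   moreover have "(h m t)(m := \<gamma> t m) = h (Suc m) t" "(h m t)(m := x m) = h m t"
    by (auto simp: h_def)
   ultimately show ?thesis by (simp add: algebra_simps)
  qed
  have ht0: "h m t0 = x" by (auto simp: h_def x_def)
  have "isCont ?q t0"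
  proof -
   let ?Q = "%(z, a, b). diff_quot m (x m) e f z a b"
   let ?U = "?D \<times> ball (x m) e \<times> ball (x m) e"
   have Q: "continuous_on ?U ?Q"
    by (rule continuous_on_diff_quot[OF hol_continuous[OF S(2)]])
      (use e m in auto)
   have xU: "(x, x m, x m) \<in> ?U" using e(1) x by (auto intro: polydisc_center)
   have "((%t. h m t j) \<longlongrightarrow> x j) (at t0)" for j
   proof (cases "j < m")
    case True then show ?thesis using cont[of j] m by (simp add: h_def isCont_def x_def)
   qed (simp add: h_def)
   then have "((%t. h m t) \<longlongrightarrow> x) (at t0)"
    by (rule tendsto_funI)
   then have lim: "((%t. (h m t, \<gamma> t m, x m)) \<longlongrightarrow> (x, x m, x m)) (at t0)"
    using cont[OF m] by (intro tendsto_Pair tendsto_const) (auto simp: isCont_def x_def)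
   have "\<forall>\<^sub>F t in at t0. t \<in> T'" using T' eventually_at_topological by blast
   then have ev: "\<forall>\<^sub>F t in at t0. (h m t, \<gamma> t m, x m) \<in> ?U"
    by eventually_elim (use hD T'(3) m e in auto)
   have "((%t. ?Q (h m t, \<gamma> t m, x m)) \<longlongrightarrow> ?Q (x, x m, x m)) (at t0)"
    by (rule continuous_on_tendsto_compose[OF Q lim xU ev])
   then show ?thesis by (simp add: isCont_def ht0 x_def)
  qed
  moreover have "((%t. \<gamma> t m - x m) has_field_derivative \<gamma>' m) (at t0)"
   using DERIV_diff[OF d[OF m] DERIV_const[of "x m"]] by simp
  ultimately have "((%t. (\<gamma> t m - x m) * ?q t) has_field_derivative \<gamma>' m * ?q t0) (at t0)"
   by (intro has_field_derivative_mult_continuous) (auto simp: x_def)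
  moreover have "?q t0 = partial_deriv m f x"
   using diff_quot_diag[OF S x m, of "x m" e] e hD[OF T'(2), of m] m polydisc_center[OF x] 
   by (simp add: ht0 x_def)
  ultimately have "((%t. f (h m t) + (\<gamma> t m - x m) * ?q t) has_field_derivative
    (\<Sum>j<m. partial_deriv j f x * \<gamma>' j) + \<gamma>' m * partial_deriv m f x) (at t0)"
   using Suc by (intro DERIV_add) auto
  then have "((%t. f (h (Suc m) t)) has_field_derivative
    (\<Sum>j<m. partial_deriv j f x * \<gamma>' j) + \<gamma>' m * partial_deriv m f x) (at t0)"
   by (rule has_field_derivative_transform_within_open[OF _ T'(1,2)]) (simp add: eq)
  then show ?case by (simp add: mult.commute)
 qed
 \<comment> \<open>The coordinates from \<open>n\<close> on are 0 both for the curve and for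
   \<open>x\<close>.\<close>
 have "h n t = \<gamma> t" if "t \<in> T'" for t
  using \<gamma>(1)[of t] x T'(4) that by (auto simp: h_def complex_space_def fun_eq_iff)
 then have "((%t. f (\<gamma> t)) has_field_derivative (\<Sum>j<n. partial_deriv j f x * \<gamma>' j)) (at t0)"
  using has_field_derivative_transform_within_open[OF main[of n] T'(1,2)] by simp
 then show ?thesis by (simp add: x_def)
qed

text \<open>Each slice of the composite is \<open>f\<close> along a curve, so the chain rule
  differentiates it.\<close>

lemma hol_compose:
 assumes S: "cs_open m S" and T: "cs_open n T" "hol n T f"
  and g: "!!j. j < n ==> hol m S (%z. g z j)" "!!z. z \<in> S ==> g z \<in> T"
 shows "hol m S (%z. f (g z))"
 unfolding holomorphic_several_def
proof (intro conjI ballI allI impI)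
 have gT: "g z \<in> complex_space n" if "z \<in> S" for z using g(2)[OF that] cs_open_subset[OF T(1)] by auto
 have "continuous_on S g"
 proof (rule continuous_on_coordinatewise_then_product)
  fix j show "continuous_on S (%z. g z j)"
  proof (cases "j < n")
   case True then show ?thesis using g(1) hol_continuous by blast
  next
   case False
   then have "g z j = 0" if "z \<in> S" for z using gT[OF that] by (auto simp: complex_space_def)
   then show ?thesis using continuous_on_cong[OF refl, of S "%z. g z j" "%_. 0"] by simp
  qed
 qed
 then show "continuous_on S (%z. f (g z))"
  by (rule continuous_on_compose2[OF hol_continuous[OF T(2)]]) (use g in auto)
 fix z i assume z: "z \<in> S" "i < m"
 have zc: "z \<in> complex_space m" using z cs_open_subset[OF S] by auto
 let ?T = "{t. z(i := t) \<in> S}"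
 have d: "((%t. g (z(i := t)) j) has_field_derivative deriv (%t. g (z(i := t)) j) (z i)) (at (z i))"
  if "j < n" for j
  using g(1)[OF that] z unfolding holomorphic_several_def by (meson field_differentiable_derivI)
 have "((%t. f (g (z(i := t)))) has_field_derivative
   (\<Sum>j<n. partial_deriv j f (g (z(i := z i))) * deriv (%t. g (z(i := t)) j) (z i))) (at (z i))"
  by (rule hol_chain[OF T cs_open_slice[OF S zc z(2)]]) (use gT g(2) z d in auto)
 then show "(%t. f (g (z(i := t)))) field_differentiable at (z i)"
  unfolding field_differentiable_def by blast
qed

lemma partial_deriv_compose:
 assumes S: "cs_open m S" and T: "cs_open n T" "hol n T f"
  and g: "!!j. j < n ==> hol m S (%z. g z j)" "!!z. z \<in> S ==> g z \<in> T"
  and z: "z \<in> S" "i < m"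
 shows "partial_deriv i (%z. f (g z)) z = (\<Sum>j<n. partial_deriv j f (g z) * partial_deriv i (%z. g z j) z)"
proof -
 have gT: "g z \<in> complex_space n" if "z \<in> S" for z using g(2)[OF that] cs_open_subset[OF T(1)] by auto
 have zc: "z \<in> complex_space m" using z cs_open_subset[OF S] by auto
 have d: "((%t. g (z(i := t)) j) has_field_derivative partial_deriv i (%z. g z j) z) (at (z i))"
  if "j < n" for j
  using g(1)[OF that] z unfolding holomorphic_several_def partial_deriv_def by (meson field_differentiable_derivI)
 have "((%t. f (g (z(i := t)))) has_field_derivative
   (\<Sum>j<n. partial_deriv j f (g (z(i := z i))) * partial_deriv i (%z. g z j) z)) (at (z i))"
  by (rule hol_chain[OF T cs_open_slice[OF S zc z(2)]]) (use gT g(2) z d in auto)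
 then show ?thesis
  unfolding partial_deriv_def[of i "%z. f (g z)"] by (simp add: DERIV_imp_deriv)
qed

section \<open>Identity theorems on polydiscs\<close>

lemma polydisc_identity:
 assumes f: "hol n (polydisc n x r) f" and U: "cs_open n U" "U \<subseteq> polydisc n x r" "y \<in> U"
  and zero: "!!z. z \<in> U ==> f z = 0" and z: "z \<in> polydisc n x r"
 shows "f z = 0"
proof -
 let ?D = "polydisc n x r"
 obtain e where e: "e > 0" "polydisc n y (%_. e) \<subseteq> U"
  using polydisc_nbhd[OF U(1,3)] by metis
 \<comment> \<open>The first \<open>m\<close> coordinates are freed from closeness to
   \<open>y\<close> one at a time, each by the identity theorem in one variable.\<close>
 have "m \<le> n ==> \<forall>z\<in>?D. (\<forall>j. m \<le> j \<and> j < n --> dist (y j) (z j) < e) --> f z = 0" for m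
 proof (induction m)
  case 0
  have "z \<in> U" if "z \<in> ?D" "\<forall>j. 0 \<le> j \<and> j < n --> dist (y j) (z j) < e" for z
  proof -
   have "z \<in> polydisc n y (%_. e)" using that unfolding polydisc_def by simp
   then show ?thesis using e(2) by (rule rev_subsetD)
  qed
  then show ?case using zero by blast
 next
  case (Suc m)
  show ?case
  proof (intro ballI impI)
   fix z assume z: "z \<in> ?D" "\<forall>j. Suc m \<le> j \<and> j < n --> dist (y j) (z j) < e"
   have m: "m < n" using Suc.prems by simp
   have zc: "z \<in> complex_space n" using z(1) by (simp add: polydisc_def)
   let ?B = "ball (x m) (r m)"
   have B: "{t. z(m := t) \<in> ?D} = ?B" by (simp only: polydisc_upd_iff[OF z(1) m] Collect_mem_eq)
   have h: "(%t. f (z(m := t))) holomorphic_on ?B"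
    using hol_slice[OF f cs_open_polydisc zc m] B by simp
   have ym: "y m \<in> ?B" using U m by (auto simp: polydisc_def)
   have "f (z(m := z m)) = 0"
   proof (rule analytic_continuation_open[of "?B \<inter> ball (y m) e" ?B "%t. f (z(m := t))" "%_. 0" "z m"])
    show "f (z(m := t)) = 0" if "t \<in> ?B \<inter> ball (y m) e" for t
    proof -
     have "z(m := t) \<in> ?D" using B that by auto
     moreover have "\<forall>j. m \<le> j \<and> j < n --> dist (y j) ((z(m := t)) j) < e"
      using z(2) that by auto
     ultimately show ?thesis using Suc.IH[OF less_imp_le[OF m]] by simp
    qed
    show "z m \<in> ?B" using z m by (auto simp: polydisc_def)
    show "?B \<inter> ball (y m) e ~= {}" using ym e by force
   qed (use h in auto)
   then show "f z = 0" by simp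
  qed
 qed
 from this[of n] show ?thesis using z by auto
qed

lemma iterate_partial_deriv:
 "(deriv ^^ k) (%t. g (z(m := t))) = (%t. ((partial_deriv m ^^ k) g) (z(m := t)))"
proof (induction k)
 case (Suc k)
 have "deriv (%t. G (z(m := t))) = (%t. partial_deriv m G (z(m := t)))" for G
  by (rule ext) (simp only: partial_deriv_def fun_upd_upd fun_upd_same)
 then show ?case using Suc by (simp only: funpow.simps o_apply)
qed simp

text \<open>\<open>fold\<close> applies the head of the list first, so indices appended to
  \<open>l\<close> are differentiated last; both later uses extend a list on the right.\<close>

lemma fold_partial_deriv_holomorphic:
 assumes "cs_open n S" "hol n S f" "set l \<subseteq> {..<n}"
 shows "hol n S (fold partial_deriv l f)"
 using assms by (induction l arbitrary: f) (auto intro: hol_partial_deriv)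

text \<open>Coordinates are released one at a time. The induction carries all iterated derivatives,
  because the Taylor coefficients of a slice of one of them are, up to factorials, again iterated
  derivatives.\<close>

lemma polydisc_iterated_derivs_zero:
 assumes f: "hol n (polydisc n x r) f"
  and zero: "!!l. set l \<subseteq> {..<n} ==> fold partial_deriv l f x = 0" and z: "z \<in> polydisc n x r"
  and x: "x \<in> complex_space n"
 shows "f z = 0"
proof -
 let ?D = "polydisc n x r"
 have "m \<le> n ==> \<forall>z\<in>?D. (\<forall>j. m \<le> j --> z j = x j) -->
     (\<forall>l. set l \<subseteq> {..<n} --> fold partial_deriv l f z = 0)" for m
 proof (induction m)
  case 0
  show ?case
  proof (intro ballI impI allI)
   fix z l assume "\<forall>j. 0 \<le> j --> z j = x j" "set l \<subseteq> {..<n}"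
   then have "z = x" "set l \<subseteq> {..<n}" by (auto intro: ext)
   then show "fold partial_deriv l f z = 0" using zero by simp
  qed
 next
  case (Suc m)
  show ?case
  proof (intro ballI impI allI)
   fix z l assume z: "z \<in> ?D" "\<forall>j. Suc m \<le> j --> z j = x j" and l: "set l \<subseteq> {..<n}"
   have m: "m < n" using Suc.prems by simp
   have zc: "z \<in> complex_space n" using z(1) by (simp add: polydisc_def)
   let ?B = "ball (x m) (r m)"
   let ?g = "fold partial_deriv l f"
   have B: "{t. z(m := t) \<in> ?D} = ?B" by (simp only: polydisc_upd_iff[OF z(1) m] Collect_mem_eq)
   have h: "(%t. ?g (z(m := t))) holomorphic_on ?B"
    using hol_slice[OF fold_partial_deriv_holomorphic[OF cs_open_polydisc f l] cs_open_polydisc zc m] B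
    by simp
   have rm: "0 < r m" using z m by (auto simp: polydisc_def) (meson dual_order.strict_trans2 zero_le_dist)
   have "(%t. ?g (z(m := t))) (z m) = 0"
   proof (rule holomorphic_fun_eq_0_on_connected[OF h])
    fix k
    have "(partial_deriv m ^^ k) ?g = fold partial_deriv (l @ replicate k m) f"
     by (simp add: fold_replicate)
    moreover have "fold partial_deriv (l @ replicate k m) f (z(m := x m)) = 0"
    proof -
     have "z(m := x m) \<in> ?D" using B rm by auto
     moreover have "\<forall>j. m \<le> j --> (z(m := x m)) j = x j" using z(2) by auto
     moreover have "set (l @ replicate k m) \<subseteq> {..<n}" using l m by auto
     ultimately show ?thesis
      by (rule Suc.IH[OF less_imp_le[OF m], THEN bspec, THEN mp, THEN spec, THEN mp])
    qed
    ultimately show "(deriv ^^ k) (%t. ?g (z(m := t))) (x m) = 0"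
     by (simp add: iterate_partial_deriv)
   qed (use rm z m in \<open>auto simp: polydisc_def\<close>)
   then show "?g z = 0" by simp
  qed
 qed
 from this[of n] have "\<forall>l. set l \<subseteq> {..<n} --> fold partial_deriv l f z = 0"
  using z x by (auto simp: polydisc_def complex_space_def)
 from this[rule_format, of "[]"] show ?thesis by simp
qed

text \<open>Among the iterated partial derivatives of \<open>h\<close> that do not vanish identically on \<open>Z\<close> choose one of minimal
 order.\<close>

lemma regular_equation:
 assumes h: "hol n (polydisc n x r) h" and x: "x \<in> Z" and Z: "Z \<subseteq> polydisc n x r"
  and zero: "!!z. z \<in> Z ==> h z = 0" and nz: "w \<in> polydisc n x r" "h w ~= 0"
 obtains g i y where "hol n (polydisc n x r) g" "!!z. z \<in> Z ==> g z = 0"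
  "i < n" "y \<in> Z" "partial_deriv i g y ~= 0"
proof -
 let ?P = "%l. set l \<subseteq> {..<n} \<and> (\<exists>y\<in>Z. fold partial_deriv l h y ~= 0)"
 have "x \<in> complex_space n" using x Z by (auto simp: polydisc_def)
 then have "\<exists>l. ?P l" using polydisc_iterated_derivs_zero[OF h _ nz(1)] x nz(2) by blast
 then obtain l where l: "?P l" "!!l'. ?P l' ==> length l \<le> length l'"
  using ex_has_least_nat[of ?P _ length] by blast
 \<comment> \<open>The empty list is excluded since \<open>h\<close> itself vanishes on
   \<open>Z\<close>. The last index then supplies the direction \<open>i\<close>, and minimality
   makes the derivative along \<open>l'\<close> vanish on \<open>Z\<close>.\<close>
 have "l ~= []" using l(1) zero by auto
 then obtain l' i where li: "l = l' @ [i]" by (cases l rule: rev_cases) auto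
 let ?g = "fold partial_deriv l' h"
 obtain y where "y \<in> Z" "partial_deriv i ?g y ~= 0" using l(1) li by auto
 moreover have "?g z = 0" if "z \<in> Z" for z using l li that by force
 moreover have "hol n (polydisc n x r) ?g"
  using fold_partial_deriv_holomorphic[OF cs_open_polydisc h] l li by auto
 ultimately show thesis using that l li by auto
qed

text \<open>The tube lemma: finitely many polydiscs about points \<open>x(i := \<zeta>)\<close>
  cover the compact set, and the least of their radii serves all slices.\<close>

lemma compact_tube:
 assumes K: "compact K" and x: "x \<in> complex_space n" and i: "i < n"
  and W: "cs_open n W" "!!\<zeta>. \<zeta> \<in> K ==> x(i := \<zeta>) \<in> W"
 obtains \<delta> where "\<delta> > 0" "\<forall>z\<in>polydisc n x (%_. \<delta>). \<forall>\<zeta>\<in>K. z(i := \<zeta>) \<in> W"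
proof -
 have "\<exists>e>0. polydisc n (x(i := \<zeta>)) (%_. e) \<subseteq> W" if "\<zeta> \<in> K" for \<zeta>
  using polydisc_nbhd[OF W(1) W(2)[OF that]] by metis
 then obtain e where e: "!!\<zeta>. \<zeta> \<in> K ==> e \<zeta> > 0 \<and> polydisc n (x(i := \<zeta>)) (%_. e \<zeta>) \<subseteq> W"
  by metis
 obtain C where C: "C \<subseteq> K" "finite C" "K \<subseteq> (\<Union>\<zeta>\<in>C. ball \<zeta> (e \<zeta>))"
  by (rule compactE_image[OF K, of K "%\<zeta>. ball \<zeta> (e \<zeta>)"]) (use e in auto)
 \<comment> \<open>The 1 guards against an empty subcover, which occurs when \<open>K\<close> is
   empty.\<close>
 define \<delta> where "\<delta> = Min (insert 1 (e ` C))"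
 have \<delta>: "\<delta> > 0" "!!\<zeta>. \<zeta> \<in> C ==> \<delta> \<le> e \<zeta>" unfolding \<delta>_def using C e by (auto intro: Min_le)
 have "\<forall>z\<in>polydisc n x (%_. \<delta>). \<forall>\<zeta>\<in>K. z(i := \<zeta>) \<in> W"
 proof (intro ballI)
  fix z \<zeta> assume z: "z \<in> polydisc n x (%_. \<delta>)" "\<zeta> \<in> K"
  then obtain \<xi> where \<xi>: "\<xi> \<in> C" "dist \<xi> \<zeta> < e \<xi>" using C(3) by auto
  have "z(i := \<zeta>) \<in> polydisc n (x(i := \<xi>)) (%_. e \<xi>)"
   using z(1) \<xi> \<delta>(2)[OF \<xi>(1)] i by (fastforce simp: polydisc_def complex_space_def)
  moreover have "polydisc n (x(i := \<xi>)) (%_. e \<xi>) \<subseteq> W" using e C(1) \<xi>(1) by (metis subsetD)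
  ultimately show "z(i := \<zeta>) \<in> W" by (rule rev_subsetD)
 qed
 then show thesis by (rule that[OF \<delta>(1)])
qed

section \<open>Zero sets and cylinders around a smooth hypersurface\<close>

lemma cs_open_preimage:
 assumes "cs_open n S" "continuous_on S f" "open B"
 shows "cs_open n {z \<in> S. f z \<in> B}"
proof -
 obtain A where A: "open A" "A \<inter> S = f -` B \<inter> S"
  using assms(2,3) unfolding continuous_on_open_invariant by metis
 then have "{z \<in> S. f z \<in> B} = S \<inter> A" by auto
 then show ?thesis using assms(1) A(1) by (simp add: openin_Int_open)
qed

lemma cs_open_nonzero:
 assumes "cs_open n S" "hol n S (f :: (nat => complex) => complex)"
 shows "cs_open n {z \<in> S. f z ~= 0}"
 using cs_open_preimage[OF assms(1) hol_continuous[OF assms(2)], of "- {0}"] by (simp add: open_Compl)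

lemma hol_freeze:
 assumes T: "cs_open n T" "hol n T f" and S: "cs_open n S" 
  and up: "!!z. z \<in> S ==> z(i := \<zeta>) \<in> T"
 shows "hol n S (%z. f (z(i := \<zeta>)))"
proof (rule hol_compose[OF S T _ up])
 fix j show "hol n S (%z. (z(i := \<zeta>)) j)"
  by (cases "j = i") (simp_all add: hol_const hol_coord)
qed

text \<open>A neighbourhood adapted to a function with nonzero derivative in direction
  \<open>i\<close>: each slice in that direction carries at most one zero, which is simple, and
  \<open>g\<close> is bounded away from 0 near the rim. The zero set is thus a graph over part of
  the remaining coordinates, without an implicit function being solved for.\<close>

locale cylinder =
 fixes n :: nat and V :: "(nat => complex) set" and g :: "(nat => complex) => complex"
  and x :: "nat => complex" and i :: nat and r :: "nat => real" and \<eta> :: real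
 assumes V: "cs_open n V" and g: "hol n V g" and i: "i < n"
  and x: "x \<in> complex_space n" and r: "!!j. r j > 0" and \<eta>: "\<eta> > 0"
  and upd_in_V: "!!z \<zeta>. z \<in> polydisc n x r ==> \<zeta> \<in> cball (x i) (r i) ==> z(i := \<zeta>) \<in> V"
  and g_annulus: "!!z \<zeta>. z \<in> polydisc n x r ==> r i / 2 \<le> dist (x i) \<zeta> ==> dist (x i) \<zeta> \<le> r i ==>
           \<eta> \<le> norm (g (z(i := \<zeta>)))"
  and g_root: "!!z w. z \<in> polydisc n x r ==> w \<in> ball (x i) (r i) ==> g z = 0 ==> g (z(i := w)) = 0 ==> w = z i"
  and g_deriv: "!!z. z \<in> polydisc n x r ==> partial_deriv i g z ~= 0"

text \<open>Where the derivative of \<open>g\<close> in direction \<open>i\<close> stays within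
  \<open>norm c / 2\<close> of its value \<open>c\<close> at \<open>x\<close>, every slice of
  \<open>g\<close> is injective. So \<open>x\<close> is the only zero on its own slice; compactness
  of an annulus bounds \<open>g\<close> below there, and the tube lemma carries the bound to nearby
  slices.\<close>

lemma cylinder_exists:
 assumes V: "cs_open n V" and g: "hol n V g" and i: "i < n" and x: "x \<in> V"
  and gx: "g x = 0" "partial_deriv i g x ~= 0"
 obtains r \<eta> where "cylinder n V g x i r \<eta>"
proof -
 define c where "c = partial_deriv i g x"
 let ?W = "{z \<in> V. partial_deriv i g z \<in> ball c (norm c / 2)}"
 have xc: "x \<in> complex_space n" using x cs_open_subset[OF V] by auto
 have c: "c ~= 0" using gx by (simp add: c_def)
 have "cs_open n ?W"
  by (rule cs_open_preimage[OF V hol_continuous[OF hol_partial_deriv[OF V g i]]]) simp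
 moreover have "x \<in> ?W" using x c by (simp add: c_def)
 ultimately obtain e where e: "e > 0" "polydisc n x (%_. e) \<subseteq> ?W" using polydisc_nbhd by metis
 let ?P = "polydisc n x (%_. e)"
 \<comment> \<open>On the slice, \<open>g - c * \<zeta>\<close> has Lipschitz constant
   \<open>norm c / 2\<close>, so two points with equal values of \<open>g\<close> are at distance
   0.\<close>
 have inj: "w = z i" if z: "z \<in> ?P" "w \<in> ball (x i) e" "g (z(i := w)) = g z" for z w
 proof (rule ccontr)
  assume ne: "w ~= z i"
  have d: "((%\<zeta>. g (z(i := \<zeta>)) - c * \<zeta>) has_field_derivative (partial_deriv i g (z(i := \<zeta>)) - c)) (at \<zeta> within ball (x i) e)"
   if "\<zeta> \<in> ball (x i) e" for \<zeta>
  proof -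
   have "z(i := \<zeta>) \<in> V" using e(2) polydisc_upd_iff[OF z(1) i] that by auto
   then have "(%t. g ((z(i := \<zeta>))(i := t))) field_differentiable at ((z(i := \<zeta>)) i)"
    using g i unfolding holomorphic_several_def by blast
   then have "((%t. g (z(i := t))) has_field_derivative partial_deriv i g (z(i := \<zeta>))) (at \<zeta>)"
    using field_differentiable_derivI by (fastforce simp: partial_deriv_def)
   moreover have "((%\<zeta>. c * \<zeta>) has_field_derivative c) (at \<zeta>)"
    using DERIV_cmult[OF DERIV_ident, of c] by simp
   ultimately show ?thesis by (intro has_field_derivative_at_within[OF DERIV_diff])
  qed
  have b: "norm (partial_deriv i g (z(i := \<zeta>)) - c) \<le> norm c / 2" if "\<zeta> \<in> ball (x i) e" for \<zeta>
  proof -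
   have "z(i := \<zeta>) \<in> ?W" using e(2) polydisc_upd_iff[OF z(1) i] that by blast
   then show ?thesis by (simp add: dist_norm norm_minus_commute)
  qed
  have zi: "z i \<in> ball (x i) e" using z i by (auto simp: polydisc_def)
  have "norm ((g (z(i := w)) - c * w) - (g (z(i := z i)) - c * z i)) \<le> norm c / 2 * norm (w - z i)"
   by (rule field_differentiable_bound[OF convex_ball d b z(2) zi])
  moreover have "(g (z(i := w)) - c * w) - (g (z(i := z i)) - c * z i) = c * (z i - w)"
   using z(3) by (simp add: algebra_simps)
  ultimately have "norm (c * (z i - w)) \<le> norm c / 2 * norm (w - z i)" by (simp only:)
  then have "norm c * norm (w - z i) \<le> norm c / 2 * norm (w - z i)"
   by (simp only: norm_mult norm_minus_commute[of "z i"])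
  then show False using c ne by simp
 qed
 define R where "R = e / 2"
 have R: "R > 0" "R < e" using e by (auto simp: R_def)
 \<comment> \<open>A closed annulus: removing the inner disc keeps the zero \<open>x i\<close> out,
   and compactness yields a positive minimum of \<open>norm g\<close>.\<close>
 define K where "K = cball (x i) R - ball (x i) (R / 2)"
 have K: "compact K" unfolding K_def by (simp add: compact_diff)
 have xP: "x \<in> ?P" using e xc by (auto intro: polydisc_center)
 have "norm (g (x(i := \<zeta>))) > 0" if "\<zeta> \<in> K" for \<zeta>
  using inj[OF xP, of \<zeta>] that R gx by (auto simp: K_def)
 moreover have xV: "x(i := \<zeta>) \<in> V" if "\<zeta> \<in> cball (x i) R" for \<zeta>
  using polydisc_upd_iff[OF xP i, of \<zeta>] that R e by auto
 moreover have "continuous_on K (%\<zeta>. norm (g (x(i := \<zeta>))))"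
  by (intro continuous_on_norm continuous_on_compose2[OF hol_continuous[OF g]]
    continuous_on_fun_upd continuous_on_const continuous_on_id) (use xV in \<open>auto simp: K_def\<close>)
 moreover have "x i + of_real R \<in> K" using R by (auto simp: K_def dist_norm)
 ultimately obtain \<xi> where \<xi>: "\<xi> \<in> K" "!!\<zeta>. \<zeta> \<in> K ==> norm (g (x(i := \<xi>))) \<le> norm (g (x(i := \<zeta>)))" "norm (g (x(i := \<xi>))) > 0"
  using continuous_attains_inf[OF K] by (metis empty_iff)
 \<comment> \<open>Half the minimum, so that the bound is strict over \<open>K\<close> and the open
   set \<open>?W'\<close> defined by it is one to which the tube lemma applies.\<close>
 define \<eta> where "\<eta> = norm (g (x(i := \<xi>))) / 2"
 have \<eta>: "\<eta> > 0" using \<xi> by (simp add: \<eta>_def)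
 let ?W' = "{z \<in> V. g z \<in> - cball 0 \<eta>}"
 have W': "cs_open n ?W'"
  by (rule cs_open_preimage[OF V hol_continuous[OF g]]) (simp add: open_Compl)
 have W'K: "x(i := \<zeta>) \<in> ?W'" if "\<zeta> \<in> K" for \<zeta>
 proof -
  have "\<eta> < norm (g (x(i := \<zeta>)))" using \<xi>(2)[OF that] \<xi>(3) unfolding \<eta>_def by linarith
  then show ?thesis using xV[of \<zeta>] that by (simp add: K_def)
 qed
 obtain \<delta> where \<delta>: "\<delta> > 0" "\<forall>z\<in>polydisc n x (%_. \<delta>). \<forall>\<zeta>\<in>K. z(i := \<zeta>) \<in> ?W'"
  by (rule compact_tube[OF K xc i W' W'K]) (assumption | rule that)+
 \<comment> \<open>Direction \<open>i\<close> keeps the radius of the annulus; the others must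
   respect both the tube and the region where the derivative hardly varies.\<close>
 define r where "r j = (if j = i then R else min \<delta> e)" for j
 have "cylinder n V g x i r \<eta>"
 proof
  fix z assume z: "z \<in> polydisc n x r"
  have "r j \<le> e" for j using R by (simp add: r_def)
  then have "polydisc n x r \<subseteq> ?P" by (intro polydisc_mono)
  then have zP: "z \<in> ?P" using z by (rule subsetD)
  then have "z \<in> ?W" using e(2) by (rule rev_subsetD)
  then show "partial_deriv i g z ~= 0" using c by (auto simp: dist_norm)
  show "z(i := \<zeta>) \<in> V" if "\<zeta> \<in> cball (x i) (r i)" for \<zeta>
   using polydisc_upd_iff[OF zP i, of \<zeta>] that R e by (auto simp: r_def)
  show "w = z i" if "w \<in> ball (x i) (r i)" "g z = 0" "g (z(i := w)) = 0" for w
   using inj[OF zP, of w] that R by (auto simp: r_def)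
  show "\<eta> \<le> norm (g (z(i := \<zeta>)))" if "r i / 2 \<le> dist (x i) \<zeta>" "dist (x i) \<zeta> \<le> r i" for \<zeta>
  proof -
   \<comment> \<open>\<open>z i\<close> may be further than \<open>\<delta>\<close> from
     \<open>x i\<close>; replacing it by \<open>x i\<close> does not change the slice.\<close>
   have "z(i := x i) \<in> polydisc n x (%_. \<delta>)"
    using z \<delta>(1) i by (auto simp: polydisc_def complex_space_def r_def)
   from \<delta>(2)[rule_format, OF this, of \<zeta>] show ?thesis using that by (auto simp: K_def r_def)
  qed
 qed (use V g i xc \<eta> R e \<delta> in \<open>auto simp: r_def\<close>)
 then show thesis using that by blast
qed

context cylinder
begin

abbreviation D where "D \<equiv> polydisc n x r"

lemma D_subset_V: "D \<subseteq> V"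
proof
 fix z assume "z \<in> D"
 then show "z \<in> V" using upd_in_V[of z "z i"] i by (auto simp: polydisc_def)
qed

lemma D_slice: "z \<in> D ==> z i \<in> ball (x i) (r i)"
 using i by (auto simp: polydisc_def)

lemma x_in_D: "x \<in> D"
 using x r by (auto intro: polydisc_center)

lemma g_sphere: "z \<in> D ==> \<zeta> \<in> sphere (x i) (r i) ==> \<eta> \<le> norm (g (z(i := \<zeta>)))"
 using g_annulus[of z \<zeta>] r[of i] by auto

text \<open>Only the values of \<open>F\<close> on the circle bounding the slice enter, and there
  \<open>g\<close> does not vanish. So \<open>F\<close> may be singular along
  \<open>g = 0\<close>.\<close>

definition cauchy_ext :: "((nat => complex) => complex) => (nat => complex) => complex" where
 "cauchy_ext F z = contour_integral (circlepath (x i) (r i)) (%\<zeta>. F (z(i := \<zeta>)) / (\<zeta> - z i)) / (2 * of_real pi * \<i>)"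

lemma cauchy_ext_holomorphic:
 assumes W: "cs_open n W" "hol n W F"
  and up: "!!z \<zeta>. z \<in> D ==> \<zeta> \<in> sphere (x i) (r i) ==> z(i := \<zeta>) \<in> W"
 shows "hol n D (cauchy_ext F)"
 unfolding cauchy_ext_def
proof (rule hol_divide[OF hol_contour_integral[OF cs_open_polydisc] hol_const])
 have ne: "\<zeta> ~= z i" if "z \<in> D" "\<zeta> \<in> sphere (x i) (r i)" for z \<zeta>
  using that D_slice by fastforce
 show "continuous_on (D \<times> sphere (x i) (r i)) (\<lambda>(z, \<zeta>). F (z(i := \<zeta>)) / (\<zeta> - z i))"
  unfolding split_beta
 proof (rule continuous_on_divide[OF _ continuous_on_diff]; (intro continuous_on_snd continuous_on_id ballI)?)
  show "continuous_on (D \<times> sphere (x i) (r i)) (%p. F ((fst p)(i := snd p)))"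
   by (rule continuous_on_upd_pair[OF hol_continuous[OF W(2)]]) (use up in auto)
  show "continuous_on (D \<times> sphere (x i) (r i)) (%p. fst p i)"
   by (intro continuous_on_coord continuous_on_fst continuous_on_id)
  show "snd p - fst p i ~= 0" if "p \<in> D \<times> sphere (x i) (r i)" for p
   using ne[of "fst p" "snd p"] that by auto
 qed
 fix \<zeta> assume z: "\<zeta> \<in> sphere (x i) (r i)"
 show "hol n D (%z. F (z(i := \<zeta>)) / (\<zeta> - z i))"
  by (rule hol_divide[OF hol_freeze[OF W cs_open_polydisc]
    hol_diff[OF hol_const hol_coord]])
    (use ne[OF _ z] up[OF _ z] in auto)
qed (use r[of i] in auto)

text \<open>Cauchy's formula on a single slice. Agreement of \<open>F\<close> and \<open>u\<close>
  is asked for on the circle only, so that \<open>u\<close> may be \<open>F\<close> with a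
  singularity removed.\<close>

lemma cauchy_ext_eq:
 assumes "z \<in> D" "u holomorphic_on cball (x i) (r i)" "!!\<zeta>. \<zeta> \<in> sphere (x i) (r i) ==> F (z(i := \<zeta>)) = u \<zeta>"
 shows "cauchy_ext F z = u (z i)"
proof -
 have "((%\<zeta>. u \<zeta> / (\<zeta> - z i)) has_contour_integral (2 * of_real pi * \<i> * u (z i))) (circlepath (x i) (r i))"
  by (rule Cauchy_integral_circlepath_simple[OF assms(2)])
    (use D_slice[OF assms(1)] in \<open>auto simp: dist_norm norm_minus_commute\<close>)
 then have "((%\<zeta>. F (z(i := \<zeta>)) / (\<zeta> - z i)) has_contour_integral (2 * of_real pi * \<i> * u (z i))) (circlepath (x i) (r i))"
  by (rule has_contour_integral_eq) (use assms(3) r[of i] in auto)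
 then show ?thesis by (simp add: cauchy_ext_def contour_integral_unique)
qed

text \<open>The slice through \<open>y\<close> meets \<open>g = 0\<close> in \<open>y\<close> alone,
  so it avoids \<open>Z\<close>, and so do nearby slices; there Cauchy's formula reproduces
  \<open>F\<close>. The identity theorem in \<open>z\<close> for fixed \<open>\<zeta>\<close>
  spreads the agreement to the annulus of every slice, and the one in \<open>\<zeta>\<close> spreads
  it from there over the slice off \<open>g = 0\<close>.\<close>

lemma hartogs_extension:
 assumes Z: "cs_open n (V - Z)" "!!z. z \<in> Z ==> g z = 0" and F: "hol n (V - Z) F"
  and y: "y \<in> D" "g y = 0" "y \<notin> Z"
 shows "hol n D (cauchy_ext F)" "!!z. z \<in> D ==> g z ~= 0 ==> cauchy_ext F z = F z"
proof -
 let ?u = "cauchy_ext F" and ?C = "cball (x i) (r i)" and ?B = "ball (x i) (r i)"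
 have off: "z(i := \<zeta>) \<in> V - Z" if "z \<in> D" "\<zeta> \<in> ?C" "g (z(i := \<zeta>)) ~= 0" for z \<zeta>
  using that upd_in_V Z(2) by blast
 have ann: "g (z(i := \<zeta>)) ~= 0" if "z \<in> D" "r i / 2 \<le> dist (x i) \<zeta>" "dist (x i) \<zeta> \<le> r i" for z \<zeta>
  using g_annulus[OF that] \<eta> by auto
 show hol: "hol n D ?u"
 proof (rule cauchy_ext_holomorphic[OF Z(1) F])
  show "z(i := \<zeta>) \<in> V - Z" if "z \<in> D" "\<zeta> \<in> sphere (x i) (r i)" for z \<zeta>
   using off[OF that(1), of \<zeta>] ann[OF that(1), of \<zeta>] that r[of i] by auto
 qed
 have yc: "y \<in> complex_space n" using y by (simp add: polydisc_def)
 \<comment> \<open>A zero of \<open>g\<close> on this closed disc lies inside by the bound near the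
   rim, hence equals \<open>y i\<close>; and \<open>y\<close> is outside \<open>Z\<close>.\<close>
 have yW: "y(i := \<zeta>) \<in> V - Z" if "\<zeta> \<in> ?C" for \<zeta>
 proof (cases "g (y(i := \<zeta>)) = 0")
  case True
  then have "\<zeta> \<in> ?B" using ann[OF y(1), of \<zeta>] that r[of i] by force
  then have "\<zeta> = y i" using g_root[OF y(1) _ y(2) True] by simp
  then show ?thesis using y D_subset_V by auto
 qed (use off[OF y(1) that] in auto)
 obtain \<delta> where \<delta>: "\<delta> > 0" "\<forall>z\<in>polydisc n y (%_. \<delta>). \<forall>\<zeta>\<in>?C. z(i := \<zeta>) \<in> V - Z"
  by (rule compact_tube[OF compact_cball yc i Z(1) yW]) (assumption | rule that)+
 let ?U = "D \<inter> polydisc n y (%_. \<delta>)"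
 have eqU: "?u (z(i := \<zeta>)) = F (z(i := \<zeta>))" if z: "z \<in> ?U" "\<zeta> \<in> ?B" for z \<zeta>
 proof -
  have zc: "z \<in> complex_space n" using z by (simp add: polydisc_def)
  have h: "(%t. F (z(i := t))) holomorphic_on ?C"
   by (rule slice_cball_holomorphic[OF Z(1) F zc i]) (use \<delta>(2) z in auto)
  have "z(i := \<zeta>) \<in> D" using polydisc_upd_iff[of z n x r i \<zeta>] z i by auto
  from cauchy_ext_eq[OF this h, of F] show ?thesis by simp
 qed
 \<comment> \<open>For \<open>\<zeta>\<close> in the annulus both sides are holomorphic in
   \<open>z\<close> on all of \<open>D\<close>, so their agreement near \<open>y\<close> spreads
   over \<open>D\<close>.\<close>
 have annulus: "?u (z(i := \<zeta>)) = F (z(i := \<zeta>))"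
  if z: "z \<in> D" and \<zeta>: "r i / 2 < dist (x i) \<zeta>" "dist (x i) \<zeta> < r i" for z \<zeta>
 proof -
  have zB: "\<zeta> \<in> ?B" using \<zeta> by simp
  have upD: "w(i := \<zeta>) \<in> D" if "w \<in> D" for w using polydisc_upd_iff[OF that i] zB by auto
  have upZ: "w(i := \<zeta>) \<in> V - Z" if "w \<in> D" for w using off[OF that, of \<zeta>] ann[OF that, of \<zeta>] \<zeta> by auto
  have "?u (z(i := \<zeta>)) - F (z(i := \<zeta>)) = 0"
  proof (rule polydisc_identity[where U = ?U and y = y and f = "%z. ?u (z(i := \<zeta>)) - F (z(i := \<zeta>))", OF _ _ _ _ _ z])
   show "hol n D (%z. ?u (z(i := \<zeta>)) - F (z(i := \<zeta>)))"
    by (intro hol_diff hol_freeze[OF cs_open_polydisc hol cs_open_polydisc upD]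
       hol_freeze[OF Z(1) F cs_open_polydisc upZ])
   show "cs_open n ?U" by (intro openin_Int cs_open_polydisc)
   show "y \<in> ?U" using y yc \<delta>(1) by (auto intro: polydisc_center)
  qed (use eqU zB in auto)
  then show ?thesis by simp
 qed
 fix z assume z: "z \<in> D" "g z ~= 0"
 have zc: "z \<in> complex_space n" using z by (simp add: polydisc_def)
 \<comment> \<open>The slice has at most one zero; removing it leaves a connected set, so the
   agreement continues from the annulus.\<close>
 define N where "N = {\<zeta> \<in> ?B. g (z(i := \<zeta>)) = 0}"
 have "\<zeta> = \<xi>" if "\<zeta> \<in> N" "\<xi> \<in> N" for \<zeta> \<xi>
 proof -
  have "z(i := \<xi>) \<in> D" using polydisc_upd_iff[OF z(1) i] that by (auto simp: N_def)
  from g_root[OF this, of \<zeta>] show ?thesis using that by (auto simp: N_def)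
 qed
 then have N: "finite N" by (metis finite.simps insertI1 is_singletonI' is_singleton_def)
 have zsub: "z(i := \<zeta>) \<in> D" if "\<zeta> \<in> ?B" for \<zeta> using polydisc_upd_iff[OF z(1) i] that by auto
 have hu: "(%t. ?u (z(i := t))) holomorphic_on ?B - N"
  by (rule holomorphic_on_subset[OF hol_slice[OF hol cs_open_polydisc zc i]]) (use zsub in auto)
 have hF: "(%t. F (z(i := t))) holomorphic_on ?B - N"
  by (rule holomorphic_on_subset[OF hol_slice[OF F Z(1) zc i]])
    (use off[OF z(1)] in \<open>auto simp: N_def\<close>)
 let ?A = "{\<zeta>. r i / 2 < dist (x i) \<zeta> \<and> dist (x i) \<zeta> < r i}"
 have "?u (z(i := z i)) = F (z(i := z i))"
 proof (rule analytic_continuation_open[of ?A "?B - N" "%t. ?u (z(i := t))" "%t. F (z(i := t))"])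
  show "open ?A" by (intro open_Collect_conj open_Collect_less continuous_intros)
  have "x i + of_real (3 * r i / 4) \<in> ?A" using r[of i] by (simp add: dist_norm)
  then show "?A ~= {}" by blast
  show "open (?B - N)" using N by (simp add: finite_imp_closed open_Diff)
  show "connected (?B - N)" using N by (intro connected_open_delete_finite) auto
  show "?A \<subseteq> ?B - N" using ann[OF z(1)] by (auto simp: N_def)
  show "z i \<in> ?B - N" using z D_slice by (auto simp: N_def)
 qed (use hu hF annulus z in auto)
 then show "?u z = F z" by simp
qed

text \<open>On each slice \<open>u\<close> vanishes at the simple zero of \<open>g\<close>, so
  \<open>u / g\<close> extends holomorphically across it. The quotient is expressed by
  \<open>cauchy_ext\<close> because that formula is holomorphic in all variables at once and can be
  estimated on the circle.\<close>

lemma division_step: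
 assumes b: "hol n V b" and u: "hol n D u"
  and bu: "!!z. z \<in> D ==> b z = g z ^ k * u z" and u0: "!!z. z \<in> D ==> g z = 0 ==> u z = 0"
 shows "hol n D (cauchy_ext (%z. b z / g z ^ Suc k))"
  "!!z. z \<in> D ==> b z = g z ^ Suc k * cauchy_ext (%z. b z / g z ^ Suc k) z"
proof -
 let ?F = "%z. b z / g z ^ Suc k" and ?W = "{z \<in> V. g z ~= 0}"
 have W: "cs_open n ?W" by (rule cs_open_nonzero[OF V g])
 have F: "hol n ?W ?F"
  by (intro hol_divide hol_power hol_subset[OF b] hol_subset[OF g])
    auto
 show "hol n D (cauchy_ext ?F)"
 proof (rule cauchy_ext_holomorphic[OF W F])
  show "z(i := \<zeta>) \<in> ?W" if "z \<in> D" "\<zeta> \<in> sphere (x i) (r i)" for z \<zeta>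
   using upd_in_V[OF that(1), of \<zeta>] g_sphere[OF that] \<eta> that(2) by auto
 qed
 fix z assume z: "z \<in> D"
 have zc: "z \<in> complex_space n" using z by (simp add: polydisc_def)
 show "b z = g z ^ Suc k * cauchy_ext ?F z"
 proof (cases "g z = 0")
  case True then show ?thesis using bu[OF z] u0[OF z] by simp
 next
  case False
  let ?T = "{\<zeta>. z(i := \<zeta>) \<in> ?W}" and ?B = "ball (x i) (r i)"
  have T: "open ?T" by (rule cs_open_slice[OF W zc i])
  have hT: "(%\<zeta>. ?F (z(i := \<zeta>))) holomorphic_on ?T"
   by (rule hol_slice[OF F W zc i])
  have zsub: "z(i := \<zeta>) \<in> D" if "\<zeta> \<in> ?B" for \<zeta> using polydisc_upd_iff[OF z(1) i] that by auto
  have cb: "\<zeta> \<in> ?T" if "\<zeta> \<in> cball (x i) (r i)" "g (z(i := \<zeta>)) ~= 0" for \<zeta>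
   using upd_in_V[OF z that(1)] that by auto
  have zi: "z i \<in> ?B" using D_slice z by simp
  have "cauchy_ext ?F z = ?F z"
  proof (cases "\<exists>p\<in>?B. g (z(i := p)) = 0")
   case False
   then have "cball (x i) (r i) \<subseteq> ?T" using cb g_sphere[OF z] \<eta> by (fastforce simp: cball_def sphere_def le_less)
   then have "(%\<zeta>. ?F (z(i := \<zeta>))) holomorphic_on cball (x i) (r i)"
    using hT holomorphic_on_subset by blast
   from cauchy_ext_eq[OF z this, of ?F] show ?thesis by simp
  next
   case True
   then obtain p where p: "p \<in> ?B" "g (z(i := p)) = 0" by blast
   have uniq: "\<zeta> = p" if "\<zeta> \<in> ?B" "g (z(i := \<zeta>)) = 0" for \<zeta>
    using g_root[OF zsub[OF p(1)], of \<zeta>] that p by auto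
   \<comment> \<open>The open disc alone does not contain its circle; adding the points of the slice
     where \<open>g\<close> is nonzero gives an open set around the closed disc.\<close>
   let ?A = "?T \<union> ?B"
   have A: "?A - {p} \<subseteq> ?T"
   proof
    fix \<zeta> assume \<zeta>: "\<zeta> \<in> ?A - {p}"
    show "\<zeta> \<in> ?T"
    proof (cases "\<zeta> \<in> ?T")
     case False
     then have "\<zeta> \<in> ?B" using \<zeta> by blast
     moreover have "g (z(i := \<zeta>)) ~= 0" using uniq[OF calculation] \<zeta> by auto
     ultimately show ?thesis using cb[of \<zeta>] by simp
    qed
   qed
   \<comment> \<open>The limit of \<open>u / g\<close> at the common zero \<open>p\<close>, as the
     quotient of the two derivatives.\<close>
   let ?c = "partial_deriv i u (z(i := p)) / partial_deriv i g (z(i := p))"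
   have quot: "((%\<zeta>. f (z(i := \<zeta>)) / (\<zeta> - p)) \<longlongrightarrow> partial_deriv i f (z(i := p))) (at p)"
    if f: "hol n D f" "f (z(i := p)) = 0" for f
   proof -
    have "(%t. f ((z(i := p))(i := t))) field_differentiable at ((z(i := p)) i)"
     using f(1) i zsub[OF p(1)] unfolding holomorphic_several_def by blast
    then have "((%t. f (z(i := t))) has_field_derivative partial_deriv i f (z(i := p))) (at p)"
     using field_differentiable_derivI by (fastforce simp: partial_deriv_def)
    then show ?thesis using f(2) by (simp add: has_field_derivative_iff)
   qed
   have "((%\<zeta>. (u (z(i := \<zeta>)) / (\<zeta> - p)) / (g (z(i := \<zeta>)) / (\<zeta> - p))) \<longlongrightarrow> ?c) (at p)"
    by (intro tendsto_divide quot u hol_subset[OF g D_subset_V] p u0 zsub g_deriv)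
   then have lim: "(%\<zeta>. ?F (z(i := \<zeta>))) \<midarrow>p\<rightarrow> ?c"
   proof (rule Lim_transform_eventually)
    have "\<forall>\<^sub>F \<zeta> in at p. \<zeta> \<in> ?B \<and> \<zeta> ~= p"
     using p(1) by (intro eventually_conj eventually_at_in_open' eventually_neq_at_within) auto
    then show "\<forall>\<^sub>F \<zeta> in at p. (u (z(i := \<zeta>)) / (\<zeta> - p)) / (g (z(i := \<zeta>)) / (\<zeta> - p)) = ?F (z(i := \<zeta>))"
    proof eventually_elim
     case (elim \<zeta>)
     then have "g (z(i := \<zeta>)) ~= 0" using uniq by blast
     then show ?case using bu[OF zsub, of \<zeta>] elim by simp
    qed
   qed
   let ?v = "%\<zeta>. if \<zeta> = p then ?c else ?F (z(i := \<zeta>))"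
   have "?v holomorphic_on ?A"
    by (rule removable_singularity[OF holomorphic_on_subset[OF hT A] _ lim]) (use T in auto)
   moreover have "cball (x i) (r i) \<subseteq> ?A"
    using cb g_sphere[OF z] \<eta> by (fastforce simp: cball_def sphere_def le_less)
   ultimately have "?v holomorphic_on cball (x i) (r i)" using holomorphic_on_subset by blast
   then have "cauchy_ext ?F z = ?v (z i)"
    by (rule cauchy_ext_eq[OF z]) (use p in auto)
   then show ?thesis using False p by auto
  qed
  then show ?thesis using False by simp
 qed
qed

text \<open>On the circle \<open>g\<close> has norm at least \<open>\<eta>\<close>, so the quotient
  by \<open>g ^ Suc k\<close> is at most a constant times \<open>1 / \<eta> ^ Suc k\<close>.
  Multiplying back bounds \<open>norm (b z)\<close> by a constant times
  \<open>(norm (g z) / \<eta>) ^ Suc k\<close>, which tends to 0.\<close>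

lemma divisible_all_powers_zero:
 assumes b: "hol n V b" and z: "z \<in> D" "norm (g z) < \<eta>"
  and div: "!!k. b z = g z ^ Suc k * cauchy_ext (%z. b z / g z ^ Suc k) z"
 shows "b z = 0"
proof -
 let ?S = "sphere (x i) (r i)"
 have zc: "z \<in> complex_space n" using z by (simp add: polydisc_def)
 have "continuous_on ?S (%\<zeta>. norm (b (z(i := \<zeta>))))"
  by (intro continuous_on_norm continuous_on_compose2[OF hol_continuous[OF b]]
    continuous_on_fun_upd continuous_on_const continuous_on_id) (use upd_in_V[OF z(1)] in auto)
 moreover have "x i + of_real (r i) \<in> ?S" using r[of i] by (simp add: dist_norm)
 ultimately obtain \<xi> where \<xi>: "\<forall>\<zeta>\<in>?S. norm (b (z(i := \<zeta>))) \<le> norm (b (z(i := \<xi>)))"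
  using continuous_attains_sup[OF compact_sphere] by (metis empty_iff)
 define M where "M = norm (b (z(i := \<xi>)))"
 have M: "!!\<zeta>. \<zeta> \<in> ?S ==> norm (b (z(i := \<zeta>))) \<le> M" and M0: "M \<ge> 0"
  using \<xi> by (simp_all add: M_def)
 \<comment> \<open>A lower bound for the distance of \<open>z i\<close> from the circle, hence for
   the denominator of Cauchy's kernel.\<close>
 define d where "d = r i - dist (x i) (z i)"
 have d: "d > 0" using D_slice[OF z(1)] by (simp add: d_def)
 let ?C = "M / d * r i"
 have bound: "norm (b z) \<le> (norm (g z) / \<eta>) ^ Suc k * ?C" for k
 proof -
  let ?F = "%z. b z / g z ^ Suc k" and ?c = "circlepath (x i) (r i)"
  let ?I = "%\<zeta>. ?F (z(i := \<zeta>)) / (\<zeta> - z i)"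
  have gS: "g (z(i := \<zeta>)) ~= 0" "\<zeta> ~= z i" if "\<zeta> \<in> ?S" for \<zeta>
   using g_sphere[OF z(1) that] \<eta> D_slice[OF z(1)] that by auto
  have "continuous_on ?S ?I"
   by (intro continuous_on_divide continuous_on_power continuous_on_diff continuous_on_compose2[OF hol_continuous[OF b]]
     continuous_on_compose2[OF hol_continuous[OF g]]
    continuous_on_fun_upd continuous_on_const continuous_on_id) (use upd_in_V[OF z(1)] gS in auto)
  then have "?I contour_integrable_on ?c"
   by (intro contour_integrable_continuous_circlepath) (use r[of i] in auto)
  then have hci: "(?I has_contour_integral contour_integral ?c ?I) ?c"
   by (rule has_contour_integral_integral)
  have "norm (contour_integral ?c ?I) \<le> (M / \<eta> ^ Suc k / d) * (2 * pi * r i)"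
  proof (rule has_contour_integral_bound_circlepath[OF hci])
   fix \<zeta> assume "norm (\<zeta> - x i) = r i"
   then have \<zeta>: "\<zeta> \<in> ?S" by (simp add: dist_norm norm_minus_commute)
   have "d \<le> norm (\<zeta> - z i)"
    using \<zeta> dist_triangle[of "x i" \<zeta> "z i"] by (simp add: d_def dist_norm norm_minus_commute)
   moreover have "norm (?F (z(i := \<zeta>))) \<le> M / \<eta> ^ Suc k"
    unfolding norm_divide norm_power using M[OF \<zeta>] g_sphere[OF z(1) \<zeta>] \<eta> M0
    by (intro frac_le power_mono zero_less_power) auto
   ultimately show "norm (?I \<zeta>) \<le> M / \<eta> ^ Suc k / d"
    unfolding norm_divide[of "?F (z(i := \<zeta>))"] using d M0 \<eta> by (intro frac_le) auto
  qed (use r[of i] M0 d \<eta> in auto)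
  then have "norm (cauchy_ext ?F z) \<le> ?C / \<eta> ^ Suc k"
   unfolding cauchy_ext_def norm_divide by (simp add: norm_mult field_simps)
  then have "norm (g z) ^ Suc k * norm (cauchy_ext ?F z) \<le> norm (g z) ^ Suc k * (?C / \<eta> ^ Suc k)"
   by (intro mult_left_mono) auto
  moreover have "norm (b z) = norm (g z) ^ Suc k * norm (cauchy_ext ?F z)"
   using div[of k] by (metis norm_mult norm_power)
  ultimately show ?thesis by (simp add: power_divide mult_ac)
 qed
 have "(%k. (norm (g z) / \<eta>) ^ Suc k * ?C) \<longlonglongrightarrow> 0 * ?C"
  using z(2) \<eta> by (intro tendsto_mult tendsto_const LIMSEQ_Suc[OF LIMSEQ_realpow_zero]) auto
 then have "norm (b z) \<le> 0"
  using LIMSEQ_le_const[of "%k. (norm (g z) / \<eta>) ^ Suc k * ?C" 0 "norm (b z)"] bound by auto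
 then show ?thesis by simp
qed

text \<open>The whole family is divided by the same power, as long as all quotients vanish on
  \<open>g = 0\<close>. This must stop, since otherwise \<open>b j0\<close> would be divisible by
  every power of \<open>g\<close> and vanish at \<open>w\<close>. The point \<open>y\<close> is a
  place where it stops.\<close>

lemma exact_power_division:
 assumes b: "!!j. j \<in> J ==> hol n V (b j)"
  and nz: "j0 \<in> J" "w \<in> D" "norm (g w) < \<eta>" "b j0 w ~= 0"
 obtains k u j y where "!!j. j \<in> J ==> hol n D (u j)"
  "!!j z. j \<in> J ==> z \<in> D ==> b j z = g z ^ k * u j z" "j \<in> J" "y \<in> D" "g y = 0" "u j y ~= 0"
proof (rule ccontr)
 assume not: "\<not> thesis"
 note thesisI = that
 \<comment> \<open>The quotients are given explicitly by Cauchy's integral, so that the estimate for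
   all powers applies to them; for \<open>k = 0\<close> nothing has been divided yet.\<close>
 define u where "u k = (%j. if k = 0 then b j else cauchy_ext (%z. b j z / g z ^ k))" for k
 have "\<forall>j\<in>J. hol n D (u k j) \<and> (\<forall>z\<in>D. b j z = g z ^ k * u k j z)" for k
 proof (induction k)
  case 0
  then show ?case using b hol_subset[OF _ D_subset_V] by (auto simp: u_def)
 next
  case (Suc k)
  have z0: "u k j z = 0" if *: "j \<in> J" "z \<in> D" "g z = 0" for j z
  proof (rule ccontr)
   assume "u k j z ~= 0"
   then show False
    using not thesisI[OF conjunct1[OF bspec[OF Suc]] bspec[OF conjunct2[OF bspec[OF Suc]]] *] by blast
  qed
  show ?case
  proof (intro ballI conjI)
   fix j assume j: "j \<in> J"
   have uh: "hol n D (u k j)" "!!z. z \<in> D ==> b j z = g z ^ k * u k j z"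
    by (rule conjunct1[OF bspec[OF Suc j]], rule bspec[OF conjunct2[OF bspec[OF Suc j]]])
   note step = division_step[where b = "b j" and u = "u k j" and k = k, OF b[OF j] uh(1)]
   have uS: "u (Suc k) j = cauchy_ext (%z. b j z / g z ^ Suc k)" by (simp add: u_def)
   show "hol n D (u (Suc k) j)" unfolding uS
    by (rule step(1)) (erule uh(2), erule (1) z0[OF j])
   show "b j z = g z ^ Suc k * u (Suc k) j z" if "z \<in> D" for z unfolding uS
    by (rule step(2)[OF _ _ that]) (erule uh(2), erule (1) z0[OF j])
  qed
 qed
 from bspec[OF conjunct2[OF bspec[OF this nz(1)]] nz(2)]
 have "b j0 w = g w ^ Suc k * u (Suc k) j0 w" for k .
 then have "b j0 w = g w ^ Suc k * cauchy_ext (%z. b j0 z / g z ^ Suc k) w" for k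
  unfolding u_def if_not_P[OF nat.distinct(2)] .
 from divisible_all_powers_zero[OF b[OF nz(1)] nz(2,3) this] nz(4) show False by (rule notE[rotated])
qed

end

section \<open>Tensor products and presheaves of modules\<close>

definition tensor_class :: "'r ring => ('r, 'a) module => ('r, 'b) module => (('a \<times> 'b) \<Rightarrow>\<^sub>0 int) => ('a, 'b) tensor" where
 "tensor_class R M N w = tensor_relations R M N #>\<^bsub>free_Abelian_group (carrier M \<times> carrier N)\<^esub> w"

abbreviation pure :: "'r ring => ('r, 'a) module => ('r, 'b) module => 'a => 'b => ('a, 'b) tensor" where
 "pure R M N a b \<equiv> tensor_class R M N (frag_of (a, b))"

text \<open>One notion for restriction maps, which change the ring, and for evaluations and
  multiplications by scalars, where \<open>\<rho>\<close> is the identity.\<close>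

definition semilinear :: "'r ring => ('r, 'm) module => 's ring => ('s, 'l) module => ('r => 's) => ('m => 'l) => bool" where
 "semilinear R M S N \<rho> u \<longleftrightarrow> \<rho> \<in> carrier R \<rightarrow> carrier S \<and> u \<in> carrier M \<rightarrow> carrier N \<and>
   (\<forall>x\<in>carrier M. \<forall>y\<in>carrier M. u (x \<oplus>\<^bsub>M\<^esub> y) = u x \<oplus>\<^bsub>N\<^esub> u y) \<and>
   (\<forall>r\<in>carrier R. \<forall>x\<in>carrier M. u (r \<odot>\<^bsub>M\<^esub> x) = \<rho> r \<odot>\<^bsub>N\<^esub> u x)"

abbreviation tmap :: "'s ring => ('s, 'c) module => ('s, 'd) module => ('a => 'c) => ('b => 'd) => ('a, 'b) tensor => ('c, 'd) tensor" where
 "tmap S M N u v \<equiv> tensor_map S M N (%(a, b). (u a, v b))"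

lemma additive_zero:
 assumes "abelian_group M" "abelian_group N" "u \<in> carrier M \<rightarrow> carrier N"
  "!!x y. x \<in> carrier M ==> y \<in> carrier M ==> u (x \<oplus>\<^bsub>M\<^esub> y) = u x \<oplus>\<^bsub>N\<^esub> u y"
 shows "u \<zero>\<^bsub>M\<^esub> = \<zero>\<^bsub>N\<^esub>"
proof -
 interpret M: abelian_group M by fact
 interpret N: abelian_group N by fact
 have c: "u \<zero>\<^bsub>M\<^esub> \<in> carrier N" using assms(3) by auto
 have "u \<zero>\<^bsub>M\<^esub> \<oplus>\<^bsub>N\<^esub> u \<zero>\<^bsub>M\<^esub> = u \<zero>\<^bsub>M\<^esub>" using assms(4)[of "\<zero>\<^bsub>M\<^esub>" "\<zero>\<^bsub>M\<^esub>"] by simp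
 then show ?thesis using c N.add.l_cancel_one by blast
qed

locale tensor =
 fixes R :: "'r ring" and M :: "('r, 'a) module" and N :: "('r, 'b) module"
 assumes M: "module R M" and N: "module R N"
begin

abbreviation "A \<equiv> free_Abelian_group (carrier M \<times> carrier N)"
abbreviation "I \<equiv> tensor_relations R M N"
abbreviation "cls \<equiv> tensor_class R M N"
abbreviation "T \<equiv> tensor_module R M N"

sublocale M: module R M by (fact M)
sublocale N: module R N by (fact N)

lemma I_subgroup: "subgroup I A"
 unfolding tensor_relations_def
 by (rule group.generate_is_subgroup) (auto simp: keys_diff subset_iff dest!: set_mp[OF keys_diff])

lemma I_normal: "I \<lhd> A"
 by (rule comm_group.normal_iff_subgroup[THEN iffD2, OF abelian_free_Abelian_group I_subgroup])

lemma I_zero: "0 \<in> I" using subgroup.one_closed[OF I_subgroup] by simp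
lemma I_add: "v \<in> I ==> w \<in> I ==> v + w \<in> I" using subgroup.m_closed[OF I_subgroup] by simp
lemma I_keys: "w \<in> I ==> Poly_Mapping.keys w \<subseteq> carrier M \<times> carrier N" using subgroup.mem_carrier[OF I_subgroup] by simp
lemma I_uminus: "w \<in> I ==> - w \<in> I" using subgroup.m_inv_closed[OF I_subgroup, of w] I_keys[of w] by simp
lemma cls_eq: "cls w = {h + w | h. h \<in> I}"
 by (auto simp: tensor_class_def r_coset_def)

lemma cls_eq_iff: "cls v = cls w \<longleftrightarrow> v - w \<in> I"
proof
 assume "cls v = cls w"
 then have "0 + v \<in> cls w" using I_zero cls_eq by blast
 then obtain h where "h \<in> I" "v = h + w" by (auto simp: cls_eq)
 then show "v - w \<in> I" by simp
next
 have sub: "cls v \<subseteq> cls w" if "v - w \<in> I" for v w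
 proof
  fix t assume "t \<in> cls v"
  then obtain h where h: "h \<in> I" "t = h + v" by (auto simp: cls_eq)
  then have "t = (h + (v - w)) + w" "h + (v - w) \<in> I" using that I_add by auto
  then show "t \<in> cls w" unfolding cls_eq by blast
 qed
 assume "v - w \<in> I"
 moreover from I_uminus[OF this] have "w - v \<in> I" by simp
 ultimately show "cls v = cls w" using sub by blast
qed

lemma T_carrier: "carrier T = cls ` {w. Poly_Mapping.keys w \<subseteq> carrier M \<times> carrier N}"
 by (auto simp: tensor_module_def FactGroup_def RCOSETS_def tensor_class_def Let_def)

lemma T_zero: "\<zero>\<^bsub>T\<^esub> = cls 0"
 by (auto simp: tensor_module_def FactGroup_def Let_def cls_eq)

lemma T_add: "Poly_Mapping.keys v \<subseteq> carrier M \<times> carrier N ==> Poly_Mapping.keys w \<subseteq> carrier M \<times> carrier N ==>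
  cls v \<oplus>\<^bsub>T\<^esub> cls w = cls (v + w)"
 using normal.rcos_sum[OF I_normal, of v w]
 by (simp add: tensor_module_def FactGroup_def Let_def tensor_class_def)

lemma T_smult: "r \<odot>\<^bsub>T\<^esub> t = tmap R M N (%a. r \<odot>\<^bsub>M\<^esub> a) (%b. b) t"
 by (simp add: tensor_module_def Let_def)

lemma cls_closed: "Poly_Mapping.keys w \<subseteq> carrier M \<times> carrier N ==> cls w \<in> carrier T"
 by (auto simp: T_carrier)

lemma T_group: "abelian_group T"
proof (rule abelian_groupI)
 fix x y assume "x \<in> carrier T" "y \<in> carrier T"
 then obtain v w where "x = cls v" "y = cls w" and vw: "Poly_Mapping.keys v \<subseteq> carrier M \<times> carrier N"
  "Poly_Mapping.keys w \<subseteq> carrier M \<times> carrier N" by (auto simp: T_carrier)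
 moreover from vw have "Poly_Mapping.keys (v + w) \<subseteq> carrier M \<times> carrier N" using keys_add[of v w] by blast
 ultimately show "x \<oplus>\<^bsub>T\<^esub> y \<in> carrier T" "x \<oplus>\<^bsub>T\<^esub> y = y \<oplus>\<^bsub>T\<^esub> x" by (auto simp: T_add cls_closed add.commute)
next
 show "\<zero>\<^bsub>T\<^esub> \<in> carrier T" by (simp add: T_zero cls_closed)
next
 fix x y z assume "x \<in> carrier T" "y \<in> carrier T" "z \<in> carrier T"
 then obtain u v w where "x = cls u" "y = cls v" "z = cls w" and k: "Poly_Mapping.keys u \<subseteq> carrier M \<times> carrier N"
  "Poly_Mapping.keys v \<subseteq> carrier M \<times> carrier N" "Poly_Mapping.keys w \<subseteq> carrier M \<times> carrier N"
  by (auto simp: T_carrier)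
 moreover from k have "Poly_Mapping.keys (v + w) \<subseteq> carrier M \<times> carrier N" "Poly_Mapping.keys (u + v) \<subseteq> carrier M \<times> carrier N"
  using keys_add[of v w] keys_add[of u v] by blast+
 ultimately show "x \<oplus>\<^bsub>T\<^esub> y \<oplus>\<^bsub>T\<^esub> z = x \<oplus>\<^bsub>T\<^esub> (y \<oplus>\<^bsub>T\<^esub> z)" by (auto simp: T_add add.assoc)
next
 fix x assume "x \<in> carrier T"
 then obtain v where v: "x = cls v" "Poly_Mapping.keys v \<subseteq> carrier M \<times> carrier N" by (auto simp: T_carrier)
 then show "\<zero>\<^bsub>T\<^esub> \<oplus>\<^bsub>T\<^esub> x = x" by (simp add: T_zero T_add)
 have "cls (- v) \<in> carrier T" "cls (- v) \<oplus>\<^bsub>T\<^esub> x = \<zero>\<^bsub>T\<^esub>" using v by (auto simp: T_zero T_add cls_closed)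
 then show "\<exists>y\<in>carrier T. y \<oplus>\<^bsub>T\<^esub> x = \<zero>\<^bsub>T\<^esub>" by blast
qed

lemma pure_closed: "a \<in> carrier M ==> b \<in> carrier N ==> pure R M N a b \<in> carrier T"
 by (rule cls_closed) simp

lemma gen_in_I:
 "a \<in> carrier M ==> a' \<in> carrier M ==> b \<in> carrier N ==> frag_of (a \<oplus>\<^bsub>M\<^esub> a', b) - frag_of (a, b) - frag_of (a', b) \<in> I"
 "a \<in> carrier M ==> b \<in> carrier N ==> b' \<in> carrier N ==> frag_of (a, b \<oplus>\<^bsub>N\<^esub> b') - frag_of (a, b) - frag_of (a, b') \<in> I"
 "r \<in> carrier R ==> a \<in> carrier M ==> b \<in> carrier N ==> frag_of (r \<odot>\<^bsub>M\<^esub> a, b) - frag_of (a, r \<odot>\<^bsub>N\<^esub> b) \<in> I"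
 unfolding tensor_relations_def by (rule generate.incl; blast)+

lemma pure_add_left: "a \<in> carrier M ==> a' \<in> carrier M ==> b \<in> carrier N ==>
  pure R M N (a \<oplus>\<^bsub>M\<^esub> a') b = pure R M N a b \<oplus>\<^bsub>T\<^esub> pure R M N a' b"
 using gen_in_I(1)[of a a' b] by (simp add: T_add cls_eq_iff diff_diff_eq)

lemma pure_add_right: "a \<in> carrier M ==> b \<in> carrier N ==> b' \<in> carrier N ==>
  pure R M N a (b \<oplus>\<^bsub>N\<^esub> b') = pure R M N a b \<oplus>\<^bsub>T\<^esub> pure R M N a b'"
 using gen_in_I(2)[of a b b'] by (simp add: T_add cls_eq_iff diff_diff_eq)

lemma pure_smult: "r \<in> carrier R ==> a \<in> carrier M ==> b \<in> carrier N ==>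
  pure R M N (r \<odot>\<^bsub>M\<^esub> a) b = pure R M N a (r \<odot>\<^bsub>N\<^esub> b)"
 using gen_in_I(3)[of r a b] by (simp add: cls_eq_iff)

text \<open>Sums of pure tensors exhaust the tensor product because the negative of a pure tensor is
  pure.\<close>

lemma T_induct [consumes 1, case_names zero pure add]:
 assumes "t \<in> carrier T" "P \<zero>\<^bsub>T\<^esub>" and pure: "!!a b. a \<in> carrier M ==> b \<in> carrier N ==> P (pure R M N a b)"
  and add: "!!s t. s \<in> carrier T ==> t \<in> carrier T ==> P s ==> P t ==> P (s \<oplus>\<^bsub>T\<^esub> t)"
 shows "P t"
proof -
 obtain w where w: "t = cls w" "Poly_Mapping.keys w \<subseteq> carrier M \<times> carrier N" using assms(1) by (auto simp: T_carrier)
 \<comment> \<open>\<open>frag_induction\<close> builds formal sums by differences, so the claim for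
   \<open>- w\<close> has to be carried along.\<close>
 have "Poly_Mapping.keys w \<subseteq> carrier M \<times> carrier N \<and> P (cls w) \<and> P (cls (- w))"
  using w(2)
 proof (induction w rule: frag_induction)
  case zero
  then show ?case using assms(2) by (simp add: T_zero)
 next
  case (one p)
  then obtain a b where p: "p = (a, b)" "a \<in> carrier M" "b \<in> carrier N" by auto
  \<comment> \<open>The chain identifies \<open>(- a) \<otimes> b\<close> with the negative of
    \<open>a \<otimes> b\<close>, by way of \<open>a \<otimes> 0 = 0\<close>.\<close>
  have "cls (frag_of (\<ominus>\<^bsub>M\<^esub> a, b)) \<oplus>\<^bsub>T\<^esub> pure R M N a b = pure R M N (\<ominus>\<^bsub>M\<^esub> a \<oplus>\<^bsub>M\<^esub> a) b"
   using p by (simp add: pure_add_left)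
  also have "\<dots> = pure R M N (\<zero>\<^bsub>R\<^esub> \<odot>\<^bsub>M\<^esub> a) b" using p by (simp add: M.l_neg)
  also have "\<dots> = pure R M N a \<zero>\<^bsub>N\<^esub>" using p by (subst pure_smult) auto
  also have "\<dots> = cls 0"
  proof -
   have "pure R M N a \<zero>\<^bsub>N\<^esub> \<oplus>\<^bsub>T\<^esub> pure R M N a \<zero>\<^bsub>N\<^esub> = pure R M N a \<zero>\<^bsub>N\<^esub>"
    using pure_add_right[of a "\<zero>\<^bsub>N\<^esub>" "\<zero>\<^bsub>N\<^esub>"] p by simp
   then show ?thesis using abelian_group.axioms(2)[OF T_group] pure_closed[of a "\<zero>\<^bsub>N\<^esub>"] p
    by (metis T_zero N.zero_closed T_group abelian_group.a_comm_group comm_group_def group.l_cancel_one monoid.simps(1,2) partial_object.simps(1))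
  qed
  finally have "cls (frag_of (\<ominus>\<^bsub>M\<^esub> a, b)) = cls (- frag_of (a, b))"
   using p by (simp add: T_add cls_eq_iff)
  then have "P (cls (- frag_of p))" using pure[of "\<ominus>\<^bsub>M\<^esub> a" b] p by simp
  then show ?case using pure[of a b] p by simp
 next
  case (diff v w)
  have "Poly_Mapping.keys (v - w) \<subseteq> carrier M \<times> carrier N" using diff keys_diff[of v w] by blast
  moreover have "cls (v - w) = cls v \<oplus>\<^bsub>T\<^esub> cls (- w)" "cls (- (v - w)) = cls (- v) \<oplus>\<^bsub>T\<^esub> cls w"
   using diff by (auto simp: T_add)
  moreover have "P (cls v \<oplus>\<^bsub>T\<^esub> cls (- w))" "P (cls (- v) \<oplus>\<^bsub>T\<^esub> cls w)"
   using diff by (auto intro!: add cls_closed)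
  ultimately show ?case by simp
 qed
 then show ?thesis using w by simp
qed

text \<open>The universal property for balanced biadditive maps: the extension to the free abelian
  group kills every generator of \<open>I\<close>, hence \<open>I\<close>, and so is constant on
  cosets.\<close>

lemma lift_exists:
 assumes "abelian_group P" and \<beta>: "!!a b. a \<in> carrier M ==> b \<in> carrier N ==> \<beta> a b \<in> carrier P"
  "!!a a' b. a \<in> carrier M ==> a' \<in> carrier M ==> b \<in> carrier N ==> \<beta> (a \<oplus>\<^bsub>M\<^esub> a') b = \<beta> a b \<oplus>\<^bsub>P\<^esub> \<beta> a' b"
  "!!a b b'. a \<in> carrier M ==> b \<in> carrier N ==> b' \<in> carrier N ==> \<beta> a (b \<oplus>\<^bsub>N\<^esub> b') = \<beta> a b \<oplus>\<^bsub>P\<^esub> \<beta> a b'"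
  "!!r a b. r \<in> carrier R ==> a \<in> carrier M ==> b \<in> carrier N ==> \<beta> (r \<odot>\<^bsub>M\<^esub> a) b = \<beta> a (r \<odot>\<^bsub>N\<^esub> b)"
 shows "\<exists>c. c \<in> carrier T \<rightarrow> carrier P \<and> (\<forall>s\<in>carrier T. \<forall>t\<in>carrier T. c (s \<oplus>\<^bsub>T\<^esub> t) = c s \<oplus>\<^bsub>P\<^esub> c t) \<and>
   (\<forall>a\<in>carrier M. \<forall>b\<in>carrier N. c (pure R M N a b) = \<beta> a b)"
proof -
 interpret P: abelian_group P by fact
 have cg: "comm_group (add_monoid P)" by (rule P.a_comm_group)
 have im: "case_prod \<beta> ` (carrier M \<times> carrier N) \<subseteq> carrier (add_monoid P)" using \<beta>(1) by auto
 obtain h where h: "h \<in> hom A (add_monoid P)" "!!p. p \<in> carrier M \<times> carrier N ==> h (frag_of p) = case_prod \<beta> p"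
  using comm_group.free_Abelian_group_universal[OF cg im] by metis
 have hc: "h w \<in> carrier P" if "Poly_Mapping.keys w \<subseteq> carrier M \<times> carrier N" for w
  using h(1) that by (auto simp: hom_def)
 have hadd: "h (v + w) = h v \<oplus>\<^bsub>P\<^esub> h w" if "Poly_Mapping.keys v \<subseteq> carrier M \<times> carrier N" "Poly_Mapping.keys w \<subseteq> carrier M \<times> carrier N" for v w
  using h(1) that by (auto simp: hom_def)
 have kd: "Poly_Mapping.keys (v - w) \<subseteq> carrier M \<times> carrier N" if "Poly_Mapping.keys v \<subseteq> carrier M \<times> carrier N" "Poly_Mapping.keys w \<subseteq> carrier M \<times> carrier N" for v w
  using that keys_diff[of v w] by blast
 have hdiff: "h (v - w) = h v \<ominus>\<^bsub>P\<^esub> h w" if *: "Poly_Mapping.keys v \<subseteq> carrier M \<times> carrier N" "Poly_Mapping.keys w \<subseteq> carrier M \<times> carrier N" for v w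
 proof -
  have "h v = h (v - w) \<oplus>\<^bsub>P\<^esub> h w" using hadd[OF kd[OF *] *(2)] by simp
  then show ?thesis using hc[OF *(2)] hc[OF kd[OF *]] by (simp add: P.minus_eq P.add.m_assoc P.r_neg)
 qed
 \<comment> \<open>The shape in which the images of the additivity relations appear once their
   summands are sorted.\<close>
 have cancel: "x \<oplus>\<^bsub>P\<^esub> (y \<oplus>\<^bsub>P\<^esub> (\<ominus>\<^bsub>P\<^esub> x \<oplus>\<^bsub>P\<^esub> \<ominus>\<^bsub>P\<^esub> y)) = \<zero>\<^bsub>P\<^esub>"
  if "x \<in> carrier P" "y \<in> carrier P" for x y
  using P.r_neg[of "x \<oplus>\<^bsub>P\<^esub> y"] that by (simp add: P.minus_add P.a_assoc)
 have h0: "h w = \<zero>\<^bsub>P\<^esub>" if "w \<in> I" for w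
  using that unfolding tensor_relations_def
 proof (induction w rule: generate.induct)
  case one
  show ?case using hdiff[of 0 0] hc[of 0] by (simp add: P.minus_eq P.r_neg)
 next
  case (incl w)
  then show ?case
   by (auto simp: hdiff kd h(2) \<beta> P.minus_eq P.a_ac P.r_neg cancel)
 next
  case (inv w)
  then have "w \<in> I" unfolding tensor_relations_def by (rule generate.incl)
  then have k: "Poly_Mapping.keys w \<subseteq> carrier M \<times> carrier N" by (rule I_keys)
  have "h w = \<zero>\<^bsub>P\<^esub>" using inv
   by (auto simp: hdiff kd h(2) \<beta> P.minus_eq P.a_ac P.r_neg cancel)
  moreover have "h (- w) = h 0 \<ominus>\<^bsub>P\<^esub> h w" using hdiff[of 0 w] k by simp
  moreover have "h 0 = \<zero>\<^bsub>P\<^esub>" using hdiff[of 0 0] hc[of 0] by (simp add: P.minus_eq P.r_neg)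
  ultimately show ?case using k by (simp add: P.minus_eq)
 next
  case (eng v w)
  then have "v \<in> I" "w \<in> I" unfolding tensor_relations_def by blast+
  then show ?case using hadd[OF I_keys I_keys] eng by simp
 qed
 \<comment> \<open>A representative of the coset is chosen; the value does not depend on it because
   \<open>h\<close> vanishes on \<open>I\<close>.\<close>
 define c where "c t = h (SOME w. t = cls w \<and> Poly_Mapping.keys w \<subseteq> carrier M \<times> carrier N)" for t
 have c: "c (cls w) = h w" if "Poly_Mapping.keys w \<subseteq> carrier M \<times> carrier N" for w
 proof -
  define v where "v = (SOME v. cls w = cls v \<and> Poly_Mapping.keys v \<subseteq> carrier M \<times> carrier N)"
  have v: "cls w = cls v" "Poly_Mapping.keys v \<subseteq> carrier M \<times> carrier N"
   using someI_ex[of "%v. cls w = cls v \<and> Poly_Mapping.keys v \<subseteq> carrier M \<times> carrier N"] that unfolding v_def by blast+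
  then have "h (w - v) = \<zero>\<^bsub>P\<^esub>" using h0 cls_eq_iff by blast
  then have "h w = h v" using hadd[OF kd[OF that v(2)] v(2)] hc[OF v(2)] by simp
  then show ?thesis by (simp add: c_def v_def[symmetric])
 qed
 show ?thesis
 proof (intro exI[of _ c] conjI ballI)
  show "c \<in> carrier T \<rightarrow> carrier P" using c hc by (auto simp: T_carrier)
  fix s t assume "s \<in> carrier T" "t \<in> carrier T"
  then obtain v w where vw: "s = cls v" "t = cls w" "Poly_Mapping.keys v \<subseteq> carrier M \<times> carrier N"
   "Poly_Mapping.keys w \<subseteq> carrier M \<times> carrier N" by (auto simp: T_carrier)
  moreover have "Poly_Mapping.keys (v + w) \<subseteq> carrier M \<times> carrier N" using vw keys_add[of v w] by blast
  ultimately show "c (s \<oplus>\<^bsub>T\<^esub> t) = c s \<oplus>\<^bsub>P\<^esub> c t" by (simp add: T_add c hadd)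
 next
  fix a b assume "a \<in> carrier M" "b \<in> carrier N"
  then show "c (pure R M N a b) = \<beta> a b" using c[of "frag_of (a, b)"] h(2)[of "(a, b)"] by simp
 qed
qed

end

lemma frag_extend_keys:
 assumes "Poly_Mapping.keys w \<subseteq> S" "!!p. p \<in> S ==> g p \<in> S'"
 shows "Poly_Mapping.keys (frag_extend (%p. frag_of (g p)) w) \<subseteq> S'"
 using assms keys_frag_extend[of "%p. frag_of (g p)" w] by fastforce

text \<open>Relations go to relations, so all cosets in the union that defines
  \<open>tensor_map\<close> coincide and any representative computes it.\<close>

lemma tmap_class:
 assumes MN: "tensor R M N" and MN': "tensor R' M' N'"
  and u: "semilinear R M R' M' \<rho> u" and v: "semilinear R N R' N' \<rho> v"
  and w: "Poly_Mapping.keys w \<subseteq> carrier M \<times> carrier N"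
 shows "tmap R' M' N' u v (tensor_class R M N w)
    = tensor_class R' M' N' (frag_extend (%p. frag_of (case p of (a, b) => (u a, v b))) w)"
proof -
 interpret a: tensor R M N by fact
 interpret b: tensor R' M' N' by fact
 let ?g = "%p. case p of (a, b) => (u a, v b)"
 let ?e = "frag_extend (%p. frag_of (?g p))"
 have uc: "u a \<in> carrier M'" if "a \<in> carrier M" for a using u that by (auto simp: semilinear_def)
 have vc: "v a \<in> carrier N'" if "a \<in> carrier N" for a using v that by (auto simp: semilinear_def)
 have \<rho>c: "\<rho> a \<in> carrier R'" if "a \<in> carrier R" for a using v that by (auto simp: semilinear_def)
 have gen: "?e h \<in> b.I" if "h \<in> ({frag_of (a \<oplus>\<^bsub>M\<^esub> a', b) - frag_of (a, b) - frag_of (a', b) | a a' b.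
      a \<in> carrier M \<and> a' \<in> carrier M \<and> b \<in> carrier N} \<union>
    {frag_of (a, b \<oplus>\<^bsub>N\<^esub> b') - frag_of (a, b) - frag_of (a, b') | a b b'.
      a \<in> carrier M \<and> b \<in> carrier N \<and> b' \<in> carrier N} \<union>
    {frag_of (r \<odot>\<^bsub>M\<^esub> a, b) - frag_of (a, r \<odot>\<^bsub>N\<^esub> b) | r a b.
      r \<in> carrier R \<and> a \<in> carrier M \<and> b \<in> carrier N})" for h
  using that u v by (auto simp: frag_extend_diff semilinear_def intro!: b.gen_in_I uc vc \<rho>c)
 have I: "?e h \<in> b.I" if "h \<in> a.I" for h
  using that unfolding tensor_relations_def[of R M N]
 proof (induction h rule: generate.induct)
  case one show ?case by (simp add: b.I_zero)
 next
  case (incl h) then show ?case by (rule gen)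
 next
  case (inv h)
  then have "h \<in> a.I" unfolding tensor_relations_def by (rule generate.incl)
  then have "Poly_Mapping.keys h \<subseteq> carrier M \<times> carrier N" by (rule a.I_keys)
  then show ?case using b.I_uminus[OF gen[OF inv]] by (simp add: frag_extend_minus)
 next
  case (eng g h) then show ?case by (simp add: frag_extend_add b.I_add)
 qed
 have "tmap R' M' N' u v (tensor_class R M N w) = (\<Union>w'\<in>a.cls w. b.cls (?e w'))"
  by (simp add: tensor_map_def tensor_class_def)
 also have "\<dots> = b.cls (?e w)"
 proof -
  have "b.cls (?e w') = b.cls (?e w)" if "w' \<in> a.cls w" for w'
  proof -
   from that obtain h where "h \<in> a.I" "w' = h + w" unfolding a.cls_eq by blast
   then show ?thesis using I by (simp add: b.cls_eq_iff frag_extend_add)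
  qed
  moreover have "0 + w \<in> a.cls w" using a.I_zero a.cls_eq by blast
  ultimately show ?thesis by blast
 qed
 finally show ?thesis .
qed

lemma tmap_pure:
 assumes "tensor R M N" "tensor R' M' N'" "semilinear R M R' M' \<rho> u" "semilinear R N R' N' \<rho> v"
  "a \<in> carrier M" "b \<in> carrier N"
 shows "tmap R' M' N' u v (pure R M N a b) = pure R' M' N' (u a) (v b)"
 using tmap_class[OF assms(1-4), of "frag_of (a, b)"] assms(5,6) by simp

lemma tmap_additive:
 assumes "tensor R M N" "tensor R' M' N'" "semilinear R M R' M' \<rho> u" "semilinear R N R' N' \<rho> v"
 shows "tmap R' M' N' u v \<in> carrier (tensor_module R M N) \<rightarrow> carrier (tensor_module R' M' N')"
  "!!s t. s \<in> carrier (tensor_module R M N) ==> t \<in> carrier (tensor_module R M N) ==>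
    tmap R' M' N' u v (s \<oplus>\<^bsub>tensor_module R M N\<^esub> t)
     = tmap R' M' N' u v s \<oplus>\<^bsub>tensor_module R' M' N'\<^esub> tmap R' M' N' u v t"
proof -
 interpret a: tensor R M N by fact
 interpret b: tensor R' M' N' by fact
 let ?g = "%p. case p of (a, b) => (u a, v b)"
 let ?e = "frag_extend (%p. frag_of (?g p))"
 have k: "Poly_Mapping.keys (?e w) \<subseteq> carrier M' \<times> carrier N'" if "Poly_Mapping.keys w \<subseteq> carrier M \<times> carrier N" for w
  by (rule frag_extend_keys[OF that]) (use assms(3,4) in \<open>auto simp: semilinear_def\<close>)
 show "tmap R' M' N' u v \<in> carrier a.T \<rightarrow> carrier b.T"
  by (auto simp: a.T_carrier tmap_class[OF assms] intro!: b.cls_closed k)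
 fix s t assume "s \<in> carrier a.T" "t \<in> carrier a.T"
 then obtain w z where wz: "s = a.cls w" "t = a.cls z" "Poly_Mapping.keys w \<subseteq> carrier M \<times> carrier N"
  "Poly_Mapping.keys z \<subseteq> carrier M \<times> carrier N" by (auto simp: a.T_carrier)
 then have "Poly_Mapping.keys (w + z) \<subseteq> carrier M \<times> carrier N" using keys_add[of w z] by blast
 then show "tmap R' M' N' u v (s \<oplus>\<^bsub>a.T\<^esub> t) = tmap R' M' N' u v s \<oplus>\<^bsub>b.T\<^esub> tmap R' M' N' u v t"
  using wz by (simp add: a.T_add tmap_class[OF assms] b.T_add k frag_extend_add)
qed

text \<open>Additive maps out of a tensor product are compared on pure tensors; most identities
  about tensors below are proved in this way.\<close>

lemma additive_eqI:
 assumes "tensor R M N" "abelian_group P"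
  and f: "f \<in> carrier (tensor_module R M N) \<rightarrow> carrier P"
   "!!s t. s \<in> carrier (tensor_module R M N) ==> t \<in> carrier (tensor_module R M N) ==> f (s \<oplus>\<^bsub>tensor_module R M N\<^esub> t) = f s \<oplus>\<^bsub>P\<^esub> f t"
  and g: "g \<in> carrier (tensor_module R M N) \<rightarrow> carrier P"
   "!!s t. s \<in> carrier (tensor_module R M N) ==> t \<in> carrier (tensor_module R M N) ==> g (s \<oplus>\<^bsub>tensor_module R M N\<^esub> t) = g s \<oplus>\<^bsub>P\<^esub> g t"
  and pure: "!!a b. a \<in> carrier M ==> b \<in> carrier N ==> f (pure R M N a b) = g (pure R M N a b)"
  and t: "t \<in> carrier (tensor_module R M N)"
 shows "f t = g t"
proof -
 interpret a: tensor R M N by fact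
 have "f \<zero>\<^bsub>a.T\<^esub> = g \<zero>\<^bsub>a.T\<^esub>"
  using additive_zero[OF a.T_group assms(2) f] additive_zero[OF a.T_group assms(2) g] by simp
 with t show ?thesis by (induction t rule: a.T_induct) (auto simp: pure f(2) g(2))
qed

text \<open>The composite has its own maps \<open>u''\<close> and \<open>v''\<close> because the
  equations between restriction maps hold only on carriers.\<close>

lemma tmap_compose:
 assumes 1: "tensor R M N" "tensor R' M' N'" "semilinear R M R' M' \<rho> u" "semilinear R N R' N' \<rho> v"
  and 2: "tensor R'' M'' N''" "semilinear R' M' R'' M'' \<rho>' u'" "semilinear R' N' R'' N'' \<rho>' v'"
  and 3: "semilinear R M R'' M'' \<rho>'' u''" "semilinear R N R'' N'' \<rho>'' v''"
  and eq: "!!a. a \<in> carrier M ==> u'' a = u' (u a)" "!!b. b \<in> carrier N ==> v'' b = v' (v b)"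
  and t: "t \<in> carrier (tensor_module R M N)"
 shows "tmap R'' M'' N'' u' v' (tmap R' M' N' u v t) = tmap R'' M'' N'' u'' v'' t"
proof -
 note add1 = tmap_additive[OF 1] and add2 = tmap_additive[OF 1(2) 2] and add3 = tmap_additive[OF 1(1) 2(1) 3]
 have cl: "tmap R' M' N' u v t \<in> carrier (tensor_module R' M' N')" if "t \<in> carrier (tensor_module R M N)" for t
  using add1(1) that by blast
 have uv: "u a \<in> carrier M'" "v b \<in> carrier N'" if "a \<in> carrier M" "b \<in> carrier N" for a b
  using 1 that by (auto simp: semilinear_def)
 show ?thesis
  by (rule additive_eqI[OF 1(1) tensor.T_group[OF 2(1)] _ _ add3 _ t, where f = "%t. tmap R'' M'' N'' u' v' (tmap R' M' N' u v t)"])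
    (simp_all add: funcset_mem[OF add2(1)] add1(2) add2(2) cl uv eq Pi_iff
     tmap_pure[OF 1] tmap_pure[OF 1(2) 2] tmap_pure[OF 1(1) 2(1) 3])
qed

lemma semilinear_id: "semilinear R M R M (%r. r) (%x. x)"
 by (auto simp: semilinear_def)

lemma semilinear_smult: "module R M ==> r \<in> carrier R ==> semilinear R M R M (%r. r) (%x. r \<odot>\<^bsub>M\<^esub> x)"
 unfolding semilinear_def
 by (auto simp: module.smult_closed module.smult_r_distr module.smult_assoc1[symmetric] cring.cring_simprules(14)[OF module.axioms(1)])

context tensor
begin

lemma smult_pure:
 assumes "r \<in> carrier R" "a \<in> carrier M" "b \<in> carrier N"
 shows "r \<odot>\<^bsub>T\<^esub> pure R M N a b = pure R M N (r \<odot>\<^bsub>M\<^esub> a) b"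
proof -
 have t: "tensor R M N" by unfold_locales
 show ?thesis unfolding T_smult using tmap_pure[OF t t semilinear_smult[OF M assms(1)] semilinear_id] assms by simp
qed

lemma smult_additive:
 assumes "r \<in> carrier R"
 shows "(%t. r \<odot>\<^bsub>T\<^esub> t) \<in> carrier T \<rightarrow> carrier T"
  "!!s t. s \<in> carrier T ==> t \<in> carrier T ==> r \<odot>\<^bsub>T\<^esub> (s \<oplus>\<^bsub>T\<^esub> t) = r \<odot>\<^bsub>T\<^esub> s \<oplus>\<^bsub>T\<^esub> r \<odot>\<^bsub>T\<^esub> t"
proof -
 have t: "tensor R M N" by unfold_locales
 from tmap_additive[OF t t semilinear_smult[OF M assms] semilinear_id]
 show "(%t. r \<odot>\<^bsub>T\<^esub> t) \<in> carrier T \<rightarrow> carrier T"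
  "!!s t. s \<in> carrier T ==> t \<in> carrier T ==> r \<odot>\<^bsub>T\<^esub> (s \<oplus>\<^bsub>T\<^esub> t) = r \<odot>\<^bsub>T\<^esub> s \<oplus>\<^bsub>T\<^esub> r \<odot>\<^bsub>T\<^esub> t"
  by (simp_all add: T_smult)
qed

lemma T_module: "module R T"
proof (rule moduleI)
 have t: "tensor R M N" by unfold_locales
 interpret T: abelian_group T by (rule T_group)
 show "cring R" by (rule M.R.is_cring)
 show "abelian_group T" by (rule T_group)
 show cl: "a \<odot>\<^bsub>T\<^esub> x \<in> carrier T" if "a \<in> carrier R" "x \<in> carrier T" for a x
  using smult_additive(1)[OF that(1)] that(2) by auto
 show "a \<odot>\<^bsub>T\<^esub> (x \<oplus>\<^bsub>T\<^esub> y) = a \<odot>\<^bsub>T\<^esub> x \<oplus>\<^bsub>T\<^esub> a \<odot>\<^bsub>T\<^esub> y" if "a \<in> carrier R" "x \<in> carrier T" "y \<in> carrier T" for a x y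
  using smult_additive(2) that by blast
 fix a b assume ab: "a \<in> carrier R" "b \<in> carrier R"
 show "(a \<oplus>\<^bsub>R\<^esub> b) \<odot>\<^bsub>T\<^esub> x = a \<odot>\<^bsub>T\<^esub> x \<oplus>\<^bsub>T\<^esub> b \<odot>\<^bsub>T\<^esub> x" if x: "x \<in> carrier T" for x
  by (rule additive_eqI[OF t T_group _ _ _ _ _ x, where f = "%x. (a \<oplus>\<^bsub>R\<^esub> b) \<odot>\<^bsub>T\<^esub> x"])
    (use ab in \<open>auto simp: smult_additive smult_pure cl M.smult_l_distr pure_add_left T.a_ac\<close>)
 show "(a \<otimes>\<^bsub>R\<^esub> b) \<odot>\<^bsub>T\<^esub> x = a \<odot>\<^bsub>T\<^esub> (b \<odot>\<^bsub>T\<^esub> x)" if x: "x \<in> carrier T" for x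
  by (rule additive_eqI[OF t T_group _ _ _ _ _ x, where f = "%x. (a \<otimes>\<^bsub>R\<^esub> b) \<odot>\<^bsub>T\<^esub> x"])
    (use ab in \<open>auto simp: smult_additive smult_pure cl M.smult_assoc1\<close>)
next
 have t: "tensor R M N" by unfold_locales
 show "\<one>\<^bsub>R\<^esub> \<odot>\<^bsub>T\<^esub> x = x" if x: "x \<in> carrier T" for x
  by (rule additive_eqI[OF t T_group _ _ _ _ _ x, where f = "%x. \<one>\<^bsub>R\<^esub> \<odot>\<^bsub>T\<^esub> x" and g = "%x. x"])
    (auto simp: smult_additive smult_pure funcset_mem[OF smult_additive(1)])
qed

end

section \<open>Presheaves of rings and modules and their morphisms\<close>

definition ring_presheaf :: "'p topology => ('p, 'r) ring_presheaf => bool" where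
 "ring_presheaf X \<O> \<longleftrightarrow>
   (\<forall>U. openin X U --> cring (Sc \<O> U)) \<and>
   (\<forall>U V. openin X U \<and> openin X V \<and> V \<subseteq> U -->
    restr \<O> U V \<in> sec \<O> U \<rightarrow> sec \<O> V \<and>
    (\<forall>s\<in>sec \<O> U. \<forall>t\<in>sec \<O> U.
      restr \<O> U V (s \<oplus>\<^bsub>Sc \<O> U\<^esub> t) = restr \<O> U V s \<oplus>\<^bsub>Sc \<O> V\<^esub> restr \<O> U V t \<and>
      restr \<O> U V (s \<otimes>\<^bsub>Sc \<O> U\<^esub> t) = restr \<O> U V s \<otimes>\<^bsub>Sc \<O> V\<^esub> restr \<O> U V t) \<and>
    restr \<O> U V \<one>\<^bsub>Sc \<O> U\<^esub> = \<one>\<^bsub>Sc \<O> V\<^esub>) \<and>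
   (\<forall>U. openin X U --> (\<forall>s\<in>sec \<O> U. restr \<O> U U s = s)) \<and>
   (\<forall>U V W. openin X U \<and> openin X V \<and> openin X W \<and> W \<subseteq> V \<and> V \<subseteq> U -->
    (\<forall>s\<in>sec \<O> U. restr \<O> V W (restr \<O> U V s) = restr \<O> U W s))"

text \<open>The part of \<^const>\<open>presheaf_of_modules\<close> that the target of a morphism needs; the module axioms are not required.\<close>

definition module_like :: "'p topology => ('p, 'r) ring_presheaf => ('p, 'r, 'm) module_presheaf => bool" where
 "module_like X \<O> F \<longleftrightarrow>
   (\<forall>U. openin X U -->
    (\<forall>s\<in>sec F U. \<forall>t\<in>sec F U. s \<oplus>\<^bsub>Sc F U\<^esub> t \<in> sec F U) \<and>
    (\<forall>r\<in>sec \<O> U. \<forall>s\<in>sec F U. r \<odot>\<^bsub>Sc F U\<^esub> s \<in> sec F U)) \<and>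
   (\<forall>U V. openin X U \<and> openin X V \<and> V \<subseteq> U -->
    restr F U V \<in> sec F U \<rightarrow> sec F V \<and>
    (\<forall>s\<in>sec F U. \<forall>t\<in>sec F U.
      restr F U V (s \<oplus>\<^bsub>Sc F U\<^esub> t)
       = restr F U V s \<oplus>\<^bsub>Sc F V\<^esub> restr F U V t) \<and>
    (\<forall>r\<in>sec \<O> U. \<forall>s\<in>sec F U.
      restr F U V (r \<odot>\<^bsub>Sc F U\<^esub> s)
       = restr \<O> U V r \<odot>\<^bsub>Sc F V\<^esub> restr F U V s)) \<and>
   (\<forall>U. openin X U --> (\<forall>s\<in>sec F U. restr F U U s = s)) \<and>
   (\<forall>U V W. openin X U \<and> openin X V \<and> openin X W \<and> W \<subseteq> V \<and> V \<subseteq> U -->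
    (\<forall>s\<in>sec F U. restr F V W (restr F U V s) = restr F U W s))"

lemma opens_in_iff [simp]: "V \<in> opens_in X U \<longleftrightarrow> openin X V \<and> V \<subseteq> U"
 by (simp add: opens_in_def)

lemma ring_presheafD:
 assumes "ring_presheaf X \<O>"
 shows "openin X U ==> cring (Sc \<O> U)"
  "openin X U ==> openin X V ==> V \<subseteq> U ==> s \<in> sec \<O> U ==> restr \<O> U V s \<in> sec \<O> V"
  "openin X U ==> openin X V ==> V \<subseteq> U ==> s \<in> sec \<O> U ==> t \<in> sec \<O> U ==>
    restr \<O> U V (s \<oplus>\<^bsub>Sc \<O> U\<^esub> t) = restr \<O> U V s \<oplus>\<^bsub>Sc \<O> V\<^esub> restr \<O> U V t"
  "openin X U ==> openin X V ==> V \<subseteq> U ==> s \<in> sec \<O> U ==> t \<in> sec \<O> U ==>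
    restr \<O> U V (s \<otimes>\<^bsub>Sc \<O> U\<^esub> t) = restr \<O> U V s \<otimes>\<^bsub>Sc \<O> V\<^esub> restr \<O> U V t"
  "openin X U ==> openin X V ==> V \<subseteq> U ==> restr \<O> U V \<one>\<^bsub>Sc \<O> U\<^esub> = \<one>\<^bsub>Sc \<O> V\<^esub>"
  "openin X U ==> s \<in> sec \<O> U ==> restr \<O> U U s = s"
  "openin X U ==> openin X V ==> openin X W ==> W \<subseteq> V ==> V \<subseteq> U ==> s \<in> sec \<O> U ==>
    restr \<O> V W (restr \<O> U V s) = restr \<O> U W s"
proof -
 note d = assms[unfolded ring_presheaf_def]
 show "openin X U ==> cring (Sc \<O> U)" using d[THEN conjunct1] by simp
 show "openin X U ==> s \<in> sec \<O> U ==> restr \<O> U U s = s"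
  using d[THEN conjunct2, THEN conjunct2, THEN conjunct1] by simp
qed (use assms[unfolded ring_presheaf_def, THEN conjunct2, THEN conjunct1, THEN spec, THEN spec, THEN mp, of U V]
   assms[unfolded ring_presheaf_def, THEN conjunct2, THEN conjunct2, THEN conjunct2, THEN spec, THEN spec, THEN spec, THEN mp, of U V W]
   in \<open>simp_all add: Pi_iff\<close>)

lemma module_likeD:
 assumes "module_like X \<O> F"
 shows "openin X U ==> s \<in> sec F U ==> t \<in> sec F U ==>
    s \<oplus>\<^bsub>Sc F U\<^esub> t \<in> sec F U"
  "openin X U ==> r \<in> sec \<O> U ==> s \<in> sec F U ==>
    r \<odot>\<^bsub>Sc F U\<^esub> s \<in> sec F U"
  "openin X U ==> openin X V ==> V \<subseteq> U ==> s \<in> sec F U ==> restr F U V s \<in> sec F V"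
  "openin X U ==> openin X V ==> V \<subseteq> U ==> s \<in> sec F U ==> t \<in> sec F U ==>
    restr F U V (s \<oplus>\<^bsub>Sc F U\<^esub> t) = restr F U V s \<oplus>\<^bsub>Sc F V\<^esub> restr F U V t"
  "openin X U ==> openin X V ==> V \<subseteq> U ==> r \<in> sec \<O> U ==> s \<in> sec F U ==>
    restr F U V (r \<odot>\<^bsub>Sc F U\<^esub> s) = restr \<O> U V r \<odot>\<^bsub>Sc F V\<^esub> restr F U V s"
  "openin X U ==> s \<in> sec F U ==> restr F U U s = s"
  "openin X U ==> openin X V ==> openin X W ==> W \<subseteq> V ==> V \<subseteq> U ==> s \<in> sec F U ==>
    restr F V W (restr F U V s) = restr F U W s"
proof -
 note d = assms[unfolded module_like_def]
 show "openin X U ==> s \<in> sec F U ==> t \<in> sec F U ==>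
    s \<oplus>\<^bsub>Sc F U\<^esub> t \<in> sec F U"
  "openin X U ==> r \<in> sec \<O> U ==> s \<in> sec F U ==>
    r \<odot>\<^bsub>Sc F U\<^esub> s \<in> sec F U" using d[THEN conjunct1] by simp_all
 show "openin X U ==> s \<in> sec F U ==> restr F U U s = s"
  using d[THEN conjunct2, THEN conjunct2, THEN conjunct1] by simp
qed (use assms[unfolded module_like_def, THEN conjunct2, THEN conjunct1, THEN spec, THEN spec, THEN mp, of U V]
   assms[unfolded module_like_def, THEN conjunct2, THEN conjunct2, THEN conjunct2, THEN spec, THEN spec, THEN spec, THEN mp, of U V W]
   in \<open>simp_all add: Pi_iff\<close>)

lemma presheaf_module: "presheaf_of_modules X \<O> F ==> openin X U ==> module (Sc \<O> U) (Sc F U)"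
 by (simp add: presheaf_of_modules_def)

lemma presheaf_module_like: assumes "presheaf_of_modules X \<O> F" shows "module_like X \<O> F"
proof -
 have "s \<oplus>\<^bsub>Sc F U\<^esub> t \<in> sec F U" if "openin X U" "s \<in> sec F U" "t \<in> sec F U" for U s t
  using module.axioms(2)[OF presheaf_module[OF assms that(1)]] that by (simp add: abelian_groupE(1))
 moreover have "r \<odot>\<^bsub>Sc F U\<^esub> s \<in> sec F U"
  if "openin X U" "r \<in> sec \<O> U" "s \<in> sec F U" for U r s
  using module.smult_closed[OF presheaf_module[OF assms that(1)]] that by blast
 ultimately show ?thesis unfolding module_like_def
  by (intro conjI[OF _ assms[unfolded presheaf_of_modules_def, THEN conjunct2]]) simp
qed

lemmas presheafD = module_likeD[OF presheaf_module_like]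

lemma presheaf_of_modulesI:
 "(!!U. openin X U ==> module (Sc \<O> U) (Sc F U)) ==> module_like X \<O> F ==> presheaf_of_modules X \<O> F"
 unfolding presheaf_of_modules_def module_like_def by (erule conjE) (rule conjI; simp)

lemma module_likeI:
 assumes "!!U s t. openin X U ==> s \<in> sec F U ==> t \<in> sec F U ==>
    s \<oplus>\<^bsub>Sc F U\<^esub> t \<in> sec F U"
  "!!U r s. openin X U ==> r \<in> sec \<O> U ==> s \<in> sec F U ==>
    r \<odot>\<^bsub>Sc F U\<^esub> s \<in> sec F U"
  "!!U V s. openin X U ==> openin X V ==> V \<subseteq> U ==> s \<in> sec F U ==> restr F U V s \<in> sec F V"
  "!!U V s t. openin X U ==> openin X V ==> V \<subseteq> U ==> s \<in> sec F U ==> t \<in> sec F U ==>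
    restr F U V (s \<oplus>\<^bsub>Sc F U\<^esub> t) = restr F U V s \<oplus>\<^bsub>Sc F V\<^esub> restr F U V t"
  "!!U V r s. openin X U ==> openin X V ==> V \<subseteq> U ==> r \<in> sec \<O> U ==> s \<in> sec F U ==>
    restr F U V (r \<odot>\<^bsub>Sc F U\<^esub> s) = restr \<O> U V r \<odot>\<^bsub>Sc F V\<^esub> restr F U V s"
  "!!U s. openin X U ==> s \<in> sec F U ==> restr F U U s = s"
  "!!U V W s. openin X U ==> openin X V ==> openin X W ==> W \<subseteq> V ==> V \<subseteq> U ==> s \<in> sec F U ==>
    restr F V W (restr F U V s) = restr F U W s"
 shows "module_like X \<O> F"
 unfolding module_like_def
 by (intro conjI allI impI ballI funcsetI; (elim conjE)?; rule assms; assumption)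

lemma semilinear_restr:
 assumes "ring_presheaf X \<O>" "presheaf_of_modules X \<O> F" "openin X U" "openin X V" "V \<subseteq> U"
 shows "semilinear (Sc \<O> U) (Sc F U) (Sc \<O> V) (Sc F V) (restr \<O> U V) (restr F U V)"
 unfolding semilinear_def
 using ring_presheafD(2)[OF assms(1,3-5)] presheafD(3-5)[OF assms(2-5)] by (simp add: Pi_iff)

lemma tensor_presheaf_simps:
 "Sc (tensor_presheaf \<O> A B) U = tensor_module (Sc \<O> U) (Sc A U) (Sc B U)"
 "restr (tensor_presheaf \<O> A B) U V = tmap (Sc \<O> V) (Sc A V) (Sc B V) (restr A U V) (restr B U V)"
 by (simp_all add: tensor_presheaf_def)

text \<open>The identities for restriction are equalities of additive maps between tensor products,
  tested on pure tensors.\<close>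

lemma tensor_presheaf_of_modules:
 assumes O: "ring_presheaf X \<O>" and A: "presheaf_of_modules X \<O> A" and B: "presheaf_of_modules X \<O> B"
 shows "presheaf_of_modules X \<O> (tensor_presheaf \<O> A B)"
proof -
 have t: "tensor (Sc \<O> U) (Sc A U) (Sc B U)" if "openin X U" for U
  using presheaf_module[OF A that] presheaf_module[OF B that] by (simp add: tensor_def)
 note sA = semilinear_restr[OF O A] and sB = semilinear_restr[OF O B]
 have add: "restr (tensor_presheaf \<O> A B) U V \<in> sec (tensor_presheaf \<O> A B) U \<rightarrow> sec (tensor_presheaf \<O> A B) V"
  "!!s t. s \<in> sec (tensor_presheaf \<O> A B) U ==> t \<in> sec (tensor_presheaf \<O> A B) U ==>
    restr (tensor_presheaf \<O> A B) U V (s \<oplus>\<^bsub>Sc (tensor_presheaf \<O> A B) U\<^esub> t) =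
    restr (tensor_presheaf \<O> A B) U V s \<oplus>\<^bsub>Sc (tensor_presheaf \<O> A B) V\<^esub> restr (tensor_presheaf \<O> A B) U V t"
  if "openin X U" "openin X V" "V \<subseteq> U" for U V
  unfolding tensor_presheaf_simps using tmap_additive[OF t t sA sB] that by simp_all
 have smult: "restr (tensor_presheaf \<O> A B) U V (r \<odot>\<^bsub>Sc (tensor_presheaf \<O> A B) U\<^esub> s)
   = restr \<O> U V r \<odot>\<^bsub>Sc (tensor_presheaf \<O> A B) V\<^esub> restr (tensor_presheaf \<O> A B) U V s"
  if UV: "openin X U" "openin X V" "V \<subseteq> U" and r: "r \<in> sec \<O> U"
   and s: "s \<in> sec (tensor_presheaf \<O> A B) U" for U V r s
 proof -
  interpret u: tensor "Sc \<O> U" "Sc A U" "Sc B U" by (rule t) fact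
  interpret v: tensor "Sc \<O> V" "Sc A V" "Sc B V" by (rule t) fact
  let ?res = "tmap (Sc \<O> V) (Sc A V) (Sc B V) (restr A U V) (restr B U V)"
  have r': "restr \<O> U V r \<in> sec \<O> V" using ring_presheafD(2)[OF O UV r] .
  have res: "?res s \<in> carrier v.T" if "s \<in> carrier u.T" for s
   using tmap_additive(1)[OF t t sA sB] UV that by blast
  have "?res (r \<odot>\<^bsub>u.T\<^esub> s) = restr \<O> U V r \<odot>\<^bsub>v.T\<^esub> ?res s"
   by (rule additive_eqI[OF t[OF UV(1)] v.T_group, where f = "%s. ?res (r \<odot>\<^bsub>u.T\<^esub> s)"])
     (use s UV r r' res in \<open>simp_all add: tensor_presheaf_simps u.smult_additive(2) v.smult_additive(2)
      funcset_mem[OF u.smult_additive(1)] funcset_mem[OF v.smult_additive(1)] Pi_iff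
      tmap_additive(2)[OF t t sA sB] u.smult_pure v.smult_pure tmap_pure[OF t t sA sB] presheafD(3,5)[OF A] presheafD(3)[OF B]\<close>)
  then show ?thesis by (simp add: tensor_presheaf_simps)
 qed
 have id: "restr (tensor_presheaf \<O> A B) U U s = s"
  if U: "openin X U" and s: "s \<in> sec (tensor_presheaf \<O> A B) U" for U s
 proof -
  interpret u: tensor "Sc \<O> U" "Sc A U" "Sc B U" by (rule t) fact
  let ?res = "tmap (Sc \<O> U) (Sc A U) (Sc B U) (restr A U U) (restr B U U)"
  have "?res s = s"
   by (rule additive_eqI[OF t[OF U] u.T_group tmap_additive[OF t t sA sB], where g = "%s. s"])
     (use s U in \<open>simp_all add: tensor_presheaf_simps tmap_pure[OF t t sA sB] presheafD(6)[OF A] presheafD(6)[OF B]\<close>)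
  then show ?thesis by (simp add: tensor_presheaf_simps)
 qed
 have comp: "restr (tensor_presheaf \<O> A B) V W (restr (tensor_presheaf \<O> A B) U V s) = restr (tensor_presheaf \<O> A B) U W s"
  if "openin X U" "openin X V" "openin X W" "W \<subseteq> V" "V \<subseteq> U" and s: "s \<in> sec (tensor_presheaf \<O> A B) U" for U V W s
 proof -
  have "W \<subseteq> U" using that by blast
  note o = that(1-5) this
  note c = tmap_compose[OF t[OF o(1)] t[OF o(2)] sA[OF o(1,2,5)] sB[OF o(1,2,5)] t[OF o(3)]
    sA[OF o(2,3,4)] sB[OF o(2,3,4)] sA[OF o(1,3,6)] sB[OF o(1,3,6)]]
  show ?thesis unfolding tensor_presheaf_simps
   by (rule c) (use s in \<open>simp_all add: tensor_presheaf_simps presheafD(7)[OF A o(1-5)] presheafD(7)[OF B o(1-5)]\<close>)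
 qed
 have mod: "module (Sc \<O> U) (Sc (tensor_presheaf \<O> A B) U)" if "openin X U" for U
  unfolding tensor_presheaf_simps by (rule tensor.T_module[OF t[OF that]])
 have ac: "s \<oplus>\<^bsub>Sc (tensor_presheaf \<O> A B) U\<^esub> t \<in> sec (tensor_presheaf \<O> A B) U"
  if "openin X U" "s \<in> sec (tensor_presheaf \<O> A B) U" "t \<in> sec (tensor_presheaf \<O> A B) U" for U s t
  using module.axioms(2)[OF mod[OF that(1)]] that by (simp add: abelian_groupE(1))
 have sc: "r \<odot>\<^bsub>Sc (tensor_presheaf \<O> A B) U\<^esub> s \<in> sec (tensor_presheaf \<O> A B) U"
  if "openin X U" "r \<in> sec \<O> U" "s \<in> sec (tensor_presheaf \<O> A B) U" for U r s
  using module.smult_closed[OF mod[OF that(1)]] that by blast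
 show ?thesis
 proof (rule presheaf_of_modulesI)
  show "module_like X \<O> (tensor_presheaf \<O> A B)"
   by (rule module_likeI; (rule ac sc funcset_mem[OF add(1)] add(2) smult id comp; assumption))
 qed (rule mod)
qed

lemma hom_sheaf_simps:
 "sec (hom_sheaf X \<O> F G) U = sheaf_hom X \<O> F G U"
 "add (Sc (hom_sheaf X \<O> F G) U) \<phi> \<psi> = (\<lambda>V\<in>opens_in X U. \<lambda>s\<in>sec F V. \<phi> V s \<oplus>\<^bsub>Sc G V\<^esub> \<psi> V s)"
 "zero (Sc (hom_sheaf X \<O> F G) U) = (\<lambda>V\<in>opens_in X U. \<lambda>s\<in>sec F V. \<zero>\<^bsub>Sc G V\<^esub>)"
 "smult (Sc (hom_sheaf X \<O> F G) U) r \<phi> = (\<lambda>V\<in>opens_in X U. \<lambda>s\<in>sec F V. restr \<O> U V r \<odot>\<^bsub>Sc G V\<^esub> \<phi> V s)"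
 "restr (hom_sheaf X \<O> F G) U V \<phi> = restrict \<phi> (opens_in X V)"
 by (simp_all add: hom_sheaf_def)

lemma sheaf_homD:
 assumes "\<phi> \<in> sheaf_hom X \<O> F G U" "openin X V" "V \<subseteq> U"
 shows "s \<in> sec F V ==> \<phi> V s \<in> sec G V"
  "s \<in> sec F V ==> t \<in> sec F V ==> \<phi> V (s \<oplus>\<^bsub>Sc F V\<^esub> t) = \<phi> V s \<oplus>\<^bsub>Sc G V\<^esub> \<phi> V t"
  "r \<in> sec \<O> V ==> s \<in> sec F V ==> \<phi> V (r \<odot>\<^bsub>Sc F V\<^esub> s) = r \<odot>\<^bsub>Sc G V\<^esub> \<phi> V s"
  "openin X W ==> W \<subseteq> V ==> s \<in> sec F V ==> \<phi> W (restr F V W s) = restr G V W (\<phi> V s)"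
  "\<phi> V \<in> extensional (sec F V)"
proof -
 have "\<phi> V \<in> module_hom (Sc \<O> V) (Sc F V) (Sc G V)"
  using assms by (auto simp: sheaf_hom_def)
 then show "s \<in> sec F V ==> \<phi> V s \<in> sec G V"
  "s \<in> sec F V ==> t \<in> sec F V ==> \<phi> V (s \<oplus>\<^bsub>Sc F V\<^esub> t) = \<phi> V s \<oplus>\<^bsub>Sc G V\<^esub> \<phi> V t"
  "r \<in> sec \<O> V ==> s \<in> sec F V ==> \<phi> V (r \<odot>\<^bsub>Sc F V\<^esub> s) = r \<odot>\<^bsub>Sc G V\<^esub> \<phi> V s"
  "\<phi> V \<in> extensional (sec F V)"
  by (auto simp: module_hom_def PiE_iff)
 show "openin X W ==> W \<subseteq> V ==> s \<in> sec F V ==> \<phi> W (restr F V W s) = restr G V W (\<phi> V s)"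
  using assms by (auto simp: sheaf_hom_def)
qed

lemma sheaf_hom_extensional: "\<phi> \<in> sheaf_hom X \<O> F G U ==> \<phi> \<in> extensional (opens_in X U)"
 by (auto simp: sheaf_hom_def PiE_iff)

lemma sheaf_homI:
 assumes "\<phi> \<in> extensional (opens_in X U)"
  "!!V. openin X V ==> V \<subseteq> U ==> \<phi> V \<in> extensional (sec F V)"
  "!!V s. openin X V ==> V \<subseteq> U ==> s \<in> sec F V ==> \<phi> V s \<in> sec G V"
  "!!V s t. openin X V ==> V \<subseteq> U ==> s \<in> sec F V ==> t \<in> sec F V ==>
    \<phi> V (s \<oplus>\<^bsub>Sc F V\<^esub> t) = \<phi> V s \<oplus>\<^bsub>Sc G V\<^esub> \<phi> V t"
  "!!V r s. openin X V ==> V \<subseteq> U ==> r \<in> sec \<O> V ==> s \<in> sec F V ==>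
    \<phi> V (r \<odot>\<^bsub>Sc F V\<^esub> s) = r \<odot>\<^bsub>Sc G V\<^esub> \<phi> V s"
  "!!V W s. openin X V ==> V \<subseteq> U ==> openin X W ==> W \<subseteq> V ==> s \<in> sec F V ==>
    \<phi> W (restr F V W s) = restr G V W (\<phi> V s)"
 shows "\<phi> \<in> sheaf_hom X \<O> F G U"
 using assms unfolding sheaf_hom_def module_hom_def by (auto simp: PiE_iff)

lemma sheaf_hom_eqI:
 assumes "\<phi> \<in> sheaf_hom X \<O> F G U" "\<psi> \<in> sheaf_hom X \<O> F G U"
  "!!V s. openin X V ==> V \<subseteq> U ==> s \<in> sec F V ==> \<phi> V s = \<psi> V s"
 shows "\<phi> = \<psi>"
proof (rule extensionalityI[OF sheaf_hom_extensional[OF assms(1)] sheaf_hom_extensional[OF assms(2)]])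
 fix V assume "V \<in> opens_in X U"
 then have V: "openin X V" "V \<subseteq> U" by auto
 show "\<phi> V = \<psi> V"
  by (rule extensionalityI[OF sheaf_homD(5)[OF assms(1) V] sheaf_homD(5)[OF assms(2) V]]) (rule assms(3)[OF V])
qed

lemma sheaf_hom_restrict:
 assumes "\<phi> \<in> sheaf_hom X \<O> F G U" "V \<subseteq> U"
 shows "restrict \<phi> (opens_in X V) \<in> sheaf_hom X \<O> F G V"
proof (rule sheaf_homI)
 fix W assume "openin X W" "W \<subseteq> V"
 moreover from this have "W \<subseteq> U" using assms by blast
 ultimately have "restrict \<phi> (opens_in X V) W = \<phi> W" "openin X W" "W \<subseteq> U" by auto
 note W = this and h = sheaf_homD[OF assms(1) this(2,3)]
 show "restrict \<phi> (opens_in X V) W \<in> extensional (sec F W)" unfolding W(1) by (rule h(5))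
 show "restrict \<phi> (opens_in X V) W s \<in> sec G W" if "s \<in> sec F W" for s
  unfolding W(1) by (rule h(1)[OF that])
 show "restrict \<phi> (opens_in X V) W (s \<oplus>\<^bsub>Sc F W\<^esub> t) = restrict \<phi> (opens_in X V) W s \<oplus>\<^bsub>Sc G W\<^esub> restrict \<phi> (opens_in X V) W t"
  if "s \<in> sec F W" "t \<in> sec F W" for s t
  unfolding W(1) by (rule h(2)[OF that])
 show "restrict \<phi> (opens_in X V) W (r \<odot>\<^bsub>Sc F W\<^esub> s) = r \<odot>\<^bsub>Sc G W\<^esub> restrict \<phi> (opens_in X V) W s"
  if "r \<in> sec \<O> W" "s \<in> sec F W" for r s
  unfolding W(1) by (rule h(3)[OF that])
 show "restrict \<phi> (opens_in X V) W' (restr F W W' s) = restr G W W' (restrict \<phi> (opens_in X V) W s)"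
  if "openin X W'" "W' \<subseteq> W" "s \<in> sec F W" for W' s
  using h(4)[OF that] that \<open>W \<subseteq> V\<close> W by auto
qed auto

lemma hom_presheaf_of_modules:
 assumes O: "ring_presheaf X \<O>" and F: "presheaf_of_modules X \<O> F" and G: "presheaf_of_modules X \<O> G"
 shows "presheaf_of_modules X \<O> (hom_sheaf X \<O> F G)"
proof -
 let ?H = "hom_sheaf X \<O> F G"
 have Fm: "module (Sc \<O> U) (Sc F U)" and Gm: "module (Sc \<O> U) (Sc G U)" if "openin X U" for U
  using presheaf_module[OF F that] presheaf_module[OF G that] .
 have Gg: "abelian_group (Sc G U)" if "openin X U" for U using module.axioms(2)[OF Gm[OF that]] .
 have Oc: "cring (Sc \<O> U)" if "openin X U" for U using ring_presheafD(1)[OF O that] .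
 note Gs = abelian_groupE[OF Gg] and GD = presheafD[OF G] and FD = presheafD[OF F]
 have val: "(\<phi> \<oplus>\<^bsub>Sc ?H U\<^esub> \<psi>) V s = \<phi> V s \<oplus>\<^bsub>Sc G V\<^esub> \<psi> V s"
   "\<zero>\<^bsub>Sc ?H U\<^esub> V s = \<zero>\<^bsub>Sc G V\<^esub>"
   "(r \<odot>\<^bsub>Sc ?H U\<^esub> \<phi>) V s = restr \<O> U V r \<odot>\<^bsub>Sc G V\<^esub> \<phi> V s"
  if "openin X V" "V \<subseteq> U" "s \<in> sec F V" for U V r s \<phi> \<psi>
  using that by (simp_all add: hom_sheaf_simps)
 have ext: "\<phi> \<oplus>\<^bsub>Sc ?H U\<^esub> \<psi> \<in> extensional (opens_in X U)"
   "\<zero>\<^bsub>Sc ?H U\<^esub> \<in> extensional (opens_in X U)"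
   "r \<odot>\<^bsub>Sc ?H U\<^esub> \<phi> \<in> extensional (opens_in X U)" for U r \<phi> \<psi>
  by (simp_all add: hom_sheaf_simps)
 have ext2: "(\<phi> \<oplus>\<^bsub>Sc ?H U\<^esub> \<psi>) V \<in> extensional (sec F V)"
   "\<zero>\<^bsub>Sc ?H U\<^esub> V \<in> extensional (sec F V)"
   "(r \<odot>\<^bsub>Sc ?H U\<^esub> \<phi>) V \<in> extensional (sec F V)"
  if "openin X V" "V \<subseteq> U" for U V r \<phi> \<psi>
  using that by (simp_all add: hom_sheaf_simps)
 have Gsm: "r \<odot>\<^bsub>Sc G V\<^esub> (s \<oplus>\<^bsub>Sc G V\<^esub> t) = r \<odot>\<^bsub>Sc G V\<^esub> s \<oplus>\<^bsub>Sc G V\<^esub> r \<odot>\<^bsub>Sc G V\<^esub> t"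
  "(r \<oplus>\<^bsub>Sc \<O> V\<^esub> r') \<odot>\<^bsub>Sc G V\<^esub> s = r \<odot>\<^bsub>Sc G V\<^esub> s \<oplus>\<^bsub>Sc G V\<^esub> r' \<odot>\<^bsub>Sc G V\<^esub> s"
  "(r \<otimes>\<^bsub>Sc \<O> V\<^esub> r') \<odot>\<^bsub>Sc G V\<^esub> s = r \<odot>\<^bsub>Sc G V\<^esub> (r' \<odot>\<^bsub>Sc G V\<^esub> s)"
  "r \<otimes>\<^bsub>Sc \<O> V\<^esub> r' = r' \<otimes>\<^bsub>Sc \<O> V\<^esub> r"
  "\<one>\<^bsub>Sc \<O> V\<^esub> \<odot>\<^bsub>Sc G V\<^esub> s = s"
  "r \<odot>\<^bsub>Sc G V\<^esub> \<zero>\<^bsub>Sc G V\<^esub> = \<zero>\<^bsub>Sc G V\<^esub>"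
  if "openin X V" "s \<in> sec G V" "t \<in> sec G V" "r \<in> sec \<O> V" "r' \<in> sec \<O> V" for V s t r r'
 proof -
  interpret module "Sc \<O> V" "Sc G V" by (rule Gm[OF that(1)])
  show "r \<odot>\<^bsub>Sc G V\<^esub> (s \<oplus>\<^bsub>Sc G V\<^esub> t) = r \<odot>\<^bsub>Sc G V\<^esub> s \<oplus>\<^bsub>Sc G V\<^esub> r \<odot>\<^bsub>Sc G V\<^esub> t"
   "(r \<oplus>\<^bsub>Sc \<O> V\<^esub> r') \<odot>\<^bsub>Sc G V\<^esub> s = r \<odot>\<^bsub>Sc G V\<^esub> s \<oplus>\<^bsub>Sc G V\<^esub> r' \<odot>\<^bsub>Sc G V\<^esub> s"
   "(r \<otimes>\<^bsub>Sc \<O> V\<^esub> r') \<odot>\<^bsub>Sc G V\<^esub> s = r \<odot>\<^bsub>Sc G V\<^esub> (r' \<odot>\<^bsub>Sc G V\<^esub> s)"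
   "\<one>\<^bsub>Sc \<O> V\<^esub> \<odot>\<^bsub>Sc G V\<^esub> s = s"
   "r \<odot>\<^bsub>Sc G V\<^esub> \<zero>\<^bsub>Sc G V\<^esub> = \<zero>\<^bsub>Sc G V\<^esub>"
   using that(2-) by (simp_all add: smult_r_distr smult_l_distr smult_assoc1)
  show "r \<otimes>\<^bsub>Sc \<O> V\<^esub> r' = r' \<otimes>\<^bsub>Sc \<O> V\<^esub> r"
   using that(4,5) by (rule R.m_comm)
 qed
 have swap: "(a \<oplus>\<^bsub>Sc G V\<^esub> b) \<oplus>\<^bsub>Sc G V\<^esub> (c \<oplus>\<^bsub>Sc G V\<^esub> d) = (a \<oplus>\<^bsub>Sc G V\<^esub> c) \<oplus>\<^bsub>Sc G V\<^esub> (b \<oplus>\<^bsub>Sc G V\<^esub> d)"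
  if "openin X V" "a \<in> sec G V" "b \<in> sec G V" "c \<in> sec G V" "d \<in> sec G V" for V a b c d
 proof -
  interpret abelian_group "Sc G V" by (rule Gg) fact
  show ?thesis using that by (simp add: a_ac)
 qed
 have addc: "\<phi> \<oplus>\<^bsub>Sc ?H U\<^esub> \<psi> \<in> sheaf_hom X \<O> F G U"
  if "openin X U" "\<phi> \<in> sheaf_hom X \<O> F G U" "\<psi> \<in> sheaf_hom X \<O> F G U" for U \<phi> \<psi>
 proof (rule sheaf_homI[OF ext(1) ext2(1)])
  fix V assume V: "openin X V" "V \<subseteq> U"
  note h1 = sheaf_homD[OF that(2) V] and h2 = sheaf_homD[OF that(3) V]
  show "(\<phi> \<oplus>\<^bsub>Sc ?H U\<^esub> \<psi>) V s \<in> sec G V" if "s \<in> sec F V" for s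
   using val(1)[OF V that] Gs(1)[OF V(1)] h1(1) h2(1) that by simp
  show "(\<phi> \<oplus>\<^bsub>Sc ?H U\<^esub> \<psi>) V (s \<oplus>\<^bsub>Sc F V\<^esub> t) = (\<phi> \<oplus>\<^bsub>Sc ?H U\<^esub> \<psi>) V s \<oplus>\<^bsub>Sc G V\<^esub> (\<phi> \<oplus>\<^bsub>Sc ?H U\<^esub> \<psi>) V t"
   if st: "s \<in> sec F V" "t \<in> sec F V" for s t
   using val(1)[OF V] st h1(1,2) h2(1,2) FD(1)[OF V(1) st] by (simp add: swap[OF V(1)])
  show "(\<phi> \<oplus>\<^bsub>Sc ?H U\<^esub> \<psi>) V (r \<odot>\<^bsub>Sc F V\<^esub> s) = r \<odot>\<^bsub>Sc G V\<^esub> (\<phi> \<oplus>\<^bsub>Sc ?H U\<^esub> \<psi>) V s"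
   if rs: "r \<in> sec \<O> V" "s \<in> sec F V" for r s
   using val(1)[OF V] rs h1(1,3) h2(1,3) FD(2)[OF V(1) rs] Gsm(1)[OF V(1)] by simp
  show "(\<phi> \<oplus>\<^bsub>Sc ?H U\<^esub> \<psi>) W (restr F V W s) = restr G V W ((\<phi> \<oplus>\<^bsub>Sc ?H U\<^esub> \<psi>) V s)"
   if W: "openin X W" "W \<subseteq> V" "s \<in> sec F V" for W s
  proof -
   have "W \<subseteq> U" using W V by blast
   then show ?thesis
    using val(1)[OF V W(3)] val(1)[OF W(1) _ FD(3)[OF V(1) W]] h1(4)[OF W] h2(4)[OF W] GD(4)[OF V(1) W(1,2) h1(1) h2(1)] W by simp
  qed
 qed
 have zeroc: "\<zero>\<^bsub>Sc ?H U\<^esub> \<in> sheaf_hom X \<O> F G U" if "openin X U" for U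
 proof (rule sheaf_homI[OF ext(2) ext2(2)])
  fix V assume V: "openin X V" "V \<subseteq> U"
  note z = val(2)[OF V]
  show "\<zero>\<^bsub>Sc ?H U\<^esub> V s \<in> sec G V" if "s \<in> sec F V" for s
   using z[OF that] Gs(2)[OF V(1)] by simp
  show "\<zero>\<^bsub>Sc ?H U\<^esub> V (s \<oplus>\<^bsub>Sc F V\<^esub> t) = \<zero>\<^bsub>Sc ?H U\<^esub> V s \<oplus>\<^bsub>Sc G V\<^esub> \<zero>\<^bsub>Sc ?H U\<^esub> V t"
   if st: "s \<in> sec F V" "t \<in> sec F V" for s t
   using z st FD(1)[OF V(1) st] Gs(2,5)[OF V(1)] by simp
  show "\<zero>\<^bsub>Sc ?H U\<^esub> V (r \<odot>\<^bsub>Sc F V\<^esub> s) = r \<odot>\<^bsub>Sc G V\<^esub> \<zero>\<^bsub>Sc ?H U\<^esub> V s"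
   if rs: "r \<in> sec \<O> V" "s \<in> sec F V" for r s
   using z rs FD(2)[OF V(1) rs] Gsm(6)[OF V(1)] Gs(2)[OF V(1)] by simp
  show "\<zero>\<^bsub>Sc ?H U\<^esub> W (restr F V W s) = restr G V W (\<zero>\<^bsub>Sc ?H U\<^esub> V s)"
   if W: "openin X W" "W \<subseteq> V" "s \<in> sec F V" for W s
  proof -
   have "restr G V W \<zero>\<^bsub>Sc G V\<^esub> = \<zero>\<^bsub>Sc G W\<^esub>"
    by (rule additive_zero[OF Gg[OF V(1)] Gg[OF W(1)]]) (use GD(3,4)[OF V(1) W(1,2)] in auto)
   moreover have "W \<subseteq> U" using W V by blast
   ultimately show ?thesis
    using z[OF W(3)] val(2)[OF W(1) _ FD(3)[OF V(1) W]] by simp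
  qed
 qed
 have smc: "r \<odot>\<^bsub>Sc ?H U\<^esub> \<phi> \<in> sheaf_hom X \<O> F G U"
  if U: "openin X U" and r: "r \<in> sec \<O> U" and p: "\<phi> \<in> sheaf_hom X \<O> F G U" for U \<phi> r
 proof (rule sheaf_homI[OF ext(3) ext2(3)])
  fix V assume V: "openin X V" "V \<subseteq> U"
  note h1 = sheaf_homD[OF p V]
  have rV: "restr \<O> U V r \<in> sec \<O> V" using ring_presheafD(2)[OF O U V r] .
  show "(r \<odot>\<^bsub>Sc ?H U\<^esub> \<phi>) V s \<in> sec G V" if "s \<in> sec F V" for s
   using val(3)[OF V that] GD(2)[OF V(1) rV] h1(1) that by simp
  show "(r \<odot>\<^bsub>Sc ?H U\<^esub> \<phi>) V (s \<oplus>\<^bsub>Sc F V\<^esub> t) = (r \<odot>\<^bsub>Sc ?H U\<^esub> \<phi>) V s \<oplus>\<^bsub>Sc G V\<^esub> (r \<odot>\<^bsub>Sc ?H U\<^esub> \<phi>) V t"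
   if st: "s \<in> sec F V" "t \<in> sec F V" for s t
   using val(3)[OF V] st h1(1,2) FD(1)[OF V(1) st] Gsm(1)[OF V(1) _ _ rV] rV by simp
  show "(r \<odot>\<^bsub>Sc ?H U\<^esub> \<phi>) V (q \<odot>\<^bsub>Sc F V\<^esub> s) = q \<odot>\<^bsub>Sc G V\<^esub> (r \<odot>\<^bsub>Sc ?H U\<^esub> \<phi>) V s"
   if rs: "q \<in> sec \<O> V" "s \<in> sec F V" for q s
   using val(3)[OF V] rs h1(1,3) FD(2)[OF V(1) rs] rV Gsm(3)[OF V(1) h1(1) h1(1), symmetric] Gsm(4)[OF V(1) h1(1) h1(1), of s s q] by simp
  show "(r \<odot>\<^bsub>Sc ?H U\<^esub> \<phi>) W (restr F V W s) = restr G V W ((r \<odot>\<^bsub>Sc ?H U\<^esub> \<phi>) V s)"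
   if W: "openin X W" "W \<subseteq> V" "s \<in> sec F V" for W s
  proof -
   have "W \<subseteq> U" using W V by blast
   then show ?thesis
    using val(3)[OF V W(3)] val(3)[OF W(1) _ FD(3)[OF V(1) W]] h1(4)[OF W] GD(5)[OF V(1) W(1,2) rV h1(1)] W
     ring_presheafD(7)[OF O U V(1) W(1,2) V(2) r] by simp
  qed
 qed
 have rs: "restr ?H U V \<phi> W s = \<phi> W s" if "openin X W" "W \<subseteq> V" for U V W \<phi> s
  using that by (simp add: hom_sheaf_simps)
 have rc: "restr ?H U V \<phi> \<in> sheaf_hom X \<O> F G V" if "\<phi> \<in> sheaf_hom X \<O> F G U" "V \<subseteq> U" for U V \<phi>
  unfolding hom_sheaf_simps using that by (rule sheaf_hom_restrict)
 have mod: "module (Sc \<O> U) (Sc ?H U)" if U: "openin X U" for U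
 proof (rule moduleI)
  show "cring (Sc \<O> U)" by (rule Oc[OF U])
  show "abelian_group (Sc ?H U)"
  proof (rule abelian_groupI; unfold hom_sheaf_simps(1))
   show "\<zero>\<^bsub>Sc ?H U\<^esub> \<in> sheaf_hom X \<O> F G U" by (rule zeroc[OF U])
   fix \<phi> assume p: "\<phi> \<in> sheaf_hom X \<O> F G U"
   show "\<zero>\<^bsub>Sc ?H U\<^esub> \<oplus>\<^bsub>Sc ?H U\<^esub> \<phi> = \<phi>"
    by (rule sheaf_hom_eqI[OF addc[OF U zeroc[OF U] p] p]) (simp add: val Gs(5) sheaf_homD(1)[OF p])
   \<comment> \<open>The additive inverse is the multiple by -1. Over \<open>V\<close> its scalar is
     the restriction of -1, and adding 1 to this gives the restriction of 0, which is 0.\<close>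
   have neg: "\<ominus>\<^bsub>Sc \<O> U\<^esub> \<one>\<^bsub>Sc \<O> U\<^esub> \<in> sec \<O> U" using Oc[OF U] by (simp add: cring.cring_simprules)
   have "(\<ominus>\<^bsub>Sc \<O> U\<^esub> \<one>\<^bsub>Sc \<O> U\<^esub>) \<odot>\<^bsub>Sc ?H U\<^esub> \<phi> \<oplus>\<^bsub>Sc ?H U\<^esub> \<phi> = \<zero>\<^bsub>Sc ?H U\<^esub>"
   proof (rule sheaf_hom_eqI[OF addc[OF U smc[OF U neg p] p] zeroc[OF U]])
    fix V s assume V: "openin X V" "V \<subseteq> U" "s \<in> sec F V"
    interpret Gv: module "Sc \<O> V" "Sc G V" by (rule Gm) fact
    interpret Ou: cring "Sc \<O> U" by (rule Oc) fact
    let ?q = "restr \<O> U V (\<ominus>\<^bsub>Sc \<O> U\<^esub> \<one>\<^bsub>Sc \<O> U\<^esub>)"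
    have q: "?q \<in> sec \<O> V" using ring_presheafD(2)[OF O U V(1,2) neg] .
    have c: "\<phi> V s \<in> sec G V" using sheaf_homD(1)[OF p V] .
    have 1: "restr \<O> U V \<one>\<^bsub>Sc \<O> U\<^esub> = \<one>\<^bsub>Sc \<O> V\<^esub>" using ring_presheafD(5)[OF O U V(1,2)] .
    have "?q \<oplus>\<^bsub>Sc \<O> V\<^esub> \<one>\<^bsub>Sc \<O> V\<^esub> = restr \<O> U V (\<ominus>\<^bsub>Sc \<O> U\<^esub> \<one>\<^bsub>Sc \<O> U\<^esub> \<oplus>\<^bsub>Sc \<O> U\<^esub> \<one>\<^bsub>Sc \<O> U\<^esub>)"
     using ring_presheafD(3)[OF O U V(1,2) neg Ou.one_closed] 1 by simp
    also have "\<dots> = restr \<O> U V \<zero>\<^bsub>Sc \<O> U\<^esub>" by (simp add: Ou.l_neg)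
    also have "\<dots> = \<zero>\<^bsub>Sc \<O> V\<^esub>"
     by (rule additive_zero) (use Ou.abelian_group_axioms Gv.R.abelian_group_axioms ring_presheafD(2,3)[OF O U V(1,2)] in auto)
    finally have "?q \<odot>\<^bsub>Sc G V\<^esub> \<phi> V s \<oplus>\<^bsub>Sc G V\<^esub> \<phi> V s = \<zero>\<^bsub>Sc G V\<^esub>"
     using Gv.smult_l_distr[OF q Gv.R.one_closed c] c by simp
    then show "((\<ominus>\<^bsub>Sc \<O> U\<^esub> \<one>\<^bsub>Sc \<O> U\<^esub>) \<odot>\<^bsub>Sc ?H U\<^esub> \<phi> \<oplus>\<^bsub>Sc ?H U\<^esub> \<phi>) V s = \<zero>\<^bsub>Sc ?H U\<^esub> V s"
     using V by (simp add: val)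
   qed
   then show "\<exists>\<psi>\<in>sheaf_hom X \<O> F G U. \<psi> \<oplus>\<^bsub>Sc ?H U\<^esub> \<phi> = \<zero>\<^bsub>Sc ?H U\<^esub>" using smc[OF U neg p] by blast
   fix \<psi> assume q: "\<psi> \<in> sheaf_hom X \<O> F G U"
   show "\<phi> \<oplus>\<^bsub>Sc ?H U\<^esub> \<psi> \<in> sheaf_hom X \<O> F G U" by (rule addc[OF U p q])
   show "\<phi> \<oplus>\<^bsub>Sc ?H U\<^esub> \<psi> = \<psi> \<oplus>\<^bsub>Sc ?H U\<^esub> \<phi>"
    by (rule sheaf_hom_eqI[OF addc[OF U p q] addc[OF U q p]]) (simp add: val Gs(4) sheaf_homD(1)[OF p] sheaf_homD(1)[OF q])
   fix \<theta> assume r: "\<theta> \<in> sheaf_hom X \<O> F G U"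
   show "\<phi> \<oplus>\<^bsub>Sc ?H U\<^esub> \<psi> \<oplus>\<^bsub>Sc ?H U\<^esub> \<theta> = \<phi> \<oplus>\<^bsub>Sc ?H U\<^esub> (\<psi> \<oplus>\<^bsub>Sc ?H U\<^esub> \<theta>)"
    by (rule sheaf_hom_eqI[OF addc[OF U addc[OF U p q] r] addc[OF U p addc[OF U q r]]])
      (simp add: val Gs(3) sheaf_homD(1)[OF p] sheaf_homD(1)[OF q] sheaf_homD(1)[OF r])
  qed
  fix a \<phi> assume a: "a \<in> sec \<O> U" and p': "\<phi> \<in> sec ?H U"
  then have p: "\<phi> \<in> sheaf_hom X \<O> F G U" by (simp add: hom_sheaf_simps)
  note rO = ring_presheafD(2)[OF O U]
  show "a \<odot>\<^bsub>Sc ?H U\<^esub> \<phi> \<in> sec ?H U" unfolding hom_sheaf_simps(1) by (rule smc[OF U a p])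
  show "a \<odot>\<^bsub>Sc ?H U\<^esub> (\<phi> \<oplus>\<^bsub>Sc ?H U\<^esub> \<psi>) = a \<odot>\<^bsub>Sc ?H U\<^esub> \<phi> \<oplus>\<^bsub>Sc ?H U\<^esub> a \<odot>\<^bsub>Sc ?H U\<^esub> \<psi>"
   if "\<psi> \<in> sec ?H U" for \<psi>
  proof -
   have q: "\<psi> \<in> sheaf_hom X \<O> F G U" using that by (simp add: hom_sheaf_simps)
   show ?thesis
    by (rule sheaf_hom_eqI[OF smc[OF U a addc[OF U p q]] addc[OF U smc[OF U a p] smc[OF U a q]]])
      (simp add: val module.smult_r_distr[OF Gm] sheaf_homD(1)[OF p] sheaf_homD(1)[OF q] rO a)
  qed
  fix b assume b: "b \<in> sec \<O> U"
  interpret Ou: cring "Sc \<O> U" by (rule Oc) fact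
  have ab: "a \<oplus>\<^bsub>Sc \<O> U\<^esub> b \<in> sec \<O> U" "a \<otimes>\<^bsub>Sc \<O> U\<^esub> b \<in> sec \<O> U" using a b by auto
  show "(a \<oplus>\<^bsub>Sc \<O> U\<^esub> b) \<odot>\<^bsub>Sc ?H U\<^esub> \<phi> = a \<odot>\<^bsub>Sc ?H U\<^esub> \<phi> \<oplus>\<^bsub>Sc ?H U\<^esub> b \<odot>\<^bsub>Sc ?H U\<^esub> \<phi>"
   by (rule sheaf_hom_eqI[OF smc[OF U ab(1) p] addc[OF U smc[OF U a p] smc[OF U b p]]])
     (simp add: val module.smult_l_distr[OF Gm] sheaf_homD(1)[OF p] rO a b ring_presheafD(3)[OF O U])
  show "(a \<otimes>\<^bsub>Sc \<O> U\<^esub> b) \<odot>\<^bsub>Sc ?H U\<^esub> \<phi> = a \<odot>\<^bsub>Sc ?H U\<^esub> (b \<odot>\<^bsub>Sc ?H U\<^esub> \<phi>)"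
   by (rule sheaf_hom_eqI[OF smc[OF U ab(2) p] smc[OF U a smc[OF U b p]]])
     (simp add: val module.smult_assoc1[OF Gm] sheaf_homD(1)[OF p] rO a b ring_presheafD(4)[OF O U])
 next
  fix \<phi> assume "\<phi> \<in> sec ?H U"
  then have p: "\<phi> \<in> sheaf_hom X \<O> F G U" by (simp add: hom_sheaf_simps)
  interpret Ou: cring "Sc \<O> U" by (rule Oc) fact
  show "\<one>\<^bsub>Sc \<O> U\<^esub> \<odot>\<^bsub>Sc ?H U\<^esub> \<phi> = \<phi>"
   by (rule sheaf_hom_eqI[OF smc[OF U Ou.one_closed p] p])
     (simp add: val module.smult_one[OF Gm] sheaf_homD(1)[OF p] ring_presheafD(5)[OF O U])
 qed
 have ml: "module_like X \<O> ?H"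
 proof (rule module_likeI; unfold hom_sheaf_simps(1))
  fix U V \<phi> \<psi> assume UV: "openin X U" "openin X V" "V \<subseteq> U"
   and p: "\<phi> \<in> sheaf_hom X \<O> F G U" and q: "\<psi> \<in> sheaf_hom X \<O> F G U"
  show "restr ?H U V (\<phi> \<oplus>\<^bsub>Sc ?H U\<^esub> \<psi>) = restr ?H U V \<phi> \<oplus>\<^bsub>Sc ?H V\<^esub> restr ?H U V \<psi>"
   by (rule sheaf_hom_eqI[OF rc[OF addc[OF UV(1) p q] UV(3)] addc[OF UV(2) rc[OF p UV(3)] rc[OF q UV(3)]]])
     (use UV(3) in \<open>simp add: rs val subset_trans[OF _ UV(3)]\<close>)
 next
  fix U V \<phi> r assume UV: "openin X U" "openin X V" "V \<subseteq> U"
   and p: "\<phi> \<in> sheaf_hom X \<O> F G U" and r: "r \<in> sec \<O> U"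
  show "restr ?H U V (r \<odot>\<^bsub>Sc ?H U\<^esub> \<phi>) = restr \<O> U V r \<odot>\<^bsub>Sc ?H V\<^esub> restr ?H U V \<phi>"
   by (rule sheaf_hom_eqI[OF rc[OF smc[OF UV(1) r p] UV(3)] smc[OF UV(2) ring_presheafD(2)[OF O UV r] rc[OF p UV(3)]]])
     (use UV r in \<open>simp add: rs val subset_trans[OF _ UV(3)] ring_presheafD(7)[OF O UV(1,2) _ _ UV(3) r]\<close>)
 next
  fix U \<phi> assume "\<phi> \<in> sheaf_hom X \<O> F G U"
  then show "restr ?H U U \<phi> = \<phi>"
   by (simp only: hom_sheaf_simps extensional_restrict[OF sheaf_hom_extensional])
 next
  fix U V W \<phi> assume "openin X V" "W \<subseteq> V"
  then have "opens_in X V \<inter> opens_in X W = opens_in X W" unfolding opens_in_def by blast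
  then show "restr ?H V W (restr ?H U V \<phi>) = restr ?H U W \<phi>" by (simp add: hom_sheaf_simps)
 qed (use addc smc rc in auto)
 show ?thesis by (rule presheaf_of_modulesI[OF mod ml])
qed

lemma structure_module_presheaf:
 assumes "ring_presheaf X \<O>"
 shows "presheaf_of_modules X \<O> (structure_module \<O>)"
proof (rule presheaf_of_modulesI)
 show "module (Sc \<O> U) (Sc (structure_module \<O>) U)" if "openin X U" for U
 proof -
  interpret cring "Sc \<O> U" by (rule ring_presheafD(1)[OF assms that])
  show ?thesis
   by (rule moduleI) (auto simp: structure_module_def is_cring l_distr r_distr m_assoc a_ac
     intro!: abelian_groupI bexI[of _ "\<ominus>\<^bsub>Sc \<O> U\<^esub> _"] l_neg)
 qed
 have "s \<oplus>\<^bsub>Sc \<O> U\<^esub> t \<in> sec \<O> U" "s \<otimes>\<^bsub>Sc \<O> U\<^esub> t \<in> sec \<O> U"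
  if "openin X U" "s \<in> sec \<O> U" "t \<in> sec \<O> U" for U s t
  using ring_presheafD(1)[OF assms that(1)] that by (simp_all add: cring.cring_simprules)
 then show "module_like X \<O> (structure_module \<O>)"
  using ring_presheafD[OF assms] unfolding module_like_def structure_module_def by (simp add: Pi_iff)
qed

section \<open>Germs and sheafification\<close>

definition gsec :: "'p topology => ('p, 'r, 'm) module_presheaf => 'p set => 'm => 'p => ('p, 'm) germ" where
 "gsec X P U t = (\<lambda>x\<in>U. germ X P x U t)"

lemma gsec_apply [simp]: "x \<in> U ==> gsec X P U t x = germ X P x U t"
 by (simp add: gsec_def)

lemma sheafify_simps:
 "sec (sheafify X \<O> P) U = {s \<in> extensional U. \<forall>x\<in>U. \<exists>V\<in>opens_in X U. x \<in> V \<and>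
           (\<exists>t\<in>sec P V. \<forall>y\<in>V. s y = germ X P y V t)}"
 "restr (sheafify X \<O> P) U V s = restrict s V"
 by (simp_all add: sheafify_def)

context
 fixes X :: "'p topology" and \<O> :: "('p, 'r) ring_presheaf" and P :: "('p, 'r, 'm) module_presheaf"
 assumes P: "presheaf_of_modules X \<O> P"
begin

lemma germ_self: "openin X U ==> x \<in> U ==> s \<in> sec P U ==> (U, s) \<in> germ X P x U s"
 by (auto simp: germ_def)

text \<open>A germ is the set of all its representatives, so any member gives back the same germ.
  This is what collapses the unions defining sums, multiples and the natural map to a single
  term.\<close>

lemma germ_mem_imp_eq:
 assumes U: "openin X U" "x \<in> U" "s \<in> sec P U" and V: "(V, t) \<in> germ X P x U s"
 shows "germ X P x V t = germ X P x U s" "openin X V" "x \<in> V" "t \<in> sec P V"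
proof -
 obtain W where W: "openin X V" "x \<in> V" "t \<in> sec P V" "openin X W" "W \<subseteq> U" "W \<subseteq> V" "x \<in> W"
  "restr P U W s = restr P V W t" using V by (auto simp: germ_def)
 then show "openin X V" "x \<in> V" "t \<in> sec P V" by auto
 have sub: "germ X P x U s \<subseteq> germ X P x V t"
  if *: "openin X U" "s \<in> sec P U" "openin X V" "t \<in> sec P V"
   "W \<subseteq> U" "W \<subseteq> V" "restr P U W s = restr P V W t" for U V s t
 proof (clarify)
  fix V' t' assume "(V', t') \<in> germ X P x U s"
  then obtain W' where W': "openin X V'" "x \<in> V'" "t' \<in> sec P V'" "openin X W'" "W' \<subseteq> U" "W' \<subseteq> V'" "x \<in> W'"
   "restr P U W' s = restr P V' W' t'" by (auto simp: germ_def)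
  have o: "openin X (W \<inter> W')" using W W' by blast
  have "restr P V (W \<inter> W') t = restr P W (W \<inter> W') (restr P V W t)"
   using presheafD(7)[OF P *(3) W(4) o _ *(6) *(4)] by simp
  also have "\<dots> = restr P U (W \<inter> W') s"
   using presheafD(7)[OF P *(1) W(4) o _ *(5) *(2)] *(7) by simp
  also have "\<dots> = restr P W' (W \<inter> W') (restr P U W' s)"
   using presheafD(7)[OF P *(1) W'(4) o _ W'(5) *(2)] by simp
  also have "\<dots> = restr P V' (W \<inter> W') t'"
   using presheafD(7)[OF P W'(1,4) o _ W'(6,3)] W'(8) by simp
  finally show "(V', t') \<in> germ X P x V t"
   using W W' o * unfolding germ_def by (auto intro!: bexI[of _ "W \<inter> W'"])
 qed
 show "germ X P x V t = germ X P x U s"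
  using sub[of U s V t] sub[of V t U s] U W by auto
qed

lemma germ_eq_iff:
 assumes "openin X U" "x \<in> U" "s \<in> sec P U" "openin X V" "x \<in> V" "t \<in> sec P V"
 shows "germ X P x U s = germ X P x V t \<longleftrightarrow>
  (\<exists>W. openin X W \<and> x \<in> W \<and> W \<subseteq> U \<and> W \<subseteq> V \<and> restr P U W s = restr P V W t)" (is "?l \<longleftrightarrow> ?r")
proof
 assume ?l
 then have "(V, t) \<in> germ X P x U s" using germ_self assms by blast
 then show ?r by (auto simp: germ_def)
next
 assume ?r
 then have "(V, t) \<in> germ X P x U s" using assms by (auto simp: germ_def)
 then show ?l using germ_mem_imp_eq(1)[OF assms(1-3)] by simp
qed

lemma germ_restr:
 assumes "openin X U" "s \<in> sec P U" "openin X V" "V \<subseteq> U" "x \<in> V"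
 shows "germ X P x V (restr P U V s) = germ X P x U s"
proof -
 have c: "restr P U V s \<in> sec P V" using presheafD(3)[OF P assms(1,3,4,2)] .
 have "restr P V V (restr P U V s) = restr P U V s" using presheafD(6)[OF P assms(3) c] .
 then show ?thesis using assms c by (subst germ_eq_iff) (auto intro!: exI[of _ V])
qed

lemma gsec_restrict:
 assumes "openin X U" "s \<in> sec P U" "openin X V" "V \<subseteq> U"
 shows "restrict (gsec X P U s) V = gsec X P V (restr P U V s)"
 using assms germ_restr[OF assms] by (auto simp: gsec_def fun_eq_iff)

lemma gsec_closed:
 "openin X U ==> t \<in> sec P U ==> gsec X P U t \<in> sec (sheafify X \<O> P) U"
 unfolding sheafify_simps by (auto simp: gsec_def intro!: exI[of _ U])

lemma sheafify_rep:
 assumes "s \<in> sec (sheafify X \<O> P) U" "x \<in> U"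
 obtains V t where "openin X V" "V \<subseteq> U" "x \<in> V" "t \<in> sec P V" "restrict s V = gsec X P V t"
proof -
 obtain V t where "openin X V" "V \<subseteq> U" "x \<in> V" "t \<in> sec P V" "\<forall>y\<in>V. s y = germ X P y V t"
  using assms unfolding sheafify_simps opens_in_def by blast
 then show thesis by (intro that[of V t]) (auto simp: gsec_def fun_eq_iff)
qed

lemma sheafify_restrict_closed:
 assumes U: "openin X U" "openin X V" "V \<subseteq> U" and s: "s \<in> sec (sheafify X \<O> P) U"
 shows "restrict s V \<in> sec (sheafify X \<O> P) V"
 unfolding sheafify_simps
proof (intro CollectI conjI ballI)
 fix x assume x: "x \<in> V"
 then have "x \<in> U" using U by auto
 with s obtain W t where W: "openin X W" "W \<subseteq> U" "x \<in> W" "t \<in> sec P W" "restrict s W = gsec X P W t"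
  by (rule sheafify_rep)
 have o: "openin X (W \<inter> V)" using W U by blast
 have "restrict s V y = germ X P y (W \<inter> V) (restr P W (W \<inter> V) t)" if "y \<in> W \<inter> V" for y
  using germ_restr[OF W(1,4) o _ that] fun_cong[OF W(5), of y] that by simp
 then show "\<exists>W\<in>opens_in X V. x \<in> W \<and> (\<exists>t\<in>sec P W. \<forall>y\<in>W. restrict s V y = germ X P y W t)"
  using o x W presheafD(3)[OF P W(1) o _ W(4)] by (intro bexI[of _ "W \<inter> V"]) auto
qed simp

text \<open>To be given locally by sections of the presheaf is a local condition.\<close>

lemma sheafify_glue:
 assumes s: "s \<in> extensional U"
  and loc: "!!x. x \<in> U ==> \<exists>V. openin X V \<and> V \<subseteq> U \<and> x \<in> V \<and> restrict s V \<in> sec (sheafify X \<O> P) V"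
 shows "s \<in> sec (sheafify X \<O> P) U"
 unfolding sheafify_simps
proof (intro CollectI conjI ballI s)
 fix x assume "x \<in> U"
 then obtain V where V: "openin X V" "V \<subseteq> U" "x \<in> V" "restrict s V \<in> sec (sheafify X \<O> P) V" using loc by blast
 obtain W t where W: "openin X W" "W \<subseteq> V" "x \<in> W" "t \<in> sec P W" "restrict (restrict s V) W = gsec X P W t"
  using sheafify_rep[OF V(4,3)] by metis
 have "s y = germ X P y W t" if "y \<in> W" for y using fun_cong[OF W(5), of y] that W(2) by auto
 then show "\<exists>V\<in>opens_in X U. x \<in> V \<and> (\<exists>t\<in>sec P V. \<forall>y\<in>V. s y = germ X P y V t)"
  using W V by (intro bexI[of _ W]) auto
qed

text \<open>Every term of the double union is the same germ, so representatives over one common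
  neighbourhood compute the sum.\<close>

lemma sheafify_add_at:
 assumes V: "openin X V" "x \<in> V" "a \<in> sec P V" "b \<in> sec P V"
  and s: "s x = germ X P x V a" "t x = germ X P x V b" and x: "x \<in> U"
 shows "(s \<oplus>\<^bsub>Sc (sheafify X \<O> P) U\<^esub> t) x = germ X P x V (a \<oplus>\<^bsub>Sc P V\<^esub> b)"
proof -
 have ab: "a \<oplus>\<^bsub>Sc P V\<^esub> b \<in> sec P V" using presheafD(1)[OF P V(1,3,4)] .
 have eq: "germ X P x (V' \<inter> W') (restr P V' (V' \<inter> W') a' \<oplus>\<^bsub>Sc P (V' \<inter> W')\<^esub> restr P W' (V' \<inter> W') b')
   = germ X P x V (a \<oplus>\<^bsub>Sc P V\<^esub> b)" (is "germ X P x _ ?c = _")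
  if m: "(V', a') \<in> s x" "(W', b') \<in> t x" for V' a' W' b'
 proof -
  note ga = germ_mem_imp_eq[OF V(1,2,3) m(1)[unfolded s]] and gb = germ_mem_imp_eq[OF V(1,2,4) m(2)[unfolded s]]
  obtain A where A: "openin X A" "x \<in> A" "A \<subseteq> V'" "A \<subseteq> V" "restr P V' A a' = restr P V A a"
   using ga germ_eq_iff[OF ga(2-4) V(1,2,3)] by blast
  obtain B where B: "openin X B" "x \<in> B" "B \<subseteq> W'" "B \<subseteq> V" "restr P W' B b' = restr P V B b"
   using gb germ_eq_iff[OF gb(2-4) V(1,2,4)] by blast
  have o: "openin X (V' \<inter> W')" "openin X (A \<inter> B)" using ga gb A B by blast+
  have sub: "V' \<inter> W' \<subseteq> V'" "V' \<inter> W' \<subseteq> W'" "A \<inter> B \<subseteq> V' \<inter> W'" "A \<inter> B \<subseteq> V" "A \<inter> B \<subseteq> A" "A \<inter> B \<subseteq> B" using A B by auto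
  have ac: "restr P V' (V' \<inter> W') a' \<in> sec P (V' \<inter> W')" using presheafD(3)[OF P ga(2) o(1) sub(1) ga(4)] .
  have bc: "restr P W' (V' \<inter> W') b' \<in> sec P (V' \<inter> W')" using presheafD(3)[OF P gb(2) o(1) sub(2) gb(4)] .
  have c: "?c \<in> sec P (V' \<inter> W')" using presheafD(1)[OF P o(1) ac bc] .
  have "restr P (V' \<inter> W') (A \<inter> B) ?c = restr P V' (A \<inter> B) a' \<oplus>\<^bsub>Sc P (A \<inter> B)\<^esub> restr P W' (A \<inter> B) b'"
   using presheafD(4)[OF P o(1,2) sub(3) ac bc] presheafD(7)[OF P ga(2) o sub(3,1) ga(4)]
    presheafD(7)[OF P gb(2) o sub(3,2) gb(4)] by simp
  also have "restr P V' (A \<inter> B) a' = restr P V (A \<inter> B) a"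
   using presheafD(7)[OF P ga(2) A(1) o(2) sub(5) A(3) ga(4)] presheafD(7)[OF P V(1) A(1) o(2) sub(5) A(4) V(3)] A(5) by simp
  also have "restr P W' (A \<inter> B) b' = restr P V (A \<inter> B) b"
   using presheafD(7)[OF P gb(2) B(1) o(2) sub(6) B(3) gb(4)] presheafD(7)[OF P V(1) B(1) o(2) sub(6) B(4) V(4)] B(5) by simp
  also have "restr P V (A \<inter> B) a \<oplus>\<^bsub>Sc P (A \<inter> B)\<^esub> restr P V (A \<inter> B) b = restr P V (A \<inter> B) (a \<oplus>\<^bsub>Sc P V\<^esub> b)"
   using presheafD(4)[OF P V(1) o(2) sub(4) V(3,4)] by simp
  finally show ?thesis
   using germ_eq_iff[OF o(1) _ c V(1,2) ab] ga(3) gb(3) A(2) B(2) o(2) sub(3,4) by blast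
 qed
 have ne: "(V, a) \<in> s x" "(V, b) \<in> t x" using germ_self V s by auto
 have "(s \<oplus>\<^bsub>Sc (sheafify X \<O> P) U\<^esub> t) x = (\<Union>(V, a)\<in>s x. \<Union>(W, b)\<in>t x.
         germ X P x (V \<inter> W)
          (restr P V (V \<inter> W) a \<oplus>\<^bsub>Sc P (V \<inter> W)\<^esub> restr P W (V \<inter> W) b))"
  using x by (simp add: sheafify_def)
 also have "\<dots> = (\<Union>(V', a')\<in>s x. \<Union>(W', b')\<in>t x. germ X P x V (a \<oplus>\<^bsub>Sc P V\<^esub> b))"
  by (intro SUP_cong refl) (auto simp: eq)
 also have "\<dots> = germ X P x V (a \<oplus>\<^bsub>Sc P V\<^esub> b)" using ne by auto
 finally show ?thesis .
qed

lemma sheafify_smult_at: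
 assumes O: "ring_presheaf X \<O>" and U: "openin X U" "r \<in> sec \<O> U"
  and V: "openin X V" "V \<subseteq> U" "x \<in> V" "a \<in> sec P V" and s: "s x = germ X P x V a"
 shows "(r \<odot>\<^bsub>Sc (sheafify X \<O> P) U\<^esub> s) x = germ X P x V (restr \<O> U V r \<odot>\<^bsub>Sc P V\<^esub> a)"
proof -
 note rO = ring_presheafD(2)[OF O U(1) _ _ U(2)]
 have x: "x \<in> U" using V by auto
 have ra: "restr \<O> U V r \<odot>\<^bsub>Sc P V\<^esub> a \<in> sec P V" using presheafD(2)[OF P V(1) rO[OF V(1,2)] V(4)] .
 have eq: "germ X P x (U \<inter> V') (restr \<O> U (U \<inter> V') r \<odot>\<^bsub>Sc P (U \<inter> V')\<^esub> restr P V' (U \<inter> V') a')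
   = germ X P x V (restr \<O> U V r \<odot>\<^bsub>Sc P V\<^esub> a)" (is "germ X P x _ ?c = _")
  if m: "(V', a') \<in> s x" for V' a'
 proof -
  note ga = germ_mem_imp_eq[OF V(1,3,4) m(1)[unfolded s]]
  obtain A where A: "openin X A" "x \<in> A" "A \<subseteq> V'" "A \<subseteq> V" "restr P V' A a' = restr P V A a"
   using ga germ_eq_iff[OF ga(2-4) V(1,3,4)] by blast
  have o: "openin X (U \<inter> V')" using ga U by blast
  have sub: "U \<inter> V' \<subseteq> U" "U \<inter> V' \<subseteq> V'" "A \<subseteq> U \<inter> V'" using A V by auto
  have ac: "restr P V' (U \<inter> V') a' \<in> sec P (U \<inter> V')" using presheafD(3)[OF P ga(2) o(1) sub(2) ga(4)] .
  note rc = rO[OF o sub(1)]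
  have c: "?c \<in> sec P (U \<inter> V')" using presheafD(2)[OF P o(1) rc ac] .
  have "restr P (U \<inter> V') A ?c = restr \<O> U A r \<odot>\<^bsub>Sc P A\<^esub> restr P V' A a'"
   using presheafD(5)[OF P o A(1) sub(3) rc ac] presheafD(7)[OF P ga(2) o A(1) sub(3,2) ga(4)]
    ring_presheafD(7)[OF O U(1) o A(1) sub(3,1) U(2)] by simp
  also have "\<dots> = restr P V A (restr \<O> U V r \<odot>\<^bsub>Sc P V\<^esub> a)"
   using presheafD(5)[OF P V(1) A(1,4) rO[OF V(1,2)] V(4)] ring_presheafD(7)[OF O U(1) V(1) A(1,4) V(2) U(2)] A(5) by simp
  finally show ?thesis
   using germ_eq_iff[OF o(1) _ c V(1,3) ra] ga(3) x A(1,2) sub(3) A(4) by blast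
 qed
 have ne: "(V, a) \<in> s x" using germ_self V s by auto
 have "(r \<odot>\<^bsub>Sc (sheafify X \<O> P) U\<^esub> s) x = (\<Union>(V, a)\<in>s x.
         germ X P x (U \<inter> V)
          (restr \<O> U (U \<inter> V) r \<odot>\<^bsub>Sc P (U \<inter> V)\<^esub> restr P V (U \<inter> V) a))"
  using x by (simp add: sheafify_def)
 also have "\<dots> = (\<Union>(V', a')\<in>s x. germ X P x V (restr \<O> U V r \<odot>\<^bsub>Sc P V\<^esub> a))"
  by (intro SUP_cong refl) (auto simp: eq)
 also have "\<dots> = germ X P x V (restr \<O> U V r \<odot>\<^bsub>Sc P V\<^esub> a)" using ne by auto
 finally show ?thesis .
qed

lemma sheafify_common_rep:
 assumes "s \<in> sec (sheafify X \<O> P) U" "t \<in> sec (sheafify X \<O> P) U" "x \<in> U"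
 obtains V a b where "openin X V" "V \<subseteq> U" "x \<in> V" "a \<in> sec P V" "b \<in> sec P V"
  "restrict s V = gsec X P V a" "restrict t V = gsec X P V b"
proof -
 obtain V a where V: "openin X V" "V \<subseteq> U" "x \<in> V" "a \<in> sec P V" "restrict s V = gsec X P V a"
  using sheafify_rep[OF assms(1,3)] by metis
 obtain W b where W: "openin X W" "W \<subseteq> U" "x \<in> W" "b \<in> sec P W" "restrict t W = gsec X P W b"
  using sheafify_rep[OF assms(2,3)] by metis
 have o: "openin X (V \<inter> W)" using V W by blast
 have "restrict s (V \<inter> W) = gsec X P (V \<inter> W) (restr P V (V \<inter> W) a)"
  using gsec_restrict[OF V(1,4) o] V(5) by (metis Int_lower1 restrict_restrict inf.absorb2)
 moreover have "restrict t (V \<inter> W) = gsec X P (V \<inter> W) (restr P W (V \<inter> W) b)"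
  using gsec_restrict[OF W(1,4) o] W(5) by (metis Int_lower2 restrict_restrict inf.absorb2)
 ultimately show thesis
  using that[OF o _ _ presheafD(3)[OF P V(1) o _ V(4)] presheafD(3)[OF P W(1) o _ W(4)]] V W by auto
qed

lemma restrict_eq_germ_section: "restrict s V = gsec X P V a ==> y \<in> V ==> s y = germ X P y V a"
 by (metis restrict_apply' gsec_apply)

lemma sheafify_module_like:
 assumes O: "ring_presheaf X \<O>"
 shows "module_like X \<O> (sheafify X \<O> P)"
proof -
 let ?S = "sheafify X \<O> P"
 have ext: "s \<oplus>\<^bsub>Sc ?S U\<^esub> t \<in> extensional U" "r \<odot>\<^bsub>Sc ?S U\<^esub> s \<in> extensional U" for U s t r
  by (simp_all add: sheafify_def)
 have sext: "s \<in> extensional U" if "s \<in> sec ?S U" for s U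
  using that by (simp add: sheafify_simps)
 have reps: "\<exists>V a b. openin X V \<and> V \<subseteq> U \<and> x \<in> V \<and> a \<in> sec P V \<and> b \<in> sec P V \<and>
   (\<forall>y\<in>V. s y = germ X P y V a \<and> t y = germ X P y V b)"
  if "s \<in> sec ?S U" "t \<in> sec ?S U" "x \<in> U" for U s t x
 proof -
  note st = that
  obtain V a b where V: "openin X V" "V \<subseteq> U" "x \<in> V" "a \<in> sec P V" "b \<in> sec P V"
   "restrict s V = gsec X P V a" "restrict t V = gsec X P V b"
   by (rule sheafify_common_rep[OF st])
  have "\<forall>y\<in>V. s y = germ X P y V a \<and> t y = germ X P y V b"
   using restrict_eq_germ_section[OF V(6)] restrict_eq_germ_section[OF V(7)] by simp
  with V(1-5) show ?thesis by (intro exI conjI)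
 qed
 show ?thesis
 proof (rule module_likeI)
  fix U s t assume U: "openin X U" and s: "s \<in> sec ?S U" and t: "t \<in> sec ?S U"
  show "s \<oplus>\<^bsub>Sc ?S U\<^esub> t \<in> sec ?S U"
   unfolding sheafify_simps
  proof (intro CollectI conjI ballI ext)
   fix x assume x: "x \<in> U"
   obtain V a b where V: "openin X V" "V \<subseteq> U" "x \<in> V" "a \<in> sec P V" "b \<in> sec P V"
    "!!y. y \<in> V ==> s y = germ X P y V a \<and> t y = germ X P y V b" using reps[OF s t x] by blast
   have "(s \<oplus>\<^bsub>Sc ?S U\<^esub> t) y = germ X P y V (a \<oplus>\<^bsub>Sc P V\<^esub> b)" if "y \<in> V" for y
    by (rule sheafify_add_at[OF V(1) that V(4,5)]) (use V(2,6) that in auto)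
   then show "\<exists>V\<in>opens_in X U. x \<in> V \<and> (\<exists>c\<in>sec P V. \<forall>y\<in>V. (s \<oplus>\<^bsub>Sc ?S U\<^esub> t) y = germ X P y V c)"
    using V presheafD(1)[OF P V(1,4,5)] by (intro bexI[of _ V]) auto
  qed
  fix V assume V: "openin X V" "V \<subseteq> U"
  show "restr ?S U V (s \<oplus>\<^bsub>Sc ?S U\<^esub> t) = restr ?S U V s \<oplus>\<^bsub>Sc ?S V\<^esub> restr ?S U V t"
   unfolding sheafify_simps(2)
  proof (rule extensionalityI[OF restrict_extensional ext(1)])
   fix x assume x: "x \<in> V"
   then have xU: "x \<in> U" using V by auto
   obtain W a b where W: "openin X W" "W \<subseteq> U" "x \<in> W" "a \<in> sec P W" "b \<in> sec P W"
    "!!y. y \<in> W ==> s y = germ X P y W a \<and> t y = germ X P y W b" using reps[OF s t xU] by blast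
   have "(s \<oplus>\<^bsub>Sc ?S U\<^esub> t) x = germ X P x W (a \<oplus>\<^bsub>Sc P W\<^esub> b)"
    by (rule sheafify_add_at[OF W(1,3,4,5)]) (use W xU in auto)
   moreover have "(restrict s V \<oplus>\<^bsub>Sc ?S V\<^esub> restrict t V) x = germ X P x W (a \<oplus>\<^bsub>Sc P W\<^esub> b)"
    by (rule sheafify_add_at[OF W(1,3,4,5)]) (use W x in auto)
   ultimately show "restrict (s \<oplus>\<^bsub>Sc ?S U\<^esub> t) V x = (restrict s V \<oplus>\<^bsub>Sc ?S V\<^esub> restrict t V) x" using x by simp
  qed
 next
  fix U r s assume U: "openin X U" and r: "r \<in> sec \<O> U" and s: "s \<in> sec ?S U"
  show "r \<odot>\<^bsub>Sc ?S U\<^esub> s \<in> sec ?S U"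
   unfolding sheafify_simps
  proof (intro CollectI conjI ballI ext)
   fix x assume x: "x \<in> U"
   obtain V a where V: "openin X V" "V \<subseteq> U" "x \<in> V" "a \<in> sec P V"
    "!!y. y \<in> V ==> s y = germ X P y V a" using reps[OF s s x] by blast
   have "(r \<odot>\<^bsub>Sc ?S U\<^esub> s) y = germ X P y V (restr \<O> U V r \<odot>\<^bsub>Sc P V\<^esub> a)" if "y \<in> V" for y
    by (rule sheafify_smult_at[OF O U r V(1,2) that V(4)]) (rule V(5)[OF that])
   then show "\<exists>V\<in>opens_in X U. x \<in> V \<and> (\<exists>c\<in>sec P V. \<forall>y\<in>V. (r \<odot>\<^bsub>Sc ?S U\<^esub> s) y = germ X P y V c)"
    using V presheafD(2)[OF P V(1) ring_presheafD(2)[OF O U V(1,2) r] V(4)] by (intro bexI[of _ V]) auto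
  qed
  fix V assume V: "openin X V" "V \<subseteq> U"
  have rV: "restr \<O> U V r \<in> sec \<O> V" using ring_presheafD(2)[OF O U V r] .
  show "restr ?S U V (r \<odot>\<^bsub>Sc ?S U\<^esub> s) = restr \<O> U V r \<odot>\<^bsub>Sc ?S V\<^esub> restr ?S U V s"
   unfolding sheafify_simps(2)
  proof (rule extensionalityI[OF restrict_extensional ext(2)])
   fix x assume x: "x \<in> V"
   then have xU: "x \<in> U" using V by auto
   obtain W a where W: "openin X W" "W \<subseteq> U" "x \<in> W" "a \<in> sec P W"
    "!!y. y \<in> W ==> s y = germ X P y W a" using reps[OF s s xU] by blast
   have o: "openin X (W \<inter> V)" "W \<inter> V \<subseteq> U" "x \<in> W \<inter> V" "W \<inter> V \<subseteq> V" using W V x by auto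
   have a: "restr P W (W \<inter> V) a \<in> sec P (W \<inter> V)" using presheafD(3)[OF P W(1) o(1) _ W(4)] by simp
   have sx: "s x = germ X P x (W \<inter> V) (restr P W (W \<inter> V) a)" using W germ_restr[OF W(1,4) o(1) _ o(3)] by simp
   have "(r \<odot>\<^bsub>Sc ?S U\<^esub> s) x = germ X P x (W \<inter> V) (restr \<O> U (W \<inter> V) r \<odot>\<^bsub>Sc P (W \<inter> V)\<^esub> restr P W (W \<inter> V) a)"
    by (rule sheafify_smult_at[OF O U r o(1-3) a]) (rule sx)
   moreover have "(restr \<O> U V r \<odot>\<^bsub>Sc ?S V\<^esub> restrict s V) x
     = germ X P x (W \<inter> V) (restr \<O> V (W \<inter> V) (restr \<O> U V r) \<odot>\<^bsub>Sc P (W \<inter> V)\<^esub> restr P W (W \<inter> V) a)"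
    by (rule sheafify_smult_at[OF O V(1) rV o(1,4,3) a]) (use sx x in simp)
   ultimately show "restrict (r \<odot>\<^bsub>Sc ?S U\<^esub> s) V x = (restr \<O> U V r \<odot>\<^bsub>Sc ?S V\<^esub> restrict s V) x"
    using x ring_presheafD(7)[OF O U V(1) o(1,4) V(2) r] by simp
  qed
 next
  fix U V s assume "openin X U" "openin X V" "V \<subseteq> U" "s \<in> sec ?S U"
  then show "restr ?S U V s \<in> sec ?S V" unfolding sheafify_simps(2) by (rule sheafify_restrict_closed)
 next
  fix U s assume "s \<in> sec ?S U"
  then show "restr ?S U U s = s" unfolding sheafify_simps(2) by (intro extensional_restrict sext)
 next
  fix U V W s assume "openin X V" "W \<subseteq> V"
  then show "restr ?S V W (restr ?S U V s) = restr ?S U W s" unfolding sheafify_simps(2) by (simp add: Int_absorb1)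
 qed
qed

lemma gsec_add:
 assumes "openin X U" "s \<in> sec P U" "t \<in> sec P U"
 shows "gsec X P U s \<oplus>\<^bsub>Sc (sheafify X \<O> P) U\<^esub> gsec X P U t = gsec X P U (s \<oplus>\<^bsub>Sc P U\<^esub> t)"
proof (rule extensionalityI[of _ U])
 show "gsec X P U s \<oplus>\<^bsub>Sc (sheafify X \<O> P) U\<^esub> gsec X P U t \<in> extensional U" by (simp add: sheafify_def)
 show "gsec X P U (s \<oplus>\<^bsub>Sc P U\<^esub> t) \<in> extensional U" by (simp add: gsec_def)
 fix x assume x: "x \<in> U"
 show "(gsec X P U s \<oplus>\<^bsub>Sc (sheafify X \<O> P) U\<^esub> gsec X P U t) x = gsec X P U (s \<oplus>\<^bsub>Sc P U\<^esub> t) x"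
  using sheafify_add_at[where s = "gsec X P U s" and t = "gsec X P U t",
    OF assms(1) x assms(2,3) gsec_apply[OF x] gsec_apply[OF x] x]
  unfolding gsec_apply[OF x] .
qed

lemma gsec_smult:
 assumes "ring_presheaf X \<O>" "openin X U" "r \<in> sec \<O> U" "s \<in> sec P U"
 shows "r \<odot>\<^bsub>Sc (sheafify X \<O> P) U\<^esub> gsec X P U s = gsec X P U (r \<odot>\<^bsub>Sc P U\<^esub> s)"
proof (rule extensionalityI[of _ U])
 show "r \<odot>\<^bsub>Sc (sheafify X \<O> P) U\<^esub> gsec X P U s \<in> extensional U" by (simp add: sheafify_def)
 show "gsec X P U (r \<odot>\<^bsub>Sc P U\<^esub> s) \<in> extensional U" by (simp add: gsec_def)
 fix x assume x: "x \<in> U"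
 show "(r \<odot>\<^bsub>Sc (sheafify X \<O> P) U\<^esub> gsec X P U s) x = gsec X P U (r \<odot>\<^bsub>Sc P U\<^esub> s) x"
 proof -
  have "(r \<odot>\<^bsub>Sc (sheafify X \<O> P) U\<^esub> gsec X P U s) x
    = germ X P x U (restr \<O> U U r \<odot>\<^bsub>Sc P U\<^esub> s)"
   by (rule sheafify_smult_at[OF assms(1-3) assms(2) subset_refl x assms(4)]) (rule gsec_apply[OF x])
  also have "restr \<O> U U r = r"
   by (rule ring_presheafD(6)[OF assms(1-3)])
  also have "germ X P x U (r \<odot>\<^bsub>Sc P U\<^esub> s) = gsec X P U (r \<odot>\<^bsub>Sc P U\<^esub> s) x"
   by (rule gsec_apply[OF x, symmetric])
  finally show ?thesis .
 qed
qed

text \<open>If the presheaf already satisfies the sheaf condition below \<open>V0\<close>, sheafification changes nothing there.\<close>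

lemma gsec_bij:
 assumes sep: "!!W s t. openin X W ==> W \<subseteq> V0 ==> s \<in> sec P W ==> t \<in> sec P W ==>
    (!!x. x \<in> W ==> \<exists>W'. openin X W' \<and> W' \<subseteq> W \<and> x \<in> W' \<and> restr P W W' s = restr P W W' t) ==> s = t"
  and glue: "!!\<U> \<sigma>. (!!W. W \<in> \<U> ==> openin X W \<and> W \<subseteq> V0 \<and> \<sigma> W \<in> sec P W) ==>
    (!!W W'. W \<in> \<U> ==> W' \<in> \<U> ==> restr P W (W \<inter> W') (\<sigma> W) = restr P W' (W \<inter> W') (\<sigma> W')) ==>
    \<exists>t\<in>sec P (\<Union>\<U>). \<forall>W\<in>\<U>. restr P (\<Union>\<U>) W t = \<sigma> W"
  and U: "openin X U" "U \<subseteq> V0"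
 shows "bij_betw (gsec X P U) (sec P U) (sec (sheafify X \<O> P) U)"
proof (rule bij_betw_imageI)
 have inj: "s = t" if W: "openin X W" "W \<subseteq> V0" and st: "s \<in> sec P W" "t \<in> sec P W"
  and eq: "!!x. x \<in> W ==> germ X P x W s = germ X P x W t" for W s t
 proof (rule sep[OF W st])
  fix x assume x: "x \<in> W"
  show "\<exists>W'. openin X W' \<and> W' \<subseteq> W \<and> x \<in> W' \<and> restr P W W' s = restr P W W' t"
   using eq[OF x] unfolding germ_eq_iff[OF W(1) x st(1) W(1) x st(2)] by blast
 qed
 show "inj_on (gsec X P U) (sec P U)"
 proof (rule inj_onI)
  fix s t assume st: "s \<in> sec P U" "t \<in> sec P U" and eq: "gsec X P U s = gsec X P U t"
  show "s = t"
  proof (rule inj[OF U st])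
   fix x assume "x \<in> U"
   then show "germ X P x U s = germ X P x U t" using fun_cong[OF eq, of x] by simp
  qed
 qed
 show "gsec X P U ` sec P U = sec (sheafify X \<O> P) U"
 proof (rule equalityI)
  show "gsec X P U ` sec P U \<subseteq> sec (sheafify X \<O> P) U"
   using gsec_closed[OF U(1)] by auto
  show "sec (sheafify X \<O> P) U \<subseteq> gsec X P U ` sec P U"
  proof
   fix s assume s: "s \<in> sec (sheafify X \<O> P) U"
   define \<U> where "\<U> = {W. openin X W \<and> W \<subseteq> U \<and> (\<exists>t\<in>sec P W. restrict s W = gsec X P W t)}"
   \<comment> \<open>A section inducing \<open>s\<close> on \<open>W\<close>. By separation it is
     the only one, so the choices agree on overlaps.\<close>
   define \<sigma> where "\<sigma> W = (SOME t. t \<in> sec P W \<and> restrict s W = gsec X P W t)" for W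
   have \<sigma>: "\<sigma> W \<in> sec P W" "restrict s W = gsec X P W (\<sigma> W)" "openin X W" "W \<subseteq> U" if "W \<in> \<U>" for W
   proof -
    have "\<exists>t. t \<in> sec P W \<and> restrict s W = gsec X P W t" using that by (auto simp: \<U>_def)
    from someI_ex[OF this] show "\<sigma> W \<in> sec P W" "restrict s W = gsec X P W (\<sigma> W)" by (simp_all add: \<sigma>_def)
    show "openin X W" "W \<subseteq> U" using that by (auto simp: \<U>_def)
   qed
   have cov: "\<Union>\<U> = U"
   proof
    show "U \<subseteq> \<Union>\<U>"
    proof
     fix x assume "x \<in> U"
     with s obtain V t where "openin X V" "V \<subseteq> U" "x \<in> V" "t \<in> sec P V" "restrict s V = gsec X P V t"
      by (rule sheafify_rep)
     then show "x \<in> \<Union>\<U>" by (auto simp: \<U>_def)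
    qed
   qed (auto simp: \<U>_def)
   have "\<exists>t\<in>sec P (\<Union>\<U>). \<forall>W\<in>\<U>. restr P (\<Union>\<U>) W t = \<sigma> W"
   proof (rule glue)
    show "openin X W \<and> W \<subseteq> V0 \<and> \<sigma> W \<in> sec P W" if "W \<in> \<U>" for W using \<sigma>[OF that] U by blast
    fix W W' assume W: "W \<in> \<U>" "W' \<in> \<U>"
    note a = \<sigma>[OF W(1)] and b = \<sigma>[OF W(2)]
    have o: "openin X (W \<inter> W')" "W \<inter> W' \<subseteq> V0" using a b U by blast+
    show "restr P W (W \<inter> W') (\<sigma> W) = restr P W' (W \<inter> W') (\<sigma> W')"
    proof (rule inj[OF o presheafD(3)[OF P a(3) o(1) _ a(1)] presheafD(3)[OF P b(3) o(1) _ b(1)]])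
     fix x assume x: "x \<in> W \<inter> W'"
     then show "germ X P x (W \<inter> W') (restr P W (W \<inter> W') (\<sigma> W)) = germ X P x (W \<inter> W') (restr P W' (W \<inter> W') (\<sigma> W'))"
      using germ_restr[OF a(3,1) o(1) _ x] germ_restr[OF b(3,1) o(1) _ x]
       restrict_eq_germ_section[OF a(2), of x] restrict_eq_germ_section[OF b(2), of x] by simp
    qed auto
   qed
   then obtain t where t: "t \<in> sec P U" "!!W. W \<in> \<U> ==> restr P U W t = \<sigma> W" unfolding cov by blast
   have "s = gsec X P U t"
   proof (rule extensionalityI[of _ U])
    show "s \<in> extensional U" using s by (simp add: sheafify_simps)
    show "gsec X P U t \<in> extensional U" by (simp add: gsec_def)
    fix x assume x: "x \<in> U"
    then obtain W where W: "W \<in> \<U>" "x \<in> W" using cov by blast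
    have "s x = germ X P x W (\<sigma> W)" using restrict_eq_germ_section[OF \<sigma>(2)[OF W(1)] W(2)] .
    also have "\<dots> = germ X P x U t" using germ_restr[OF U(1) t(1) \<sigma>(3,4)[OF W(1)] W(2)] t(2)[OF W(1)] by simp
    finally show "s x = gsec X P U t x" using x by simp
   qed
   then show "s \<in> gsec X P U ` sec P U" using t(1) by blast
  qed
 qed
qed

end

section \<open>Locally projective tensor factors\<close>

text \<open>The dual basis of a finitely generated projective module, spread over the open subsets
  of \<open>V0\<close>. The \<open>e i\<close> may be dependent: for forms the index set consists of
  all multi-indices, not just the increasing ones.\<close>

definition dual_basis :: "'p topology => ('p, 'r) ring_presheaf => ('p, 'r, 'a) module_presheaf => 'p set =>
  'i set => ('i => 'a) => ('i => 'p set => 'a => 'r) => bool" where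
 "dual_basis X \<O> A V0 I e l \<longleftrightarrow> finite I \<and> openin X V0 \<and> (\<forall>i\<in>I. e i \<in> sec A V0) \<and>
   (\<forall>i\<in>I. l i \<in> sheaf_hom X \<O> A (structure_module \<O>) V0) \<and>
   (\<forall>W a. openin X W \<and> W \<subseteq> V0 \<and> a \<in> sec A W -->
    a = (\<Oplus>\<^bsub>Sc A W\<^esub>i\<in>I. l i W a \<odot>\<^bsub>Sc A W\<^esub> restr A V0 W (e i)))"

lemma additive_finsum:
 assumes "abelian_group M" "abelian_group N" and h: "!!x. x \<in> carrier M ==> h x \<in> carrier N"
  "!!x y. x \<in> carrier M ==> y \<in> carrier M ==> h (x \<oplus>\<^bsub>M\<^esub> y) = h x \<oplus>\<^bsub>N\<^esub> h y"
  and I: "finite I" "!!i. i \<in> I ==> f i \<in> carrier M"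
 shows "h (\<Oplus>\<^bsub>M\<^esub>i\<in>I. f i) = (\<Oplus>\<^bsub>N\<^esub>i\<in>I. h (f i))"
proof -
 interpret M: abelian_group M by fact
 interpret N: abelian_group N by fact
 have 0: "h \<zero>\<^bsub>M\<^esub> = \<zero>\<^bsub>N\<^esub>" by (rule additive_zero[OF assms(1,2)]) (use h in auto)
 show ?thesis using I
 proof (induction I rule: finite_induct)
  case empty then show ?case by (simp add: 0)
 next
  case (insert i I)
  have "f \<in> I \<rightarrow> carrier M" "f i \<in> carrier M" "(%i. h (f i)) \<in> I \<rightarrow> carrier N" "h (f i) \<in> carrier N"
   using insert.prems h(1) by auto
  then show ?case using insert by (simp add: h(2) M.finsum_closed)
 qed
qed

definition tensor_lift :: "'r ring => ('r, 'a) module => ('r, 'b) module => ('r, 'c) module => ('a => 'b => 'c) => ('a, 'b) tensor => 'c" where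
 "tensor_lift R M N P \<beta> = (SOME c. c \<in> carrier (tensor_module R M N) \<rightarrow> carrier P \<and>
   (\<forall>s\<in>carrier (tensor_module R M N). \<forall>t\<in>carrier (tensor_module R M N). c (s \<oplus>\<^bsub>tensor_module R M N\<^esub> t) = c s \<oplus>\<^bsub>P\<^esub> c t) \<and>
   (\<forall>a\<in>carrier M. \<forall>b\<in>carrier N. c (pure R M N a b) = \<beta> a b))"

text \<open>The contraction of the first factor with \<open>l\<close>. For the functionals of a dual
  basis these are coordinates on the tensor product, with values in \<open>B\<close>.\<close>

definition coord :: "('p, 'r) ring_presheaf => ('p, 'r, 'a) module_presheaf => ('p, 'r, 'b) module_presheaf =>
  ('p set => 'a => 'r) => 'p set => ('a, 'b) tensor => 'b" where
 "coord \<O> A B l W = tensor_lift (Sc \<O> W) (Sc A W) (Sc B W) (Sc B W) (%a b. l W a \<odot>\<^bsub>Sc B W\<^esub> b)"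

context
 fixes X :: "'p topology" and \<O> :: "('p, 'r) ring_presheaf" and A :: "('p, 'r, 'a) module_presheaf" and B :: "('p, 'r, 'b) module_presheaf"
 assumes O: "ring_presheaf X \<O>" and A: "presheaf_of_modules X \<O> A" and B: "presheaf_of_modules X \<O> B"
begin

abbreviation "PAB \<equiv> tensor_presheaf \<O> A B"

lemma tensor_locale: "openin X U ==> tensor (Sc \<O> U) (Sc A U) (Sc B U)"
 using presheaf_module[OF A] presheaf_module[OF B] by (simp add: tensor_def)

lemma structure_homD:
 assumes "l \<in> sheaf_hom X \<O> A (structure_module \<O>) V0" "openin X V" "V \<subseteq> V0"
 shows "s \<in> sec A V ==> l V s \<in> sec \<O> V"
  "s \<in> sec A V ==> t \<in> sec A V ==> l V (s \<oplus>\<^bsub>Sc A V\<^esub> t) = l V s \<oplus>\<^bsub>Sc \<O> V\<^esub> l V t"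
  "r \<in> sec \<O> V ==> s \<in> sec A V ==> l V (r \<odot>\<^bsub>Sc A V\<^esub> s) = r \<otimes>\<^bsub>Sc \<O> V\<^esub> l V s"
  "openin X W ==> W \<subseteq> V ==> s \<in> sec A V ==> l W (restr A V W s) = restr \<O> V W (l V s)"
 using sheaf_homD[OF assms] by (simp_all add: structure_module_def)

context
 fixes V0 l assumes l: "l \<in> sheaf_hom X \<O> A (structure_module \<O>) V0"
begin

lemma coord:
 assumes W: "openin X W" "W \<subseteq> V0"
 shows "t \<in> sec PAB W ==> coord \<O> A B l W t \<in> sec B W"
  "s \<in> sec PAB W ==> t \<in> sec PAB W ==>
    coord \<O> A B l W (s \<oplus>\<^bsub>Sc PAB W\<^esub> t) = coord \<O> A B l W s \<oplus>\<^bsub>Sc B W\<^esub> coord \<O> A B l W t"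
  "a \<in> sec A W ==> b \<in> sec B W ==>
    coord \<O> A B l W (pure (Sc \<O> W) (Sc A W) (Sc B W) a b) = l W a \<odot>\<^bsub>Sc B W\<^esub> b"
proof -
 interpret w: tensor "Sc \<O> W" "Sc A W" "Sc B W" by (rule tensor_locale) fact
 note d = structure_homD[OF l W]
 have "\<exists>c. c \<in> carrier w.T \<rightarrow> sec B W \<and>
   (\<forall>s\<in>carrier w.T. \<forall>t\<in>carrier w.T. c (s \<oplus>\<^bsub>w.T\<^esub> t) = c s \<oplus>\<^bsub>Sc B W\<^esub> c t) \<and>
   (\<forall>a\<in>sec A W. \<forall>b\<in>sec B W.
    c (pure (Sc \<O> W) (Sc A W) (Sc B W) a b) = l W a \<odot>\<^bsub>Sc B W\<^esub> b)"
  by (rule w.lift_exists)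
    (simp_all add: d w.N.abelian_group_axioms w.N.smult_l_distr w.N.smult_r_distr w.N.smult_assoc1[symmetric] w.M.R.m_comm)
 from someI_ex[OF this]
 have "coord \<O> A B l W \<in> carrier w.T \<rightarrow> sec B W \<and>
   (\<forall>s\<in>carrier w.T. \<forall>t\<in>carrier w.T. coord \<O> A B l W (s \<oplus>\<^bsub>w.T\<^esub> t) = coord \<O> A B l W s \<oplus>\<^bsub>Sc B W\<^esub> coord \<O> A B l W t) \<and>
   (\<forall>a\<in>sec A W. \<forall>b\<in>sec B W.
    coord \<O> A B l W (pure (Sc \<O> W) (Sc A W) (Sc B W) a b) = l W a \<odot>\<^bsub>Sc B W\<^esub> b)"
  unfolding coord_def tensor_lift_def .
 then show "t \<in> sec PAB W ==> coord \<O> A B l W t \<in> sec B W"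
  "s \<in> sec PAB W ==> t \<in> sec PAB W ==>
    coord \<O> A B l W (s \<oplus>\<^bsub>Sc PAB W\<^esub> t) = coord \<O> A B l W s \<oplus>\<^bsub>Sc B W\<^esub> coord \<O> A B l W t"
  "a \<in> sec A W ==> b \<in> sec B W ==>
    coord \<O> A B l W (pure (Sc \<O> W) (Sc A W) (Sc B W) a b) = l W a \<odot>\<^bsub>Sc B W\<^esub> b"
  unfolding tensor_presheaf_simps by (simp_all add: Pi_iff)
qed

lemma coord_smult:
 assumes W: "openin X W" "W \<subseteq> V0" and r: "r \<in> sec \<O> W" and t: "t \<in> sec PAB W"
 shows "coord \<O> A B l W (r \<odot>\<^bsub>Sc PAB W\<^esub> t) = r \<odot>\<^bsub>Sc B W\<^esub> coord \<O> A B l W t"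
proof -
 interpret w: tensor "Sc \<O> W" "Sc A W" "Sc B W" by (rule tensor_locale) fact
 note c = coord[OF W, unfolded tensor_presheaf_simps] and d = structure_homD[OF l W]
 show ?thesis unfolding tensor_presheaf_simps
 proof (rule additive_eqI[OF tensor_locale[OF W(1)] w.N.abelian_group_axioms, where f = "%t. coord \<O> A B l W (r \<odot>\<^bsub>w.T\<^esub> t)"])
  show "t \<in> carrier w.T" using t by (simp add: tensor_presheaf_simps)
 qed (simp_all add: c d r funcset_mem[OF w.smult_additive(1)] w.smult_additive(2) w.smult_pure w.N.smult_r_distr w.N.smult_assoc1 Pi_iff)
qed

lemma coord_restr:
 assumes W: "openin X W" "W \<subseteq> V0" and W': "openin X W'" "W' \<subseteq> W" and t: "t \<in> sec PAB W"
 shows "coord \<O> A B l W' (restr PAB W W' t) = restr B W W' (coord \<O> A B l W t)"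
proof -
 interpret w: tensor "Sc \<O> W" "Sc A W" "Sc B W" by (rule tensor_locale) fact
 interpret w': tensor "Sc \<O> W'" "Sc A W'" "Sc B W'" by (rule tensor_locale) fact
 have W'V: "W' \<subseteq> V0" using W W' by blast
 note P = presheafD[OF tensor_presheaf_of_modules[OF O A B]]
 note c = coord[OF W] and c' = coord[OF W'(1) W'V] and d = structure_homD[OF l W]
 note TW = tensor_presheaf_simps(1)[of \<O> A B W, symmetric]
 have pr: "restr PAB W W' (pure (Sc \<O> W) (Sc A W) (Sc B W) a b)
   = pure (Sc \<O> W') (Sc A W') (Sc B W') (restr A W W' a) (restr B W W' b)"
  if "a \<in> sec A W" "b \<in> sec B W" for a b
  unfolding tensor_presheaf_simps
  by (rule tmap_pure[OF tensor_locale[OF W(1)] tensor_locale[OF W'(1)] semilinear_restr[OF O A W(1) W'] semilinear_restr[OF O B W(1) W'] that])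
 show ?thesis
 proof (rule additive_eqI[OF tensor_locale[OF W(1)] w'.N.abelian_group_axioms, where f = "%t. coord \<O> A B l W' (restr PAB W W' t)"])
  show "t \<in> carrier w.T" using t by (simp add: tensor_presheaf_simps)
 qed (simp_all add: TW c c' P(3,4)[OF W(1) W'] pr presheafD(3-5)[OF A W(1) W'] presheafD(3-5)[OF B W(1) W'] d structure_homD(4)[OF l W W'] Pi_iff)
qed

end

text \<open>The sum of the tensors \<open>e i \<otimes> b i\<close>. It recovers a tensor from its
  coordinates, whereas the coordinates of such a sum may differ from the \<open>b i\<close>.\<close>

definition comb :: "'i set => ('i => 'a) => 'p set => 'p set => ('i => 'b) => ('a, 'b) tensor" where
 "comb I e V0 W b = (\<Oplus>\<^bsub>Sc PAB W\<^esub>i\<in>I. pure (Sc \<O> W) (Sc A W) (Sc B W) (restr A V0 W (e i)) (b i))"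

context
 fixes V0 :: "'p set" and I :: "'i set" and e :: "'i => 'a" and l :: "'i => 'p set => 'a => 'r"
 assumes db: "dual_basis X \<O> A V0 I e l"
begin

lemma dual_basisD:
 shows "finite I" "openin X V0" "i \<in> I ==> e i \<in> sec A V0"
  "i \<in> I ==> l i \<in> sheaf_hom X \<O> A (structure_module \<O>) V0"
  "openin X W ==> W \<subseteq> V0 ==> a \<in> sec A W ==>
    (\<Oplus>\<^bsub>Sc A W\<^esub>i\<in>I. l i W a \<odot>\<^bsub>Sc A W\<^esub> restr A V0 W (e i)) = a"
 using db by (simp_all add: dual_basis_def)

lemma basis_restr: "openin X W ==> W \<subseteq> V0 ==> i \<in> I ==> restr A V0 W (e i) \<in> sec A W"
 using presheafD(3)[OF A dual_basisD(2)] dual_basisD(3) by blast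

lemma pure_basis_closed: 
 assumes "openin X W" "W \<subseteq> V0" "i \<in> I" "b \<in> sec B W"
 shows "pure (Sc \<O> W) (Sc A W) (Sc B W) (restr A V0 W (e i)) b \<in> sec PAB W"
 unfolding tensor_presheaf_simps
 by (rule tensor.pure_closed[OF tensor_locale[OF assms(1)] basis_restr[OF assms(1-3)] assms(4)])

lemma P_group: "openin X W ==> abelian_group (Sc PAB W)"
 unfolding tensor_presheaf_simps by (rule tensor.T_group[OF tensor_locale])

lemma comb_closed:
 assumes "openin X W" "W \<subseteq> V0" "!!i. i \<in> I ==> b i \<in> sec B W"
 shows "comb I e V0 W b \<in> sec PAB W"
proof -
 interpret abelian_group "Sc PAB W" by (rule P_group) fact
 show ?thesis unfolding comb_def by (rule finsum_closed) (use pure_basis_closed assms in auto)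
qed

lemma comb_restr:
 assumes W: "openin X W" "W \<subseteq> V0" "!!i. i \<in> I ==> b i \<in> sec B W" and W': "openin X W'" "W' \<subseteq> W"
 shows "restr PAB W W' (comb I e V0 W b) = comb I e V0 W' (%i. restr B W W' (b i))"
proof -
 note P = presheafD[OF tensor_presheaf_of_modules[OF O A B]]
 interpret w': abelian_group "Sc PAB W'" by (rule P_group) fact
 have W'V: "W' \<subseteq> V0" using W W' by blast
 have "restr PAB W W' (comb I e V0 W b) = (\<Oplus>\<^bsub>Sc PAB W'\<^esub>i\<in>I. restr PAB W W' (pure (Sc \<O> W) (Sc A W) (Sc B W) (restr A V0 W (e i)) (b i)))"
  unfolding comb_def
  by (rule additive_finsum[OF P_group[OF W(1)] P_group[OF W'(1)] P(3,4)[OF W(1) W'] dual_basisD(1)])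
    (use pure_basis_closed[OF W(1,2)] W(3) in auto)
 also have "\<dots> = comb I e V0 W' (%i. restr B W W' (b i))"
  unfolding comb_def
 proof (rule w'.finsum_cong')
  show "(%i. pure (Sc \<O> W') (Sc A W') (Sc B W') (restr A V0 W' (e i)) (restr B W W' (b i))) \<in> I \<rightarrow> sec PAB W'"
   using pure_basis_closed[OF W'(1) W'V] presheafD(3)[OF B W(1) W' W(3)] by auto
  fix i assume i: "i \<in> I"
  show "restr PAB W W' (pure (Sc \<O> W) (Sc A W) (Sc B W) (restr A V0 W (e i)) (b i))
   = pure (Sc \<O> W') (Sc A W') (Sc B W') (restr A V0 W' (e i)) (restr B W W' (b i))"
   unfolding tensor_presheaf_simps
   using tmap_pure[OF tensor_locale[OF W(1)] tensor_locale[OF W'(1)] semilinear_restr[OF O A W(1) W'] semilinear_restr[OF O B W(1) W'] basis_restr[OF W(1,2) i] W(3)[OF i]]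
    presheafD(7)[OF A dual_basisD(2) W(1) W'(1) W'(2) W(2) dual_basisD(3)[OF i]] by simp
 qed simp
 finally show ?thesis .
qed

text \<open>On a pure tensor the scalar \<open>l i a\<close> moves from the second factor to the
  first, where the dual basis sums the terms back to \<open>a\<close>. So the tensor presheaf below
  \<open>V0\<close> is a retract of finitely many copies of \<open>B\<close>.\<close>

lemma comb_coord:
 assumes W: "openin X W" "W \<subseteq> V0" and t: "t \<in> sec PAB W"
 shows "comb I e V0 W (%i. coord \<O> A B (l i) W t) = t"
proof -
 interpret w: tensor "Sc \<O> W" "Sc A W" "Sc B W" by (rule tensor_locale) fact
 interpret T: abelian_group w.T by (rule w.T_group)
 note c = coord[OF dual_basisD(4) W, unfolded tensor_presheaf_simps] and d = structure_homD[OF dual_basisD(4) W]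
 note er = basis_restr[OF W]
 let ?p = "pure (Sc \<O> W) (Sc A W) (Sc B W)"
 let ?e = "%i. restr A V0 W (e i)"
 have pc: "(%i. ?p (?e i) (coord \<O> A B (l i) W t)) \<in> I \<rightarrow> carrier w.T" if "t \<in> carrier w.T" for t
  using w.pure_closed er c(1) that by auto
 have add: "(\<Oplus>\<^bsub>w.T\<^esub>i\<in>I. ?p (?e i) (coord \<O> A B (l i) W (s \<oplus>\<^bsub>w.T\<^esub> t))) =
   (\<Oplus>\<^bsub>w.T\<^esub>i\<in>I. ?p (?e i) (coord \<O> A B (l i) W s)) \<oplus>\<^bsub>w.T\<^esub> (\<Oplus>\<^bsub>w.T\<^esub>i\<in>I. ?p (?e i) (coord \<O> A B (l i) W t))"
  if st: "s \<in> carrier w.T" "t \<in> carrier w.T" for s t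
 proof -
  have "(\<Oplus>\<^bsub>w.T\<^esub>i\<in>I. ?p (?e i) (coord \<O> A B (l i) W (s \<oplus>\<^bsub>w.T\<^esub> t))) =
   (\<Oplus>\<^bsub>w.T\<^esub>i\<in>I. ?p (?e i) (coord \<O> A B (l i) W s) \<oplus>\<^bsub>w.T\<^esub> ?p (?e i) (coord \<O> A B (l i) W t))"
   by (rule T.finsum_cong') (use pc st in \<open>auto simp: c er w.pure_add_right w.pure_closed\<close>)
  then show ?thesis using T.finsum_addf[OF pc[OF st(1)] pc[OF st(2)]] by simp
 qed
 have pure_eq: "(\<Oplus>\<^bsub>w.T\<^esub>i\<in>I. ?p (?e i) (coord \<O> A B (l i) W (?p a b))) = ?p a b"
  if ab: "a \<in> sec A W" "b \<in> sec B W" for a b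
 proof -
  have "(\<Oplus>\<^bsub>w.T\<^esub>i\<in>I. ?p (?e i) (coord \<O> A B (l i) W (?p a b))) = (\<Oplus>\<^bsub>w.T\<^esub>i\<in>I. ?p (l i W a \<odot>\<^bsub>Sc A W\<^esub> ?e i) b)"
   by (rule T.finsum_cong') (use ab in \<open>auto simp: c d er w.pure_smult w.pure_closed\<close>)
  also have "\<dots> = ?p (\<Oplus>\<^bsub>Sc A W\<^esub>i\<in>I. l i W a \<odot>\<^bsub>Sc A W\<^esub> ?e i) b"
   by (rule additive_finsum[where h = "%a. ?p a b", symmetric, OF w.M.abelian_group_axioms w.T_group _ _ dual_basisD(1)])
     (use ab d er in \<open>auto simp: w.pure_closed w.pure_add_left\<close>)
  finally show ?thesis using dual_basisD(5)[OF W ab(1)] by simp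
 qed
 have "(\<Oplus>\<^bsub>w.T\<^esub>i\<in>I. ?p (?e i) (coord \<O> A B (l i) W t)) = t"
  by (rule additive_eqI[OF tensor_locale[OF W(1)] w.T_group, where g = "%t. t" and f = "%t. (\<Oplus>\<^bsub>w.T\<^esub>i\<in>I. ?p (?e i) (coord \<O> A B (l i) W t))"])
    (use add pure_eq pc t in \<open>auto simp: tensor_presheaf_simps intro!: T.finsum_closed\<close>)
 then show ?thesis unfolding comb_def tensor_presheaf_simps .
qed

lemma coord_eqI:
 assumes W: "openin X W" "W \<subseteq> V0" and s: "s \<in> sec PAB W" and t: "t \<in> sec PAB W"
  and eq: "!!i. i \<in> I ==> coord \<O> A B (l i) W s = coord \<O> A B (l i) W t"
 shows "s = t"
proof -
 interpret w: abelian_group "Sc PAB W" by (rule P_group) fact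
 have "comb I e V0 W (%i. coord \<O> A B (l i) W s) = comb I e V0 W (%i. coord \<O> A B (l i) W t)"
  unfolding comb_def
  by (rule w.finsum_cong') (use pure_basis_closed[OF W] coord(1)[OF dual_basisD(4) W t] eq in auto)
 then show ?thesis using comb_coord[OF W s] comb_coord[OF W t] by simp
qed

end

end

text \<open>Uniqueness in the gluing axiom, for the cover by all open subsets on which
  \<open>s\<close> and \<open>t\<close> agree.\<close>

lemma sheaf_separated:
 assumes F: "sheaf_of_modules X \<O> F" and W: "openin X W" and s: "s \<in> sec F W" and t: "t \<in> sec F W"
  and loc: "!!x. x \<in> W ==> \<exists>W'. openin X W' \<and> W' \<subseteq> W \<and> x \<in> W' \<and> restr F W W' s = restr F W W' t"
 shows "s = t"
proof -
 have P: "presheaf_of_modules X \<O> F" using F by (simp add: sheaf_of_modules_def)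
 define \<U> where "\<U> = {W'. openin X W' \<and> W' \<subseteq> W \<and> restr F W W' s = restr F W W' t}"
 have cov: "\<Union>\<U> = W" using loc unfolding \<U>_def by blast
 have "\<exists>!u. u \<in> sec F (\<Union>\<U>) \<and> (\<forall>U\<in>\<U>. restr F (\<Union>\<U>) U u = restr F W U s)"
 proof (rule F[unfolded sheaf_of_modules_def, THEN conjunct2, THEN spec, THEN spec, THEN mp], intro conjI ballI)
  fix U assume U: "U \<in> \<U>"
  then have U': "openin X U" "U \<subseteq> W" by (auto simp: \<U>_def)
  then show "openin X U" "restr F W U s \<in> sec F U" using presheafD(3)[OF P W _ _ s] by auto
  fix V assume "V \<in> \<U>"
  then have V': "openin X V" "V \<subseteq> W" by (auto simp: \<U>_def)
  have o: "openin X (U \<inter> V)" using U' V' by blast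
  show "restr F U (U \<inter> V) (restr F W U s) = restr F V (U \<inter> V) (restr F W V s)"
   using presheafD(7)[OF P W U'(1) o _ U'(2) s] presheafD(7)[OF P W V'(1) o _ V'(2) s] by simp
 qed
 then have "\<exists>!u. u \<in> sec F W \<and> (\<forall>U\<in>\<U>. restr F W U u = restr F W U s)" unfolding cov .
 moreover have "\<forall>U\<in>\<U>. restr F W U t = restr F W U s" by (auto simp: \<U>_def)
 ultimately show ?thesis using s t by blast
qed

lemma sheaf_glue:
 assumes F: "sheaf_of_modules X \<O> F"
  and s: "!!U. U \<in> \<U> ==> openin X U \<and> s U \<in> sec F U"
  and eq: "!!U V. U \<in> \<U> ==> V \<in> \<U> ==> restr F U (U \<inter> V) (s U) = restr F V (U \<inter> V) (s V)"
 obtains t where "t \<in> sec F (\<Union>\<U>)" "!!U. U \<in> \<U> ==> restr F (\<Union>\<U>) U t = s U"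
proof -
 have "\<exists>!t. t \<in> sec F (\<Union>\<U>) \<and> (\<forall>U\<in>\<U>. restr F (\<Union>\<U>) U t = s U)"
  by (rule F[unfolded sheaf_of_modules_def, THEN conjunct2, THEN spec, THEN spec, THEN mp]) (use s eq in blast)
 then show thesis using that by (metis (no_types, lifting))
qed

text \<open>As a retract of finitely many copies of the sheaf \<open>F\<close>, the tensor presheaf
  satisfies the sheaf condition below \<open>V0\<close>: equality and gluing are tested on
  coordinates.\<close>

lemma tensor_germ_section_bij:
 assumes O: "ring_presheaf X \<O>" and A: "presheaf_of_modules X \<O> A" and F: "sheaf_of_modules X \<O> F"
  and db: "dual_basis X \<O> A V0 I e l" and U: "openin X U" "U \<subseteq> V0"
 shows "bij_betw (gsec X (tensor_presheaf \<O> A F) U) (sec (tensor_presheaf \<O> A F) U)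
      (sec (tensor_sheaf X \<O> A F) U)"
proof -
 have Fp: "presheaf_of_modules X \<O> F" using F by (simp add: sheaf_of_modules_def)
 let ?P = "tensor_presheaf \<O> A F"
 have P: "presheaf_of_modules X \<O> ?P" by (rule tensor_presheaf_of_modules[OF O A Fp])
 note DB = dual_basisD[OF O A Fp db] and c = coord[OF O A Fp dual_basisD(4)[OF O A Fp db]] and cr = coord_restr[OF O A Fp dual_basisD(4)[OF O A Fp db]]
 show ?thesis unfolding tensor_sheaf_def
 proof (rule gsec_bij[OF P _ _ U])
  fix W s t assume W: "openin X W" "W \<subseteq> V0" and s: "s \<in> sec ?P W" and t: "t \<in> sec ?P W"
   and loc: "!!x. x \<in> W ==> \<exists>W'. openin X W' \<and> W' \<subseteq> W \<and> x \<in> W' \<and> restr ?P W W' s = restr ?P W W' t"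
  show "s = t"
  proof (rule coord_eqI[OF O A Fp db W s t])
   fix i assume i: "i \<in> I"
   show "coord \<O> A F (l i) W s = coord \<O> A F (l i) W t"
   proof (rule sheaf_separated[OF F W(1) c(1)[OF i W s] c(1)[OF i W t]])
    fix x assume "x \<in> W"
    then obtain W' where W': "openin X W'" "W' \<subseteq> W" "x \<in> W'" "restr ?P W W' s = restr ?P W W' t" using loc by blast
    then show "\<exists>W'. openin X W' \<and> W' \<subseteq> W \<and> x \<in> W' \<and> restr F W W' (coord \<O> A F (l i) W s) = restr F W W' (coord \<O> A F (l i) W t)"
     using cr[OF i W W'(1,2) s] cr[OF i W W'(1,2) t] by (intro exI[of _ W']) simp
   qed
  qed
 next
  fix \<U> \<sigma> assume \<sigma>: "!!W. W \<in> \<U> ==> openin X W \<and> W \<subseteq> V0 \<and> \<sigma> W \<in> sec ?P W"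
   and eq: "!!W W'. W \<in> \<U> ==> W' \<in> \<U> ==> restr ?P W (W \<inter> W') (\<sigma> W) = restr ?P W' (W \<inter> W') (\<sigma> W')"
  have oU: "openin X (\<Union>\<U>)" "\<Union>\<U> \<subseteq> V0" using \<sigma> by blast+
  have ex: "\<exists>b. b \<in> sec F (\<Union>\<U>) \<and> (\<forall>W\<in>\<U>. restr F (\<Union>\<U>) W b = coord \<O> A F (l i) W (\<sigma> W))" if i: "i \<in> I" for i
  proof -
   obtain b where "b \<in> sec F (\<Union>\<U>)" "!!W. W \<in> \<U> ==> restr F (\<Union>\<U>) W b = coord \<O> A F (l i) W (\<sigma> W)"
   proof (rule sheaf_glue[OF F, of \<U> "%W. coord \<O> A F (l i) W (\<sigma> W)"])
    show "openin X W \<and> coord \<O> A F (l i) W (\<sigma> W) \<in> sec F W" if "W \<in> \<U>" for W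
     using \<sigma>[OF that] c(1)[OF i] by blast
    fix W W' assume W: "W \<in> \<U>" "W' \<in> \<U>"
    have o: "openin X (W \<inter> W')" using \<sigma>[OF W(1)] \<sigma>[OF W(2)] by blast
    show "restr F W (W \<inter> W') (coord \<O> A F (l i) W (\<sigma> W)) = restr F W' (W \<inter> W') (coord \<O> A F (l i) W' (\<sigma> W'))"
     using cr[OF i _ _ o, of W "\<sigma> W"] cr[OF i _ _ o, of W' "\<sigma> W'"] \<sigma>[OF W(1)] \<sigma>[OF W(2)] eq[OF W] by simp
   qed auto
   then show ?thesis by blast
  qed
  then obtain b where b: "!!i. i \<in> I ==> b i \<in> sec F (\<Union>\<U>) \<and> (\<forall>W\<in>\<U>. restr F (\<Union>\<U>) W (b i) = coord \<O> A F (l i) W (\<sigma> W))"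
   by metis
  show "\<exists>t\<in>sec ?P (\<Union>\<U>). \<forall>W\<in>\<U>. restr ?P (\<Union>\<U>) W t = \<sigma> W"
  \<comment> \<open>The coordinates have been glued in \<open>F\<close>. On each \<open>W\<close>
    the restricted coefficients are the coordinates of \<open>\<sigma> W\<close>, from which
    \<open>comb\<close> recovers it.\<close>
  proof (intro bexI[of _ "comb \<O> A F I e V0 (\<Union>\<U>) b"] ballI)
   show "comb \<O> A F I e V0 (\<Union>\<U>) b \<in> sec ?P (\<Union>\<U>)"
    by (rule comb_closed[OF O A Fp db oU]) (use b in blast)
   fix W assume W: "W \<in> \<U>"
   have Wo: "openin X W" "W \<subseteq> V0" "\<sigma> W \<in> sec ?P W" "W \<subseteq> \<Union>\<U>" using \<sigma>[OF W] W by auto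
   interpret w: abelian_group "Sc ?P W" by (rule P_group[OF O A Fp db]) fact
   have "restr ?P (\<Union>\<U>) W (comb \<O> A F I e V0 (\<Union>\<U>) b) = comb \<O> A F I e V0 W (%i. restr F (\<Union>\<U>) W (b i))"
    by (rule comb_restr[OF O A Fp db oU _ Wo(1,4)]) (use b in blast)
   also have "\<dots> = comb \<O> A F I e V0 W (%i. coord \<O> A F (l i) W (\<sigma> W))"
    unfolding comb_def[OF O A Fp]
    by (rule w.finsum_cong') (use pure_basis_closed[OF O A Fp db Wo(1,2)] c(1)[OF _ Wo(1-3)] b W in auto)
   also have "\<dots> = \<sigma> W" by (rule comb_coord[OF O A Fp db Wo(1-3)])
   finally show "restr ?P (\<Union>\<U>) W (comb \<O> A F I e V0 (\<Union>\<U>) b) = \<sigma> W" .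
  qed
 qed
qed

text \<open>If sections of \<open>G\<close> extend uniquely from \<open>V \<inter> Y\<close> to
  \<open>V\<close>, a morphism over \<open>U \<inter> Y\<close> extends to \<open>U\<close>: a
  section goes to the unique extension of the image of its restriction. Linearity and naturality
  follow from uniqueness.\<close>

lemma hom_restr_bij:
 assumes O: "ring_presheaf X \<O>" and F: "presheaf_of_modules X \<O> F" and G: "module_like X \<O> G" and Y: "openin X Y" and U: "openin X U"
  and ext: "!!V. openin X V ==> V \<subseteq> U ==> bij_betw (restr G V (V \<inter> Y)) (sec G V) (sec G (V \<inter> Y))"
 shows "bij_betw (%\<phi>. restrict \<phi> (opens_in X (U \<inter> Y))) (sheaf_hom X \<O> F G U) (sheaf_hom X \<O> F G (U \<inter> Y))"
proof (rule bij_betw_imageI)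
 note FD = presheafD[OF F] and GD = module_likeD[OF G]
 have oY: "openin X (V \<inter> Y)" if "openin X V" for V using that Y by blast
 have inj: "s = t" if "openin X V" "V \<subseteq> U" "s \<in> sec G V" "t \<in> sec G V"
  "restr G V (V \<inter> Y) s = restr G V (V \<inter> Y) t" for V s t
  using inj_onD[OF bij_betw_imp_inj_on[OF ext[OF that(1,2)]] that(5,3,4)] .
 show "inj_on (%\<phi>. restrict \<phi> (opens_in X (U \<inter> Y))) (sheaf_hom X \<O> F G U)"
 proof (rule inj_onI)
  fix \<phi> \<psi> assume p: "\<phi> \<in> sheaf_hom X \<O> F G U" and q: "\<psi> \<in> sheaf_hom X \<O> F G U"
   and eq: "restrict \<phi> (opens_in X (U \<inter> Y)) = restrict \<psi> (opens_in X (U \<inter> Y))"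
  show "\<phi> = \<psi>"
  proof (rule sheaf_hom_eqI[OF p q])
   fix V s assume V: "openin X V" "V \<subseteq> U" and s: "s \<in> sec F V"
   have "V \<inter> Y \<in> opens_in X (U \<inter> Y)" using oY[OF V(1)] V by auto
   then have e: "\<phi> (V \<inter> Y) = \<psi> (V \<inter> Y)" using fun_cong[OF eq, of "V \<inter> Y"] by simp
   show "\<phi> V s = \<psi> V s"
    by (rule inj[OF V sheaf_homD(1)[OF p V s] sheaf_homD(1)[OF q V s]])
      (simp add: sheaf_homD(4)[OF p V oY[OF V(1)] _ s, symmetric] sheaf_homD(4)[OF q V oY[OF V(1)] _ s, symmetric] e)
  qed
 qed
 show "(%\<phi>. restrict \<phi> (opens_in X (U \<inter> Y))) ` sheaf_hom X \<O> F G U = sheaf_hom X \<O> F G (U \<inter> Y)"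
 proof (rule equalityI)
  show "(%\<phi>. restrict \<phi> (opens_in X (U \<inter> Y))) ` sheaf_hom X \<O> F G U \<subseteq> sheaf_hom X \<O> F G (U \<inter> Y)"
   using sheaf_hom_restrict[of _ X \<O> F G U "U \<inter> Y"] by auto
  show "sheaf_hom X \<O> F G (U \<inter> Y) \<subseteq> (%\<phi>. restrict \<phi> (opens_in X (U \<inter> Y))) ` sheaf_hom X \<O> F G U"
  proof
   fix \<psi> assume q: "\<psi> \<in> sheaf_hom X \<O> F G (U \<inter> Y)"
   define \<phi> where "\<phi> = (\<lambda>V\<in>opens_in X U. \<lambda>s\<in>sec F V.
     the_inv_into (sec G V) (restr G V (V \<inter> Y)) (\<psi> (V \<inter> Y) (restr F V (V \<inter> Y) s)))"
   have VY: "openin X (V \<inter> Y)" "V \<inter> Y \<subseteq> U \<inter> Y" "V \<inter> Y \<subseteq> V" if "openin X V" "V \<subseteq> U" for V using oY that by auto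
   have rF: "restr F V (V \<inter> Y) s \<in> sec F (V \<inter> Y)" if "openin X V" "V \<subseteq> U" "s \<in> sec F V" for V s
    using FD(3)[OF that(1) VY(1,3)[OF that(1,2)] that(3)] .
   have \<phi>: "\<phi> V s \<in> sec G V" "restr G V (V \<inter> Y) (\<phi> V s) = \<psi> (V \<inter> Y) (restr F V (V \<inter> Y) s)"
    if V: "openin X V" "V \<subseteq> U" and s: "s \<in> sec F V" for V s
   proof -
    have m: "\<psi> (V \<inter> Y) (restr F V (V \<inter> Y) s) \<in> sec G (V \<inter> Y)"
     using sheaf_homD(1)[OF q VY(1,2)[OF V] rF[OF V s]] .
    have v: "\<phi> V s = the_inv_into (sec G V) (restr G V (V \<inter> Y)) (\<psi> (V \<inter> Y) (restr F V (V \<inter> Y) s))"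
     using V s by (simp add: \<phi>_def)
    show "\<phi> V s \<in> sec G V" unfolding v
     using bij_betwE[OF bij_betw_the_inv_into[OF ext[OF V]]] m by blast
    show "restr G V (V \<inter> Y) (\<phi> V s) = \<psi> (V \<inter> Y) (restr F V (V \<inter> Y) s)" unfolding v
     by (rule f_the_inv_into_f_bij_betw[OF ext[OF V]]) (use m in simp)
   qed
   have ph: "\<phi> \<in> sheaf_hom X \<O> F G U"
   proof (rule sheaf_homI)
    show "\<phi> \<in> extensional (opens_in X U)" by (simp add: \<phi>_def)
    fix V assume V: "openin X V" "V \<subseteq> U"
    note vy = VY[OF V] and qd = sheaf_homD[OF q VY(1,2)[OF V]]
    show "\<phi> V \<in> extensional (sec F V)" using V by (simp add: \<phi>_def)
    show "\<phi> V s \<in> sec G V" if "s \<in> sec F V" for s by (rule \<phi>(1)[OF V that])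
    show "\<phi> V (s \<oplus>\<^bsub>Sc F V\<^esub> t) = \<phi> V s \<oplus>\<^bsub>Sc G V\<^esub> \<phi> V t"
     if st: "s \<in> sec F V" "t \<in> sec F V" for s t
     by (rule inj[OF V \<phi>(1)[OF V FD(1)[OF V(1) st]] GD(1)[OF V(1) \<phi>(1)[OF V st(1)] \<phi>(1)[OF V st(2)]]])
       (simp add: \<phi>(2)[OF V] FD(1)[OF V(1)] st FD(4)[OF V(1) vy(1,3)] qd(2) rF[OF V] GD(4)[OF V(1) vy(1,3)] \<phi>(1)[OF V])
    show "\<phi> V (r \<odot>\<^bsub>Sc F V\<^esub> s) = r \<odot>\<^bsub>Sc G V\<^esub> \<phi> V s"
     if rs: "r \<in> sec \<O> V" "s \<in> sec F V" for r s
     by (rule inj[OF V \<phi>(1)[OF V FD(2)[OF V(1) rs]] GD(2)[OF V(1) rs(1) \<phi>(1)[OF V rs(2)]]])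
       (simp add: \<phi>(2)[OF V] FD(2)[OF V(1)] rs ring_presheafD(2)[OF O V(1) vy(1,3) rs(1)] FD(5)[OF V(1) vy(1,3)] qd(3) rF[OF V] GD(5)[OF V(1) vy(1,3)] \<phi>(1)[OF V])
    show "\<phi> W (restr F V W s) = restr G V W (\<phi> V s)"
     if W: "openin X W" "W \<subseteq> V" and s: "s \<in> sec F V" for W s
    proof -
     have WU: "W \<subseteq> U" "W \<inter> Y \<subseteq> V \<inter> Y" using W V by auto
     note wy = VY[OF W(1) WU(1)]
     have rs: "restr F V W s \<in> sec F W" using FD(3)[OF V(1) W s] .
     have "restr G W (W \<inter> Y) (restr G V W (\<phi> V s)) = restr G (V \<inter> Y) (W \<inter> Y) (restr G V (V \<inter> Y) (\<phi> V s))"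
      using GD(7)[OF V(1) W(1) wy(1,3) W(2) \<phi>(1)[OF V s]] GD(7)[OF V(1) vy(1) wy(1) WU(2) vy(3) \<phi>(1)[OF V s]] by simp
     also have "\<dots> = \<psi> (W \<inter> Y) (restr F (V \<inter> Y) (W \<inter> Y) (restr F V (V \<inter> Y) s))"
      using qd(4)[OF wy(1) WU(2) rF[OF V s]] \<phi>(2)[OF V s] by simp
     also have "\<dots> = \<psi> (W \<inter> Y) (restr F W (W \<inter> Y) (restr F V W s))"
      using FD(7)[OF V(1) W(1) wy(1,3) W(2) s] FD(7)[OF V(1) vy(1) wy(1) WU(2) vy(3) s] by simp
     also have "\<dots> = restr G W (W \<inter> Y) (\<phi> W (restr F V W s))" using \<phi>(2)[OF W(1) WU(1) rs] by simp
     finally show ?thesis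
      by (intro inj[OF W(1) WU(1) \<phi>(1)[OF W(1) WU(1) rs] GD(3)[OF V(1) W \<phi>(1)[OF V s]]]) simp
    qed
   qed
   have "\<psi> = restrict \<phi> (opens_in X (U \<inter> Y))"
   proof (rule sheaf_hom_eqI[OF q sheaf_hom_restrict[OF ph]])
    fix V s assume V: "openin X V" "V \<subseteq> U \<inter> Y" and s: "s \<in> sec F V"
    then have VU: "V \<subseteq> U" "V \<inter> Y = V" by auto
    show "\<psi> V s = restrict \<phi> (opens_in X (U \<inter> Y)) V s"
     using \<phi>(2)[OF V(1) VU(1) s] FD(6)[OF V(1) s] GD(6)[OF V(1) \<phi>(1)[OF V(1) VU(1) s]] V VU(2) by simp
   qed simp
   then show "\<psi> \<in> (%\<phi>. restrict \<phi> (opens_in X (U \<inter> Y))) ` sheaf_hom X \<O> F G U" using ph by blast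
  qed
 qed
qed

section \<open>The natural map from tensors with endomorphisms to morphisms\<close>

locale locally_projective =
 fixes X :: "'p topology" and \<O> :: "('p, 'r) ring_presheaf" and A :: "('p, 'r, 'a) module_presheaf"
  and F :: "('p, 'r, 'm) module_presheaf" and bI :: "'p => 'i set" and bV :: "'p => 'p set"
  and be :: "'p => 'i => 'a" and bl :: "'p => 'i => 'p set => 'a => 'r"
 assumes O: "ring_presheaf X \<O>" and A: "presheaf_of_modules X \<O> A" and F: "sheaf_of_modules X \<O> F"
  and db: "!!x. x \<in> topspace X ==> x \<in> bV x \<and> dual_basis X \<O> A (bV x) (bI x) (be x) (bl x)"
begin

lemma Fp: "presheaf_of_modules X \<O> F" using F by (simp add: sheaf_of_modules_def)

abbreviation "E \<equiv> end_sheaf X \<O> F"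
lemma Ep: "presheaf_of_modules X \<O> E" by (rule hom_presheaf_of_modules[OF O Fp Fp])

abbreviation "PF \<equiv> tensor_presheaf \<O> A F"
abbreviation "PE \<equiv> tensor_presheaf \<O> A E"
abbreviation "GF \<equiv> tensor_sheaf X \<O> A F"
abbreviation "GE \<equiv> tensor_sheaf X \<O> A E"

lemma PFp: "presheaf_of_modules X \<O> PF" by (rule tensor_presheaf_of_modules[OF O A Fp])
lemma PEp: "presheaf_of_modules X \<O> PE" by (rule tensor_presheaf_of_modules[OF O A Ep])
lemma GF_like: "module_like X \<O> GF" unfolding tensor_sheaf_def by (rule sheafify_module_like[OF PFp O])

text \<open>The natural map at the level of presheaves, for one fixed section of
  \<open>F\<close>.\<close>

definition ev :: "'p set => 'm => ('a, 'p set => 'm => 'm) tensor => ('a, 'm) tensor" where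
 "ev V \<sigma> = tmap (Sc \<O> V) (Sc A V) (Sc F V) (%\<alpha>. \<alpha>) (%f. f V \<sigma>)"

lemma tF: "openin X V ==> tensor (Sc \<O> V) (Sc A V) (Sc F V)" by (rule tensor_locale[OF O A Fp])
lemma tE: "openin X V ==> tensor (Sc \<O> V) (Sc A V) (Sc E V)" by (rule tensor_locale[OF O A Ep])

lemma E_val:
 assumes "openin X V" "V \<subseteq> U" "s \<in> sec F V"
 shows "(f \<oplus>\<^bsub>Sc E U\<^esub> g) V s = f V s \<oplus>\<^bsub>Sc F V\<^esub> g V s"
  "(r \<odot>\<^bsub>Sc E U\<^esub> f) V s = restr \<O> U V r \<odot>\<^bsub>Sc F V\<^esub> f V s"
  "restr E U V f V s = f V s"
 using assms by (simp_all add: hom_sheaf_simps)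

lemma semilinear_eval:
 assumes V: "openin X V" and s: "\<sigma> \<in> sec F V"
 shows "semilinear (Sc \<O> V) (Sc E V) (Sc \<O> V) (Sc F V) (%r. r) (%f. f V \<sigma>)"
 unfolding semilinear_def
proof (intro conjI ballI funcsetI)
 show "f V \<sigma> \<in> sec F V" if "f \<in> sec E V" for f
  using that unfolding hom_sheaf_simps(1) by (rule sheaf_homD(1)[OF _ V subset_refl s])
qed (simp_all only: E_val[OF V subset_refl s] ring_presheafD(6)[OF O V])

lemma ev_closed: "openin X V ==> \<sigma> \<in> sec F V ==> t \<in> sec PE V ==> ev V \<sigma> t \<in> sec PF V"
 unfolding ev_def tensor_presheaf_simps
 using tmap_additive(1)[OF tE tF semilinear_id semilinear_eval] by (simp add: Pi_iff)

lemma ev_add: "openin X V ==> \<sigma> \<in> sec F V ==> s \<in> sec PE V ==> t \<in> sec PE V ==>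
  ev V \<sigma> (s \<oplus>\<^bsub>Sc PE V\<^esub> t) = ev V \<sigma> s \<oplus>\<^bsub>Sc PF V\<^esub> ev V \<sigma> t"
 unfolding ev_def tensor_presheaf_simps
 by (rule tmap_additive(2)[OF tE tF semilinear_id semilinear_eval])

lemma ev_pure: "openin X V ==> \<sigma> \<in> sec F V ==> \<alpha> \<in> sec A V ==> f \<in> sec E V ==>
  ev V \<sigma> (pure (Sc \<O> V) (Sc A V) (Sc E V) \<alpha> f) = pure (Sc \<O> V) (Sc A V) (Sc F V) \<alpha> (f V \<sigma>)"
 unfolding ev_def by (rule tmap_pure[OF tE tF semilinear_id semilinear_eval])

lemma E_closed: "openin X V ==> V \<subseteq> U ==> \<sigma> \<in> sec F V ==> f \<in> sec E U ==> f V \<sigma> \<in> sec F V"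
 unfolding hom_sheaf_simps(1) by (rule sheaf_homD(1))

lemma PE_eqI:
 assumes V: "openin X V" and G: "abelian_group G"
  and f: "!!t. t \<in> sec PE V ==> f t \<in> carrier G"
   "!!s t. s \<in> sec PE V ==> t \<in> sec PE V ==> f (s \<oplus>\<^bsub>Sc PE V\<^esub> t) = f s \<oplus>\<^bsub>G\<^esub> f t"
  and g: "!!t. t \<in> sec PE V ==> g t \<in> carrier G"
   "!!s t. s \<in> sec PE V ==> t \<in> sec PE V ==> g (s \<oplus>\<^bsub>Sc PE V\<^esub> t) = g s \<oplus>\<^bsub>G\<^esub> g t"
  and pure: "!!a b. a \<in> sec A V ==> b \<in> sec E V ==>
    f (pure (Sc \<O> V) (Sc A V) (Sc E V) a b) = g (pure (Sc \<O> V) (Sc A V) (Sc E V) a b)"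
  and t: "t \<in> sec PE V"
 shows "f t = g t"
 by (rule additive_eqI[OF tE[OF V] G])
   (use f g pure t in \<open>simp_all add: tensor_presheaf_simps Pi_iff\<close>)

lemma PF_group: "openin X V ==> abelian_group (Sc PF V)"
 unfolding tensor_presheaf_simps by (rule tensor.T_group[OF tF])

lemma ev_restr:
 assumes V: "openin X V" and s: "\<sigma> \<in> sec F V" and W: "openin X W" "W \<subseteq> V" and t: "t \<in> sec PE V"
 shows "restr PF V W (ev V \<sigma> t) = ev W (restr F V W \<sigma>) (restr PE V W t)"
proof (rule PE_eqI[OF V PF_group[OF W(1)] _ _ _ _ _ t])
 note PFd = presheafD[OF PFp] and PEd = presheafD[OF PEp]
 have s': "restr F V W \<sigma> \<in> sec F W" using presheafD(3)[OF Fp V W s] .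
 fix t assume t: "t \<in> sec PE V"
 show "restr PF V W (ev V \<sigma> t) \<in> sec PF W" by (rule PFd(3)[OF V W ev_closed[OF V s t]])
 show "ev W (restr F V W \<sigma>) (restr PE V W t) \<in> sec PF W" by (rule ev_closed[OF W(1) s' PEd(3)[OF V W t]])
 fix u assume u: "u \<in> sec PE V"
 show "restr PF V W (ev V \<sigma> (u \<oplus>\<^bsub>Sc PE V\<^esub> t)) = restr PF V W (ev V \<sigma> u) \<oplus>\<^bsub>Sc PF W\<^esub> restr PF V W (ev V \<sigma> t)"
  unfolding ev_add[OF V s u t] by (rule PFd(4)[OF V W ev_closed[OF V s u] ev_closed[OF V s t]])
 show "ev W (restr F V W \<sigma>) (restr PE V W (u \<oplus>\<^bsub>Sc PE V\<^esub> t)) =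
   ev W (restr F V W \<sigma>) (restr PE V W u) \<oplus>\<^bsub>Sc PF W\<^esub> ev W (restr F V W \<sigma>) (restr PE V W t)"
  unfolding PEd(4)[OF V W u t] by (rule ev_add[OF W(1) s' PEd(3)[OF V W u] PEd(3)[OF V W t]])
next
 fix a f assume a: "a \<in> sec A V" and f: "f \<in> sec E V"
 have s': "restr F V W \<sigma> \<in> sec F W" using presheafD(3)[OF Fp V W s] .
 have a': "restr A V W a \<in> sec A W" using presheafD(3)[OF A V W a] .
 have f': "restr E V W f \<in> sec E W" using presheafD(3)[OF Ep V W f] .
 have fh: "f \<in> sheaf_hom X \<O> F F V" using f by (simp add: hom_sheaf_simps)
 have rE: "restr PE V W (pure (Sc \<O> V) (Sc A V) (Sc E V) a f) = pure (Sc \<O> W) (Sc A W) (Sc E W) (restr A V W a) (restr E V W f)"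
  unfolding tensor_presheaf_simps by (rule tmap_pure[OF tE[OF V] tE[OF W(1)] semilinear_restr[OF O A V W] semilinear_restr[OF O Ep V W] a f])
 have rF: "restr PF V W (pure (Sc \<O> V) (Sc A V) (Sc F V) a (f V \<sigma>)) = pure (Sc \<O> W) (Sc A W) (Sc F W) (restr A V W a) (restr F V W (f V \<sigma>))"
  unfolding tensor_presheaf_simps by (rule tmap_pure[OF tF[OF V] tF[OF W(1)] semilinear_restr[OF O A V W] semilinear_restr[OF O Fp V W] a E_closed[OF V subset_refl s f]])
 show "restr PF V W (ev V \<sigma> (pure (Sc \<O> V) (Sc A V) (Sc E V) a f)) =
   ev W (restr F V W \<sigma>) (restr PE V W (pure (Sc \<O> V) (Sc A V) (Sc E V) a f))"
  unfolding rE ev_pure[OF V s a f] ev_pure[OF W(1) s' a' f'] rF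
  using sheaf_homD(4)[OF fh V subset_refl W s] E_val(3)[OF W(1) W(2) s'] W by (simp add: hom_sheaf_simps)
qed

lemma ev_section_add:
 assumes V: "openin X V" and s: "\<sigma> \<in> sec F V" "\<tau> \<in> sec F V" and t: "t \<in> sec PE V"
 shows "ev V (\<sigma> \<oplus>\<^bsub>Sc F V\<^esub> \<tau>) t = ev V \<sigma> t \<oplus>\<^bsub>Sc PF V\<^esub> ev V \<tau> t"
proof -
 interpret G: abelian_group "Sc PF V" by (rule PF_group[OF V])
 have st: "\<sigma> \<oplus>\<^bsub>Sc F V\<^esub> \<tau> \<in> sec F V" using presheafD(1)[OF Fp V s] .
 note c = ev_closed[OF V s(1)] ev_closed[OF V s(2)] ev_closed[OF V st]
 show ?thesis
 proof (rule PE_eqI[OF V PF_group[OF V] _ _ _ _ _ t, where g = "%t. ev V \<sigma> t \<oplus>\<^bsub>Sc PF V\<^esub> ev V \<tau> t"])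
  fix a f assume a: "a \<in> sec A V" and f: "f \<in> sec E V"
  have fh: "f \<in> sheaf_hom X \<O> F F V" using f by (simp add: hom_sheaf_simps)
  show "ev V (\<sigma> \<oplus>\<^bsub>Sc F V\<^esub> \<tau>) (pure (Sc \<O> V) (Sc A V) (Sc E V) a f) =
    ev V \<sigma> (pure (Sc \<O> V) (Sc A V) (Sc E V) a f) \<oplus>\<^bsub>Sc PF V\<^esub> ev V \<tau> (pure (Sc \<O> V) (Sc A V) (Sc E V) a f)"
   unfolding ev_pure[OF V st a f] ev_pure[OF V s(1) a f] ev_pure[OF V s(2) a f] sheaf_homD(2)[OF fh V subset_refl s] tensor_presheaf_simps
   by (rule tensor.pure_add_right[OF tF[OF V] a E_closed[OF V subset_refl s(1) f] E_closed[OF V subset_refl s(2) f]])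
 qed (simp_all add: c ev_add[OF V s(1)] ev_add[OF V s(2)] ev_add[OF V st] G.a_ac)
qed

lemma ev_section_smult:
 assumes V: "openin X V" and r: "r \<in> sec \<O> V" and s: "\<sigma> \<in> sec F V" and t: "t \<in> sec PE V"
 shows "ev V (r \<odot>\<^bsub>Sc F V\<^esub> \<sigma>) t = r \<odot>\<^bsub>Sc PF V\<^esub> ev V \<sigma> t"
proof -
 interpret T: tensor "Sc \<O> V" "Sc A V" "Sc F V" by (rule tF[OF V])
 have st: "r \<odot>\<^bsub>Sc F V\<^esub> \<sigma> \<in> sec F V" using presheafD(2)[OF Fp V r s] .
 note c = ev_closed[OF V s] ev_closed[OF V st]
 have sm: "r \<odot>\<^bsub>Sc PF V\<^esub> x \<in> sec PF V" if "x \<in> sec PF V" for x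
  using presheafD(2)[OF PFp V r that] .
 have sa: "r \<odot>\<^bsub>Sc PF V\<^esub> (x \<oplus>\<^bsub>Sc PF V\<^esub> y) = r \<odot>\<^bsub>Sc PF V\<^esub> x \<oplus>\<^bsub>Sc PF V\<^esub> r \<odot>\<^bsub>Sc PF V\<^esub> y"
  if "x \<in> sec PF V" "y \<in> sec PF V" for x y
  using T.smult_additive(2)[OF r] that by (simp add: tensor_presheaf_simps)
 show ?thesis
 proof (rule PE_eqI[OF V PF_group[OF V] _ _ _ _ _ t, where g = "%t. r \<odot>\<^bsub>Sc PF V\<^esub> ev V \<sigma> t"])
  fix a f assume a: "a \<in> sec A V" and f: "f \<in> sec E V"
  have fh: "f \<in> sheaf_hom X \<O> F F V" using f by (simp add: hom_sheaf_simps)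
  show "ev V (r \<odot>\<^bsub>Sc F V\<^esub> \<sigma>) (pure (Sc \<O> V) (Sc A V) (Sc E V) a f) =
    r \<odot>\<^bsub>Sc PF V\<^esub> ev V \<sigma> (pure (Sc \<O> V) (Sc A V) (Sc E V) a f)"
   unfolding ev_pure[OF V st a f] ev_pure[OF V s a f] sheaf_homD(3)[OF fh V subset_refl r s] tensor_presheaf_simps
    T.smult_pure[OF r a E_closed[OF V subset_refl s f]]
   by (rule T.pure_smult[OF r a E_closed[OF V subset_refl s f], symmetric])
 qed (simp_all add: c ev_add[OF V s] ev_add[OF V st] sm sa)
qed

text \<open>Contraction in the first factor commutes with evaluation in the second. Hence the
  coordinates of a tensor, which are endomorphisms of \<open>F\<close>, can be read off from its
  evaluations; injectivity of the natural map rests on this.\<close>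

lemma ev_coord:
 assumes V: "openin X V" "V \<subseteq> V0" and l: "l \<in> sheaf_hom X \<O> A (structure_module \<O>) V0"
  and s: "\<sigma> \<in> sec F V" and t: "t \<in> sec PE V"
 shows "coord \<O> A F l V (ev V \<sigma> t) = coord \<O> A E l V t V \<sigma>"
proof -
 note cF = coord[OF O A Fp l V] and cE = coord[OF O A Ep l V] and d = structure_homD[OF O A Fp l V]
 have Fg: "abelian_group (Sc F V)" using module.axioms(2)[OF presheaf_module[OF Fp V(1)]] .
 show ?thesis
 proof (rule PE_eqI[OF V(1) Fg _ _ _ _ _ t, where f = "%t. coord \<O> A F l V (ev V \<sigma> t)" and g = "%t. coord \<O> A E l V t V \<sigma>"])
  fix a f assume a: "a \<in> sec A V" and f: "f \<in> sec E V"
  show "coord \<O> A F l V (ev V \<sigma> (pure (Sc \<O> V) (Sc A V) (Sc E V) a f)) =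
    coord \<O> A E l V (pure (Sc \<O> V) (Sc A V) (Sc E V) a f) V \<sigma>"
   unfolding ev_pure[OF V(1) s a f] cF(3)[OF a E_closed[OF V(1) subset_refl s f]] cE(3)[OF a f] E_val(2)[OF V(1) subset_refl s]
    ring_presheafD(6)[OF O V(1) d(1)[OF a]] ..
 qed (simp_all add: cF cE ev_closed[OF V(1) s] ev_add[OF V(1) s] E_val(1)[OF V(1) subset_refl s] E_closed[OF V(1) subset_refl s])
qed

lemma ev_comb:
 assumes d: "dual_basis X \<O> A V0 I e l" and V: "openin X V" "V \<subseteq> V0" and s: "\<sigma> \<in> sec F V"
  and f: "!!i. i \<in> I ==> f i \<in> sec E V"
 shows "ev V \<sigma> (comb \<O> A E I e V0 V f) = comb \<O> A F I e V0 V (%i. f i V \<sigma>)"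
proof -
 interpret G: abelian_group "Sc PF V" by (rule PF_group[OF V(1)])
 have "ev V \<sigma> (comb \<O> A E I e V0 V f) = (\<Oplus>\<^bsub>Sc PF V\<^esub>i\<in>I. ev V \<sigma> (pure (Sc \<O> V) (Sc A V) (Sc E V) (restr A V0 V (e i)) (f i)))"
  unfolding comb_def[OF O A Ep]
  by (rule additive_finsum[OF P_group[OF O A Ep d V(1)] PF_group[OF V(1)] ev_closed[OF V(1) s] ev_add[OF V(1) s] dual_basisD(1)[OF O A Ep d]])
    (use pure_basis_closed[OF O A Ep d V] f in auto)
 also have "\<dots> = comb \<O> A F I e V0 V (%i. f i V \<sigma>)"
  unfolding comb_def[OF O A Fp]
 proof (rule G.finsum_cong')
  show "(%i. pure (Sc \<O> V) (Sc A V) (Sc F V) (restr A V0 V (e i)) (f i V \<sigma>)) \<in> I \<rightarrow> sec PF V"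
   using pure_basis_closed[OF O A Fp d V _ E_closed[OF V(1) subset_refl s f]] by (simp add: Pi_iff)
 qed (simp_all add: ev_pure[OF V(1) s basis_restr[OF O A Fp d V] f])
 finally show ?thesis .
qed

text \<open>Evaluations over all smaller \<open>W\<close> are compared because each coordinate is a
  morphism of sheaves, determined only by its values over all of them.\<close>

lemma local_injective:
 assumes d: "dual_basis X \<O> A V0 I e l" and V: "openin X V" "V \<subseteq> V0"
  and t: "t \<in> sec PE V" "u \<in> sec PE V"
  and eq: "!!W \<sigma>. openin X W ==> W \<subseteq> V ==> \<sigma> \<in> sec F W ==>
    gsec X PF W (ev W \<sigma> (restr PE V W t)) = gsec X PF W (ev W \<sigma> (restr PE V W u))"
 shows "t = u"
proof (rule coord_eqI[OF O A Ep d V t])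
 fix i assume i: "i \<in> I"
 note l = dual_basisD(4)[OF O A Ep d i]
 have h: "coord \<O> A E (l i) V x \<in> sheaf_hom X \<O> F F V" if "x \<in> sec PE V" for x
  using coord(1)[OF O A Ep l V that] by (simp add: hom_sheaf_simps)
 have val: "coord \<O> A E (l i) V x W \<sigma> = coord \<O> A F (l i) W (ev W \<sigma> (restr PE V W x))"
  if W: "openin X W" "W \<subseteq> V" and s: "\<sigma> \<in> sec F W" and x: "x \<in> sec PE V" for W \<sigma> x
 proof -
  have WV: "W \<subseteq> V0" using W V by blast
  have "coord \<O> A F (l i) W (ev W \<sigma> (restr PE V W x)) = coord \<O> A E (l i) W (restr PE V W x) W \<sigma>"
   by (rule ev_coord[OF W(1) WV l s presheafD(3)[OF PEp V(1) W x]])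
  also have "\<dots> = coord \<O> A E (l i) V x W \<sigma>"
   unfolding coord_restr[OF O A Ep l V W x] using W by (simp add: hom_sheaf_simps)
  finally show ?thesis ..
 qed
 show "coord \<O> A E (l i) V t = coord \<O> A E (l i) V u"
 proof (rule sheaf_hom_eqI[OF h[OF t(1)] h[OF t(2)]])
  fix W \<sigma> assume W: "openin X W" "W \<subseteq> V" and s: "\<sigma> \<in> sec F W"
  have WV: "W \<subseteq> V0" using W V by blast
  have inj: "inj_on (gsec X PF W) (sec PF W)"
   by (rule bij_betw_imp_inj_on[OF tensor_germ_section_bij[OF O A F d W(1) WV]])
  have "ev W \<sigma> (restr PE V W t) = ev W \<sigma> (restr PE V W u)"
   by (rule inj_onD[where f = "gsec X PF W", OF inj eq[OF W s]]) (intro ev_closed W s presheafD(3)[OF PEp V(1)] t)+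
  then show "coord \<O> A E (l i) V t W \<sigma> = coord \<O> A E (l i) V u W \<sigma>"
   by (simp add: val[OF W s] t)
 qed
qed

lemma GF_restr: "restr GF U V s = restrict s V"
 by (simp add: tensor_sheaf_def sheafify_simps)

text \<open>The preimage of \<open>\<phi>\<close> is the sum of the
  \<open>e i \<otimes> f i\<close>, where \<open>f i\<close> is the endomorphism of \<open>F\<close>
  obtained by contracting the values of \<open>\<phi>\<close> with \<open>l i\<close>.\<close>

lemma local_surjective:
 assumes d: "dual_basis X \<O> A V0 I e l" and V: "openin X V" "V \<subseteq> V0" and p: "\<phi> \<in> sheaf_hom X \<O> F GF V"
 obtains t where "t \<in> sec PE V" "!!W \<sigma>. openin X W ==> W \<subseteq> V ==> \<sigma> \<in> sec F W ==>
    \<phi> W \<sigma> = gsec X PF W (ev W \<sigma> (restr PE V W t))"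
proof -
 \<comment> \<open>Below \<open>V0\<close> sheafification adds nothing, so the values of
   \<open>\<phi>\<close> lift uniquely to tensors, and uniqueness passes linearity and naturality on
   to the lift.\<close>
 define \<tau> where "\<tau> W \<sigma> = the_inv_into (sec PF W) (gsec X PF W) (\<phi> W \<sigma>)" for W \<sigma>
 have WV: "W \<subseteq> V0" if "W \<subseteq> V" for W using that V by blast
 note bij = tensor_germ_section_bij[OF O A F d _ WV]
 have \<tau>: "\<tau> W \<sigma> \<in> sec PF W" "gsec X PF W (\<tau> W \<sigma>) = \<phi> W \<sigma>"
  if W: "openin X W" "W \<subseteq> V" and s: "\<sigma> \<in> sec F W" for W \<sigma>
 proof -
  have m: "\<phi> W \<sigma> \<in> sec GF W" by (rule sheaf_homD(1)[OF p W s])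
  show "\<tau> W \<sigma> \<in> sec PF W" unfolding \<tau>_def
   using bij_betwE[OF bij_betw_the_inv_into[OF bij[OF W]]] m by blast
  show "gsec X PF W (\<tau> W \<sigma>) = \<phi> W \<sigma>" unfolding \<tau>_def
   by (rule f_the_inv_into_f_bij_betw[OF bij[OF W]]) (use m in simp)
 qed
 have inj: "x = y" if "openin X W" "W \<subseteq> V" "gsec X PF W x = gsec X PF W y" "x \<in> sec PF W" "y \<in> sec PF W" for W x y
  by (rule inj_onD[OF bij_betw_imp_inj_on[OF bij[OF that(1,2)]] that(3-5)])
 note PFd = presheafD[OF PFp]
 note gadd = gsec_add[OF PFp, folded tensor_sheaf_def] and gsm = gsec_smult[OF PFp O, folded tensor_sheaf_def]
 have \<tau>add: "\<tau> W (\<sigma> \<oplus>\<^bsub>Sc F W\<^esub> \<rho>) = \<tau> W \<sigma> \<oplus>\<^bsub>Sc PF W\<^esub> \<tau> W \<rho>"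
  if W: "openin X W" "W \<subseteq> V" and s: "\<sigma> \<in> sec F W" "\<rho> \<in> sec F W" for W \<sigma> \<rho>
 proof (rule inj[OF W])
  have sr: "\<sigma> \<oplus>\<^bsub>Sc F W\<^esub> \<rho> \<in> sec F W" using presheafD(1)[OF Fp W(1) s] .
  show "gsec X PF W (\<tau> W (\<sigma> \<oplus>\<^bsub>Sc F W\<^esub> \<rho>)) = gsec X PF W (\<tau> W \<sigma> \<oplus>\<^bsub>Sc PF W\<^esub> \<tau> W \<rho>)"
   unfolding \<tau>(2)[OF W sr] gadd[OF W(1) \<tau>(1)[OF W s(1)] \<tau>(1)[OF W s(2)], symmetric] \<tau>(2)[OF W s(1)] \<tau>(2)[OF W s(2)]
   by (rule sheaf_homD(2)[OF p W s])
  show "\<tau> W (\<sigma> \<oplus>\<^bsub>Sc F W\<^esub> \<rho>) \<in> sec PF W" by (rule \<tau>(1)[OF W sr])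
  show "\<tau> W \<sigma> \<oplus>\<^bsub>Sc PF W\<^esub> \<tau> W \<rho> \<in> sec PF W" by (rule PFd(1)[OF W(1) \<tau>(1)[OF W s(1)] \<tau>(1)[OF W s(2)]])
 qed
 have \<tau>sm: "\<tau> W (r \<odot>\<^bsub>Sc F W\<^esub> \<sigma>) = r \<odot>\<^bsub>Sc PF W\<^esub> \<tau> W \<sigma>"
  if W: "openin X W" "W \<subseteq> V" and r: "r \<in> sec \<O> W" and s: "\<sigma> \<in> sec F W" for W \<sigma> r
 proof (rule inj[OF W])
  have sr: "r \<odot>\<^bsub>Sc F W\<^esub> \<sigma> \<in> sec F W" using presheafD(2)[OF Fp W(1) r s] .
  show "gsec X PF W (\<tau> W (r \<odot>\<^bsub>Sc F W\<^esub> \<sigma>)) = gsec X PF W (r \<odot>\<^bsub>Sc PF W\<^esub> \<tau> W \<sigma>)"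
   unfolding \<tau>(2)[OF W sr] gsm[OF W(1) r \<tau>(1)[OF W s], symmetric] \<tau>(2)[OF W s]
   by (rule sheaf_homD(3)[OF p W r s])
  show "\<tau> W (r \<odot>\<^bsub>Sc F W\<^esub> \<sigma>) \<in> sec PF W" by (rule \<tau>(1)[OF W sr])
  show "r \<odot>\<^bsub>Sc PF W\<^esub> \<tau> W \<sigma> \<in> sec PF W" by (rule PFd(2)[OF W(1) r \<tau>(1)[OF W s]])
 qed
 have \<tau>re: "\<tau> W' (restr F W W' \<sigma>) = restr PF W W' (\<tau> W \<sigma>)"
  if W: "openin X W" "W \<subseteq> V" and s: "\<sigma> \<in> sec F W" and W': "openin X W'" "W' \<subseteq> W" for W W' \<sigma>
 proof (rule inj[OF W'(1)])
  show W'V: "W' \<subseteq> V" using W W' by blast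
  have sr: "restr F W W' \<sigma> \<in> sec F W'" using presheafD(3)[OF Fp W(1) W' s] .
  show "gsec X PF W' (\<tau> W' (restr F W W' \<sigma>)) = gsec X PF W' (restr PF W W' (\<tau> W \<sigma>))"
   unfolding \<tau>(2)[OF W'(1) W'V sr] gsec_restrict[OF PFp W(1) \<tau>(1)[OF W s] W', symmetric] \<tau>(2)[OF W s]
   using sheaf_homD(4)[OF p W W' s] unfolding GF_restr .
  show "\<tau> W' (restr F W W' \<sigma>) \<in> sec PF W'" by (rule \<tau>(1)[OF W'(1) W'V sr])
  show "restr PF W W' (\<tau> W \<sigma>) \<in> sec PF W'" by (rule PFd(3)[OF W(1) W' \<tau>(1)[OF W s]])
 qed
 define f where "f i = (\<lambda>W\<in>opens_in X V. \<lambda>\<sigma>\<in>sec F W. coord \<O> A F (l i) W (\<tau> W \<sigma>))" for i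
 have fv: "f i W \<sigma> = coord \<O> A F (l i) W (\<tau> W \<sigma>)" if "openin X W" "W \<subseteq> V" "\<sigma> \<in> sec F W" for i W \<sigma>
  using that by (simp add: f_def)
 have fE: "f i \<in> sheaf_hom X \<O> F F V" if i: "i \<in> I" for i
 proof (rule sheaf_homI)
  note l = dual_basisD(4)[OF O A Fp d i]
  show "f i \<in> extensional (opens_in X V)" by (simp add: f_def)
  fix W assume W: "openin X W" "W \<subseteq> V"
  note c = coord[OF O A Fp l W(1) WV[OF W(2)]] and cs = coord_smult[OF O A Fp l W(1) WV[OF W(2)]] and FD = presheafD[OF Fp]
  show "f i W \<in> extensional (sec F W)" using W by (simp add: f_def)
  show "f i W s \<in> sec F W" if "s \<in> sec F W" for s
   unfolding fv[OF W that] by (rule c(1)[OF \<tau>(1)[OF W that]])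
  show "f i W (s \<oplus>\<^bsub>Sc F W\<^esub> t) = f i W s \<oplus>\<^bsub>Sc F W\<^esub> f i W t"
   if st: "s \<in> sec F W" "t \<in> sec F W" for s t
   unfolding fv[OF W st(1)] fv[OF W st(2)] fv[OF W FD(1)[OF W(1) st]] \<tau>add[OF W st]
   by (rule c(2)[OF \<tau>(1)[OF W st(1)] \<tau>(1)[OF W st(2)]])
  show "f i W (r \<odot>\<^bsub>Sc F W\<^esub> s) = r \<odot>\<^bsub>Sc F W\<^esub> f i W s"
   if rs: "r \<in> sec \<O> W" "s \<in> sec F W" for r s
   unfolding fv[OF W rs(2)] fv[OF W FD(2)[OF W(1) rs]] \<tau>sm[OF W rs] by (rule cs[OF rs(1) \<tau>(1)[OF W rs(2)]])
  show "f i W' (restr F W W' s) = restr F W W' (f i W s)"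
   if W': "openin X W'" "W' \<subseteq> W" and s: "s \<in> sec F W" for W' s
  proof -
   have W'V: "W' \<subseteq> V" using W W' by blast
   show ?thesis
    unfolding fv[OF W s] fv[OF W'(1) W'V FD(3)[OF W(1) W' s]] \<tau>re[OF W s W']
    by (rule coord_restr[OF O A Fp l W(1) WV[OF W(2)] W' \<tau>(1)[OF W s]])
  qed
 qed
 then have fE': "f i \<in> sec E V" if "i \<in> I" for i using that by (simp add: hom_sheaf_simps)
 define t where "t = comb \<O> A E I e V0 V f"
 show thesis
 proof (rule that)
  show t: "t \<in> sec PE V" unfolding t_def by (rule comb_closed[OF O A Ep d V fE'])
  fix W \<sigma> assume W: "openin X W" "W \<subseteq> V" and s: "\<sigma> \<in> sec F W"
  interpret G: abelian_group "Sc PF W" by (rule PF_group[OF W(1)])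
  have "ev W \<sigma> (restr PE V W t) = ev W \<sigma> (comb \<O> A E I e V0 W (%i. restr E V W (f i)))"
   unfolding t_def by (subst comb_restr[OF O A Ep d V fE' W]) auto
  also have "\<dots> = comb \<O> A F I e V0 W (%i. restr E V W (f i) W \<sigma>)"
   by (rule ev_comb[OF d W(1) WV[OF W(2)] s presheafD(3)[OF Ep V(1) W fE']])
  also have "\<dots> = comb \<O> A F I e V0 W (%i. coord \<O> A F (l i) W (\<tau> W \<sigma>))"
   using W by (simp add: hom_sheaf_simps fv[OF W s])
  also have "\<dots> = \<tau> W \<sigma>" by (rule comb_coord[OF O A Fp d W(1) WV[OF W(2)] \<tau>(1)[OF W s]])
  finally show "\<phi> W \<sigma> = gsec X PF W (ev W \<sigma> (restr PE V W t))" using \<tau>(2)[OF W s] by simp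
 qed
qed

end

context locally_projective
begin

abbreviation "N U \<equiv> tensor_end_to_hom X \<O> A F U"

lemma ev_germ:
 assumes W: "openin X W" "\<sigma> \<in> sec F W" "t \<in> sec PE W" and V: "openin X V" "V \<subseteq> W" "x \<in> V"
 shows "germ X PF x W (ev W \<sigma> t) = germ X PF x V (ev V (restr F W V \<sigma>) (restr PE W V t))"
 using germ_restr[OF PFp W(1) ev_closed[OF W] V] ev_restr[OF W(1,2) V(1,2) W(3)] by simp

text \<open>All terms of the union defining the natural map are the same germ, so one representative
  of \<open>c x\<close> over a neighbourhood inside \<open>V\<close> computes it.\<close>

lemma N_at:
 assumes c: "c x = germ X PE x W t" and W: "openin X W" "x \<in> W" "t \<in> sec PE W"
  and V: "openin X V" "V \<subseteq> U" "W \<subseteq> V" and s: "\<sigma> \<in> sec F V"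
 shows "N U c V \<sigma> x = germ X PF x W (ev W (restr F V W \<sigma>) t)"
proof -
 have xV: "x \<in> V" using W V by blast
 have sW: "restr F V W \<sigma> \<in> sec F W" using presheafD(3)[OF Fp V(1) W(1) V(3) s] .
 have eq: "germ X PF x (V \<inter> W') (ev (V \<inter> W') (restr F V (V \<inter> W') \<sigma>) (restr PE W' (V \<inter> W') t'))
   = germ X PF x W (ev W (restr F V W \<sigma>) t)" if m: "(W', t') \<in> c x" for W' t'
 proof -
  note g = germ_mem_imp_eq[OF PEp W(1,2,3) m[unfolded c]]
  obtain B where B: "openin X B" "x \<in> B" "B \<subseteq> W'" "B \<subseteq> W" "restr PE W' B t' = restr PE W B t"
   using g(1) unfolding germ_eq_iff[OF PEp g(2-4) W(1-3)] by blast
  have o: "openin X (V \<inter> W')" "V \<inter> W' \<subseteq> V" "V \<inter> W' \<subseteq> W'" "B \<subseteq> V \<inter> W'" "B \<subseteq> V" using V g(2) B(3,4) by auto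
  have s': "restr F V (V \<inter> W') \<sigma> \<in> sec F (V \<inter> W')" using presheafD(3)[OF Fp V(1) o(1,2) s] .
  have t'': "restr PE W' (V \<inter> W') t' \<in> sec PE (V \<inter> W')" using presheafD(3)[OF PEp g(2) o(1,3) g(4)] .
  show ?thesis
   unfolding ev_germ[OF o(1) s' t'' B(1) o(4) B(2)] ev_germ[OF W(1) sW W(3) B(1,4,2)]
    presheafD(7)[OF PEp g(2) o(1) B(1) o(4,3) g(4)] B(5) presheafD(7)[OF Fp V(1) o(1) B(1) o(4,2) s] presheafD(7)[OF Fp V(1) W(1) B(1,4) V(3) s] ..
 qed
 have ne: "(W, t) \<in> c x" using germ_self[OF PEp W] c by simp
 have "N U c V \<sigma> x = (\<Union>(W', t')\<in>c x. germ X PF x (V \<inter> W') (ev (V \<inter> W') (restr F V (V \<inter> W') \<sigma>) (restr PE W' (V \<inter> W') t')))"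
  using V s xV by (simp add: tensor_end_to_hom_def ev_def)
 also have "\<dots> = (\<Union>(W', t')\<in>c x. germ X PF x W (ev W (restr F V W \<sigma>) t))"
  by (intro SUP_cong refl) (auto simp: eq)
 also have "\<dots> = germ X PF x W (ev W (restr F V W \<sigma>) t)" using ne by auto
 finally show ?thesis .
qed

text \<open>One representative serves all \<open>V'\<close> and all sections at once, so that the
  two sides of linearity and naturality can be compared as germs over the same
  \<open>W\<close>.\<close>

lemma N_rep:
 assumes c: "c \<in> sec GE U" and V: "openin X V" "V \<subseteq> U" "x \<in> V"
 obtains W t where "openin X W" "W \<subseteq> V" "x \<in> W" "t \<in> sec PE W" "restrict c W = gsec X PE W t"
  "!!V' \<sigma> y. openin X V' ==> V' \<subseteq> U ==> W \<subseteq> V' ==> \<sigma> \<in> sec F V' ==> y \<in> W ==>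
    N U c V' \<sigma> y = germ X PF y W (ev W (restr F V' W \<sigma>) t)"
proof -
 have xU: "x \<in> U" using V by blast
 obtain W t where W: "openin X W" "W \<subseteq> U" "x \<in> W" "t \<in> sec PE W" "restrict c W = gsec X PE W t"
  using sheafify_rep[OF PEp c[unfolded tensor_sheaf_def] xU] by metis
 have o: "openin X (W \<inter> V)" "W \<inter> V \<subseteq> W" using W V by auto
 let ?t = "restr PE W (W \<inter> V) t"
 have t: "?t \<in> sec PE (W \<inter> V)" using presheafD(3)[OF PEp W(1) o W(4)] .
 have r: "restrict c (W \<inter> V) = gsec X PE (W \<inter> V) ?t"
  using gsec_restrict[OF PEp W(1,4) o] W(5) by (metis Int_lower1 restrict_restrict inf.absorb2)
 show thesis
 proof (rule that[OF o(1) _ _ t r])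
  fix V' \<sigma> y assume V': "openin X V'" "V' \<subseteq> U" "W \<inter> V \<subseteq> V'" "\<sigma> \<in> sec F V'" and y: "y \<in> W \<inter> V"
  show "N U c V' \<sigma> y = germ X PF y (W \<inter> V) (ev (W \<inter> V) (restr F V' (W \<inter> V) \<sigma>) ?t)"
   by (rule N_at[where c = c, OF restrict_eq_germ_section[OF PEp r y] o(1) y t V'])
 qed (use W V in auto)
qed

lemma N_restr_at:
 assumes c: "c \<in> sec GE U" and V: "openin X V" "V \<subseteq> U" and W: "openin X W" "W \<subseteq> V"
  and s: "\<sigma> \<in> sec F V" and x: "x \<in> W"
 shows "N U c V \<sigma> x = N U c W (restr F V W \<sigma>) x"
proof -
 have WU: "W \<subseteq> U" using W V by blast
 obtain B t where B: "openin X B" "B \<subseteq> W" "x \<in> B" and n: "!!V' \<sigma> y. openin X V' ==> V' \<subseteq> U ==> B \<subseteq> V' ==> \<sigma> \<in> sec F V' ==> y \<in> B ==>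
    N U c V' \<sigma> y = germ X PF y B (ev B (restr F V' B \<sigma>) t)"
  using N_rep[OF c W(1) WU x] by metis
 have BV: "B \<subseteq> V" using B W by blast
 show ?thesis
  unfolding n[OF V BV s B(3)] n[OF W(1) WU B(2) presheafD(3)[OF Fp V(1) W s] B(3)] presheafD(7)[OF Fp V(1) W(1) B(1,2) W(2) s] ..
qed

lemma N_local:
 assumes c: "restrict c V = gsec X PE V t" and V: "openin X V" "V \<subseteq> U" and t: "t \<in> sec PE V"
  and W: "openin X W" "W \<subseteq> V" and s: "\<sigma> \<in> sec F W"
 shows "N U c W \<sigma> = gsec X PF W (ev W \<sigma> (restr PE V W t))"
proof (rule extensionalityI[of _ W])
 have WU: "W \<subseteq> U" using W V by blast
 show "N U c W \<sigma> \<in> extensional W" using W(1) WU s by (simp add: tensor_end_to_hom_def)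
 show "gsec X PF W (ev W \<sigma> (restr PE V W t)) \<in> extensional W" by (simp add: gsec_def)
 fix x assume x: "x \<in> W"
 have t': "restr PE V W t \<in> sec PE W" using presheafD(3)[OF PEp V(1) W t] .
 have "c x = germ X PE x W (restr PE V W t)"
  using restrict_eq_germ_section[OF PEp c, of x] germ_restr[OF PEp V(1) t W x] x W by auto
 then have "N U c W \<sigma> x = germ X PF x W (ev W (restr F W W \<sigma>) (restr PE V W t))"
  by (rule N_at[OF _ W(1) x t' W(1) WU subset_refl s])
 then show "N U c W \<sigma> x = gsec X PF W (ev W \<sigma> (restr PE V W t)) x"
  using x presheafD(6)[OF Fp W(1) s] by simp
qed

lemma N_hom:
 assumes c: "c \<in> sec GE U"
 shows "N U c \<in> sheaf_hom X \<O> F GF U"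
proof (rule sheaf_homI)
 show "N U c \<in> extensional (opens_in X U)" by (simp add: tensor_end_to_hom_def)
 fix V assume V: "openin X V" "V \<subseteq> U"
 note FD = presheafD[OF Fp] and GD = module_likeD[OF GF_like]
 show "N U c V \<in> extensional (sec F V)" using V by (simp add: tensor_end_to_hom_def)
 have ext: "N U c V s \<in> extensional V" if "s \<in> sec F V" for s
  using V that by (simp add: tensor_end_to_hom_def)
 have gext: "g \<in> extensional W" if "g \<in> sec GF W" for g W using that by (simp add: tensor_sheaf_def sheafify_simps)
 have nat: "N U c W (restr F V W s) = restrict (N U c V s) W"
  if W: "openin X W" "W \<subseteq> V" and s: "s \<in> sec F V" for W s
 proof (rule extensionalityI[of _ W])
  have "W \<subseteq> U" using W V by blast
  then show "N U c W (restr F V W s) \<in> extensional W" using W FD(3)[OF V(1) W s] by (simp add: tensor_end_to_hom_def)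
 qed (simp_all add: N_restr_at[OF c V W s])
 show cl: "N U c V s \<in> sec GF V" if s: "s \<in> sec F V" for s
  unfolding tensor_sheaf_def
 proof (rule sheafify_glue[OF PFp ext[OF s]])
  fix x assume x: "x \<in> V"
  obtain W t where W: "openin X W" "W \<subseteq> V" "x \<in> W" "t \<in> sec PE W" "restrict c W = gsec X PE W t"
   using N_rep[OF c V x] by metis
  have WU: "W \<subseteq> U" using W V by blast
  have s': "restr F V W s \<in> sec F W" using FD(3)[OF V(1) W(1,2) s] .
  have "restrict (N U c V s) W = gsec X PF W (ev W (restr F V W s) (restr PE W W t))"
   unfolding nat[OF W(1,2) s, symmetric] by (rule N_local[OF W(5,1) WU W(4) W(1) subset_refl s'])
  also have "\<dots> \<in> sec (sheafify X \<O> PF) W"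
   by (rule gsec_closed[OF PFp W(1) ev_closed[OF W(1) s' presheafD(3)[OF PEp W(1) W(1) subset_refl W(4)]]])
  finally show "\<exists>W. openin X W \<and> W \<subseteq> V \<and> x \<in> W \<and> restrict (N U c V s) W \<in> sec (sheafify X \<O> PF) W"
   using W by blast
 qed
 show "N U c W (restr F V W s) = restr GF V W (N U c V s)"
  if W: "openin X W" "W \<subseteq> V" and s: "s \<in> sec F V" for W s
  unfolding GF_restr by (rule nat[OF W s])
 show "N U c V (s \<oplus>\<^bsub>Sc F V\<^esub> t) = N U c V s \<oplus>\<^bsub>Sc GF V\<^esub> N U c V t"
  if s: "s \<in> sec F V" and t: "t \<in> sec F V" for s t
 proof (rule extensionalityI[of _ V])
  have st: "s \<oplus>\<^bsub>Sc F V\<^esub> t \<in> sec F V" by (rule FD(1)[OF V(1) s t])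
  show "N U c V (s \<oplus>\<^bsub>Sc F V\<^esub> t) \<in> extensional V" by (rule ext[OF st])
  show "N U c V s \<oplus>\<^bsub>Sc GF V\<^esub> N U c V t \<in> extensional V" by (rule gext[OF GD(1)[OF V(1) cl[OF s] cl[OF t]]])
  fix x assume x: "x \<in> V"
  obtain W u where W: "openin X W" "W \<subseteq> V" "x \<in> W" "u \<in> sec PE W"
   and n: "!!V' \<sigma> y. openin X V' ==> V' \<subseteq> U ==> W \<subseteq> V' ==> \<sigma> \<in> sec F V' ==> y \<in> W ==>
    N U c V' \<sigma> y = germ X PF y W (ev W (restr F V' W \<sigma>) u)"
   using N_rep[OF c V x] by metis
  note r = FD(3)[OF V(1) W(1,2)]
  have "(N U c V s \<oplus>\<^bsub>Sc GF V\<^esub> N U c V t) x = germ X PF x W (ev W (restr F V W s) u \<oplus>\<^bsub>Sc PF W\<^esub> ev W (restr F V W t) u)"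
   unfolding tensor_sheaf_def
   by (rule sheafify_add_at[OF PFp W(1,3) ev_closed[OF W(1) r[OF s] W(4)] ev_closed[OF W(1) r[OF t] W(4)] _ _ x])
     (rule n[OF V W(2) s W(3)] n[OF V W(2) t W(3)])+
  then show "N U c V (s \<oplus>\<^bsub>Sc F V\<^esub> t) x = (N U c V s \<oplus>\<^bsub>Sc GF V\<^esub> N U c V t) x"
   unfolding n[OF V W(2) st W(3)] FD(4)[OF V(1) W(1,2) s t] ev_section_add[OF W(1) r[OF s] r[OF t] W(4)] by (rule sym)
 qed
 show "N U c V (r \<odot>\<^bsub>Sc F V\<^esub> s) = r \<odot>\<^bsub>Sc GF V\<^esub> N U c V s"
  if r: "r \<in> sec \<O> V" and s: "s \<in> sec F V" for r s
 proof (rule extensionalityI[of _ V])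
  have st: "r \<odot>\<^bsub>Sc F V\<^esub> s \<in> sec F V" by (rule FD(2)[OF V(1) r s])
  show "N U c V (r \<odot>\<^bsub>Sc F V\<^esub> s) \<in> extensional V" by (rule ext[OF st])
  show "r \<odot>\<^bsub>Sc GF V\<^esub> N U c V s \<in> extensional V" by (rule gext[OF GD(2)[OF V(1) r cl[OF s]]])
  fix x assume x: "x \<in> V"
  obtain W u where W: "openin X W" "W \<subseteq> V" "x \<in> W" "u \<in> sec PE W"
   and n: "!!V' \<sigma> y. openin X V' ==> V' \<subseteq> U ==> W \<subseteq> V' ==> \<sigma> \<in> sec F V' ==> y \<in> W ==>
    N U c V' \<sigma> y = germ X PF y W (ev W (restr F V' W \<sigma>) u)"
   using N_rep[OF c V x] by metis
  note rs = FD(3)[OF V(1) W(1,2) s] and rO = ring_presheafD(2)[OF O V(1) W(1,2) r]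
  have "(r \<odot>\<^bsub>Sc GF V\<^esub> N U c V s) x = germ X PF x W (restr \<O> V W r \<odot>\<^bsub>Sc PF W\<^esub> ev W (restr F V W s) u)"
   unfolding tensor_sheaf_def
   by (rule sheafify_smult_at[OF PFp O V(1) r W(1,2,3) ev_closed[OF W(1) rs W(4)]]) (rule n[OF V W(2) s W(3)])
  then show "N U c V (r \<odot>\<^bsub>Sc F V\<^esub> s) x = (r \<odot>\<^bsub>Sc GF V\<^esub> N U c V s) x"
   unfolding n[OF V W(2) st W(3)] FD(5)[OF V(1) W(1,2) r s] ev_section_smult[OF W(1) rO rs W(4)] by (rule sym)
 qed
qed

text \<open>Both halves are known over the dual basis neighbourhood of each point. Local preimages
  of a morphism are unique, hence agree on overlaps and glue.\<close>

lemma N_bij: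
 assumes U: "openin X U"
 shows "bij_betw (N U) (sec GE U) (sheaf_hom X \<O> F GF U)"
proof (rule bij_betw_imageI)
 have top: "x \<in> topspace X" if "x \<in> U" for x using that U openin_subset by blast
 have dbD: "x \<in> bV x" "dual_basis X \<O> A (bV x) (bI x) (be x) (bl x)" "openin X (bV x)" if "x \<in> U" for x
  using db[OF top[OF that]] by (auto simp: dual_basis_def)
 show "inj_on (N U) (sec GE U)"
 proof (rule inj_onI)
  fix c d assume c: "c \<in> sec GE U" and d: "d \<in> sec GE U" and eq: "N U c = N U d"
  show "c = d"
  proof (rule extensionalityI[of _ U])
   show "c \<in> extensional U" "d \<in> extensional U" using c d by (simp_all add: tensor_sheaf_def sheafify_simps)
   fix x assume x: "x \<in> U"
   obtain V a b where V: "openin X V" "V \<subseteq> U" "x \<in> V" "a \<in> sec PE V" "b \<in> sec PE V"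
    "restrict c V = gsec X PE V a" "restrict d V = gsec X PE V b"
    by (rule sheafify_common_rep[OF PEp c[unfolded tensor_sheaf_def] d[unfolded tensor_sheaf_def] x])
   let ?W = "V \<inter> bV x"
   have W: "openin X ?W" "?W \<subseteq> bV x" "?W \<subseteq> V" "?W \<subseteq> U" "x \<in> ?W" using V dbD[OF x] by auto
   note rP = presheafD(3)[OF PEp V(1) W(1,3)]
   have rc: "restrict c ?W = gsec X PE ?W (restr PE V ?W a)"
    using gsec_restrict[OF PEp V(1,4) W(1,3)] V(6) by (metis W(3) restrict_restrict inf.absorb2)
   have rd: "restrict d ?W = gsec X PE ?W (restr PE V ?W b)"
    using gsec_restrict[OF PEp V(1,5) W(1,3)] V(7) by (metis W(3) restrict_restrict inf.absorb2)
   have "restr PE V ?W a = restr PE V ?W b"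
   proof (rule local_injective[OF dbD(2)[OF x] W(1,2) rP[OF V(4)] rP[OF V(5)]])
    fix W' \<sigma> assume W': "openin X W'" "W' \<subseteq> ?W" and s: "\<sigma> \<in> sec F W'"
    show "gsec X PF W' (ev W' \<sigma> (restr PE ?W W' (restr PE V ?W a))) = gsec X PF W' (ev W' \<sigma> (restr PE ?W W' (restr PE V ?W b)))"
     unfolding N_local[OF rc W(1,4) rP[OF V(4)] W' s, symmetric] N_local[OF rd W(1,4) rP[OF V(5)] W' s, symmetric] eq ..
   qed
   then show "c x = d x"
    using restrict_eq_germ_section[OF PEp rc W(5)] restrict_eq_germ_section[OF PEp rd W(5)] by simp
  qed
 qed
 show "N U ` sec GE U = sheaf_hom X \<O> F GF U"
 proof (rule equalityI)
  show "N U ` sec GE U \<subseteq> sheaf_hom X \<O> F GF U" using N_hom by blast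
  show "sheaf_hom X \<O> F GF U \<subseteq> N U ` sec GE U"
  proof
   fix \<phi> assume p: "\<phi> \<in> sheaf_hom X \<O> F GF U"
   let ?V = "%x. U \<inter> bV x"
   have V: "openin X (?V x)" "?V x \<subseteq> bV x" "?V x \<subseteq> U" "x \<in> ?V x" if "x \<in> U" for x using U dbD[OF that] that by auto
   have "\<exists>t. t \<in> sec PE (?V x) \<and> (\<forall>W \<sigma>. openin X W --> W \<subseteq> ?V x --> \<sigma> \<in> sec F W -->
     \<phi> W \<sigma> = gsec X PF W (ev W \<sigma> (restr PE (?V x) W t)))" if x: "x \<in> U" for x
   proof -
    have px: "restrict \<phi> (opens_in X (?V x)) \<in> sheaf_hom X \<O> F GF (?V x)" by (rule sheaf_hom_restrict[OF p V(3)[OF x]])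
    show ?thesis
    proof (rule local_surjective[OF dbD(2)[OF x] V(1,2)[OF x] px])
     fix t assume t: "t \<in> sec PE (?V x)" and h: "!!W \<sigma>. openin X W ==> W \<subseteq> ?V x ==> \<sigma> \<in> sec F W ==>
      restrict \<phi> (opens_in X (?V x)) W \<sigma> = gsec X PF W (ev W \<sigma> (restr PE (?V x) W t))"
     show ?thesis
     proof (intro exI[of _ t] conjI allI impI t)
      fix W \<sigma> assume W: "openin X W" "W \<subseteq> ?V x" "\<sigma> \<in> sec F W"
      have "restrict \<phi> (opens_in X (?V x)) W = \<phi> W" using W by (simp only: restrict_apply opens_in_iff simp_thms if_True)
      then show "\<phi> W \<sigma> = gsec X PF W (ev W \<sigma> (restr PE (?V x) W t))" using h[OF W] by simp
     qed
    qed
   qed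
   then obtain t where t: "!!x. x \<in> U ==> t x \<in> sec PE (?V x) \<and> (\<forall>W \<sigma>. openin X W --> W \<subseteq> ?V x --> \<sigma> \<in> sec F W -->
     \<phi> W \<sigma> = gsec X PF W (ev W \<sigma> (restr PE (?V x) W (t x))))" by metis
   have tc: "t x \<in> sec PE (?V x)" if "x \<in> U" for x using t[OF that] by simp
   have tv: "\<phi> W \<sigma> = gsec X PF W (ev W \<sigma> (restr PE (?V x) W (t x)))"
    if "x \<in> U" "openin X W" "W \<subseteq> ?V x" "\<sigma> \<in> sec F W" for x W \<sigma>
    using t[OF that(1), THEN conjunct2, rule_format, OF that(2-4)] .
   \<comment> \<open>At each point the germ of the preimage found around that very point;
     \<open>cx\<close> shows that another centre gives the same germ.\<close>
   define c where "c = (\<lambda>x\<in>U. germ X PE x (?V x) (t x))"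
   have cx: "restrict c (?V x) = gsec X PE (?V x) (t x)" if x: "x \<in> U" for x
   proof (rule extensionalityI[OF restrict_extensional])
    show "gsec X PE (?V x) (t x) \<in> extensional (?V x)" by (simp add: gsec_def)
    fix y assume y: "y \<in> ?V x"
    then have yU: "y \<in> U" by simp
    let ?W = "?V x \<inter> ?V y"
    have W: "openin X ?W" "?W \<subseteq> ?V x" "?W \<subseteq> ?V y" "?W \<subseteq> bV x" "y \<in> ?W"
     by (rule openin_Int[OF V(1)[OF x] V(1)[OF yU]], rule Int_lower1, rule Int_lower2, rule le_infI1[OF V(2)[OF x]],
       rule IntI[OF y V(4)[OF yU]])
    have "restr PE (?V x) ?W (t x) = restr PE (?V y) ?W (t y)"
    proof (rule local_injective[OF dbD(2)[OF x] W(1,4) presheafD(3)[OF PEp V(1)[OF x] W(1,2) tc[OF x]] presheafD(3)[OF PEp V(1)[OF yU] W(1,3) tc[OF yU]]])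
     fix W' \<sigma> assume W': "openin X W'" "W' \<subseteq> ?W" and s: "\<sigma> \<in> sec F W'"
     have W'x: "W' \<subseteq> ?V x" and W'y: "W' \<subseteq> ?V y" by (rule subset_trans[OF W'(2) W(2)], rule subset_trans[OF W'(2) W(3)])
     show "gsec X PF W' (ev W' \<sigma> (restr PE ?W W' (restr PE (?V x) ?W (t x)))) =
       gsec X PF W' (ev W' \<sigma> (restr PE ?W W' (restr PE (?V y) ?W (t y))))"
      unfolding presheafD(7)[OF PEp V(1)[OF x] W(1) W' W(2) tc[OF x]] presheafD(7)[OF PEp V(1)[OF yU] W(1) W' W(3) tc[OF yU]]
       tv[OF x W'(1) W'x s, symmetric] tv[OF yU W'(1) W'y s, symmetric] ..
    qed
    then have "germ X PE y (?V x) (t x) = germ X PE y (?V y) (t y)"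
     using germ_restr[OF PEp V(1)[OF x] tc[OF x] W(1,2,5)] germ_restr[OF PEp V(1)[OF yU] tc[OF yU] W(1,3,5)] by simp
    then show "restrict c (?V x) y = gsec X PE (?V x) (t x) y" using y yU by (simp add: c_def)
   qed
   have c: "c \<in> sec GE U"
    unfolding tensor_sheaf_def
   proof (rule sheafify_glue[OF PEp])
    show "c \<in> extensional U" by (simp add: c_def)
    fix x assume x: "x \<in> U"
    have "restrict c (?V x) \<in> sec (sheafify X \<O> PE) (?V x)"
     unfolding cx[OF x] by (rule gsec_closed[OF PEp V(1)[OF x] tc[OF x]])
    then show "\<exists>V. openin X V \<and> V \<subseteq> U \<and> x \<in> V \<and> restrict c V \<in> sec (sheafify X \<O> PE) V"
     using V[OF x] by blast
   qed
   have "\<phi> = N U c"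
   proof (rule sheaf_hom_eqI[OF p N_hom[OF c]])
    fix W \<sigma> assume W: "openin X W" "W \<subseteq> U" and s: "\<sigma> \<in> sec F W"
    note ph = sheaf_homD[OF p W] and nh = sheaf_homD[OF N_hom[OF c] W]
    have gext: "g \<in> extensional W" if "g \<in> sec GF W" for g using that by (simp add: tensor_sheaf_def sheafify_simps)
    show "\<phi> W \<sigma> = N U c W \<sigma>"
    proof (rule extensionalityI[OF gext[OF ph(1)[OF s]] gext[OF nh(1)[OF s]]])
     fix x assume x: "x \<in> W"
     then have xU: "x \<in> U" using W by blast
     let ?W = "W \<inter> bV x"
     have W': "openin X ?W" "?W \<subseteq> W" "?W \<subseteq> ?V x" "x \<in> ?W" using W x dbD[OF xU] by auto
     have s': "restr F W ?W \<sigma> \<in> sec F ?W" using presheafD(3)[OF Fp W(1) W'(1,2) s] .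
     have "restrict (\<phi> W \<sigma>) ?W = \<phi> ?W (restr F W ?W \<sigma>)" using ph(4)[OF W'(1,2) s] by (simp only: GF_restr)
     also have "\<dots> = N U c ?W (restr F W ?W \<sigma>)"
      unfolding tv[OF xU W'(1,3) s'] N_local[OF cx[OF xU] V(1,3)[OF xU] tc[OF xU] W'(1,3) s'] ..
     also have "\<dots> = restrict (N U c W \<sigma>) ?W" using nh(4)[OF W'(1,2) s] by (simp only: GF_restr)
     finally show "\<phi> W \<sigma> x = N U c W \<sigma> x" using W'(4) by (metis restrict_apply')
    qed
   qed
   then show "\<phi> \<in> N U ` sec GE U" using c by blast
  qed
 qed
qed

text \<open>The value at \<open>x\<close> uses only the germ \<open>c x\<close>, which restriction
  does not change.\<close>

lemma N_restrict:
 assumes c: "c \<in> sec GE U" and V: "openin X U" "openin X V" "V \<subseteq> U"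
 shows "N V (restrict c V) = restrict (N U c) (opens_in X V)"
proof -
 have "N V (restrict c V) W \<sigma> x = N U c W \<sigma> x" if "openin X W" "W \<subseteq> V" "\<sigma> \<in> sec F W" "x \<in> W" for W \<sigma> x
 proof -
  have "x \<in> V" "W \<subseteq> U" using that V by blast+
  then show ?thesis using that by (simp add: tensor_end_to_hom_def)
 qed
 moreover have "W \<subseteq> U" if "W \<subseteq> V" for W using that V by blast
 ultimately show ?thesis by (auto simp: fun_eq_iff tensor_end_to_hom_def)
qed

text \<open>Unique extension passes from \<open>F\<close> to the tensor sheaf: near each point
  coordinates are extended one by one, and uniqueness glues the local extensions.\<close>

lemma GF_extension:
 assumes Y: "openin X Y"
  and ext: "!!V. openin X V ==> bij_betw (restr F V (V \<inter> Y)) (sec F V) (sec F (V \<inter> Y))"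
  and V: "openin X V"
 shows "bij_betw (restr GF V (V \<inter> Y)) (sec GF V) (sec GF (V \<inter> Y))"
proof -
 have dbD: "x \<in> bV x" "dual_basis X \<O> A (bV x) (bI x) (be x) (bl x)" "openin X (bV x)" if "openin X W" "x \<in> W" for x W
  using db[of x] openin_subset[OF that(1)] that(2) by (auto simp: dual_basis_def)
 have oY: "openin X (W \<inter> Y)" if "openin X W" for W using that Y by blast
 have extI: "s = t" if "openin X W" "s \<in> sec F W" "t \<in> sec F W" "restr F W (W \<inter> Y) s = restr F W (W \<inter> Y) t" for W s t
  using inj_onD[OF bij_betw_imp_inj_on[OF ext[OF that(1)]] that(4,2,3)] .
 note PFd = presheafD[OF PFp] and gres = gsec_restrict[OF PFp]
 have PFinj: "t = u"
  if d: "dual_basis X \<O> A V0 I e l" and W: "openin X W" "W \<subseteq> V0" and t: "t \<in> sec PF W" "u \<in> sec PF W"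
   and eq: "restr PF W (W \<inter> Y) t = restr PF W (W \<inter> Y) u" for V0 I e l W t u
 proof (rule coord_eqI[OF O A Fp d W t])
  fix i assume i: "i \<in> I"
  note l = dual_basisD(4)[OF O A Fp d i] and c = coord[OF O A Fp dual_basisD(4)[OF O A Fp d i] W]
  show "coord \<O> A F (l i) W t = coord \<O> A F (l i) W u"
   by (rule extI[OF W(1) c(1)[OF t(1)] c(1)[OF t(2)]])
     (simp only: coord_restr[OF O A Fp l W oY[OF W(1)] Int_lower1 t(1), symmetric] coord_restr[OF O A Fp l W oY[OF W(1)] Int_lower1 t(2), symmetric] eq)
 qed
 have inj: "s = t" if W: "openin X W" and s: "s \<in> sec GF W" and t: "t \<in> sec GF W"
  and eq: "restrict s (W \<inter> Y) = restrict t (W \<inter> Y)" for W s t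
 proof (rule extensionalityI[of _ W])
  show "s \<in> extensional W" "t \<in> extensional W" using s t by (simp_all add: tensor_sheaf_def sheafify_simps)
  fix x assume x: "x \<in> W"
  obtain V a b where V: "openin X V" "V \<subseteq> W" "x \<in> V" "a \<in> sec PF V" "b \<in> sec PF V"
    "restrict s V = gsec X PF V a" "restrict t V = gsec X PF V b"
   by (rule sheafify_common_rep[OF PFp s[unfolded tensor_sheaf_def] t[unfolded tensor_sheaf_def] x])
  note dx = dbD[OF W x]
  let ?V = "V \<inter> bV x"
  have V': "openin X ?V" "?V \<subseteq> bV x" "?V \<subseteq> V" "x \<in> ?V" "?V \<inter> Y \<subseteq> V" "?V \<inter> Y \<subseteq> bV x" using V dx by auto
  note ra = PFd(3)[OF V(1) V'(1,3)]
  have "restr PF V ?V a = restr PF V ?V b"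
  proof (rule PFinj[OF dx(2) V'(1,2) ra[OF V(4)] ra[OF V(5)]])
   have c: "restr PF V (?V \<inter> Y) a \<in> sec PF (?V \<inter> Y)" "restr PF V (?V \<inter> Y) b \<in> sec PF (?V \<inter> Y)"
    using PFd(3)[OF V(1) oY[OF V'(1)] V'(5)] V(4,5) by blast+
   have "gsec X PF (?V \<inter> Y) (restr PF V (?V \<inter> Y) a) = gsec X PF (?V \<inter> Y) (restr PF V (?V \<inter> Y) b)"
   proof (rule extensionalityI[of _ "?V \<inter> Y"])
    fix y assume y: "y \<in> ?V \<inter> Y"
    then have "y \<in> V" "y \<in> W \<inter> Y" using V by auto
    moreover from this have "s y = t y" using eq by (metis restrict_apply')
    ultimately show "gsec X PF (?V \<inter> Y) (restr PF V (?V \<inter> Y) a) y = gsec X PF (?V \<inter> Y) (restr PF V (?V \<inter> Y) b) y"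
     using y germ_restr[OF PFp V(1,4) oY[OF V'(1)] V'(5) y] germ_restr[OF PFp V(1,5) oY[OF V'(1)] V'(5) y]
      restrict_eq_germ_section[OF PFp V(6), of y] restrict_eq_germ_section[OF PFp V(7), of y] by simp
   qed (simp_all add: gsec_def)
   then have "restr PF V (?V \<inter> Y) a = restr PF V (?V \<inter> Y) b"
    by (rule inj_onD[OF bij_betw_imp_inj_on[OF tensor_germ_section_bij[OF O A F dx(2) oY[OF V'(1)] V'(6)]] _ c])
   then show "restr PF ?V (?V \<inter> Y) (restr PF V ?V a) = restr PF ?V (?V \<inter> Y) (restr PF V ?V b)"
    by (simp only: PFd(7)[OF V(1) V'(1) oY[OF V'(1)] Int_lower1 V'(3) V(4)] PFd(7)[OF V(1) V'(1) oY[OF V'(1)] Int_lower1 V'(3) V(5)])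
  qed
  then show "s x = t x"
   using germ_restr[OF PFp V(1,4) V'(1,3,4)] germ_restr[OF PFp V(1,5) V'(1,3,4)]
    restrict_eq_germ_section[OF PFp V(6,3)] restrict_eq_germ_section[OF PFp V(7,3)] by simp
 qed
 \<comment> \<open>Existence near one point: the coordinates of \<open>t\<close> extend across the
   complement of \<open>Y\<close>, and \<open>comb\<close> reassembles them.\<close>
 have loc: "\<exists>s. s \<in> sec GF (W \<inter> bV x) \<and> restrict s (W \<inter> bV x \<inter> Y) = restrict t (W \<inter> bV x \<inter> Y)"
  if W: "openin X W" "x \<in> W" and t: "t \<in> sec GF (W \<inter> Y)" for W x t
 proof -
  note dx = dbD[OF W]
  let ?V = "W \<inter> bV x"
  have V: "openin X ?V" "?V \<subseteq> bV x" "?V \<inter> Y \<subseteq> W \<inter> Y" "?V \<inter> Y \<subseteq> bV x" using W dx by auto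
  have r: "restrict t (?V \<inter> Y) \<in> sec GF (?V \<inter> Y)"
   using t unfolding tensor_sheaf_def by (rule sheafify_restrict_closed[OF PFp oY[OF W(1)] oY[OF V(1)] V(3)])
  then obtain a where a: "a \<in> sec PF (?V \<inter> Y)" "restrict t (?V \<inter> Y) = gsec X PF (?V \<inter> Y) a"
   using bij_betw_imp_surj_on[OF tensor_germ_section_bij[OF O A F dx(2) oY[OF V(1)] V(4)]] by blast
  let ?c = "%i. coord \<O> A F (bl x i) (?V \<inter> Y) a"
  have cc: "?c i \<in> sec F (?V \<inter> Y)" if "i \<in> bI x" for i
   by (rule coord(1)[OF O A Fp dual_basisD(4)[OF O A Fp dx(2) that] oY[OF V(1)] V(4) a(1)])
  have "\<exists>b. b \<in> sec F ?V \<and> restr F ?V (?V \<inter> Y) b = ?c i" if "i \<in> bI x" for i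
  proof -
   have "?c i \<in> restr F ?V (?V \<inter> Y) ` sec F ?V"
    unfolding bij_betw_imp_surj_on[OF ext[OF V(1)]] by (rule cc[OF that])
   then show ?thesis by auto
  qed
  then obtain b where b: "!!i. i \<in> bI x ==> b i \<in> sec F ?V \<and> restr F ?V (?V \<inter> Y) (b i) = ?c i" by metis
  have bc: "b i \<in> sec F ?V" if "i \<in> bI x" for i using b[OF that] by simp
  let ?s = "comb \<O> A F (bI x) (be x) (bV x) ?V b"
  have s: "?s \<in> sec PF ?V" by (rule comb_closed[OF O A Fp dx(2) V(1,2) bc])
  interpret G: abelian_group "Sc PF (?V \<inter> Y)" by (rule PF_group[OF oY[OF V(1)]])
  have "restr PF ?V (?V \<inter> Y) ?s = comb \<O> A F (bI x) (be x) (bV x) (?V \<inter> Y) (%i. restr F ?V (?V \<inter> Y) (b i))"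
   by (rule comb_restr[OF O A Fp dx(2) V(1,2) bc oY[OF V(1)] Int_lower1])
  also have "\<dots> = comb \<O> A F (bI x) (be x) (bV x) (?V \<inter> Y) ?c"
   unfolding comb_def[OF O A Fp]
   by (rule G.finsum_cong') (use pure_basis_closed[OF O A Fp dx(2) oY[OF V(1)] V(4)] cc b in \<open>simp_all add: Pi_iff\<close>)
  also have "\<dots> = a" by (rule comb_coord[OF O A Fp dx(2) oY[OF V(1)] V(4) a(1)])
  finally have ra: "restr PF ?V (?V \<inter> Y) ?s = a" .
  show ?thesis
  proof (intro exI conjI)
   show "gsec X PF ?V ?s \<in> sec GF ?V"
    unfolding tensor_sheaf_def by (rule gsec_closed[OF PFp V(1) s])
   show "restrict (gsec X PF ?V ?s) (?V \<inter> Y) = restrict t (?V \<inter> Y)"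
    unfolding gres[OF V(1) s oY[OF V(1)] Int_lower1] ra a(2) ..
  qed
 qed
 show ?thesis unfolding GF_restr[abs_def]
 proof (rule bij_betw_imageI)
  show "inj_on (%s. restrict s (V \<inter> Y)) (sec GF V)"
   by (rule inj_onI) (rule inj[OF V])
  show "(%s. restrict s (V \<inter> Y)) ` sec GF V = sec GF (V \<inter> Y)"
  proof (rule equalityI)
   show "(%s. restrict s (V \<inter> Y)) ` sec GF V \<subseteq> sec GF (V \<inter> Y)"
    unfolding tensor_sheaf_def using sheafify_restrict_closed[OF PFp V oY[OF V] Int_lower1] by blast
   show "sec GF (V \<inter> Y) \<subseteq> (%s. restrict s (V \<inter> Y)) ` sec GF V"
   proof
    fix t assume t: "t \<in> sec GF (V \<inter> Y)"
    let ?V = "%x. V \<inter> bV x"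
    obtain s where s: "!!x. x \<in> V ==> s x \<in> sec GF (?V x) \<and> restrict (s x) (?V x \<inter> Y) = restrict t (?V x \<inter> Y)"
     using loc[OF V _ t] by metis
    have sc: "s x \<in> sec GF (?V x)" and st: "restrict (s x) (?V x \<inter> Y) = restrict t (?V x \<inter> Y)" if "x \<in> V" for x
     using s[OF that] by simp_all
    have oV: "openin X (?V x)" "x \<in> ?V x" if "x \<in> V" for x using V dbD[OF V that] that by auto
    \<comment> \<open>The value at \<open>x\<close> of the extension found around \<open>x\<close>;
      by uniqueness any other centre gives the same.\<close>
    define u where "u = (\<lambda>x\<in>V. s x x)"
    have agree: "s x y = s y y" if x: "x \<in> V" and y: "y \<in> ?V x" for x y
    proof -
     have yV: "y \<in> V" using y by simp
     let ?W = "?V x \<inter> ?V y"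
     have W: "openin X ?W" "?W \<subseteq> ?V x" "?W \<subseteq> ?V y" "y \<in> ?W" using oV[OF x] oV[OF yV] y by auto
     have "restrict (s x) ?W = restrict (s y) ?W"
     proof (rule inj[OF W(1)])
      show "restrict (s x) ?W \<in> sec GF ?W" "restrict (s y) ?W \<in> sec GF ?W"
       using sheafify_restrict_closed[OF PFp oV(1)[OF x] W(1,2) sc[OF x, unfolded tensor_sheaf_def]]
        sheafify_restrict_closed[OF PFp oV(1)[OF yV] W(1,3) sc[OF yV, unfolded tensor_sheaf_def]]
       unfolding tensor_sheaf_def .
      have "s x z = s y z" if "z \<in> ?W \<inter> Y" for z
       using that fun_cong[OF st[OF x], of z] fun_cong[OF st[OF yV], of z] by (simp del: restrict_apply add: restrict_apply')
      then show "restrict (restrict (s x) ?W) (?W \<inter> Y) = restrict (restrict (s y) ?W) (?W \<inter> Y)"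
       by (simp add: restrict_def fun_eq_iff)
     qed
     then show ?thesis using W(4) by (metis restrict_apply')
    qed
    have u: "u \<in> sec GF V"
     unfolding tensor_sheaf_def
    proof (rule sheafify_glue[OF PFp])
     show "u \<in> extensional V" by (simp add: u_def)
     fix x assume x: "x \<in> V"
     have "restrict u (?V x) = s x"
     proof (rule extensionalityI[OF restrict_extensional])
      show "s x \<in> extensional (?V x)" using sc[OF x] by (simp add: tensor_sheaf_def sheafify_simps)
     qed (use agree[OF x] in \<open>simp add: u_def\<close>)
     then show "\<exists>W. openin X W \<and> W \<subseteq> V \<and> x \<in> W \<and> restrict u W \<in> sec (sheafify X \<O> PF) W"
      using sc[OF x] oV[OF x] unfolding tensor_sheaf_def by (intro exI[of _ "?V x"]) simp
    qed
    have "t = restrict u (V \<inter> Y)"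
    proof (rule extensionalityI[OF _ restrict_extensional])
     show "t \<in> extensional (V \<inter> Y)" using t by (simp add: tensor_sheaf_def sheafify_simps)
     fix x assume x: "x \<in> V \<inter> Y"
     then have "x \<in> ?V x \<inter> Y" using oV by auto
     then show "t x = restrict u (V \<inter> Y) x" using x fun_cong[OF st, of x x] by (simp add: u_def)
    qed
    then show "t \<in> (%s. restrict s (V \<inter> Y)) ` sec GF V" using u by blast
   qed
  qed
 qed
qed

text \<open>The natural maps over \<open>X\<close> and \<open>Y\<close> and the two restrictions
  form a commuting square. Three sides are bijective, so the fourth, restriction of sections of
  \<open>GE\<close>, is bijective too, and both inverses in the definition of the correspondence are
  genuine.\<close>

theorem hom_to_tensor_end_bij:
 assumes Y: "openin X (topspace X - singularity_set X \<O> F)"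
  and ext: "!!V. openin X V ==> bij_betw (restr F V (V \<inter> (topspace X - singularity_set X \<O> F)))
    (sec F V) (sec F (V \<inter> (topspace X - singularity_set X \<O> F)))"
 shows "bij_betw (hom_to_tensor_end X \<O> A F) (sheaf_hom X \<O> F GF (topspace X)) (sec GE (topspace X))"
proof -
 define Y where "Y = topspace X - singularity_set X \<O> F"
 have oY: "openin X Y" and YX: "topspace X \<inter> Y = Y" "Y \<subseteq> topspace X" using Y by (auto simp: Y_def)
 have oX: "openin X (topspace X)" by simp
 let ?rH = "%\<phi>. restrict \<phi> (opens_in X Y)" and ?rE = "%c. restrict c Y"
 have H: "bij_betw ?rH (sheaf_hom X \<O> F GF (topspace X)) (sheaf_hom X \<O> F GF Y)"
 proof -
  have "bij_betw (%\<phi>. restrict \<phi> (opens_in X (topspace X \<inter> Y))) (sheaf_hom X \<O> F GF (topspace X)) (sheaf_hom X \<O> F GF (topspace X \<inter> Y))"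
   by (rule hom_restr_bij[OF O Fp GF_like oY oX]) (rule GF_extension[OF oY ext[folded Y_def]])
  then show ?thesis unfolding YX .
 qed
 note NX = N_bij[OF oX] and NY = N_bij[OF oY]
 have comp: "bij_betw (the_inv_into (sec GE Y) (N Y) \<circ> (?rH \<circ> N (topspace X))) (sec GE (topspace X)) (sec GE Y)"
  by (rule bij_betw_trans[OF bij_betw_trans[OF NX H] bij_betw_the_inv_into[OF NY]])
 have eq: "(the_inv_into (sec GE Y) (N Y) \<circ> (?rH \<circ> N (topspace X))) c = ?rE c"
  if c: "c \<in> sec GE (topspace X)" for c
 proof -
  have "?rE c \<in> sec GE Y"
   using c unfolding tensor_sheaf_def by (rule sheafify_restrict_closed[OF PEp oX oY YX(2)])
  then show ?thesis
   unfolding o_apply N_restrict[OF c oX oY YX(2), symmetric]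
   by (rule the_inv_into_f_f[OF bij_betw_imp_inj_on[OF NY]])
 qed
 have E: "bij_betw ?rE (sec GE (topspace X)) (sec GE Y)"
  by (rule iffD1[OF bij_betw_cong comp]) (rule eq)
 have "bij_betw (the_inv_into (sec GE (topspace X)) ?rE \<circ> (the_inv_into (sec GE Y) (N Y) \<circ> ?rH))
   (sheaf_hom X \<O> F GF (topspace X)) (sec GE (topspace X))"
  by (rule bij_betw_trans[OF bij_betw_trans[OF H bij_betw_the_inv_into[OF NY]] bij_betw_the_inv_into[OF E]])
 moreover have "hom_to_tensor_end X \<O> A F = the_inv_into (sec GE (topspace X)) ?rE \<circ> (the_inv_into (sec GE Y) (N Y) \<circ> ?rH)"
  by (rule HOL.ext) (simp add: hom_to_tensor_end_def Let_def Y_def[symmetric] hom_sheaf_simps GF_restr[abs_def] sheafify_def tensor_sheaf_def)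
 ultimately show ?thesis by simp
qed

end

section \<open>Functions and forms on a complex manifold\<close>

lemma partial_deriv_cong:
 assumes "cs_open n S" "z \<in> S" "i < n" "!!z. z \<in> S ==> f z = g z"
 shows "partial_deriv i f z = partial_deriv i g z"
 unfolding partial_deriv_def
proof (rule deriv_cong_ev)
 show "\<forall>\<^sub>F t in nhds (z i). f (z(i := t)) = g (z(i := t))"
  using eventually_slice[OF assms(1-3)] by eventually_elim (rule assms(4))
qed simp

lemma multi_indices_finite: "finite (multi_indices n k)"
 using finite_lists_length_eq[of "{..<n}" k] by (simp add: multi_indices_def conj_commute)

lemma multi_indices_nth: "l \<in> multi_indices n k ==> q < k ==> l ! q < n"
 by (auto simp: multi_indices_def subset_iff)

lemma multi_indices_length: "l \<in> multi_indices n k ==> length l = k"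
 by (simp add: multi_indices_def)

lemma multi_indices_permute:
 assumes "p permutes {..<k}" "l \<in> multi_indices n k"
 shows "permute_list p l \<in> multi_indices n k"
 using assms by (simp add: multi_indices_def)

text \<open>Expansion of a product of sums. It splits a sum over multi-indices in the transformation
  law of forms into one sum for each argument.\<close>

lemma sum_prod_multi_indices:
 fixes h :: "nat => nat => complex"
 shows "(\<Sum>m\<in>multi_indices n k. \<Prod>q<k. h q (m ! q)) = (\<Prod>q<k. \<Sum>j<n. h q j)"
proof (induction k arbitrary: h)
 case 0
 have "multi_indices n 0 = {[]}" by (auto simp: multi_indices_def)
 then show ?case by simp
next
 case (Suc k)
 have eq: "multi_indices n (Suc k) = (%(j, l). j # l) ` ({..<n} \<times> multi_indices n k)"
 proof (intro equalityI subsetI)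
  fix m assume "m \<in> multi_indices n (Suc k)"
  then show "m \<in> (%(j, l). j # l) ` ({..<n} \<times> multi_indices n k)"
   by (cases m) (auto simp: multi_indices_def)
 qed (auto simp: multi_indices_def)
 have inj: "inj_on (%(j, l). j # l) ({..<n} \<times> multi_indices n k)" by (auto simp: inj_on_def)
 have "(\<Sum>m\<in>multi_indices n (Suc k). \<Prod>q<Suc k. h q (m ! q))
   = (\<Sum>(j, l)\<in>{..<n} \<times> multi_indices n k. h 0 j * (\<Prod>q<k. h (Suc q) (l ! q)))"
  unfolding eq by (subst sum.reindex[OF inj]) (simp add: split_beta prod.lessThan_Suc_shift del: prod.lessThan_Suc)
 also have "\<dots> = (\<Sum>j<n. h 0 j) * (\<Sum>l\<in>multi_indices n k. \<Prod>q<k. h (Suc q) (l ! q))"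
  by (simp add: sum.cartesian_product[symmetric] sum_product)
 also have "\<dots> = (\<Prod>q<Suc k. \<Sum>j<n. h q j)"
  by (simp only: Suc[of "%q. h (Suc q)"] prod.lessThan_Suc_shift)
 finally show ?case .
qed

section \<open>Holomorphic functions on a complex manifold\<close>

locale cmanifold =
 fixes X :: "'p topology" and \<A> :: "'p chart set"
 assumes manifold: "complex_manifold X \<A>"
begin

abbreviation "\<O> \<equiv> holomorphic_sheaf X \<A>"

text \<open>\<open>chart_map\<close> is a total function, so preimages are cut down to the domain of
  the chart.\<close>

definition chart_pre :: "'p chart => (nat => complex) set => 'p set" where
 "chart_pre c W = {p \<in> chart_dom c. chart_map c p \<in> W}"

lemma chart: "c \<in> \<A> ==> is_chart X c" using manifold by (simp add: complex_manifold_def)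

lemma chart_open: "c \<in> \<A> ==> openin X (chart_dom c)" using chart by (simp add: is_chart_def)

lemma chart_cover: "x \<in> topspace X ==> \<exists>c\<in>\<A>. x \<in> chart_dom c" using manifold by (auto simp: complex_manifold_def)

lemma chart_homeo: "c \<in> \<A> ==> homeomorphic_map (subtopology X (chart_dom c)) (top_of_set (chart_map c ` chart_dom c)) (chart_map c)"
 using chart by (simp add: is_chart_def)

lemma chart_inj: assumes "c \<in> \<A>" shows "inj_on (chart_map c) (chart_dom c)"
proof -
 have "topspace (subtopology X (chart_dom c)) = chart_dom c"
  using openin_subset[OF chart_open[OF assms]] by auto
 then show ?thesis using chart_homeo[OF assms] by (metis homeomorphic_imp_injective_map)
qed

lemma chart_inv_map [simp]: "c \<in> \<A> ==> x \<in> chart_dom c ==> chart_inv c (chart_map c x) = x"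
 unfolding chart_inv_def by (rule inv_into_f_f[OF chart_inj])

lemma chart_image_open:
 assumes c: "c \<in> \<A>" and U: "openin X U"
 shows "cs_open (chart_dim c) (chart_map c ` (U \<inter> chart_dom c))"
proof -
 have "openin (subtopology X (chart_dom c)) (U \<inter> chart_dom c)" using U by (auto simp: openin_subtopology)
 then have "openin (top_of_set (chart_map c ` chart_dom c)) (chart_map c ` (U \<inter> chart_dom c))"
  using homeomorphic_imp_open_map[OF chart_homeo[OF c]] by (simp add: open_map_def)
 then show ?thesis using chart[OF c] openin_trans by (auto simp: is_chart_def)
qed

lemma chart_pre_open:
 assumes c: "c \<in> \<A>" and W: "cs_open (chart_dim c) W"
 shows "openin X (chart_pre c W)"
proof -
 obtain T where T: "open T" "W = complex_space (chart_dim c) \<inter> T" using W by (rule cs_openE)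
 have "chart_map c ` chart_dom c \<subseteq> complex_space (chart_dim c)"
  using openin_imp_subset[of euclidean "complex_space (chart_dim c)" "chart_map c ` chart_dom c"] chart[OF c] by (simp add: is_chart_def)
 then have eq: "chart_pre c W = {p \<in> topspace (subtopology X (chart_dom c)). chart_map c p \<in> chart_map c ` chart_dom c \<inter> T}"
  using T openin_subset[OF chart_open[OF c]] by (auto simp: chart_pre_def)
 have "openin (subtopology X (chart_dom c)) (chart_pre c W)" unfolding eq
  by (rule openin_continuous_map_preimage[OF homeomorphic_imp_continuous_map[OF chart_homeo[OF c]]])
    (use T in \<open>auto simp: openin_open\<close>)
 then show ?thesis using openin_open_subtopology[OF chart_open[OF c]] by simp
qed

lemma transition_holomorphic:
 "c \<in> \<A> ==> d \<in> \<A> ==> j < chart_dim d ==>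
   hol (chart_dim c) (chart_map c ` (chart_dom c \<inter> chart_dom d)) (%z. chart_map d (chart_inv c z) j)"
 using manifold by (simp add: complex_manifold_def)

lemma holomorphic_iff: "f \<in> sec \<O> U \<longleftrightarrow> f \<in> extensional U \<and> (\<forall>c\<in>\<A>.
   hol (chart_dim c) (chart_map c ` (U \<inter> chart_dom c)) (f \<circ> chart_inv c))"
 by (simp add: holomorphic_sheaf_def)

text \<open>The structure sheaf asks for holomorphy in every chart. On an open set inside one chart
  domain that chart decides, since transition maps are holomorphic.\<close>

lemma holomorphic_transition:
 assumes c: "c \<in> \<A>" and d: "d \<in> \<A>" and U: "openin X U" "U \<subseteq> chart_dom c"
  and f: "hol (chart_dim c) (chart_map c ` U) (f \<circ> chart_inv c)"
 shows "hol (chart_dim d) (chart_map d ` (U \<inter> chart_dom d)) (f \<circ> chart_inv d)"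
proof -
 let ?S = "chart_map d ` (U \<inter> chart_dom d)"
 have S: "cs_open (chart_dim d) ?S" by (rule chart_image_open[OF d U(1)])
 have T: "cs_open (chart_dim c) (chart_map c ` U)" using chart_image_open[OF c U(1)] U(2) by (simp add: Int_absorb2)
 have "hol (chart_dim d) ?S (%z. (f \<circ> chart_inv c) (chart_map c (chart_inv d z)))"
 proof (rule hol_compose[OF S T f])
  fix j assume "j < chart_dim c"
  from transition_holomorphic[OF d c this]
  show "hol (chart_dim d) ?S (%z. chart_map c (chart_inv d z) j)"
   by (rule hol_subset) (use U in auto)
 next
  fix z assume "z \<in> ?S"
  then show "chart_map c (chart_inv d z) \<in> chart_map c ` U" using d by auto
 qed
 then show ?thesis
  by (rule hol_cong[OF _ S]) (use c d U in auto)
qed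

lemma holomorphic_chartI:
 assumes c: "c \<in> \<A>" and U: "openin X U" "U \<subseteq> chart_dom c" and f: "f \<in> extensional U"
  "hol (chart_dim c) (chart_map c ` U) (f \<circ> chart_inv c)"
 shows "f \<in> sec \<O> U"
 using holomorphic_transition[OF c _ U f(2)] f(1) by (simp add: holomorphic_iff)

lemma holomorphic_cong_on:
 assumes "c \<in> \<A>" "openin X U" "hol (chart_dim c) (chart_map c ` (U \<inter> chart_dom c)) (f \<circ> chart_inv c)"
  "!!x. x \<in> U \<inter> chart_dom c ==> f x = g x"
 shows "hol (chart_dim c) (chart_map c ` (U \<inter> chart_dom c)) (g \<circ> chart_inv c)"
 by (rule hol_cong[OF assms(3) chart_image_open[OF assms(1,2)]]) (use assms in auto)

lemma holomorphic_restrict: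
 assumes "openin X V" "V \<subseteq> U" "f \<in> sec \<O> U"
 shows "restrict f V \<in> sec \<O> V"
 unfolding holomorphic_iff
proof (intro conjI ballI)
 fix c assume c: "c \<in> \<A>"
 have "hol (chart_dim c) (chart_map c ` (V \<inter> chart_dom c)) (f \<circ> chart_inv c)"
  using assms(2,3) c unfolding holomorphic_iff by (meson hol_subset image_mono Int_mono order_refl)
 then show "hol (chart_dim c) (chart_map c ` (V \<inter> chart_dom c)) (restrict f V \<circ> chart_inv c)"
  by (rule holomorphic_cong_on[OF c assms(1)]) auto
qed simp

lemma holomorphic_local:
 assumes f: "f \<in> extensional U" and U: "openin X U"
  and loc: "!!x. x \<in> U ==> \<exists>V. openin X V \<and> V \<subseteq> U \<and> x \<in> V \<and> restrict f V \<in> sec \<O> V"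
 shows "f \<in> sec \<O> U"
 unfolding holomorphic_iff
proof (intro conjI ballI f)
 fix c assume c: "c \<in> \<A>"
 show "hol (chart_dim c) (chart_map c ` (U \<inter> chart_dom c)) (f \<circ> chart_inv c)"
 proof (rule hol_local[OF chart_image_open[OF c U]])
  fix z assume "z \<in> chart_map c ` (U \<inter> chart_dom c)"
  then obtain x where x: "x \<in> U" "x \<in> chart_dom c" "z = chart_map c x" by auto
  obtain V where V: "openin X V" "V \<subseteq> U" "x \<in> V" "restrict f V \<in> sec \<O> V" using loc[OF x(1)] by auto
  have "hol (chart_dim c) (chart_map c ` (V \<inter> chart_dom c)) (restrict f V \<circ> chart_inv c)"
   using V(4) c by (simp add: holomorphic_iff)
  then have "hol (chart_dim c) (chart_map c ` (V \<inter> chart_dom c)) (f \<circ> chart_inv c)"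
   by (rule holomorphic_cong_on[OF c V(1)]) auto
  then show "\<exists>T. cs_open (chart_dim c) T \<and> z \<in> T \<and> hol (chart_dim c) T (f \<circ> chart_inv c)"
   using chart_image_open[OF c V(1)] x V(3) by (intro exI[of _ "chart_map c ` (V \<inter> chart_dom c)"]) auto
 qed
qed

lemma O_simps:
 "add (Sc \<O> U) f g = (\<lambda>x\<in>U. f x + g x)" "mult (Sc \<O> U) f g = (\<lambda>x\<in>U. f x * g x)"
 "zero (Sc \<O> U) = (\<lambda>x\<in>U. 0)" "one (Sc \<O> U) = (\<lambda>x\<in>U. 1)" "restr \<O> U V f = restrict f V"
 by (simp_all add: holomorphic_sheaf_def)

lemma O_closed:
 assumes U: "openin X U"
 shows "f \<in> sec \<O> U ==> g \<in> sec \<O> U ==> (\<lambda>x\<in>U. f x + g x) \<in> sec \<O> U"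
  "f \<in> sec \<O> U ==> g \<in> sec \<O> U ==> (\<lambda>x\<in>U. f x * g x) \<in> sec \<O> U"
  "(\<lambda>x\<in>U. k) \<in> sec \<O> U"
  "f \<in> sec \<O> U ==> g \<in> sec \<O> U ==> (!!x. x \<in> U ==> g x ~= 0) ==>
    (\<lambda>x\<in>U. f x / g x) \<in> sec \<O> U"
proof -
 have I: "(\<lambda>x\<in>U. h x) \<in> sec \<O> U"
  if "!!c. c \<in> \<A> ==> hol (chart_dim c) (chart_map c ` (U \<inter> chart_dom c)) (%z. h (chart_inv c z))" for h
  unfolding holomorphic_iff
 proof (intro conjI ballI)
  fix c assume c: "c \<in> \<A>"
  show "hol (chart_dim c) (chart_map c ` (U \<inter> chart_dom c)) ((\<lambda>x\<in>U. h x) \<circ> chart_inv c)"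
   by (rule holomorphic_cong_on[OF c U, of h]) (use that[OF c] in \<open>auto simp: o_def\<close>)
 qed simp
 have D: "hol (chart_dim c) (chart_map c ` (U \<inter> chart_dom c)) (%z. f (chart_inv c z))"
  if "f \<in> sec \<O> U" "c \<in> \<A>" for f c using that by (simp add: holomorphic_iff o_def)
 show "f \<in> sec \<O> U ==> g \<in> sec \<O> U ==> (\<lambda>x\<in>U. f x + g x) \<in> sec \<O> U"
  by (intro I hol_add D)
 show "f \<in> sec \<O> U ==> g \<in> sec \<O> U ==> (\<lambda>x\<in>U. f x * g x) \<in> sec \<O> U"
  by (intro I hol_mult D)
 show "(\<lambda>x\<in>U. k) \<in> sec \<O> U" by (intro I hol_const)
 assume fg: "f \<in> sec \<O> U" "g \<in> sec \<O> U" "!!x. x \<in> U ==> g x ~= 0"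
 show "(\<lambda>x\<in>U. f x / g x) \<in> sec \<O> U"
  by (intro I hol_divide D fg) (use fg(3) in auto)
qed

lemma O_ext: "f \<in> sec \<O> U ==> f \<in> extensional U" by (simp add: holomorphic_iff)

lemma O_cring: assumes U: "openin X U" shows "cring (Sc \<O> U)"
proof (rule cringI)
 note cl = O_closed[OF U]
 have e: "f = (\<lambda>x\<in>U. f x)" if "f \<in> sec \<O> U" for f using O_ext[OF that] by (simp add: extensional_restrict)
 show "abelian_group (Sc \<O> U)"
 proof (rule abelian_groupI; unfold O_simps)
  fix f assume f: "f \<in> sec \<O> U"
  show "(\<lambda>x\<in>U. (\<lambda>x\<in>U. 0) x + f x) = f" by (subst (2) e[OF f]) (simp cong: restrict_cong)
  have "(\<lambda>x\<in>U. (\<lambda>x\<in>U. - 1) x * f x) \<in> sec \<O> U" by (rule cl(2)[OF cl(3) f])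
  then show "\<exists>g\<in>sec \<O> U. (\<lambda>x\<in>U. g x + f x) = (\<lambda>x\<in>U. 0)" by (rule bexI[rotated]) (simp cong: restrict_cong)
 qed (use cl in \<open>auto simp: fun_eq_iff\<close>)
 show "Group.comm_monoid (Sc \<O> U)"
 proof (rule comm_monoidI; unfold O_simps)
  fix f assume f: "f \<in> sec \<O> U"
  show "(\<lambda>x\<in>U. (\<lambda>x\<in>U. 1) x * f x) = f" by (subst (2) e[OF f]) (simp cong: restrict_cong)
 qed (use cl in \<open>auto simp: fun_eq_iff\<close>)
qed (auto simp: O_simps fun_eq_iff algebra_simps)

lemma O_presheaf: "ring_presheaf X \<O>"
 unfolding ring_presheaf_def
proof (intro conjI allI impI ballI funcsetI; (elim conjE)?)
 show "cring (Sc \<O> U)" if "openin X U" for U by (rule O_cring[OF that])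
 show "restr \<O> U V f \<in> sec \<O> V" if "openin X V" "V \<subseteq> U" "f \<in> sec \<O> U" for U V f
  unfolding O_simps by (rule holomorphic_restrict[OF that])
 show "restr \<O> U U f = f" if "f \<in> sec \<O> U" for U f
  unfolding O_simps by (rule extensional_restrict[OF O_ext[OF that]])
qed (auto simp: O_simps fun_eq_iff)

text \<open>On a triple overlap the transition from \<open>c\<close> to \<open>e\<close> factors
  through \<open>d\<close>. This cocycle rule makes families of components compatible.\<close>

lemma jacobian_chain:
 assumes c: "c \<in> \<A>" and d: "d \<in> \<A>" and c0: "e \<in> \<A>" and x: "x \<in> chart_dom c" "x \<in> chart_dom d" "x \<in> chart_dom e"
  and i: "i < chart_dim e" and j: "j < chart_dim c"
 shows "jac c e i j x = (\<Sum>t<chart_dim d. jac d e i t x * jac c d t j x)"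
proof -
 let ?U = "chart_dom d \<inter> chart_dom e"
 let ?S = "chart_map c ` (?U \<inter> chart_dom c)" and ?T = "chart_map d ` (chart_dom d \<inter> chart_dom e)"
 have oU: "openin X ?U" using chart_open d c0 by blast
 have S: "cs_open (chart_dim c) ?S" by (rule chart_image_open[OF c oU])
 have T: "cs_open (chart_dim d) ?T" using chart_image_open[OF d oU] by (simp add: Int_commute Int_left_commute Int_assoc)
 have xS: "chart_map c x \<in> ?S" using x by auto
 have "jac c e i j x = partial_deriv j (%z. chart_map e (chart_inv d (chart_map d (chart_inv c z))) i) (chart_map c x)"
  unfolding transition_jacobian_def by (rule partial_deriv_cong[OF S xS j]) (use c d in auto)
 also have "\<dots> = (\<Sum>t<chart_dim d. partial_deriv t (%z. chart_map e (chart_inv d z) i) (chart_map d (chart_inv c (chart_map c x)))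
    * partial_deriv j (%z. chart_map d (chart_inv c z) t) (chart_map c x))"
 proof (rule partial_deriv_compose[OF S T transition_holomorphic[OF d c0 i] _ _ xS j])
  fix t assume "t < chart_dim d"
  from transition_holomorphic[OF c d this]
  show "hol (chart_dim c) ?S (%z. chart_map d (chart_inv c z) t)"
   by (rule hol_subset) auto
 next
  fix z assume "z \<in> ?S" then show "chart_map d (chart_inv c z) \<in> ?T" using c by auto
 qed
 finally show ?thesis using c x by (simp add: transition_jacobian_def)
qed

lemma jacobian_holomorphic:
 assumes c: "c \<in> \<A>" and d: "d \<in> \<A>" and i: "i < chart_dim d" and j: "j < chart_dim c" and U: "openin X U" "U \<subseteq> chart_dom d"
 shows "hol (chart_dim c) (chart_map c ` (U \<inter> chart_dom c)) (jac c d i j \<circ> chart_inv c)"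
proof -
 have S: "cs_open (chart_dim c) (chart_map c ` (chart_dom c \<inter> chart_dom d))"
  using chart_image_open[OF c chart_open[OF d]] by (simp add: Int_commute)
 have "hol (chart_dim c) (chart_map c ` (chart_dom c \<inter> chart_dom d)) (partial_deriv j (%z. chart_map d (chart_inv c z) i))"
  by (rule hol_partial_deriv[OF S transition_holomorphic[OF c d i] j])
 then have "hol (chart_dim c) (chart_map c ` (U \<inter> chart_dom c)) (partial_deriv j (%z. chart_map d (chart_inv c z) i))"
  by (rule hol_subset) (use U in auto)
 then show ?thesis
  by (rule hol_cong[OF _ chart_image_open[OF c U(1)]]) (use c in \<open>auto simp: transition_jacobian_def\<close>)
qed

section \<open>Holomorphic forms and their local dual bases\<close>

context
 fixes k :: nat
begin

abbreviation "\<Omega> \<equiv> form_sheaf X \<A> k"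
abbreviation "MI c \<equiv> multi_indices (chart_dim c) k"

lemma formD:
 assumes "\<omega> \<in> sec \<Omega> U"
 shows "\<omega> \<in> extensional \<A>" "c \<in> \<A> ==> \<omega> c \<in> extensional (MI c)"
  "c \<in> \<A> ==> l \<in> MI c ==> \<omega> c l \<in> extensional (U \<inter> chart_dom c)"
  "c \<in> \<A> ==> l \<in> MI c ==> hol (chart_dim c) (chart_map c ` (U \<inter> chart_dom c)) (\<omega> c l \<circ> chart_inv c)"
  "c \<in> \<A> ==> l \<in> MI c ==> p permutes {..<k} ==> x \<in> U ==> x \<in> chart_dom c ==> \<omega> c (permute_list p l) x = of_int (sign p) * \<omega> c l x"
  "c \<in> \<A> ==> d \<in> \<A> ==> l \<in> MI c ==> x \<in> U ==> x \<in> chart_dom c ==> x \<in> chart_dom d ==>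
    \<omega> c l x = (\<Sum>m\<in>MI d. \<omega> d m x * (\<Prod>q<k. jac c d (m ! q) (l ! q) x))"
proof -
 have w: "\<omega> \<in> (\<Pi>\<^sub>E c\<in>\<A>. \<Pi>\<^sub>E l\<in>MI c. extensional (U \<inter> chart_dom c))"
  and hp: "!!c l. c \<in> \<A> ==> l \<in> MI c ==>
      hol (chart_dim c) (chart_map c ` (U \<inter> chart_dom c)) (\<omega> c l \<circ> chart_inv c) \<and>
      (\<forall>p x. p permutes {..<k} \<and> x \<in> U \<inter> chart_dom c --> \<omega> c (permute_list p l) x = of_int (sign p) * \<omega> c l x)"
  and tr: "\<forall>c\<in>\<A>. \<forall>d\<in>\<A>. \<forall>l\<in>MI c. \<forall>x\<in>U \<inter> chart_dom c \<inter> chart_dom d.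
    \<omega> c l x = (\<Sum>m\<in>MI d. \<omega> d m x * (\<Prod>q<k. jac c d (m ! q) (l ! q) x))"
  using assms unfolding form_sheaf_def holomorphic_forms_def by simp_all
 show "\<omega> \<in> extensional \<A>" using w by (simp add: PiE_def)
 show "c \<in> \<A> ==> \<omega> c \<in> extensional (MI c)" using PiE_mem[OF w] by (simp add: PiE_def)
 show "c \<in> \<A> ==> l \<in> MI c ==> \<omega> c l \<in> extensional (U \<inter> chart_dom c)" using PiE_mem[OF PiE_mem[OF w]] .
 show "c \<in> \<A> ==> l \<in> MI c ==> hol (chart_dim c) (chart_map c ` (U \<inter> chart_dom c)) (\<omega> c l \<circ> chart_inv c)"
  using hp by simp
 show "c \<in> \<A> ==> l \<in> MI c ==> p permutes {..<k} ==> x \<in> U ==> x \<in> chart_dom c ==> \<omega> c (permute_list p l) x = of_int (sign p) * \<omega> c l x"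
  using hp by simp
 show "c \<in> \<A> ==> d \<in> \<A> ==> l \<in> MI c ==> x \<in> U ==> x \<in> chart_dom c ==> x \<in> chart_dom d ==>
    \<omega> c l x = (\<Sum>m\<in>MI d. \<omega> d m x * (\<Prod>q<k. jac c d (m ! q) (l ! q) x))"
  by (rule tr[rule_format]) simp_all
qed

lemma formI:
 assumes "!!c l. c \<in> \<A> ==> l \<in> MI c ==> hol (chart_dim c) (chart_map c ` (U \<inter> chart_dom c)) (%z. w c l (chart_inv c z))"
  "!!c l p x. c \<in> \<A> ==> l \<in> MI c ==> p permutes {..<k} ==> x \<in> U ==> x \<in> chart_dom c ==> w c (permute_list p l) x = of_int (sign p) * w c l x"
  "!!c d l x. c \<in> \<A> ==> d \<in> \<A> ==> l \<in> MI c ==> x \<in> U ==> x \<in> chart_dom c ==> x \<in> chart_dom d ==>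
    w c l x = (\<Sum>m\<in>MI d. w d m x * (\<Prod>q<k. jac c d (m ! q) (l ! q) x))" and U: "openin X U"
 shows "(\<lambda>c\<in>\<A>. \<lambda>l\<in>MI c. \<lambda>x\<in>U \<inter> chart_dom c. w c l x) \<in> sec \<Omega> U"
proof -
 have h: "hol (chart_dim c) (chart_map c ` (U \<inter> chart_dom c)) ((\<lambda>x\<in>U \<inter> chart_dom c. w c l x) \<circ> chart_inv c)"
  if "c \<in> \<A>" "l \<in> MI c" for c l
  by (rule holomorphic_cong_on[OF that(1) U, of "w c l"]) (use assms(1)[OF that] in \<open>auto simp: o_def\<close>)
 show ?thesis
  unfolding form_sheaf_def holomorphic_forms_def
 proof (simp only: presheaf.simps ring.simps partial_object.simps module.simps, intro CollectI conjI ballI allI impI)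
  fix c d l x assume c: "c \<in> \<A>" "d \<in> \<A>" "l \<in> MI c" "x \<in> U \<inter> chart_dom c \<inter> chart_dom d"
  have "w c l x = (\<Sum>m\<in>MI d. w d m x * (\<Prod>q<k. jac c d (m ! q) (l ! q) x))"
   by (rule assms(3)) (use c in simp_all)
  moreover have "(\<Sum>m\<in>MI d. (\<lambda>c\<in>\<A>. \<lambda>l\<in>MI c. \<lambda>x\<in>U \<inter> chart_dom c. w c l x) d m x * (\<Prod>q<k. jac c d (m ! q) (l ! q) x))
   = (\<Sum>m\<in>MI d. w d m x * (\<Prod>q<k. jac c d (m ! q) (l ! q) x))"
   by (rule sum.cong) (use c in simp_all)
  ultimately show "(\<lambda>c\<in>\<A>. \<lambda>l\<in>MI c. \<lambda>x\<in>U \<inter> chart_dom c. w c l x) c l x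
   = (\<Sum>m\<in>MI d. (\<lambda>c\<in>\<A>. \<lambda>l\<in>MI c. \<lambda>x\<in>U \<inter> chart_dom c. w c l x) d m x * (\<Prod>q<k. jac c d (m ! q) (l ! q) x))"
   using c by simp
 qed (use h assms(2) in \<open>auto simp: multi_indices_permute\<close>)
qed

lemma form_eqI:
 assumes "\<omega> \<in> sec \<Omega> U" "\<eta> \<in> sec \<Omega> U"
  "!!c l x. c \<in> \<A> ==> l \<in> MI c ==> x \<in> U ==> x \<in> chart_dom c ==> \<omega> c l x = \<eta> c l x"
 shows "\<omega> = \<eta>"
proof (rule extensionalityI[OF formD(1)[OF assms(1)] formD(1)[OF assms(2)]])
 fix c assume c: "c \<in> \<A>"
 show "\<omega> c = \<eta> c"
 proof (rule extensionalityI[OF formD(2)[OF assms(1) c] formD(2)[OF assms(2) c]])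
  fix l assume l: "l \<in> MI c"
  show "\<omega> c l = \<eta> c l"
   by (rule extensionalityI[OF formD(3)[OF assms(1) c l] formD(3)[OF assms(2) c l]]) (use assms(3)[OF c l] in auto)
 qed
qed

lemma form_ops:
 "zero (Sc \<Omega> U) = (\<lambda>c\<in>\<A>. \<lambda>l\<in>MI c. \<lambda>x\<in>U \<inter> chart_dom c. 0)"
 "add (Sc \<Omega> U) \<omega> \<eta> = (\<lambda>c\<in>\<A>. \<lambda>l\<in>MI c. \<lambda>x\<in>U \<inter> chart_dom c. \<omega> c l x + \<eta> c l x)"
 "smult (Sc \<Omega> U) f \<omega> = (\<lambda>c\<in>\<A>. \<lambda>l\<in>MI c. \<lambda>x\<in>U \<inter> chart_dom c. f x * \<omega> c l x)"
 "restr \<Omega> U V \<omega> = (\<lambda>c\<in>\<A>. \<lambda>l\<in>MI c. \<lambda>x\<in>V \<inter> chart_dom c. \<omega> c l x)"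
 by (simp_all add: form_sheaf_def)

lemma form_val:
 assumes "c \<in> \<A>" "l \<in> MI c" "x \<in> U" "x \<in> chart_dom c"
 shows "\<zero>\<^bsub>Sc \<Omega> U\<^esub> c l x = 0" "(\<omega> \<oplus>\<^bsub>Sc \<Omega> U\<^esub> \<eta>) c l x = \<omega> c l x + \<eta> c l x"
  "(f \<odot>\<^bsub>Sc \<Omega> U\<^esub> \<omega>) c l x = f x * \<omega> c l x" "restr \<Omega> V U \<omega> c l x = \<omega> c l x"
 using assms by (simp_all add: form_ops)

lemma form_closed:
 assumes U: "openin X U"
 shows "\<zero>\<^bsub>Sc \<Omega> U\<^esub> \<in> sec \<Omega> U"
  "\<omega> \<in> sec \<Omega> U ==> \<eta> \<in> sec \<Omega> U ==> \<omega> \<oplus>\<^bsub>Sc \<Omega> U\<^esub> \<eta> \<in> sec \<Omega> U"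
  "f \<in> sec \<O> U ==> \<omega> \<in> sec \<Omega> U ==> f \<odot>\<^bsub>Sc \<Omega> U\<^esub> \<omega> \<in> sec \<Omega> U"
  "openin X V ==> V \<subseteq> U ==> \<omega> \<in> sec \<Omega> U ==> restr \<Omega> U V \<omega> \<in> sec \<Omega> V"
proof -
 show "\<zero>\<^bsub>Sc \<Omega> U\<^esub> \<in> sec \<Omega> U"
  unfolding form_ops by (rule formI[OF _ _ _ U]) (auto intro: hol_const)
 have D: "hol (chart_dim c) (chart_map c ` (U \<inter> chart_dom c)) (%z. \<omega> c l (chart_inv c z))"
  if "\<omega> \<in> sec \<Omega> U" "c \<in> \<A>" "l \<in> MI c" for \<omega> c l using formD(4)[OF that] by (simp add: o_def)
 show "\<omega> \<oplus>\<^bsub>Sc \<Omega> U\<^esub> \<eta> \<in> sec \<Omega> U"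
  if w: "\<omega> \<in> sec \<Omega> U" and e: "\<eta> \<in> sec \<Omega> U" for \<omega> \<eta>
  unfolding form_ops
 proof (rule formI[OF _ _ _ U])
  show "hol (chart_dim c) (chart_map c ` (U \<inter> chart_dom c)) (%z. \<omega> c l (chart_inv c z) + \<eta> c l (chart_inv c z))"
   if "c \<in> \<A>" "l \<in> MI c" for c l by (intro hol_add D w e that)
  show "\<omega> c (permute_list p l) x + \<eta> c (permute_list p l) x = of_int (sign p) * (\<omega> c l x + \<eta> c l x)"
   if "c \<in> \<A>" "l \<in> MI c" "p permutes {..<k}" "x \<in> U" "x \<in> chart_dom c" for c l p x
   unfolding formD(5)[OF w that] formD(5)[OF e that] by (simp add: algebra_simps)
  show "\<omega> c l x + \<eta> c l x = (\<Sum>m\<in>MI d. (\<omega> d m x + \<eta> d m x) * (\<Prod>q<k. jac c d (m ! q) (l ! q) x))"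
   if "c \<in> \<A>" "d \<in> \<A>" "l \<in> MI c" "x \<in> U" "x \<in> chart_dom c" "x \<in> chart_dom d" for c d l x
   unfolding formD(6)[OF w that] formD(6)[OF e that] by (simp add: distrib_right sum.distrib)
 qed
 show "f \<odot>\<^bsub>Sc \<Omega> U\<^esub> \<omega> \<in> sec \<Omega> U"
  if f: "f \<in> sec \<O> U" and w: "\<omega> \<in> sec \<Omega> U" for f \<omega>
  unfolding form_ops
 proof (rule formI[OF _ _ _ U])
  show "hol (chart_dim c) (chart_map c ` (U \<inter> chart_dom c)) (%z. f (chart_inv c z) * \<omega> c l (chart_inv c z))"
   if "c \<in> \<A>" "l \<in> MI c" for c l
   by (rule hol_mult[OF _ D[OF w that]]) (use f that in \<open>simp add: holomorphic_iff o_def\<close>)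
  show "f x * \<omega> c (permute_list p l) x = of_int (sign p) * (f x * \<omega> c l x)"
   if "c \<in> \<A>" "l \<in> MI c" "p permutes {..<k}" "x \<in> U" "x \<in> chart_dom c" for c l p x
   unfolding formD(5)[OF w that] by (simp add: algebra_simps)
  show "f x * \<omega> c l x = (\<Sum>m\<in>MI d. (f x * \<omega> d m x) * (\<Prod>q<k. jac c d (m ! q) (l ! q) x))"
   if "c \<in> \<A>" "d \<in> \<A>" "l \<in> MI c" "x \<in> U" "x \<in> chart_dom c" "x \<in> chart_dom d" for c d l x
   unfolding formD(6)[OF w that] by (simp add: sum_distrib_left mult.assoc)
 qed
 show "restr \<Omega> U V \<omega> \<in> sec \<Omega> V"
  if V: "openin X V" "V \<subseteq> U" and w: "\<omega> \<in> sec \<Omega> U" for \<omega> V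
  unfolding form_ops
 proof (rule formI[OF _ _ _ V(1)])
  show "hol (chart_dim c) (chart_map c ` (V \<inter> chart_dom c)) (%z. \<omega> c l (chart_inv c z))"
   if "c \<in> \<A>" "l \<in> MI c" for c l
   by (rule hol_subset[OF D[OF w that]]) (use V in auto)
  show "\<omega> c (permute_list p l) x = of_int (sign p) * \<omega> c l x"
   if "c \<in> \<A>" "l \<in> MI c" "p permutes {..<k}" "x \<in> V" "x \<in> chart_dom c" for c l p x
   using formD(5)[OF w that(1-3) _ that(5)] that V by blast
  show "\<omega> c l x = (\<Sum>m\<in>MI d. \<omega> d m x * (\<Prod>q<k. jac c d (m ! q) (l ! q) x))"
   if "c \<in> \<A>" "d \<in> \<A>" "l \<in> MI c" "x \<in> V" "x \<in> chart_dom c" "x \<in> chart_dom d" for c d l x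
   using formD(6)[OF w that(1-3) _ that(5,6)] that V by blast
 qed
qed

lemma form_module: assumes U: "openin X U" shows "module (Sc \<O> U) (Sc \<Omega> U)"
proof (rule moduleI)
 note cl = form_closed[OF U] and oc = O_closed[OF U]
 interpret R: cring "Sc \<O> U" by (rule O_cring[OF U])
 show "cring (Sc \<O> U)" by (rule O_cring[OF U])
 show "abelian_group (Sc \<Omega> U)"
 proof (rule abelian_groupI)
  fix \<omega> assume w: "\<omega> \<in> sec \<Omega> U"
  show "\<zero>\<^bsub>Sc \<Omega> U\<^esub> \<oplus>\<^bsub>Sc \<Omega> U\<^esub> \<omega> = \<omega>" by (rule form_eqI[OF cl(2)[OF cl(1) w] w]) (simp add: form_val)
  have n: "(\<lambda>x\<in>U. - 1) \<odot>\<^bsub>Sc \<Omega> U\<^esub> \<omega> \<in> sec \<Omega> U" by (rule cl(3)[OF oc(3) w])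
  have "(\<lambda>x\<in>U. - 1) \<odot>\<^bsub>Sc \<Omega> U\<^esub> \<omega> \<oplus>\<^bsub>Sc \<Omega> U\<^esub> \<omega> = \<zero>\<^bsub>Sc \<Omega> U\<^esub>"
   by (rule form_eqI[OF cl(2)[OF n w] cl(1)]) (simp add: form_val)
  then show "\<exists>\<eta>\<in>sec \<Omega> U. \<eta> \<oplus>\<^bsub>Sc \<Omega> U\<^esub> \<omega> = \<zero>\<^bsub>Sc \<Omega> U\<^esub>" using n by (rule bexI)
  fix \<eta> assume e: "\<eta> \<in> sec \<Omega> U"
  show "\<omega> \<oplus>\<^bsub>Sc \<Omega> U\<^esub> \<eta> = \<eta> \<oplus>\<^bsub>Sc \<Omega> U\<^esub> \<omega>" by (rule form_eqI[OF cl(2)[OF w e] cl(2)[OF e w]]) (simp add: form_val)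
  fix \<theta> assume t: "\<theta> \<in> sec \<Omega> U"
  show "\<omega> \<oplus>\<^bsub>Sc \<Omega> U\<^esub> \<eta> \<oplus>\<^bsub>Sc \<Omega> U\<^esub> \<theta> = \<omega> \<oplus>\<^bsub>Sc \<Omega> U\<^esub> (\<eta> \<oplus>\<^bsub>Sc \<Omega> U\<^esub> \<theta>)"
   by (rule form_eqI[OF cl(2)[OF cl(2)[OF w e] t] cl(2)[OF w cl(2)[OF e t]]]) (simp add: form_val)
 qed (use cl in auto)
 fix f \<omega> assume f: "f \<in> sec \<O> U" and w: "\<omega> \<in> sec \<Omega> U"
 show "f \<odot>\<^bsub>Sc \<Omega> U\<^esub> \<omega> \<in> sec \<Omega> U" by (rule cl(3)[OF f w])
 show "f \<odot>\<^bsub>Sc \<Omega> U\<^esub> (\<omega> \<oplus>\<^bsub>Sc \<Omega> U\<^esub> \<eta>) = f \<odot>\<^bsub>Sc \<Omega> U\<^esub> \<omega> \<oplus>\<^bsub>Sc \<Omega> U\<^esub> f \<odot>\<^bsub>Sc \<Omega> U\<^esub> \<eta>"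
  if e: "\<eta> \<in> sec \<Omega> U" for \<eta>
  by (rule form_eqI[OF cl(3)[OF f cl(2)[OF w e]] cl(2)[OF cl(3)[OF f w] cl(3)[OF f e]]]) (simp add: form_val distrib_left)
 fix g assume g: "g \<in> sec \<O> U"
 show "(f \<oplus>\<^bsub>Sc \<O> U\<^esub> g) \<odot>\<^bsub>Sc \<Omega> U\<^esub> \<omega> = f \<odot>\<^bsub>Sc \<Omega> U\<^esub> \<omega> \<oplus>\<^bsub>Sc \<Omega> U\<^esub> g \<odot>\<^bsub>Sc \<Omega> U\<^esub> \<omega>"
  by (rule form_eqI[OF cl(3)[OF R.a_closed[OF f g] w] cl(2)[OF cl(3)[OF f w] cl(3)[OF g w]]]) (simp add: form_val distrib_right O_simps)
 show "(f \<otimes>\<^bsub>Sc \<O> U\<^esub> g) \<odot>\<^bsub>Sc \<Omega> U\<^esub> \<omega> = f \<odot>\<^bsub>Sc \<Omega> U\<^esub> (g \<odot>\<^bsub>Sc \<Omega> U\<^esub> \<omega>)"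
  by (rule form_eqI[OF cl(3)[OF R.m_closed[OF f g] w] cl(3)[OF f cl(3)[OF g w]]]) (simp add: form_val mult.assoc O_simps)
next
 interpret R: cring "Sc \<O> U" by (rule O_cring[OF U])
 fix \<omega> assume w: "\<omega> \<in> sec \<Omega> U"
 show "\<one>\<^bsub>Sc \<O> U\<^esub> \<odot>\<^bsub>Sc \<Omega> U\<^esub> \<omega> = \<omega>"
  by (rule form_eqI[OF form_closed(3)[OF U R.one_closed w] w]) (simp add: form_val O_simps)
qed

lemma form_presheaf: "presheaf_of_modules X \<O> \<Omega>"
proof (rule presheaf_of_modulesI[OF form_module])
 show "module_like X \<O> \<Omega>"
 proof (rule module_likeI)
  fix U V \<omega> \<eta> assume UV: "openin X U" "openin X V" "V \<subseteq> U" and w: "\<omega> \<in> sec \<Omega> U" and e: "\<eta> \<in> sec \<Omega> U"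
  note cU = form_closed[OF UV(1)] and cV = form_closed[OF UV(2)]
  show "restr \<Omega> U V (\<omega> \<oplus>\<^bsub>Sc \<Omega> U\<^esub> \<eta>) = restr \<Omega> U V \<omega> \<oplus>\<^bsub>Sc \<Omega> V\<^esub> restr \<Omega> U V \<eta>"
   by (rule form_eqI[OF cU(4)[OF UV(2,3) cU(2)[OF w e]] cV(2)[OF cU(4)[OF UV(2,3) w] cU(4)[OF UV(2,3) e]]])
     (use UV(3) in \<open>simp add: form_val subsetD\<close>)
 next
  fix U V f \<omega> assume UV: "openin X U" "openin X V" "V \<subseteq> U" and f: "f \<in> sec \<O> U" and w: "\<omega> \<in> sec \<Omega> U"
  note cU = form_closed[OF UV(1)] and cV = form_closed[OF UV(2)]
  show "restr \<Omega> U V (f \<odot>\<^bsub>Sc \<Omega> U\<^esub> \<omega>) = restr \<O> U V f \<odot>\<^bsub>Sc \<Omega> V\<^esub> restr \<Omega> U V \<omega>"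
   by (rule form_eqI[OF cU(4)[OF UV(2,3) cU(3)[OF f w]] cV(3)[OF ring_presheafD(2)[OF O_presheaf UV f] cU(4)[OF UV(2,3) w]]])
     (use UV(3) in \<open>simp add: form_val subsetD O_simps\<close>)
 next
  fix U \<omega> assume U: "openin X U" and w: "\<omega> \<in> sec \<Omega> U"
  show "restr \<Omega> U U \<omega> = \<omega>" by (rule form_eqI[OF form_closed(4)[OF U U subset_refl w] w]) (simp add: form_val)
 next
  fix U V W \<omega> assume o: "openin X U" "openin X V" "openin X W" "W \<subseteq> V" "V \<subseteq> U" and w: "\<omega> \<in> sec \<Omega> U"
  have WU: "W \<subseteq> U" using o by blast
  show "restr \<Omega> V W (restr \<Omega> U V \<omega>) = restr \<Omega> U W \<omega>"
   by (rule form_eqI[OF form_closed(4)[OF o(2,3,4) form_closed(4)[OF o(1,2,5) w]] form_closed(4)[OF o(1,3) WU w]])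
     (use o(4) in \<open>simp add: form_val subsetD\<close>)
 qed (use form_closed in auto)
qed

lemma form_finsum_val:
 assumes U: "openin X U" and I: "finite I" "!!i. i \<in> I ==> w i \<in> sec \<Omega> U"
  and c: "c \<in> \<A>" "l \<in> MI c" "x \<in> U" "x \<in> chart_dom c"
 shows "(\<Oplus>\<^bsub>Sc \<Omega> U\<^esub>i\<in>I. w i) c l x = (\<Sum>i\<in>I. w i c l x)"
proof -
 interpret module "Sc \<O> U" "Sc \<Omega> U" by (rule form_module[OF U])
 show ?thesis using I
 proof (induction I rule: finite_induct)
  case empty then show ?case using form_val(1)[OF c] by simp
 next
  case (insert i I)
  then have "w \<in> I \<rightarrow> sec \<Omega> U" "w i \<in> sec \<Omega> U" by auto
  then show ?case using insert form_val(2)[OF c] by (simp add: finsum_insert)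
 qed
qed

text \<open>The wedge product of the coordinate differentials of \<open>c0\<close> with indices
  \<open>l\<close>, in determinant normalisation: its components in a chart \<open>d\<close> are
  determinants of rows and columns of the Jacobian matrix. It is 0 when an index of \<open>l\<close>
  repeats.\<close>

definition basis_form :: "'p chart => nat list => 'p chart => nat list => 'p => complex" where
 "basis_form c0 l = (\<lambda>d\<in>\<A>. \<lambda>m\<in>MI d. \<lambda>x\<in>chart_dom c0 \<inter> chart_dom d.
   \<Sum>p | p permutes {..<k}. of_int (sign p) * (\<Prod>q<k. jac d c0 (l ! p q) (m ! q) x))"

text \<open>All \<open>fact k\<close> orderings of an index set occur among the multi-indices and
  contribute equally, hence the division.\<close>

definition basis_coord :: "'p chart => nat list => 'p set => ('p chart => nat list => 'p => complex) => 'p => complex" where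
 "basis_coord c0 l = (\<lambda>W\<in>opens_in X (chart_dom c0). \<lambda>\<omega>\<in>sec \<Omega> W. \<lambda>x\<in>W. \<omega> c0 l x / fact k)"

text \<open>A permutation of the arguments is absorbed by reindexing the sum over permutations. The
  transformation law is the chain rule in each factor, once the sum over multi-indices has become a
  product of sums.\<close>

lemma basis_form_closed:
 assumes c0: "c0 \<in> \<A>" and l: "l \<in> MI c0"
 shows "basis_form c0 l \<in> sec \<Omega> (chart_dom c0)"
 unfolding basis_form_def
proof (rule formI[OF _ _ _ chart_open[OF c0]])
 have lp: "l ! p q < chart_dim c0" if "p permutes {..<k}" "q < k" for p q
  using multi_indices_nth[OF l] permutes_in_image[OF that(1), of q] that(2) by simp
 show "hol (chart_dim d) (chart_map d ` (chart_dom c0 \<inter> chart_dom d))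
   (%z. \<Sum>p | p permutes {..<k}. of_int (sign p) * (\<Prod>q<k. jac d c0 (l ! p q) (m ! q) (chart_inv d z)))"
  if d: "d \<in> \<A>" "m \<in> MI d" for d m
  by (intro hol_sum hol_mult hol_const hol_prod)
    (use jacobian_holomorphic[OF d(1) c0 lp multi_indices_nth[OF d(2)] chart_open[OF c0]] in \<open>simp add: o_def\<close>)
 fix d m x assume d: "d \<in> \<A>" and m: "m \<in> MI d" and x: "x \<in> chart_dom c0" "x \<in> chart_dom d"
 show "(\<Sum>p | p permutes {..<k}. of_int (sign p) * (\<Prod>q<k. jac d c0 (l ! p q) (permute_list s m ! q) x))
   = of_int (sign s) * (\<Sum>p | p permutes {..<k}. of_int (sign p) * (\<Prod>q<k. jac d c0 (l ! p q) (m ! q) x))"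
  if s: "s permutes {..<k}" for s
 proof -
  have pm: "permute_list s m ! q = m ! s q" if "q < k" for q
   using permute_list_nth[of s m q] s that multi_indices_length[OF m] by simp
  have "(\<Sum>p | p permutes {..<k}. of_int (sign p) * (\<Prod>q<k. jac d c0 (l ! p q) (permute_list s m ! q) x))
   = (\<Sum>p | p permutes {..<k}. of_int (sign (p \<circ> s)) * (\<Prod>q<k. jac d c0 (l ! (p \<circ> s) q) (permute_list s m ! q) x))"
   by (rule sum_permutations_compose_right[OF s])
  also have "\<dots> = (\<Sum>p | p permutes {..<k}. of_int (sign s) * (of_int (sign p) * (\<Prod>q<k. jac d c0 (l ! p q) (m ! q) x)))"
  proof (rule sum.cong[OF refl])
   fix p assume "p \<in> {p. p permutes {..<k}}"
   then have p: "p permutes {..<k}" by simp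
   have sg: "sign (p \<circ> s) = sign p * sign s" using p s by (intro sign_compose) (auto simp: permutation_permutes)
   have "(\<Prod>q<k. jac d c0 (l ! (p \<circ> s) q) (permute_list s m ! q) x)
     = (\<Prod>q<k. ((%q. jac d c0 (l ! p q) (m ! q) x) \<circ> s) q)"
    by (rule prod.cong) (auto simp: pm)
   also have "\<dots> = (\<Prod>q<k. jac d c0 (l ! p q) (m ! q) x)"
    by (rule prod.permute[OF s, symmetric])
   finally show "of_int (sign (p \<circ> s)) * (\<Prod>q<k. jac d c0 (l ! (p \<circ> s) q) (permute_list s m ! q) x)
    = of_int (sign s) * (of_int (sign p) * (\<Prod>q<k. jac d c0 (l ! p q) (m ! q) x))"
    by (simp add: sg)
  qed
  finally show ?thesis by (simp add: sum_distrib_left)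
 qed
 fix d' assume d': "d' \<in> \<A>" "x \<in> chart_dom d'"
 have "(\<Sum>m'\<in>MI d'. (\<Sum>p | p permutes {..<k}. of_int (sign p) * (\<Prod>q<k. jac d' c0 (l ! p q) (m' ! q) x))
    * (\<Prod>q<k. jac d d' (m' ! q) (m ! q) x))
   = (\<Sum>p | p permutes {..<k}. of_int (sign p) * (\<Sum>m'\<in>MI d'. \<Prod>q<k. jac d' c0 (l ! p q) (m' ! q) x * jac d d' (m' ! q) (m ! q) x))"
  unfolding sum_distrib_right sum_distrib_left by (subst sum.swap) (simp add: prod.distrib mult.assoc)
 also have "\<dots> = (\<Sum>p | p permutes {..<k}. of_int (sign p) * (\<Prod>q<k. jac d c0 (l ! p q) (m ! q) x))"
 proof (rule sum.cong[OF refl])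
  fix p assume "p \<in> {p. p permutes {..<k}}"
  then have p: "p permutes {..<k}" by simp
  have "(\<Sum>m'\<in>MI d'. \<Prod>q<k. jac d' c0 (l ! p q) (m' ! q) x * jac d d' (m' ! q) (m ! q) x)
    = (\<Prod>q<k. \<Sum>j<chart_dim d'. jac d' c0 (l ! p q) j x * jac d d' j (m ! q) x)"
   by (rule sum_prod_multi_indices[of "%q j. jac d' c0 (l ! p q) j x * jac d d' j (m ! q) x"])
  also have "\<dots> = (\<Prod>q<k. jac d c0 (l ! p q) (m ! q) x)"
   by (rule prod.cong[OF refl], rule jacobian_chain[symmetric])
     (use d d' c0 x lp[OF p] multi_indices_nth[OF m] in auto)
  finally show "of_int (sign p) * (\<Sum>m'\<in>MI d'. \<Prod>q<k. jac d' c0 (l ! p q) (m' ! q) x * jac d d' (m' ! q) (m ! q) x)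
   = of_int (sign p) * (\<Prod>q<k. jac d c0 (l ! p q) (m ! q) x)" by simp
 qed
 finally show "(\<Sum>p | p permutes {..<k}. of_int (sign p) * (\<Prod>q<k. jac d c0 (l ! p q) (m ! q) x))
  = (\<Sum>m'\<in>MI d'. (\<Sum>p | p permutes {..<k}. of_int (sign p) * (\<Prod>q<k. jac d' c0 (l ! p q) (m' ! q) x))
    * (\<Prod>q<k. jac d d' (m' ! q) (m ! q) x))" by simp
qed

lemma basis_coord_hom:
 assumes c0: "c0 \<in> \<A>" and l: "l \<in> MI c0"
 shows "basis_coord c0 l \<in> sheaf_hom X \<O> \<Omega> (structure_module \<O>) (chart_dom c0)"
proof (rule sheaf_homI)
 show "basis_coord c0 l \<in> extensional (opens_in X (chart_dom c0))" by (simp add: basis_coord_def)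
 fix W assume W: "openin X W" "W \<subseteq> chart_dom c0"
 have val: "basis_coord c0 l W \<omega> = (\<lambda>x\<in>W. \<omega> c0 l x / fact k)" if "\<omega> \<in> sec \<Omega> W" for \<omega>
  using W that by (simp add: basis_coord_def)
 note cl = form_closed[OF W(1)]
 have Wd: "x \<in> chart_dom c0" if "x \<in> W" for x using W that by blast
 show "basis_coord c0 l W \<in> extensional (sec \<Omega> W)" using W by (simp add: basis_coord_def)
 show "basis_coord c0 l W \<omega> \<in> sec (structure_module \<O>) W" if w: "\<omega> \<in> sec \<Omega> W" for \<omega>
 proof -
  have WW: "W \<inter> chart_dom c0 = W" using W by blast
  have "hol (chart_dim c0) (chart_map c0 ` (W \<inter> chart_dom c0)) ((%x. \<omega> c0 l x / fact k) \<circ> chart_inv c0)"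
   using formD(4)[OF w c0 l] unfolding o_def by (intro hol_divide hol_const) auto
  from holomorphic_cong_on[OF c0 W(1) this, of "\<lambda>x\<in>W. \<omega> c0 l x / fact k"]
  have "hol (chart_dim c0) (chart_map c0 ` W) ((\<lambda>x\<in>W. \<omega> c0 l x / fact k) \<circ> chart_inv c0)" by (simp add: WW)
  then show ?thesis
   unfolding val[OF w] structure_module_def using holomorphic_chartI[OF c0 W, of "\<lambda>x\<in>W. \<omega> c0 l x / fact k"] by simp
 qed
 show "basis_coord c0 l W (\<omega> \<oplus>\<^bsub>Sc \<Omega> W\<^esub> \<eta>) = basis_coord c0 l W \<omega> \<oplus>\<^bsub>Sc (structure_module \<O>) W\<^esub> basis_coord c0 l W \<eta>"
  if "\<omega> \<in> sec \<Omega> W" "\<eta> \<in> sec \<Omega> W" for \<omega> \<eta>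
  using that Wd by (auto simp: val cl(2) structure_module_def O_simps form_val(2)[OF c0 l] add_divide_distrib intro!: restrict_ext)
 show "basis_coord c0 l W (f \<odot>\<^bsub>Sc \<Omega> W\<^esub> \<omega>) = f \<odot>\<^bsub>Sc (structure_module \<O>) W\<^esub> basis_coord c0 l W \<omega>"
  if "f \<in> sec \<O> W" "\<omega> \<in> sec \<Omega> W" for \<omega> f
  using that Wd by (auto simp: val cl(3) structure_module_def O_simps form_val(3)[OF c0 l] intro!: restrict_ext)
 show "basis_coord c0 l W' (restr \<Omega> W W' \<omega>) = restr (structure_module \<O>) W W' (basis_coord c0 l W \<omega>)"
  if W': "openin X W'" "W' \<subseteq> W" and w: "\<omega> \<in> sec \<Omega> W" for W' \<omega>
 proof -
  have "W' \<subseteq> chart_dom c0" using W W' by blast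
  then have "basis_coord c0 l W' (restr \<Omega> W W' \<omega>) = (\<lambda>x\<in>W'. restr \<Omega> W W' \<omega> c0 l x / fact k)"
   using W' cl(4)[OF W' w] by (simp add: basis_coord_def)
  also have "\<dots> = restrict (\<lambda>x\<in>W. \<omega> c0 l x / fact k) W'"
   using W' Wd by (auto simp: fun_eq_iff form_val(4)[OF c0 l] subsetD)
  finally show ?thesis using val[OF w] by (simp add: structure_module_def O_simps)
 qed
qed

text \<open>Expanding the wedge products gives a double sum over multi-indices and permutations. As
  \<open>\<omega>\<close> is alternating, each sign moves into the index, every permutation
  contributes the same sum, and division by \<open>fact k\<close> leaves the law expressing the
  components in \<open>d\<close> by those in \<open>c0\<close>.\<close>

lemma form_dual_basis:
 assumes c0: "c0 \<in> \<A>"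
 shows "dual_basis X \<O> \<Omega> (chart_dom c0) (MI c0) (basis_form c0) (basis_coord c0)"
 unfolding dual_basis_def
proof (intro conjI ballI allI impI multi_indices_finite chart_open[OF c0] basis_form_closed[OF c0] basis_coord_hom[OF c0]; (elim conjE)?)
 fix W \<omega> assume W: "openin X W" "W \<subseteq> chart_dom c0" and w: "\<omega> \<in> sec \<Omega> W"
 interpret module "Sc \<O> W" "Sc \<Omega> W" by (rule form_module[OF W(1)])
 have bc: "basis_coord c0 l W \<omega> \<in> sec \<O> W" if "l \<in> MI c0" for l
  using sheaf_homD(1)[OF basis_coord_hom[OF c0 that] W w] by (simp add: structure_module_def)
 have bf: "restr \<Omega> (chart_dom c0) W (basis_form c0 l) \<in> sec \<Omega> W" if "l \<in> MI c0" for l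
  by (rule form_closed(4)[OF chart_open[OF c0] W basis_form_closed[OF c0 that]])
 have t: "basis_coord c0 l W \<omega> \<odot>\<^bsub>Sc \<Omega> W\<^esub> restr \<Omega> (chart_dom c0) W (basis_form c0 l) \<in> sec \<Omega> W" if "l \<in> MI c0" for l
  using smult_closed bc bf that by blast
 have fin: "finite (MI c0)" by (rule multi_indices_finite)
 show "\<omega> = (\<Oplus>\<^bsub>Sc \<Omega> W\<^esub>l\<in>MI c0. basis_coord c0 l W \<omega> \<odot>\<^bsub>Sc \<Omega> W\<^esub> restr \<Omega> (chart_dom c0) W (basis_form c0 l))"
 proof (rule form_eqI[OF w finsum_closed])
  fix d m x assume d: "d \<in> \<A>" and m: "m \<in> MI d" and x: "x \<in> W" "x \<in> chart_dom d"
  have x0: "x \<in> chart_dom c0" using x W by blast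
  let ?J = "%l. \<Prod>q<k. jac d c0 (l ! q) (m ! q) x"
  have "(\<Oplus>\<^bsub>Sc \<Omega> W\<^esub>l\<in>MI c0. basis_coord c0 l W \<omega> \<odot>\<^bsub>Sc \<Omega> W\<^esub> restr \<Omega> (chart_dom c0) W (basis_form c0 l)) d m x
   = (\<Sum>l\<in>MI c0. \<omega> c0 l x / fact k * (\<Sum>p | p permutes {..<k}. of_int (sign p) * (\<Prod>q<k. jac d c0 (l ! p q) (m ! q) x)))"
   by (subst form_finsum_val[OF W(1) fin _ d m x], erule t, rule sum.cong[OF refl]) (use d m x x0 W w in \<open>simp add: form_val basis_form_def basis_coord_def\<close>)
  also have "\<dots> = (\<Sum>p | p permutes {..<k}. \<Sum>l\<in>MI c0. \<omega> c0 (permute_list p l) x / fact k * ?J (permute_list p l))"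
   unfolding sum_distrib_left
  proof (subst sum.swap, intro sum.cong refl)
   fix p l assume "p \<in> {p. p permutes {..<k}}" and l: "l \<in> MI c0"
   then have p: "p permutes {..<k}" by simp
   have "?J (permute_list p l) = (\<Prod>q<k. jac d c0 (l ! p q) (m ! q) x)"
    using permute_list_nth[of p l] p multi_indices_length[OF l] by (intro prod.cong) auto
   then show "\<omega> c0 l x / fact k * (of_int (sign p) * (\<Prod>q<k. jac d c0 (l ! p q) (m ! q) x))
    = \<omega> c0 (permute_list p l) x / fact k * ?J (permute_list p l)"
    using formD(5)[OF w c0 l p x(1) x0] by simp
  qed
  also have "\<dots> = (\<Sum>p | p permutes {..<k}. \<Sum>l\<in>MI c0. \<omega> c0 l x / fact k * ?J l)"
  proof (rule sum.cong[OF refl])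
   fix p assume "p \<in> {p. p permutes {..<k}}"
   then have p: "p permutes {..<k}" by simp
   \<comment> \<open>Permuting the entries is a bijection of the finite set of multi-indices, so the
     inner sum does not depend on \<open>p\<close>.\<close>
   have inj: "inj_on (permute_list p) (MI c0)"
   proof (rule inj_onI)
    fix a b assume ab: "a \<in> MI c0" "b \<in> MI c0" "permute_list p a = permute_list p b"
    have len: "length a = k" "length b = k" using ab multi_indices_length by auto
    have "a ! q = b ! q" if "q < k" for q
    proof -
     have "inv_into UNIV p q < k" using permutes_in_image[OF permutes_inv[OF p], of q] that by simp
     then have "permute_list p a ! inv_into UNIV p q = a ! q" "permute_list p b ! inv_into UNIV p q = b ! q"
      using permute_list_nth[of p a "inv_into UNIV p q"] permute_list_nth[of p b "inv_into UNIV p q"] p len permutes_inverses(1)[OF p] by simp_all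
     then show ?thesis using ab(3) by simp
    qed
    then show "a = b" using len by (intro nth_equalityI) auto
   qed
   have "permute_list p ` MI c0 \<subseteq> MI c0" using multi_indices_permute[OF p] by blast
   then have bij: "bij_betw (permute_list p) (MI c0) (MI c0)"
    using inj endo_inj_surj[OF fin] by (simp add: bij_betw_def)
   show "(\<Sum>l\<in>MI c0. \<omega> c0 (permute_list p l) x / fact k * ?J (permute_list p l)) = (\<Sum>l\<in>MI c0. \<omega> c0 l x / fact k * ?J l)"
    by (rule sum.reindex_bij_betw[OF bij])
  qed
  also have "\<dots> = fact k * (\<Sum>l\<in>MI c0. \<omega> c0 l x / fact k * ?J l)"
   using card_permutations[of "{..<k}" k] by simp
  also have "\<dots> = (\<Sum>l\<in>MI c0. \<omega> c0 l x * ?J l)"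
   by (simp add: sum_distrib_left)
  also have "\<dots> = \<omega> d m x" using formD(6)[OF w d c0 m x x0] by simp
  finally show "\<omega> d m x = (\<Oplus>\<^bsub>Sc \<Omega> W\<^esub>l\<in>MI c0. basis_coord c0 l W \<omega> \<odot>\<^bsub>Sc \<Omega> W\<^esub> restr \<Omega> (chart_dom c0) W (basis_form c0 l)) d m x" ..
 qed (use t in auto)
qed

end

end

section \<open>Coherent sheaves and their singularities\<close>

locale manifold_module = cmanifold X \<A> for X :: "'p topology" and \<A> +
 fixes F :: "('p, 'p => complex, 'm) module_presheaf"
 assumes F: "sheaf_of_modules X \<O> F"
begin

lemma F_pre: "presheaf_of_modules X \<O> F" using F by (simp add: sheaf_of_modules_def)

lemma F_module: "openin X U ==> module (Sc \<O> U) (Sc F U)"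
 using F_pre by (simp add: presheaf_of_modules_def)

lemmas F_like = presheaf_module_like[OF F_pre]
lemmas F_restr = module_likeD(3)[OF F_like]
lemmas F_restr_add = module_likeD(4)[OF F_like]
lemmas F_restr_smult = module_likeD(5)[OF F_like]
lemmas F_restr_trans = module_likeD(7)[OF F_like]

definition lin :: "'p set => 'i set => ('i => 'p => complex) => ('i => 'm) => 'm" where
 "lin U I a s = (\<Oplus>\<^bsub>Sc F U\<^esub>i\<in>I. a i \<odot>\<^bsub>Sc F U\<^esub> s i)"

lemma lin_closed:
 assumes U: "openin X U" and a: "!!i. i \<in> I ==> a i \<in> sec \<O> U" and s: "!!i. i \<in> I ==> s i \<in> sec F U"
 shows "lin U I a s \<in> sec F U"
proof -
 interpret module "Sc \<O> U" "Sc F U" by (rule F_module[OF U])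
 show ?thesis unfolding lin_def by (rule finsum_closed) (use a s in auto)
qed

lemma lin_cong:
 assumes U: "openin X U" and b: "!!i. i \<in> I ==> b i \<in> sec \<O> U" and t: "!!i. i \<in> I ==> t i \<in> sec F U"
  and eq: "!!i. i \<in> I ==> a i = b i" "!!i. i \<in> I ==> s i = t i"
 shows "lin U I a s = lin U I b t"
proof -
 interpret module "Sc \<O> U" "Sc F U" by (rule F_module[OF U])
 show ?thesis unfolding lin_def by (rule finsum_cong') (use b t eq in auto)
qed

lemma lin_restr:
 assumes U: "openin X U" "openin X V" "V \<subseteq> U" and I: "finite I"
  and a: "!!i. i \<in> I ==> a i \<in> sec \<O> U" and s: "!!i. i \<in> I ==> s i \<in> sec F U"
 shows "restr F U V (lin U I a s) = lin V I (%i. restrict (a i) V) (%i. restr F U V (s i))"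
proof -
 interpret M: module "Sc \<O> U" "Sc F U" by (rule F_module[OF U(1)])
 interpret N: module "Sc \<O> V" "Sc F V" by (rule F_module[OF U(2)])
 have "restr F U V (lin U I a s) = (\<Oplus>\<^bsub>Sc F V\<^esub>i\<in>I. restr F U V (a i \<odot>\<^bsub>Sc F U\<^esub> s i))"
  unfolding lin_def
  by (rule additive_finsum[OF M.abelian_group_axioms N.abelian_group_axioms F_restr[OF U] F_restr_add[OF U] I])
    (use a s in auto)
 also have "\<dots> = lin V I (%i. restrict (a i) V) (%i. restr F U V (s i))"
  unfolding lin_def
 proof (rule N.finsum_cong')
  show "(%i. restrict (a i) V \<odot>\<^bsub>Sc F V\<^esub> restr F U V (s i)) \<in> I \<rightarrow> sec F V"
   using holomorphic_restrict[OF U(2,3) a] F_restr[OF U s] by auto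
  fix i assume i: "i \<in> I"
  show "restr F U V (a i \<odot>\<^bsub>Sc F U\<^esub> s i) = restrict (a i) V \<odot>\<^bsub>Sc F V\<^esub> restr F U V (s i)"
   using F_restr_smult[OF U a[OF i] s[OF i]] by (simp add: O_simps)
 qed simp
 finally show ?thesis .
qed

lemma lin_add:
 assumes U: "openin X U" and I: "finite I" and a: "!!i. i \<in> I ==> a i \<in> sec \<O> U"
  and b: "!!i. i \<in> I ==> b i \<in> sec \<O> U" and s: "!!i. i \<in> I ==> s i \<in> sec F U"
 shows "lin U I (%i. \<lambda>x\<in>U. a i x + b i x) s = lin U I a s \<oplus>\<^bsub>Sc F U\<^esub> lin U I b s"
proof -
 interpret module "Sc \<O> U" "Sc F U" by (rule F_module[OF U])
 have "lin U I (%i. \<lambda>x\<in>U. a i x + b i x) s = (\<Oplus>\<^bsub>Sc F U\<^esub>i\<in>I. a i \<odot>\<^bsub>Sc F U\<^esub> s i \<oplus>\<^bsub>Sc F U\<^esub> b i \<odot>\<^bsub>Sc F U\<^esub> s i)"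
  unfolding lin_def
 proof (rule finsum_cong')
  fix i assume i: "i \<in> I"
  show "(\<lambda>x\<in>U. a i x + b i x) \<odot>\<^bsub>Sc F U\<^esub> s i = a i \<odot>\<^bsub>Sc F U\<^esub> s i \<oplus>\<^bsub>Sc F U\<^esub> b i \<odot>\<^bsub>Sc F U\<^esub> s i"
   using smult_l_distr[OF a[OF i] b[OF i] s[OF i]] by (simp add: O_simps)
 qed (use a b s in auto)
 also have "\<dots> = lin U I a s \<oplus>\<^bsub>Sc F U\<^esub> lin U I b s"
  unfolding lin_def by (rule finsum_addf) (use a b s in auto)
 finally show ?thesis .
qed

lemma lin_smult:
 assumes U: "openin X U" and I: "finite I" and r: "r \<in> sec \<O> U"
  and a: "!!i. i \<in> I ==> a i \<in> sec \<O> U" and s: "!!i. i \<in> I ==> s i \<in> sec F U"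
 shows "lin U I (%i. \<lambda>x\<in>U. r x * a i x) s = r \<odot>\<^bsub>Sc F U\<^esub> lin U I a s"
proof -
 interpret module "Sc \<O> U" "Sc F U" by (rule F_module[OF U])
 have "lin U I (%i. \<lambda>x\<in>U. r x * a i x) s = (\<Oplus>\<^bsub>Sc F U\<^esub>i\<in>I. r \<odot>\<^bsub>Sc F U\<^esub> (a i \<odot>\<^bsub>Sc F U\<^esub> s i))"
  unfolding lin_def
 proof (rule finsum_cong')
  fix i assume i: "i \<in> I"
  show "(\<lambda>x\<in>U. r x * a i x) \<odot>\<^bsub>Sc F U\<^esub> s i = r \<odot>\<^bsub>Sc F U\<^esub> (a i \<odot>\<^bsub>Sc F U\<^esub> s i)"
   using smult_assoc1[OF r a[OF i] s[OF i]] by (simp add: O_simps)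
 qed (use r a s in auto)
 also have "\<dots> = r \<odot>\<^bsub>Sc F U\<^esub> lin U I a s"
  unfolding lin_def by (rule finsum_smult_ldistr[symmetric]) (use I r a s in auto)
 finally show ?thesis .
qed

lemma lin_insert:
 assumes U: "openin X U" and I: "finite I" "i \<notin> I" and a: "!!j. j \<in> insert i I ==> a j \<in> sec \<O> U"
  and s: "!!j. j \<in> insert i I ==> s j \<in> sec F U"
 shows "lin U (insert i I) a s = lin U I a s \<oplus>\<^bsub>Sc F U\<^esub> a i \<odot>\<^bsub>Sc F U\<^esub> s i"
proof -
 interpret module "Sc \<O> U" "Sc F U" by (rule F_module[OF U])
 have "lin U (insert i I) a s = a i \<odot>\<^bsub>Sc F U\<^esub> s i \<oplus>\<^bsub>Sc F U\<^esub> lin U I a s"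
  unfolding lin_def by (rule finsum_insert) (use I a s in auto)
 also have "\<dots> = lin U I a s \<oplus>\<^bsub>Sc F U\<^esub> a i \<odot>\<^bsub>Sc F U\<^esub> s i"
  by (rule a_comm) (use a s in \<open>auto intro!: lin_closed[OF U]\<close>)
 finally show ?thesis .
qed

lemma lin_drop_zero:
 assumes U: "openin X U" and I: "finite I" "i \<in> I" and a: "!!j. j \<in> I ==> a j \<in> sec \<O> U"
  and s: "!!j. j \<in> I ==> s j \<in> sec F U" and z: "!!x. x \<in> U ==> a i x = 0"
 shows "lin U I a s = lin U (I - {i}) a s"
proof -
 interpret module "Sc \<O> U" "Sc F U" by (rule F_module[OF U])
 have "a i = \<zero>\<^bsub>Sc \<O> U\<^esub>"
  unfolding O_simps by (rule extensionalityI[OF O_ext[OF a[OF I(2)]]]) (use z in auto)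
 then have 0: "a i \<odot>\<^bsub>Sc F U\<^esub> s i = \<zero>\<^bsub>Sc F U\<^esub>" using s[OF I(2)] by simp
 have c: "lin U (I - {i}) a s \<in> sec F U" by (rule lin_closed[OF U]) (use a s in auto)
 have "lin U (insert i (I - {i})) a s = lin U (I - {i}) a s \<oplus>\<^bsub>Sc F U\<^esub> a i \<odot>\<^bsub>Sc F U\<^esub> s i"
  by (rule lin_insert[OF U]) (use I a s in auto)
 then show ?thesis using c 0 insert_Diff[OF I(2)] by simp
qed

lemma lin_reindex:
 assumes U: "openin X U" and h: "inj_on h J" and a: "!!j. j \<in> h ` J ==> a j \<in> sec \<O> U"
  and s: "!!j. j \<in> h ` J ==> s j \<in> sec F U"
 shows "lin U (h ` J) a s = lin U J (%j. a (h j)) (%j. s (h j))"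
proof -
 interpret module "Sc \<O> U" "Sc F U" by (rule F_module[OF U])
 show ?thesis unfolding lin_def by (rule finsum_reindex[OF _ h], rule funcsetI) (rule smult_closed[OF a s])
qed

text \<open>The sections live over \<open>U\<close> but generate only at the points of
  \<open>W\<close>. The two are kept apart because later sections over a whole patch generate off a
  hypersurface of it.\<close>

definition generates :: "'p set => 'i set => ('i => 'm) => 'p set => bool" where
 "generates U I s W \<longleftrightarrow> (\<forall>V t x. openin X V \<and> V \<subseteq> W \<and> t \<in> sec F V \<and> x \<in> V -->
   (\<exists>V' a. openin X V' \<and> V' \<subseteq> V \<and> x \<in> V' \<and> (\<forall>i\<in>I. a i \<in> sec \<O> V') \<and>
    restr F V V' t = lin V' I a (%i. restr F U V' (s i))))"

lemma generatesE:
 assumes "generates U I s W" "openin X V" "V \<subseteq> W" "t \<in> sec F V" "x \<in> V"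
 obtains V' a where "openin X V'" "V' \<subseteq> V" "x \<in> V'" "\<forall>i\<in>I. a i \<in> sec \<O> V'"
  "restr F V V' t = lin V' I a (%i. restr F U V' (s i))"
proof -
 have "\<exists>V' a. openin X V' \<and> V' \<subseteq> V \<and> x \<in> V' \<and> (\<forall>i\<in>I. a i \<in> sec \<O> V') \<and>
    restr F V V' t = lin V' I a (%i. restr F U V' (s i))"
  by (rule assms(1)[unfolded generates_def, THEN spec, THEN spec, THEN spec, THEN mp]) (use assms in simp)
 then show thesis by (elim exE conjE) (rule that)
qed

lemma generates_restr:
 assumes g: "generates U I s W" and U: "openin X U" "openin X U'" "U' \<subseteq> U" "W' \<subseteq> W" "W' \<subseteq> U'"
  and s: "!!i. i \<in> I ==> s i \<in> sec F U"
 shows "generates U' I (%i. restr F U U' (s i)) W'"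
 unfolding generates_def
proof (intro allI impI; elim conjE)
 fix V t x assume V: "openin X V" "V \<subseteq> W'" and t: "t \<in> sec F V" and x: "x \<in> V"
 have "V \<subseteq> W" using V U by blast
 from generatesE[OF g V(1) this t x] obtain V' a where V': "openin X V'" "V' \<subseteq> V" "x \<in> V'" "\<forall>i\<in>I. a i \<in> sec \<O> V'"
  "restr F V V' t = lin V' I a (%i. restr F U V' (s i))" .
 have VU: "V' \<subseteq> U'" "V' \<subseteq> U" using V' V U by auto
 have "lin V' I a (%i. restr F U V' (s i)) = lin V' I a (%i. restr F U' V' (restr F U U' (s i)))"
 proof (rule lin_cong[OF V'(1)])
  fix i assume i: "i \<in> I"
  show "a i \<in> sec \<O> V'" using V' i by blast
  show "restr F U' V' (restr F U U' (s i)) \<in> sec F V'"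
   by (rule F_restr[OF U(2) V'(1) VU(1) F_restr[OF U(1-3) s[OF i]]])
  show "restr F U V' (s i) = restr F U' V' (restr F U U' (s i))"
   by (rule F_restr_trans[OF U(1,2) V'(1) VU(1) U(3) s[OF i], symmetric])
 qed simp
 then show "\<exists>V' a. openin X V' \<and> V' \<subseteq> V \<and> x \<in> V' \<and> (\<forall>i\<in>I. a i \<in> sec \<O> V') \<and>
    restr F V V' t = lin V' I a (%i. restr F U' V' (restr F U U' (s i)))"
  using V' by (intro exI[of _ V'] exI[of _ a]) simp
qed

lemma generates_reindex:
 assumes g: "generates U I s W" and U: "openin X U" "W \<subseteq> U" and h: "bij_betw h J I"
  and s: "!!i. i \<in> I ==> s i \<in> sec F U"
 shows "generates U J (%j. s (h j)) W"
 unfolding generates_def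
proof (intro allI impI; elim conjE)
 fix V t x assume V: "openin X V" "V \<subseteq> W" and t: "t \<in> sec F V" and x: "x \<in> V"
 from generatesE[OF g V t x] obtain V' a where V': "openin X V'" "V' \<subseteq> V" "x \<in> V'" "\<forall>i\<in>I. a i \<in> sec \<O> V'"
  "restr F V V' t = lin V' I a (%i. restr F U V' (s i))" .
 have I: "I = h ` J" and inj: "inj_on h J" using h by (auto simp: bij_betw_def)
 have VU: "V' \<subseteq> U" using V' V U by auto
 have "lin V' (h ` J) a (%i. restr F U V' (s i)) = lin V' J (%j. a (h j)) (%j. restr F U V' (s (h j)))"
 proof (rule lin_reindex[OF V'(1) inj])
  show "a j \<in> sec \<O> V'" if "j \<in> h ` J" for j using V'(4) that unfolding I by blast
  show "restr F U V' (s j) \<in> sec F V'" if "j \<in> h ` J" for j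
   using F_restr[OF U(1) V'(1) VU s] that unfolding I .
 qed
 moreover have "\<forall>j\<in>J. a (h j) \<in> sec \<O> V'" using V'(4) by (simp add: I)
 ultimately show "\<exists>V' a. openin X V' \<and> V' \<subseteq> V \<and> x \<in> V' \<and> (\<forall>i\<in>J. a i \<in> sec \<O> V') \<and>
    restr F V V' t = lin V' J a (%i. restr F U V' (s (h i)))"
  using V' by (intro exI[of _ V'] exI[of _ "%j. a (h j)"]) (simp add: I)
qed

text \<open>A relation whose \<open>i\<close>-th coefficient has no zero expresses \<open>s i\<close> through the other generators.\<close>

lemma generates_drop:
 assumes g: "generates U I s W" and U: "openin X U" and W: "openin X W" "W \<subseteq> U" and I: "finite I" "i0 \<in> I"
  and s: "!!i. i \<in> I ==> s i \<in> sec F U" and b: "!!i. i \<in> I ==> b i \<in> sec \<O> W"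
  and rel: "lin W I b (%i. restr F U W (s i)) = \<zero>\<^bsub>Sc F W\<^esub>" and nz: "!!x. x \<in> W ==> b i0 x ~= 0"
 shows "generates U (I - {i0}) s W"
 unfolding generates_def
proof (intro allI impI; elim conjE)
 fix V t x assume V: "openin X V" "V \<subseteq> W" and t: "t \<in> sec F V" and x: "x \<in> V"
 from generatesE[OF g V t x] obtain V' a where V': "openin X V'" "V' \<subseteq> V" "x \<in> V'" "\<forall>i\<in>I. a i \<in> sec \<O> V'"
  "restr F V V' t = lin V' I a (%i. restr F U V' (s i))" .
 have VU: "V' \<subseteq> U" "V' \<subseteq> W" using V' V W by auto
 interpret M: module "Sc \<O> V'" "Sc F V'" by (rule F_module[OF V'(1)])
 interpret N: module "Sc \<O> W" "Sc F W" by (rule F_module[OF W(1)])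
 let ?s = "%i. restr F U V' (s i)" and ?b = "%i. restrict (b i) V'"
 have s': "?s i \<in> sec F V'" if "i \<in> I" for i by (rule F_restr[OF U V'(1) VU(1) s[OF that]])
 have b': "?b i \<in> sec \<O> V'" if "i \<in> I" for i by (rule holomorphic_restrict[OF V'(1) VU(2) b[OF that]])
 have sW: "restr F U W (s i) \<in> sec F W" if "i \<in> I" for i by (rule F_restr[OF U W s[OF that]])
 have a: "a i \<in> sec \<O> V'" if "i \<in> I" for i using V'(4) that by blast
 have z: "restr F W V' \<zero>\<^bsub>Sc F W\<^esub> = \<zero>\<^bsub>Sc F V'\<^esub>"
  by (rule additive_zero[OF N.abelian_group_axioms M.abelian_group_axioms]) (use F_restr[OF W(1) V'(1) VU(2)] F_restr_add[OF W(1) V'(1) VU(2)] in auto)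
 have "lin V' I ?b (%i. restr F W V' (restr F U W (s i))) = \<zero>\<^bsub>Sc F V'\<^esub>"
  using lin_restr[OF W(1) V'(1) VU(2) I(1), of b "%i. restr F U W (s i)", OF b sW] unfolding rel z by simp
 moreover have "lin V' I ?b (%i. restr F W V' (restr F U W (s i))) = lin V' I ?b ?s"
  by (rule lin_cong[OF V'(1)]) (use b' s' F_restr_trans[OF U W(1) V'(1) VU(2) W(2) s] in auto)
 ultimately have rel': "lin V' I ?b ?s = \<zero>\<^bsub>Sc F V'\<^esub>" by simp
 \<comment> \<open>The factor by which the relation has to be multiplied so that adding it cancels
   the coefficient of \<open>s i0\<close>.\<close>
 define q where "q = (\<lambda>x\<in>V'. - 1 * (a i0 x / ?b i0 x))"
 have c1: "(\<lambda>x\<in>V'. (\<lambda>x\<in>V'. a i0 x / ?b i0 x) x * (\<lambda>x\<in>V'. - 1) x) \<in> sec \<O> V'"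
  by (intro O_closed(2)[OF V'(1)] O_closed(3)[OF V'(1)] O_closed(4)[OF V'(1)] a b' I(2)) (use nz VU(2) in auto)
 have "q = (\<lambda>x\<in>V'. (\<lambda>x\<in>V'. a i0 x / ?b i0 x) x * (\<lambda>x\<in>V'. - 1) x)" unfolding q_def by (rule restrict_ext) simp
 then have q: "q \<in> sec \<O> V'" using c1 by simp
 define d where "d = (%i. \<lambda>x\<in>V'. a i x + (\<lambda>x\<in>V'. q x * ?b i x) x)"
 have qb: "(\<lambda>x\<in>V'. q x * ?b i x) \<in> sec \<O> V'" if "i \<in> I" for i by (rule O_closed(2)[OF V'(1) q b'[OF that]])
 have d: "d i \<in> sec \<O> V'" if "i \<in> I" for i
  unfolding d_def by (rule O_closed(1)[OF V'(1) a[OF that] qb[OF that]])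
 have la: "lin V' I a ?s \<in> sec F V'" by (rule lin_closed[OF V'(1) a s'])
 have "lin V' I d ?s = lin V' I a ?s \<oplus>\<^bsub>Sc F V'\<^esub> q \<odot>\<^bsub>Sc F V'\<^esub> lin V' I ?b ?s"
 proof -
  have "lin V' I (%i. \<lambda>x\<in>V'. q x * ?b i x) ?s = q \<odot>\<^bsub>Sc F V'\<^esub> lin V' I ?b ?s"
   by (rule lin_smult[OF V'(1) I(1) q b' s'])
  moreover have "lin V' I d ?s = lin V' I a ?s \<oplus>\<^bsub>Sc F V'\<^esub> lin V' I (%i. \<lambda>x\<in>V'. q x * ?b i x) ?s"
   unfolding d_def by (rule lin_add[OF V'(1) I(1) a qb s'])
  ultimately show ?thesis by simp
 qed
 also have "\<dots> = lin V' I a ?s" unfolding rel' using q la by simp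
 finally have "lin V' I a ?s = lin V' I d ?s" ..
 also have "\<dots> = lin V' (I - {i0}) d ?s"
  by (rule lin_drop_zero[OF V'(1) I d s']) (use nz VU(2) in \<open>auto simp: d_def q_def\<close>)
 finally show "\<exists>V' a. openin X V' \<and> V' \<subseteq> V \<and> x \<in> V' \<and> (\<forall>i\<in>I - {i0}. a i \<in> sec \<O> V') \<and>
    restr F V V' t = lin V' (I - {i0}) a (%i. restr F U V' (s i))"
  using V' d by (intro exI[of _ V'] exI[of _ d]) simp
qed

text \<open>The remaining generators are renumbered by an initial segment, so that their number can
  be minimised.\<close>

lemma generates_drop_index:
 fixes s :: "nat => 'm"
 assumes "generates U {..<q} s W" "openin X U" "openin X W" "W \<subseteq> U" "i0 < q"
  "!!i. i < q ==> s i \<in> sec F U" "!!i. i < q ==> b i \<in> sec \<O> W"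
  "lin W {..<q} b (%i. restr F U W (s i)) = \<zero>\<^bsub>Sc F W\<^esub>" "!!x. x \<in> W ==> b i0 x ~= 0"
 shows "\<exists>s'. (\<forall>i<q - 1. s' i \<in> sec F U) \<and> generates U {..<q - 1} s' W"
proof -
 have g: "generates U ({..<q} - {i0}) s W" by (rule generates_drop[OF assms(1-4) _ _ _ _ assms(8,9)]) (use assms in auto)
 have "card {..<q - 1} = card ({..<q} - {i0})" using assms(5) by simp
 then obtain h where h: "bij_betw h {..<q - 1} ({..<q} - {i0})"
  using finite_same_card_bij[of "{..<q - 1}" "{..<q} - {i0}"] by auto
 have "generates U {..<q - 1} (%j. s (h j)) W"
  by (rule generates_reindex[OF g assms(2,4) h]) (use assms(6) in auto)
 moreover have "\<forall>i<q - 1. s (h i) \<in> sec F U" using bij_betwE[OF h] assms(6) by auto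
 ultimately show ?thesis by (intro exI[of _ "%j. s (h j)"] conjI)
qed

lemma free_simps:
 "sec (free_sheaf \<O> n) U = {..<n} \<rightarrow>\<^sub>E sec \<O> U"
 "add (Sc (free_sheaf \<O> n) U) a b = (\<lambda>i\<in>{..<n}. \<lambda>x\<in>U. a i x + b i x)"
 "smult (Sc (free_sheaf \<O> n) U) r a = (\<lambda>i\<in>{..<n}. \<lambda>x\<in>U. r x * a i x)"
 "restr (free_sheaf \<O> n) U V a = (\<lambda>i\<in>{..<n}. restrict (a i) V)"
 by (simp_all add: free_sheaf_def O_simps)

definition unit_vec :: "nat => 'p set => nat => nat => 'p => complex" where
 "unit_vec n U j = (\<lambda>i\<in>{..<n}. \<lambda>x\<in>U. if i = j then 1 else 0)"

text \<open>Truncations build up a vector one unit vector at a time, by induction on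
  \<open>J\<close>, with a single addition in the target at each step.\<close>

definition trunc :: "nat => 'p set => nat set => (nat => 'p => complex) => nat => 'p => complex" where
 "trunc n U J c = (\<lambda>i\<in>{..<n}. \<lambda>x\<in>U. if i \<in> J then c i x else 0)"

lemma unit_vec_closed: "openin X U ==> unit_vec n U j \<in> sec (free_sheaf \<O> n) U"
 unfolding free_simps unit_vec_def using O_closed(3)[of U 1] O_closed(3)[of U 0] by (auto simp: PiE_iff)

lemma trunc_closed:
 assumes "openin X U" "c \<in> sec (free_sheaf \<O> n) U"
 shows "trunc n U J c \<in> sec (free_sheaf \<O> n) U"
proof -
 have "(\<lambda>x\<in>U. if i \<in> J then c i x else 0) \<in> sec \<O> U" if "i < n" for i
 proof (cases "i \<in> J")
  case True
  have "c i \<in> sec \<O> U" using assms(2) that by (auto simp: free_simps PiE_iff)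
  then show ?thesis using True extensional_restrict[OF O_ext] by simp
 qed (use O_closed(3)[OF assms(1)] in simp)
 then show ?thesis unfolding free_simps trunc_def by (auto simp: PiE_iff)
qed

lemma trunc_all: "openin X U ==> c \<in> sec (free_sheaf \<O> n) U ==> trunc n U {..<n} c = c"
proof (rule extensionalityI[of _ "{..<n}"])
 assume c: "c \<in> sec (free_sheaf \<O> n) U"
 show "c \<in> extensional {..<n}" using c by (simp add: free_simps PiE_iff)
 fix i assume i: "i \<in> {..<n}"
 then have ci: "c i \<in> extensional U" using c O_ext[of "c i" U] by (auto simp: free_simps PiE_iff)
 show "trunc n U {..<n} c i = c i"
  using i extensional_restrict[OF ci] by (simp add: trunc_def)
qed (simp add: trunc_def)

text \<open>The target is a general \<open>G\<close>, so that the step applies to kernel sheaves as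
  well as to \<open>F\<close>.\<close>

lemma free_hom_step:
 assumes p: "\<phi> \<in> sheaf_hom X \<O> (free_sheaf \<O> n) G V" and V: "openin X V" and W: "openin X W" "W \<subseteq> V"
  and c: "c \<in> sec (free_sheaf \<O> n) W" and j: "j < n" "j \<notin> J"
 shows "\<phi> W (trunc n W (insert j J) c) = \<phi> W (trunc n W J c) \<oplus>\<^bsub>Sc G W\<^esub> (c j \<odot>\<^bsub>Sc G W\<^esub> restr G V W (\<phi> V (unit_vec n V j)))"
proof -
 let ?u = "restr (free_sheaf \<O> n) V W (unit_vec n V j)"
 have u: "?u \<in> sec (free_sheaf \<O> n) W"
 proof -
  have "?u = unit_vec n W j" using W(2) by (auto simp: free_simps unit_vec_def fun_eq_iff)
  then show ?thesis using unit_vec_closed[OF W(1)] by simp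
 qed
 have cj: "c j \<in> sec \<O> W" using c j by (auto simp: free_simps PiE_iff)
 have cu: "c j \<odot>\<^bsub>Sc (free_sheaf \<O> n) W\<^esub> ?u \<in> sec (free_sheaf \<O> n) W"
 proof -
  have ui: "?u i \<in> sec \<O> W" if "i \<in> {..<n}" for i
   using u that unfolding free_simps(1) by (rule PiE_mem)
  show ?thesis unfolding free_simps(1,3) using O_closed(2)[OF W(1) cj ui] by (simp add: PiE_iff)
 qed
 have "trunc n W (insert j J) c = trunc n W J c \<oplus>\<^bsub>Sc (free_sheaf \<O> n) W\<^esub> (c j \<odot>\<^bsub>Sc (free_sheaf \<O> n) W\<^esub> ?u)"
  using W j by (auto simp: free_simps trunc_def unit_vec_def fun_eq_iff)
 then have "\<phi> W (trunc n W (insert j J) c) = \<phi> W (trunc n W J c) \<oplus>\<^bsub>Sc G W\<^esub> \<phi> W (c j \<odot>\<^bsub>Sc (free_sheaf \<O> n) W\<^esub> ?u)"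
  using sheaf_homD(2)[OF p W trunc_closed[OF W(1) c] cu] by simp
 also have "\<phi> W (c j \<odot>\<^bsub>Sc (free_sheaf \<O> n) W\<^esub> ?u) = c j \<odot>\<^bsub>Sc G W\<^esub> restr G V W (\<phi> V (unit_vec n V j))"
  using sheaf_homD(3)[OF p W cj u] sheaf_homD(4)[OF p V subset_refl W unit_vec_closed[OF V]] by simp
 finally show ?thesis .
qed

lemma free_hom_lin:
 assumes p: "\<phi> \<in> sheaf_hom X \<O> (free_sheaf \<O> n) F V" and V: "openin X V" and W: "openin X W" "W \<subseteq> V"
  and c: "c \<in> sec (free_sheaf \<O> n) W"
 shows "\<phi> W c = lin W {..<n} c (%i. restr F V W (\<phi> V (unit_vec n V i)))"
proof -
 interpret M: module "Sc \<O> W" "Sc F W" by (rule F_module[OF W(1)])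
 have cj: "c j \<in> sec \<O> W" if "j < n" for j using c that by (auto simp: free_simps PiE_iff)
 have sj: "restr F V W (\<phi> V (unit_vec n V j)) \<in> sec F W" for j
  by (rule F_restr[OF V W sheaf_homD(1)[OF p V subset_refl unit_vec_closed[OF V]]])
 have "\<phi> W (trunc n W J c) = lin W J c (%i. restr F V W (\<phi> V (unit_vec n V i)))" if "finite J" "J \<subseteq> {..<n}" for J
  using that
 proof (induction J rule: finite_induct)
  case empty
  have "trunc n W {} c = (\<lambda>x\<in>W. 0) \<odot>\<^bsub>Sc (free_sheaf \<O> n) W\<^esub> c"
   by (auto simp: free_simps trunc_def fun_eq_iff)
  then have "\<phi> W (trunc n W {} c) = \<zero>\<^bsub>Sc \<O> W\<^esub> \<odot>\<^bsub>Sc F W\<^esub> \<phi> W c"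
   using sheaf_homD(3)[OF p W O_closed(3)[OF W(1)] c] by (simp add: O_simps)
  then show ?case using sheaf_homD(1)[OF p W c] by (simp add: lin_def)
 next
  case (insert j J)
  then have c': "c i \<in> sec \<O> W" if "i \<in> insert j J" for i using cj that by auto
  show ?case
   using free_hom_step[OF p V W c, of j J] lin_insert[OF W(1) insert(1,2) c' sj] insert by simp
 qed
 from this[of "{..<n}"] show ?thesis using trunc_all[OF W(1) c] by simp
qed

lemma lin_hom:
 assumes U: "openin X U" and s: "!!i. i < n ==> s i \<in> sec F U"
 shows "(\<lambda>V\<in>opens_in X U. \<lambda>a\<in>sec (free_sheaf \<O> n) V. lin V {..<n} a (%i. restr F U V (s i)))
   \<in> sheaf_hom X \<O> (free_sheaf \<O> n) F U" (is "?\<phi> \<in> _")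
proof (rule sheaf_homI)
 fix V assume V: "openin X V" "V \<subseteq> U"
 interpret M: module "Sc \<O> V" "Sc F V" by (rule F_module[OF V(1)])
 let ?s = "%i. restr F U V (s i)"
 have s': "?s i \<in> sec F V" if "i \<in> {..<n}" for i using F_restr[OF U V s] that by simp
 have ac: "a i \<in> sec \<O> V" if "a \<in> sec (free_sheaf \<O> n) V" "i \<in> {..<n}" for a i
  using that by (auto simp: free_simps PiE_iff)
 have val: "?\<phi> V a = lin V {..<n} a ?s" if "a \<in> sec (free_sheaf \<O> n) V" for a using V that by simp
 show "?\<phi> V \<in> extensional (sec (free_sheaf \<O> n) V)" using V by simp
 fix a assume a: "a \<in> sec (free_sheaf \<O> n) V"
 show "?\<phi> V a \<in> sec F V" unfolding val[OF a] by (rule lin_closed[OF V(1) ac[OF a] s'])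
 show "?\<phi> V (a \<oplus>\<^bsub>Sc (free_sheaf \<O> n) V\<^esub> b) = ?\<phi> V a \<oplus>\<^bsub>Sc F V\<^esub> ?\<phi> V b"
  if b: "b \<in> sec (free_sheaf \<O> n) V" for b
 proof -
  have ab: "a \<oplus>\<^bsub>Sc (free_sheaf \<O> n) V\<^esub> b \<in> sec (free_sheaf \<O> n) V"
   using O_closed(1)[OF V(1) ac[OF a] ac[OF b]] by (auto simp: free_simps PiE_iff)
  have "lin V {..<n} (a \<oplus>\<^bsub>Sc (free_sheaf \<O> n) V\<^esub> b) ?s = lin V {..<n} (%i. \<lambda>x\<in>V. a i x + b i x) ?s"
   by (rule lin_cong[OF V(1) O_closed(1)[OF V(1) ac[OF a] ac[OF b]] s']) (auto simp: free_simps)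
  also have "\<dots> = lin V {..<n} a ?s \<oplus>\<^bsub>Sc F V\<^esub> lin V {..<n} b ?s"
   by (rule lin_add[OF V(1) _ ac[OF a] ac[OF b] s']) auto
  finally show ?thesis unfolding val[OF a] val[OF b] val[OF ab] .
 qed
 show "?\<phi> V (r \<odot>\<^bsub>Sc (free_sheaf \<O> n) V\<^esub> a) = r \<odot>\<^bsub>Sc F V\<^esub> ?\<phi> V a"
  if r: "r \<in> sec \<O> V" for r
 proof -
  have ra: "r \<odot>\<^bsub>Sc (free_sheaf \<O> n) V\<^esub> a \<in> sec (free_sheaf \<O> n) V"
   using O_closed(2)[OF V(1) r ac[OF a]] by (auto simp: free_simps PiE_iff)
  have "lin V {..<n} (r \<odot>\<^bsub>Sc (free_sheaf \<O> n) V\<^esub> a) ?s = lin V {..<n} (%i. \<lambda>x\<in>V. r x * a i x) ?s"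
   by (rule lin_cong[OF V(1) O_closed(2)[OF V(1) r ac[OF a]] s']) (auto simp: free_simps)
  also have "\<dots> = r \<odot>\<^bsub>Sc F V\<^esub> lin V {..<n} a ?s"
   by (rule lin_smult[OF V(1) _ r ac[OF a] s']) auto
  finally show ?thesis unfolding val[OF a] val[OF ra] .
 qed
 show "?\<phi> W (restr (free_sheaf \<O> n) V W a) = restr F V W (?\<phi> V a)" if W: "openin X W" "W \<subseteq> V" for W
 proof -
  have WU: "W \<subseteq> U" using W V by blast
  have ra: "restr (free_sheaf \<O> n) V W a \<in> sec (free_sheaf \<O> n) W"
   using holomorphic_restrict[OF W ac[OF a]] by (auto simp: free_simps PiE_iff)
  have "restr F V W (?\<phi> V a) = lin W {..<n} (%i. restrict (a i) W) (%i. restr F V W (?s i))"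
   unfolding val[OF a] by (rule lin_restr[OF V(1) W _ ac[OF a] s']) auto
  also have "\<dots> = lin W {..<n} (restr (free_sheaf \<O> n) V W a) (%i. restr F U W (s i))"
  proof (rule lin_cong[OF W(1)])
   fix i assume i: "i \<in> {..<n}"
   show "restr (free_sheaf \<O> n) V W a i \<in> sec \<O> W" using ra i by (auto simp: free_simps PiE_iff)
   show "restr F U W (s i) \<in> sec F W" using F_restr[OF U W(1) WU s] i by simp
   show "restrict (a i) W = restr (free_sheaf \<O> n) V W a i" using i by (simp add: free_simps)
   show "restr F V W (?s i) = restr F U W (s i)" using F_restr_trans[OF U V(1) W V(2) s] i by simp
  qed
  finally show ?thesis using W WU ra by simp
 qed
qed simp

text \<open>Independence over all smaller open sets gives injectivity. It also makes local
  coefficients unique, so those provided by generation glue to coefficients over all of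
  \<open>V\<close>.\<close>

lemma free_onI:
 fixes s :: "nat => 'm"
 assumes U: "openin X U" and s: "!!i. i < n ==> s i \<in> sec F U" and g: "generates U {..<n} s U"
  and ind: "!!V a i x. openin X V ==> V \<subseteq> U ==> (!!i. i < n ==> a i \<in> sec \<O> V) ==>
   lin V {..<n} a (%i. restr F U V (s i)) = \<zero>\<^bsub>Sc F V\<^esub> ==> i < n ==> x \<in> V ==> a i x = 0"
 shows "free_on X \<O> F U"
proof -
 define \<phi> where "\<phi> = (\<lambda>V\<in>opens_in X U. \<lambda>a\<in>sec (free_sheaf \<O> n) V. lin V {..<n} a (%i. restr F U V (s i)))"
 have p: "\<phi> \<in> sheaf_hom X \<O> (free_sheaf \<O> n) F U" unfolding \<phi>_def by (rule lin_hom[OF U s])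
 have val: "\<phi> V a = lin V {..<n} a (%i. restr F U V (s i))" if "openin X V" "V \<subseteq> U" "a \<in> sec (free_sheaf \<O> n) V" for V a
  using that by (simp add: \<phi>_def)
 have ac: "a i \<in> sec \<O> V" if "a \<in> sec (free_sheaf \<O> n) V" "i < n" for a i V
  using that by (auto simp: free_simps PiE_iff)
 have inj: "a = b" if V: "openin X V" "V \<subseteq> U" and a: "a \<in> sec (free_sheaf \<O> n) V"
  and b: "b \<in> sec (free_sheaf \<O> n) V" and eq: "\<phi> V a = \<phi> V b" for V a b
 proof -
  interpret M: module "Sc \<O> V" "Sc F V" by (rule F_module[OF V(1)])
  let ?s = "%i. restr F U V (s i)"
  have s': "?s i \<in> sec F V" if "i \<in> {..<n}" for i using F_restr[OF U V s] that by simp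
  \<comment> \<open>The difference of two coefficient vectors is written as a sum with the constant
    -1 times the second, matching the closure rules for sections.\<close>
  have m1: "(\<lambda>x\<in>V. - 1) \<in> sec \<O> V" by (rule O_closed(3)[OF V(1)])
  have mb: "(\<lambda>x\<in>V. (\<lambda>x\<in>V. - 1) x * b i x) \<in> sec \<O> V" if "i \<in> {..<n}" for i
   using O_closed(2)[OF V(1) m1 ac[OF b]] that by simp
  have fin: "finite {..<n}" by simp
  have la: "lin V {..<n} b ?s \<in> sec F V" by (rule lin_closed[OF V(1) _ s']) (use ac[OF b] in auto)
  have "\<one>\<^bsub>Sc \<O> V\<^esub> \<oplus>\<^bsub>Sc \<O> V\<^esub> (\<lambda>x\<in>V. - 1) = \<zero>\<^bsub>Sc \<O> V\<^esub>" by (auto simp: O_simps fun_eq_iff)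
  then have "lin V {..<n} b ?s \<oplus>\<^bsub>Sc F V\<^esub> (\<lambda>x\<in>V. - 1) \<odot>\<^bsub>Sc F V\<^esub> lin V {..<n} b ?s = \<zero>\<^bsub>Sc F V\<^esub>"
   using M.smult_l_distr[OF M.R.one_closed m1 la, unfolded M.smult_one[OF la]] M.smult_l_null[OF la] by simp
  moreover have "lin V {..<n} (%i. \<lambda>x\<in>V. a i x + (\<lambda>x\<in>V. (\<lambda>x\<in>V. - 1) x * b i x) x) ?s
    = lin V {..<n} a ?s \<oplus>\<^bsub>Sc F V\<^esub> (\<lambda>x\<in>V. - 1) \<odot>\<^bsub>Sc F V\<^esub> lin V {..<n} b ?s"
   using lin_add[OF V(1) fin _ mb s', of a] lin_smult[OF V(1) fin m1 _ s', of b] ac[OF a] ac[OF b] by simp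
  ultimately have z: "lin V {..<n} (%i. \<lambda>x\<in>V. a i x + (\<lambda>x\<in>V. (\<lambda>x\<in>V. - 1) x * b i x) x) ?s = \<zero>\<^bsub>Sc F V\<^esub>"
   using eq val[OF V a] val[OF V b] by simp
  have "a i x = b i x" if "i < n" "x \<in> V" for i x
   using ind[OF V _ z that] O_closed(1)[OF V(1) ac[OF a] mb] that by simp
  then have "a i = b i" if "i < n" for i
   by (intro extensionalityI[OF O_ext[OF ac[OF a that]] O_ext[OF ac[OF b that]]]) (use that in auto)
  then show "a = b" using a b by (intro extensionalityI[of a "{..<n}" b]) (auto simp: free_simps PiE_iff)
 qed
 have surj: "\<exists>a\<in>sec (free_sheaf \<O> n) V. \<phi> V a = t" if V: "openin X V" "V \<subseteq> U" and t: "t \<in> sec F V" for V t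
 proof -
  \<comment> \<open>The open sets over which \<open>t\<close> has coefficients. These are unique by
    \<open>inj\<close>, so a choice over each member is consistent.\<close>
  define \<U> where "\<U> = {W. openin X W \<and> W \<subseteq> V \<and> (\<exists>a\<in>sec (free_sheaf \<O> n) W. \<phi> W a = restr F V W t)}"
  have "\<exists>W\<in>\<U>. x \<in> W" if x: "x \<in> V" for x
  proof -
   from generatesE[OF g V t x] obtain W a where W: "openin X W" "W \<subseteq> V" "x \<in> W" "\<forall>i\<in>{..<n}. a i \<in> sec \<O> W"
    "restr F V W t = lin W {..<n} a (%i. restr F U W (s i))" .
   have WU: "W \<subseteq> U" using W V by blast
   have ra: "restrict a {..<n} \<in> sec (free_sheaf \<O> n) W" using W(4) by (auto simp: free_simps)
   have "lin W {..<n} (restrict a {..<n}) (%i. restr F U W (s i)) = lin W {..<n} a (%i. restr F U W (s i))"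
    by (rule lin_cong[OF W(1)]) (use W(4) F_restr[OF U W(1) WU s] in auto)
   then have "\<phi> W (restrict a {..<n}) = restr F V W t" using val[OF W(1) WU ra] W(5) by simp
   then have "W \<in> \<U>" unfolding \<U>_def using W(1,2) ra by (intro CollectI conjI) (assumption | rule bexI)+
   then show ?thesis using W(3) by (rule bexI[rotated])
  qed
  moreover have sub: "W \<subseteq> V" "openin X W" if "W \<in> \<U>" for W using that by (auto simp: \<U>_def)
  ultimately have cov: "\<Union>\<U> = V" by blast
  have "\<exists>a. \<forall>W\<in>\<U>. a W \<in> sec (free_sheaf \<O> n) W \<and> \<phi> W (a W) = restr F V W t"
   by (rule bchoice) (auto simp: \<U>_def)
  then obtain a where a: "!!W. W \<in> \<U> ==> a W \<in> sec (free_sheaf \<O> n) W" "!!W. W \<in> \<U> ==> \<phi> W (a W) = restr F V W t"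
   by blast
  have ra: "restr (free_sheaf \<O> n) W W' b \<in> sec (free_sheaf \<O> n) W'"
   if "openin X W'" "W' \<subseteq> W" "b \<in> sec (free_sheaf \<O> n) W" for W W' b
   using holomorphic_restrict[OF that(1,2) ac[OF that(3)]] by (auto simp: free_simps PiE_iff)
  have loc: "restr (free_sheaf \<O> n) W (W \<inter> W') (a W) = restr (free_sheaf \<O> n) W' (W \<inter> W') (a W')" if W: "W \<in> \<U>" "W' \<in> \<U>" for W W'
  proof (rule inj)
   have o: "openin X W" "openin X W'" "W \<subseteq> U" "W' \<subseteq> U" using sub W V by auto
   then show o': "openin X (W \<inter> W')" and i: "W \<inter> W' \<subseteq> U" by auto
   have l: "W \<inter> W' \<subseteq> W" "W \<inter> W' \<subseteq> W'" by auto
   show "restr (free_sheaf \<O> n) W (W \<inter> W') (a W) \<in> sec (free_sheaf \<O> n) (W \<inter> W')"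
    by (rule ra[OF o' l(1) a(1)[OF W(1)]])
   show "restr (free_sheaf \<O> n) W' (W \<inter> W') (a W') \<in> sec (free_sheaf \<O> n) (W \<inter> W')"
    by (rule ra[OF o' l(2) a(1)[OF W(2)]])
   have "\<phi> (W \<inter> W') (restr (free_sheaf \<O> n) W (W \<inter> W') (a W)) = restr F V (W \<inter> W') t"
    using sheaf_homD(4)[OF p o(1,3) o' l(1) a(1)[OF W(1)]] a(2)[OF W(1)]
     F_restr_trans[OF V(1) sub(2)[OF W(1)] o' l(1) sub(1)[OF W(1)] t] by simp
   moreover have "\<phi> (W \<inter> W') (restr (free_sheaf \<O> n) W' (W \<inter> W') (a W')) = restr F V (W \<inter> W') t"
    using sheaf_homD(4)[OF p o(2,4) o' l(2) a(1)[OF W(2)]] a(2)[OF W(2)]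
     F_restr_trans[OF V(1) sub(2)[OF W(2)] o' l(2) sub(1)[OF W(2)] t] by simp
   ultimately show "\<phi> (W \<inter> W') (restr (free_sheaf \<O> n) W (W \<inter> W') (a W)) = \<phi> (W \<inter> W') (restr (free_sheaf \<O> n) W' (W \<inter> W') (a W'))" by simp
  qed
  have agree: "a W i x = a W' i x" if "W \<in> \<U>" "W' \<in> \<U>" "x \<in> W" "x \<in> W'" "i < n" for W W' i x
   using fun_cong[OF fun_cong[OF loc[OF that(1,2)], of i], of x] that by (simp add: free_simps)
  \<comment> \<open>At each point the value of any of the local coefficients defined there.\<close>
  define b where "b = (\<lambda>i\<in>{..<n}. \<lambda>x\<in>V. a (SOME W. W \<in> \<U> \<and> x \<in> W) i x)"
  have bW: "restrict (b i) W = a W i" if W: "W \<in> \<U>" and i: "i < n" for W i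
  proof (rule extensionalityI[OF _ O_ext[OF ac[OF a(1)[OF W] i]]])
   fix x assume x: "x \<in> W"
   have "(SOME W. W \<in> \<U> \<and> x \<in> W) \<in> \<U> \<and> x \<in> (SOME W. W \<in> \<U> \<and> x \<in> W)" by (rule someI[of _ W]) (use W x in simp)
   then show "restrict (b i) W x = a W i x"
    using agree[of "SOME W. W \<in> \<U> \<and> x \<in> W" W x i] W x i sub[OF W] by (auto simp: b_def)
  qed simp
  have bi: "b i \<in> sec \<O> V" if i: "i < n" for i
  proof (rule holomorphic_local[OF _ V(1)])
   show "b i \<in> extensional V" using i by (simp add: b_def)
   fix x assume "x \<in> V"
   then obtain W where W: "W \<in> \<U>" "x \<in> W" using cov by blast
   then show "\<exists>W. openin X W \<and> W \<subseteq> V \<and> x \<in> W \<and> restrict (b i) W \<in> sec \<O> W"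
    using sub[OF W(1)] bW[OF W(1) i] ac[OF a(1)[OF W(1)] i] by (intro exI[of _ W]) simp
  qed
  have b: "b \<in> sec (free_sheaf \<O> n) V" using bi by (auto simp: free_simps PiE_iff b_def)
  have "\<phi> V b = t"
  proof (rule sheaf_separated[OF F V(1) sheaf_homD(1)[OF p V b] t])
   fix x assume "x \<in> V"
   then obtain W where W: "W \<in> \<U>" "x \<in> W" using cov by blast
   have "restr (free_sheaf \<O> n) V W b = a W"
    by (rule extensionalityI[of _ "{..<n}"]) (use a(1)[OF W(1)] bW[OF W(1)] in \<open>auto simp: free_simps PiE_iff\<close>)
   then have "restr F V W (\<phi> V b) = restr F V W t"
    using sheaf_homD(4)[OF p V sub(2,1)[OF W(1)] b] a(2)[OF W(1)] by simp
   then show "\<exists>W'. openin X W' \<and> W' \<subseteq> V \<and> x \<in> W' \<and> restr F V W' (\<phi> V b) = restr F V W' t"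
    using sub[OF W(1)] W(2) by (intro exI[of _ W]) simp
  qed
  then show ?thesis using b by blast
 qed
 show ?thesis unfolding free_on_def
 proof (intro exI[of _ n] bexI[OF _ p] ballI bij_betw_imageI equalityI subsetI)
  fix V assume "V \<in> opens_in X U"
  then have V: "openin X V" "V \<subseteq> U" by auto
  show "inj_on (\<phi> V) (sec (free_sheaf \<O> n) V)" by (rule inj_onI) (rule inj[OF V])
  fix t
  show "t \<in> sec F V" if "t \<in> \<phi> V ` sec (free_sheaf \<O> n) V" using that sheaf_homD(1)[OF p V] by auto
  show "t \<in> \<phi> V ` sec (free_sheaf \<O> n) V" if "t \<in> sec F V" using surj[OF V that] by auto
 qed
qed

end

locale coherent_module = manifold_module X \<A> F for X :: "'p topology" and \<A> and F :: "('p, 'p => complex, 'm) module_presheaf" +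
 assumes coh: "coherent_sheaf X \<O> F"
begin

lemma generators_exist:
 assumes "x \<in> topspace X"
 obtains U n and s :: "nat => 'm" where "openin X U" "x \<in> U" "\<forall>i<n. s i \<in> sec F U" "generates U {..<n} s U"
proof -
 have "finite_type_on X \<O> (topspace X) F" using coh by (simp add: coherent_sheaf_def)
 then obtain V n \<phi> where V: "openin X V" "x \<in> V" and p: "\<phi> \<in> sheaf_hom X \<O> (free_sheaf \<O> n) F V"
  and sj: "sheaf_surjective X (free_sheaf \<O> n) F V \<phi>"
  using assms unfolding finite_type_on_def by (meson opens_in_iff)
 define s where "s i = \<phi> V (unit_vec n V i)" for i
 have "generates V {..<n} s V"
  unfolding generates_def
 proof (intro allI impI; elim conjE)
  fix V' t y assume V': "openin X V'" "V' \<subseteq> V" and t: "t \<in> sec F V'" and y: "y \<in> V'"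
  obtain W c where W: "openin X W" "W \<subseteq> V'" "y \<in> W" and c: "c \<in> sec (free_sheaf \<O> n) W" "\<phi> W c = restr F V' W t"
   using sj V' t y unfolding sheaf_surjective_def by (meson opens_in_iff)
  have "W \<subseteq> V" using W V' by blast
  from free_hom_lin[OF p V(1) W(1) this c(1)]
  show "\<exists>W a. openin X W \<and> W \<subseteq> V' \<and> y \<in> W \<and> (\<forall>i\<in>{..<n}. a i \<in> sec \<O> W) \<and> restr F V' W t = lin W {..<n} a (%i. restr F V W (s i))"
   using W c by (intro exI[of _ W] exI[of _ c]) (auto simp: s_def free_simps PiE_iff)
 qed
 moreover have "\<forall>i<n. s i \<in> sec F V"
  unfolding s_def using sheaf_homD(1)[OF p V(1) subset_refl unit_vec_closed[OF V(1)]] by simp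
 ultimately show thesis by (intro that[OF V])
qed

text \<open>Only the pointwise consequence of the coherence of the relation sheaf is needed: where all
 generating relations vanish, every relation vanishes.\<close>

lemma relations_exist:
 fixes s :: "nat => 'm"
 assumes U: "openin X U" and x: "x \<in> U" and s: "!!i. i < n ==> s i \<in> sec F U"
 obtains V and m :: nat and r where "openin X V" "V \<subseteq> U" "x \<in> V"
  "\<forall>j<m. \<forall>i<n. r j i \<in> sec \<O> V"
  "\<forall>j<m. lin V {..<n} (r j) (%i. restr F U V (s i)) = \<zero>\<^bsub>Sc F V\<^esub>"
  "\<forall>W a y. openin X W \<and> W \<subseteq> V \<and> (\<forall>i<n. a i \<in> sec \<O> W) \<and>
    lin W {..<n} a (%i. restr F U W (s i)) = \<zero>\<^bsub>Sc F W\<^esub> \<and> y \<in> W \<and> (\<forall>j<m. \<forall>i<n. r j i y = 0) --> (\<forall>i<n. a i y = 0)"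
proof -
 define \<phi> where "\<phi> = (\<lambda>V\<in>opens_in X U. \<lambda>a\<in>sec (free_sheaf \<O> n) V. lin V {..<n} a (%i. restr F U V (s i)))"
 have p: "\<phi> \<in> sheaf_hom X \<O> (free_sheaf \<O> n) F U" unfolding \<phi>_def by (rule lin_hom[OF U s])
 have val: "\<phi> V a = lin V {..<n} a (%i. restr F U V (s i))" if "openin X V" "V \<subseteq> U" "a \<in> sec (free_sheaf \<O> n) V" for V a
  using that by (simp add: \<phi>_def)
 let ?K = "kernel_sheaf (free_sheaf \<O> n) F \<phi>"
 have K: "sec ?K W = {a \<in> sec (free_sheaf \<O> n) W. \<phi> W a = \<zero>\<^bsub>Sc F W\<^esub>}"
  "add (Sc ?K W) a b = (\<lambda>i\<in>{..<n}. \<lambda>x\<in>W. a i x + b i x)"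
  "smult (Sc ?K W) f a = (\<lambda>i\<in>{..<n}. \<lambda>x\<in>W. f x * a i x)" "restr ?K W W' a = (\<lambda>i\<in>{..<n}. restrict (a i) W')" for W W' a b f
  by (simp_all add: kernel_sheaf_def free_sheaf_def O_simps)
 have "finite_type_on X \<O> U ?K" using coh p U by (simp add: coherent_sheaf_def)
 then obtain V m \<psi> where V: "openin X V" "V \<subseteq> U" "x \<in> V" and q: "\<psi> \<in> sheaf_hom X \<O> (free_sheaf \<O> m) ?K V"
  and sj: "sheaf_surjective X (free_sheaf \<O> m) ?K V \<psi>"
  using x unfolding finite_type_on_def by (meson opens_in_iff)
 define r where "r j = \<psi> V (unit_vec m V j)" for j
 have rK: "r j \<in> sec ?K V" for j
  unfolding r_def by (rule sheaf_homD(1)[OF q V(1) subset_refl unit_vec_closed[OF V(1)]])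
 have 1: "\<forall>j<m. \<forall>i<n. r j i \<in> sec \<O> V" using rK unfolding K free_simps by (auto simp: PiE_iff)
 have 2: "\<forall>j<m. lin V {..<n} (r j) (%i. restr F U V (s i)) = \<zero>\<^bsub>Sc F V\<^esub>"
 proof (intro allI impI)
  fix j
  have m: "r j \<in> sec (free_sheaf \<O> n) V" and z: "\<phi> V (r j) = \<zero>\<^bsub>Sc F V\<^esub>"
   using rK[of j] unfolding K by auto
  show "lin V {..<n} (r j) (%i. restr F U V (s i)) = \<zero>\<^bsub>Sc F V\<^esub>"
   using val[OF V(1,2) m, symmetric] z by (rule trans)
 qed
 have 3: "a i y = 0" if W: "openin X W" "W \<subseteq> V" and a: "\<forall>i<n. a i \<in> sec \<O> W"
  and rel: "lin W {..<n} a (%i. restr F U W (s i)) = \<zero>\<^bsub>Sc F W\<^esub>" and y: "y \<in> W"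
  and z: "\<forall>j<m. \<forall>i<n. r j i y = 0" and i: "i < n" for W a y i
 proof -
  have WU: "W \<subseteq> U" using W V by blast
  have ra: "restrict a {..<n} \<in> sec (free_sheaf \<O> n) W" using a by (auto simp: free_simps)
  have "lin W {..<n} (restrict a {..<n}) (%i. restr F U W (s i)) = lin W {..<n} a (%i. restr F U W (s i))"
   by (rule lin_cong[OF W(1)]) (use a F_restr[OF U W(1) WU s] in auto)
  then have "restrict a {..<n} \<in> sec ?K W" using ra val[OF W(1) WU ra] rel by (simp add: K)
  then obtain W' c where W': "openin X W'" "W' \<subseteq> W" "y \<in> W'" and c: "c \<in> sec (free_sheaf \<O> m) W'"
   "\<psi> W' c = restr ?K W W' (restrict a {..<n})"
   using sj W y unfolding sheaf_surjective_def by (meson opens_in_iff)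
  have W'V: "W' \<subseteq> V" using W W' by blast
  \<comment> \<open>Near \<open>y\<close> the relation is a combination of the \<open>r j\<close>;
    adding these one at a time keeps the value at \<open>y\<close> equal to 0.\<close>
  have "\<psi> W' (trunc m W' J c) i y = 0" if "finite J" "J \<subseteq> {..<m}" for J
   using that
  proof (induction J rule: finite_induct)
   case empty
   have "trunc m W' {} c = (\<lambda>x\<in>W'. 0) \<odot>\<^bsub>Sc (free_sheaf \<O> m) W'\<^esub> c"
    by (auto simp: free_simps trunc_def fun_eq_iff)
   then have "\<psi> W' (trunc m W' {} c) = (\<lambda>x\<in>W'. 0) \<odot>\<^bsub>Sc ?K W'\<^esub> \<psi> W' c"
    using sheaf_homD(3)[OF q W'(1) W'V O_closed(3)[OF W'(1)] c(1)] by simp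
   then show ?case using i W' by (simp add: K)
  next
   case (insert j J)
   then have "\<psi> W' (trunc m W' (insert j J) c) i y
     = (\<psi> W' (trunc m W' J c) \<oplus>\<^bsub>Sc ?K W'\<^esub> (c j \<odot>\<^bsub>Sc ?K W'\<^esub> restr ?K V W' (r j))) i y"
    using free_hom_step[OF q V(1) W'(1) W'V c(1), of j J] by (simp add: r_def)
   then show ?case using insert i W' z by (simp add: K)
  qed
  from this[of "{..<m}"] have "\<psi> W' c i y = 0" using trunc_all[OF W'(1) c(1)] by simp
  then show ?thesis unfolding c(2) K using i W'(3) by simp
 qed
 show thesis by (rule that[OF V 1 2]) (intro allI impI, elim conjE, rule 3, assumption+)
qed

end

section \<open>Coordinate polydiscs on the manifold\<close>

context cmanifold
begin

lemma chart_pre_subset: "chart_pre c W \<subseteq> chart_dom c" by (auto simp: chart_pre_def)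

lemma chart_pre_mem: "x \<in> chart_pre c W \<longleftrightarrow> x \<in> chart_dom c \<and> chart_map c x \<in> W" by (simp add: chart_pre_def)

lemma chart_pre_image:
 assumes "c \<in> \<A>" "W \<subseteq> chart_map c ` chart_dom c"
 shows "chart_map c ` chart_pre c W = W"
proof (intro equalityI subsetI)
 fix z assume z: "z \<in> W"
 then obtain p where "p \<in> chart_dom c" "z = chart_map c p" using assms(2) by auto
 then show "z \<in> chart_map c ` chart_pre c W" using z by (auto simp: chart_pre_def)
qed (auto simp: chart_pre_def)

lemma chart_inv_pre:
 assumes "c \<in> \<A>" "W \<subseteq> chart_map c ` chart_dom c" "z \<in> W"
 shows "chart_inv c z \<in> chart_pre c W" "chart_map c (chart_inv c z) = z"
proof -
 obtain p where "p \<in> chart_dom c" "z = chart_map c p" using assms(2,3) by auto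
 then show "chart_inv c z \<in> chart_pre c W" "chart_map c (chart_inv c z) = z" using assms by (simp_all add: chart_pre_def)
qed

lemma chart_polydisc:
 assumes c: "c \<in> \<A>" and V: "openin X V" and x: "x \<in> V" "x \<in> chart_dom c"
 obtains r where "polydisc (chart_dim c) (chart_map c x) r \<subseteq> chart_map c ` chart_dom c"
  "x \<in> chart_pre c (polydisc (chart_dim c) (chart_map c x) r)" "chart_pre c (polydisc (chart_dim c) (chart_map c x) r) \<subseteq> V"
proof -
 have co: "cs_open (chart_dim c) (chart_map c ` (V \<inter> chart_dom c))" by (rule chart_image_open[OF c V])
 have m: "chart_map c x \<in> chart_map c ` (V \<inter> chart_dom c)" using x by simp
 obtain e where e: "e > 0" "polydisc (chart_dim c) (chart_map c x) (%_. e) \<subseteq> chart_map c ` (V \<inter> chart_dom c)"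
  using polydisc_nbhd[OF co m] .
 have "chart_map c x \<in> complex_space (chart_dim c)" using cs_open_subset[OF co] m by (rule subsetD)
 then have xm: "chart_map c x \<in> polydisc (chart_dim c) (chart_map c x) (%_. e)" using e(1) by (intro polydisc_center)
 show thesis
 proof (rule that)
  show "polydisc (chart_dim c) (chart_map c x) (%_. e) \<subseteq> chart_map c ` chart_dom c" using e(2) by auto
  show "x \<in> chart_pre c (polydisc (chart_dim c) (chart_map c x) (%_. e))" using x xm by (simp add: chart_pre_mem)
  show "chart_pre c (polydisc (chart_dim c) (chart_map c x) (%_. e)) \<subseteq> V"
  proof
   fix p assume "p \<in> chart_pre c (polydisc (chart_dim c) (chart_map c x) (%_. e))"
   then have p: "p \<in> chart_dom c" "chart_map c p \<in> chart_map c ` (V \<inter> chart_dom c)" using e(2) by (auto simp: chart_pre_mem)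
   then obtain p' where p': "p' \<in> V" "p' \<in> chart_dom c" "chart_map c p = chart_map c p'" by auto
   then have "p = p'" using inj_onD[OF chart_inj[OF c]] p by blast
   then show "p \<in> V" using p' by simp
  qed
 qed
qed

text \<open>Coordinate polydiscs form a basis of open sets on which the identity theorem
  holds.\<close>

definition patch :: "'p set => bool" where
 "patch P \<longleftrightarrow> (\<exists>c\<in>\<A>. \<exists>w r. polydisc (chart_dim c) w r \<subseteq> chart_map c ` chart_dom c \<and> P = chart_pre c (polydisc (chart_dim c) w r))"

lemma patch_open: "patch P ==> openin X P"
 unfolding patch_def using chart_pre_open cs_open_polydisc by auto

lemma patch_nbhd:
 assumes V: "openin X V" and x: "x \<in> V"
 obtains P where "patch P" "x \<in> P" "P \<subseteq> V"
proof -
 have "x \<in> topspace X" using openin_subset[OF V] x by auto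
 then obtain c where c: "c \<in> \<A>" "x \<in> chart_dom c" using chart_cover by auto
 obtain r where "polydisc (chart_dim c) (chart_map c x) r \<subseteq> chart_map c ` chart_dom c"
  "x \<in> chart_pre c (polydisc (chart_dim c) (chart_map c x) r)" "chart_pre c (polydisc (chart_dim c) (chart_map c x) r) \<subseteq> V"
  using chart_polydisc[OF c(1) V x c(2)] .
 then show thesis using c(1) by (intro that) (auto simp: patch_def)
qed

lemma O_chart:
 assumes c: "c \<in> \<A>" and f: "f \<in> sec \<O> U" and W: "W \<subseteq> chart_map c ` (U \<inter> chart_dom c)"
 shows "hol (chart_dim c) W (%z. f (chart_inv c z))"
proof -
 have "hol (chart_dim c) (chart_map c ` (U \<inter> chart_dom c)) (f \<circ> chart_inv c)"
  using f c by (simp add: holomorphic_iff)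
 then show ?thesis unfolding o_def by (rule hol_subset[OF _ W])
qed

lemma O_pull:
 assumes c: "c \<in> \<A>" and W: "cs_open (chart_dim c) W" "W \<subseteq> chart_map c ` chart_dom c" and g: "hol (chart_dim c) W g"
 shows "(\<lambda>x\<in>chart_pre c W. g (chart_map c x)) \<in> sec \<O> (chart_pre c W)"
proof (rule holomorphic_chartI[OF c chart_pre_open[OF c W(1)] chart_pre_subset])
 show "hol (chart_dim c) (chart_map c ` chart_pre c W) ((\<lambda>x\<in>chart_pre c W. g (chart_map c x)) \<circ> chart_inv c)"
  unfolding chart_pre_image[OF c W(2)]
  by (rule hol_cong[OF g W(1)]) (simp add: chart_inv_pre[OF c W(2)])
qed simp

lemma O_nonzero_open:
 assumes U: "openin X U" and f: "f \<in> sec \<O> U"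
 shows "openin X {x \<in> U. f x ~= 0}"
proof (subst openin_subopen, intro ballI)
 fix x assume x: "x \<in> {x \<in> U. f x ~= 0}"
 then have "x \<in> topspace X" using openin_subset[OF U] by auto
 then obtain c where c: "c \<in> \<A>" "x \<in> chart_dom c" using chart_cover by auto
 let ?S = "chart_map c ` (U \<inter> chart_dom c)"
 have S: "cs_open (chart_dim c) ?S" by (rule chart_image_open[OF c(1) U])
 have T: "cs_open (chart_dim c) {z \<in> ?S. f (chart_inv c z) ~= 0}"
  by (rule cs_open_nonzero[OF S O_chart[OF c(1) f subset_refl]])
 have "chart_pre c {z \<in> ?S. f (chart_inv c z) ~= 0} \<subseteq> {x \<in> U. f x ~= 0}"
 proof
  fix p assume "p \<in> chart_pre c {z \<in> ?S. f (chart_inv c z) ~= 0}"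
  then obtain p' where p: "p \<in> chart_dom c" "f (chart_inv c (chart_map c p)) ~= 0" "p' \<in> U" "p' \<in> chart_dom c" "chart_map c p = chart_map c p'"
   by (auto simp: chart_pre_mem)
  then have "p = p'" using inj_onD[OF chart_inj[OF c(1)]] by blast
  then show "p \<in> {x \<in> U. f x ~= 0}" using p c(1) by simp
 qed
 moreover have "x \<in> chart_pre c {z \<in> ?S. f (chart_inv c z) ~= 0}" using x c by (simp add: chart_pre_mem)
 ultimately show "\<exists>T. openin X T \<and> x \<in> T \<and> T \<subseteq> {x \<in> U. f x ~= 0}"
  using chart_pre_open[OF c(1) T] by (intro exI[of _ "chart_pre c {z \<in> ?S. f (chart_inv c z) ~= 0}"]) simp
qed

lemma patch_identity:
 assumes P: "patch P" and f: "f \<in> sec \<O> P" and G: "openin X G" "G \<subseteq> P" "y \<in> G"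
  and z: "!!x. x \<in> G ==> f x = 0" and x: "x \<in> P"
 shows "f x = 0"
proof -
 obtain c w r where c: "c \<in> \<A>" and w: "polydisc (chart_dim c) w r \<subseteq> chart_map c ` chart_dom c"
  and P': "P = chart_pre c (polydisc (chart_dim c) w r)" using P unfolding patch_def by blast
 let ?Q = "polydisc (chart_dim c) w r"
 have Pc: "P \<subseteq> chart_dom c" using P' chart_pre_subset by simp
 have Q: "chart_map c ` (P \<inter> chart_dom c) = ?Q" using chart_pre_image[OF c w] Pc by (simp add: P' Int_absorb2)
 have "f (chart_inv c (chart_map c x)) = 0"
 proof (rule polydisc_identity[OF O_chart[OF c f] chart_image_open[OF c G(1)]])
  show "?Q \<subseteq> chart_map c ` (P \<inter> chart_dom c)" using Q by simp
  show "chart_map c ` (G \<inter> chart_dom c) \<subseteq> ?Q" using Q G(2) by blast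
  show "chart_map c y \<in> chart_map c ` (G \<inter> chart_dom c)" using G Pc by blast
  show "f (chart_inv c u) = 0" if "u \<in> chart_map c ` (G \<inter> chart_dom c)" for u using that z c by auto
  show "chart_map c x \<in> ?Q" using x by (simp add: P' chart_pre_mem)
 qed
 then show ?thesis using c x Pc by (simp add: subset_iff)
qed

lemma patch_nonzero_subset:
 assumes P: "patch P" and h: "h \<in> sec \<O> P" "y \<in> P" "h y ~= 0" and G: "openin X G" "G \<subseteq> P" "x \<in> G"
 obtains z where "z \<in> G" "h z ~= 0"
 using patch_identity[OF P h(1) G _ h(2)] h(3) by blast

text \<open>\<open>g\<close> is not a zero divisor on a cylinder: on the open set where
  \<open>f\<close> is nonzero it would vanish identically, against its nonzero derivative in
  direction \<open>i\<close>.\<close>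

lemma cylinder_regular:
 assumes c: "c \<in> \<A>" and cyl: "cylinder (chart_dim c) Q g x i r \<eta>"
  and W: "openin X W" "W \<subseteq> chart_pre c (polydisc (chart_dim c) x r)" and f: "f \<in> sec \<O> W"
  and z: "!!p. p \<in> W ==> g (chart_map c p) * f p = 0" and p: "p \<in> W"
 shows "f p = 0"
proof (rule ccontr)
 interpret cylinder "chart_dim c" Q g x i r \<eta> by (rule cyl)
 assume nz: "f p ~= 0"
 let ?G = "{p \<in> W. f p ~= 0}"
 have G: "openin X ?G" by (rule O_nonzero_open[OF W(1) f])
 have pc: "p \<in> chart_dom c" "chart_map c p \<in> polydisc (chart_dim c) x r" using p W(2) by (auto simp: chart_pre_mem)
 have T: "cs_open (chart_dim c) (chart_map c ` (?G \<inter> chart_dom c))" by (rule chart_image_open[OF c G])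
 have pT: "chart_map c p \<in> chart_map c ` (?G \<inter> chart_dom c)" using p nz pc by blast
 have "partial_deriv i g (chart_map c p) = partial_deriv i (%_. 0) (chart_map c p)"
  by (rule partial_deriv_cong[OF T pT i]) (use z in auto)
 then show False using g_deriv[OF pc(2)] by (simp add: partial_deriv_def)
qed

end

lemma (in manifold_module) generates_mono:
 assumes "generates U I s W" "W' \<subseteq> W"
 shows "generates U I s W'"
 unfolding generates_def
proof (intro allI impI)
 fix V t x assume "openin X V \<and> V \<subseteq> W' \<and> t \<in> sec F V \<and> x \<in> V"
 then show "\<exists>V' a. openin X V' \<and> V' \<subseteq> V \<and> x \<in> V' \<and> (\<forall>i\<in>I. a i \<in> sec \<O> V') \<and>
    restr F V V' t = lin V' I a (%i. restr F U V' (s i))"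
  using assms(2) by (intro assms(1)[unfolded generates_def, THEN spec, THEN spec, THEN spec, THEN mp]) auto
qed

section \<open>The singular set of a coherent sheaf\<close>

context coherent_module
begin

abbreviation "Z \<equiv> singularity_set X \<O> F"
abbreviation "Y \<equiv> topspace X - Z"

lemma free_on_nonsingular: "openin X U ==> free_on X \<O> F U ==> x \<in> U ==> x \<notin> Z"
 unfolding singularity_set_def by blast

lemma Y_open: "openin X Y"
proof (subst openin_subopen, intro ballI)
 fix x assume "x \<in> Y"
 then obtain U where U: "openin X U" "x \<in> U" "free_on X \<O> F U" unfolding singularity_set_def by blast
 then have "U \<subseteq> Y" using free_on_nonsingular[OF U(1,3)] openin_subset[OF U(1)] by blast
 then show "\<exists>T. openin X T \<and> x \<in> T \<and> T \<subseteq> Y" using U by (intro exI[of _ U]) simp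
qed

text \<open>The relation holds over \<open>V\<close> but its coefficient is invertible only on
  \<open>W\<close>. The surviving sections are restricted to any \<open>U'\<close> between
  \<open>W\<close> and \<open>U\<close>, the form in which the minimality arguments use
  them.\<close>

lemma drop_relation:
 fixes s :: "nat => 'm"
 assumes U: "openin X U" and s: "!!i. i < q ==> s i \<in> sec F U" and V: "openin X V" "V \<subseteq> U"
  and b: "!!i. i < q ==> b i \<in> sec \<O> V" and rel: "lin V {..<q} b (%i. restr F U V (s i)) = \<zero>\<^bsub>Sc F V\<^esub>"
  and W: "openin X W" "W \<subseteq> V" and i0: "i0 < q" and nz: "!!x. x \<in> W ==> b i0 x ~= 0" and g: "generates U {..<q} s W"
  and U': "openin X U'" "W \<subseteq> U'" "U' \<subseteq> U"
 obtains s' where "\<forall>i<q - 1. s' i \<in> sec F U'" "generates U' {..<q - 1} s' W"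
proof -
 interpret M: module "Sc \<O> V" "Sc F V" by (rule F_module[OF V(1)])
 interpret N: module "Sc \<O> W" "Sc F W" by (rule F_module[OF W(1)])
 have WU: "W \<subseteq> U" using V W by blast
 have z: "restr F V W \<zero>\<^bsub>Sc F V\<^esub> = \<zero>\<^bsub>Sc F W\<^esub>"
  by (rule additive_zero[OF M.abelian_group_axioms N.abelian_group_axioms]) (use F_restr[OF V(1) W] F_restr_add[OF V(1) W] in auto)
 have b': "b i \<in> sec \<O> V" if "i \<in> {..<q}" for i using b that by simp
 have sV: "restr F U V (s i) \<in> sec F V" if "i \<in> {..<q}" for i using F_restr[OF U V s] that by simp
 have "restr F V W (lin V {..<q} b (%i. restr F U V (s i))) = lin W {..<q} (%i. restrict (b i) W) (%i. restr F V W (restr F U V (s i)))"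
  by (rule lin_restr[OF V(1) W _ b' sV]) auto
 also have "\<dots> = lin W {..<q} (%i. restrict (b i) W) (%i. restr F U W (s i))"
  by (rule lin_cong[OF W(1)]) (use holomorphic_restrict[OF W b] F_restr[OF U W(1) WU s] F_restr_trans[OF U V(1) W V(2) s] in auto)
 finally have rel': "lin W {..<q} (%i. restrict (b i) W) (%i. restr F U W (s i)) = \<zero>\<^bsub>Sc F W\<^esub>" unfolding rel z ..
 have "\<exists>s'. (\<forall>i<q - 1. s' i \<in> sec F U) \<and> generates U {..<q - 1} s' W"
  by (rule generates_drop_index[OF g U W(1) WU i0 s holomorphic_restrict[OF W b] rel']) (use nz in auto)
 then obtain s' where s': "\<forall>i<q - 1. s' i \<in> sec F U" "generates U {..<q - 1} s' W" by (elim exE conjE)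
 show thesis
 proof (rule that)
  show "\<forall>i<q - 1. restr F U U' (s' i) \<in> sec F U'" using F_restr[OF U U'(1,3)] s'(1) by simp
  show "generates U' {..<q - 1} (%i. restr F U U' (s' i)) W"
   by (rule generates_restr[OF s'(2) U U'(1,3) subset_refl U'(2)]) (use s'(1) in simp)
 qed
qed

lemma independent_nonsingular:
 fixes s :: "nat => 'm"
 assumes U: "openin X U" and s: "!!i. i < n ==> s i \<in> sec F U" and W: "openin X W" "W \<subseteq> U" and g: "generates U {..<n} s W"
  and ind: "!!V a i y. openin X V ==> V \<subseteq> W ==> (\<forall>i<n. a i \<in> sec \<O> V) ==>
   lin V {..<n} a (%i. restr F U V (s i)) = \<zero>\<^bsub>Sc F V\<^esub> ==> y \<in> V ==> i < n ==> a i y = 0"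
  and x: "x \<in> W"
 shows "x \<notin> Z"
proof (rule free_on_nonsingular[OF W(1) _ x])
 show "free_on X \<O> F W"
 proof (rule free_onI[OF W(1) F_restr[OF U W s]])
  show "generates W {..<n} (%i. restr F U W (s i)) W"
   by (rule generates_restr[OF g U W subset_refl subset_refl]) (use s in simp)
  fix V a i y assume V: "openin X V" "V \<subseteq> W" and a: "!!i. i < n ==> a i \<in> sec \<O> V"
   and z: "lin V {..<n} a (%i. restr F W V (restr F U W (s i))) = \<zero>\<^bsub>Sc F V\<^esub>" and i: "i < n" and y: "y \<in> V"
  have VU: "V \<subseteq> U" using V W by blast
  have "lin V {..<n} a (%i. restr F W V (restr F U W (s i))) = lin V {..<n} a (%i. restr F U V (s i))"
   by (rule lin_cong[OF V(1)]) (use a F_restr[OF U V(1) VU s] F_restr_trans[OF U W(1) V W(2) s] in auto)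
  then have z': "lin V {..<n} a (%i. restr F U V (s i)) = \<zero>\<^bsub>Sc F V\<^esub>" using z by simp
  show "a i y = 0" by (rule ind[OF V _ z' y i]) (use a in simp)
 qed
qed

text \<open>The number of sections generating off some hypersurface \<open>h = 0\<close> of a patch
  around \<open>x0\<close> is minimised. If a generating relation had a coefficient not identically
  0, multiplying \<open>h\<close> by it would allow a generator to be dropped. So all relations
  vanish on a smaller patch off \<open>h = 0\<close>, and \<open>F\<close> is free there.\<close>

lemma singular_hypersurface:
 assumes x0: "x0 \<in> topspace X"
 obtains P h y where "patch P" "x0 \<in> P" "h \<in> sec \<O> P" "y \<in> P" "h y ~= 0" "\<forall>x\<in>P. h x ~= 0 --> x \<notin> Z"
proof -
 note result = that
 \<comment> \<open>The point \<open>y\<close> with \<open>h y ~= 0\<close> excludes the degenerate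
   equation that vanishes everywhere.\<close>
 define Q where "Q q \<longleftrightarrow> (\<exists>P h y s. patch P \<and> x0 \<in> P \<and> h \<in> sec \<O> P \<and> y \<in> P \<and> h y ~= 0 \<and>
   (\<forall>i<q. s i \<in> sec F P) \<and> generates P {..<q} s {x \<in> P. h x ~= 0})" for q :: nat
 have "\<exists>q. Q q"
 proof -
  obtain U n and s :: "nat => 'm" where U: "openin X U" "x0 \<in> U" and s: "\<forall>i<n. s i \<in> sec F U" and g: "generates U {..<n} s U"
   using generators_exist[OF x0] .
  obtain P where P: "patch P" "x0 \<in> P" "P \<subseteq> U" using patch_nbhd[OF U] .
  have oP: "openin X P" by (rule patch_open[OF P(1)])
  have "generates P {..<n} (%i. restr F U P (s i)) {x \<in> P. (\<lambda>x\<in>P. 1) x ~= (0::complex)}"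
   by (rule generates_restr[OF g U(1) oP P(3)]) (use P(3) s in auto)
  moreover have "\<forall>i<n. restr F U P (s i) \<in> sec F P" using F_restr[OF U(1) oP P(3)] s by simp
  ultimately have "Q n" unfolding Q_def using P O_closed(3)[OF oP, of 1]
   by (intro exI[of _ P] exI[of _ "\<lambda>x\<in>P. 1"] exI[of _ x0] exI[of _ "%i. restr F U P (s i)"]) simp
  then show ?thesis ..
 qed
 then obtain q where q: "Q q" and min: "!!q'. q' < q ==> \<not> Q q'" using exists_least_iff[of Q] by auto
 from q obtain P h y s where P: "patch P" "x0 \<in> P" and h: "h \<in> sec \<O> P" and y: "y \<in> P" "h y ~= 0"
  and s: "\<forall>i<q. s i \<in> sec F P" and g: "generates P {..<q} s {x \<in> P. h x ~= 0}"
  unfolding Q_def by (elim exE conjE)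
 have oP: "openin X P" by (rule patch_open[OF P(1)])
 have s': "s i \<in> sec F P" if "i < q" for i using s that by simp
 obtain V and m :: nat and r where V: "openin X V" "V \<subseteq> P" "x0 \<in> V" and r: "\<forall>j<m. \<forall>i<q. r j i \<in> sec \<O> V"
  and rel: "\<forall>j<m. lin V {..<q} (r j) (%i. restr F P V (s i)) = \<zero>\<^bsub>Sc F V\<^esub>"
  and all: "\<forall>W a y. openin X W \<and> W \<subseteq> V \<and> (\<forall>i<q. a i \<in> sec \<O> W) \<and>
    lin W {..<q} a (%i. restr F P W (s i)) = \<zero>\<^bsub>Sc F W\<^esub> \<and> y \<in> W \<and> (\<forall>j<m. \<forall>i<q. r j i y = 0) --> (\<forall>i<q. a i y = 0)"
  using relations_exist[OF oP P(2) s'] .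
 obtain P' where P': "patch P'" "x0 \<in> P'" "P' \<subseteq> V" using patch_nbhd[OF V(1,3)] .
 have oP': "openin X P'" by (rule patch_open[OF P'(1)])
 have PP: "P' \<subseteq> P" using P' V by blast
 have h': "restrict h P' \<in> sec \<O> P'" by (rule holomorphic_restrict[OF oP' PP h])
 \<comment> \<open>By the identity theorem \<open>h\<close> is not identically 0 on the smaller
   patch either.\<close>
 obtain y' where y': "y' \<in> P'" "h y' ~= 0" using patch_nonzero_subset[OF P(1) h y oP' PP P'(2)] .
 show thesis
 proof (cases "\<forall>j<m. \<forall>i<q. \<forall>x\<in>P'. r j i x = 0")
  case True
  have "x \<notin> Z" if x: "x \<in> P'" "h x ~= 0" for x
  proof (rule independent_nonsingular[OF oP s'])
   let ?W = "{x \<in> P'. restrict h P' x ~= 0}"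
   show oW: "openin X ?W" by (rule O_nonzero_open[OF oP' h'])
   show WP: "?W \<subseteq> P" using PP by blast
   show "generates P {..<q} s ?W" by (rule generates_mono[OF g]) (use PP in auto)
   show "x \<in> ?W" using x by simp
   fix V' a i u assume V': "openin X V'" "V' \<subseteq> ?W" and a: "\<forall>i<q. a i \<in> sec \<O> V'"
    and z: "lin V' {..<q} a (%i. restr F P V' (s i)) = \<zero>\<^bsub>Sc F V'\<^esub>" and u: "u \<in> V'" and i: "i < q"
   have "V' \<subseteq> V" "\<forall>j<m. \<forall>i<q. r j i u = 0" using V' P'(3) True u by auto
   then have "\<forall>i<q. a i u = 0"
    by (intro all[THEN spec, THEN spec, THEN spec, THEN mp, of V' a u] conjI V'(1) a z u)
   then show "a i u = 0" using i by simp
  qed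
  then show thesis using y' by (intro result[OF P'(1,2) h' y'(1)]) auto
 next
  case False
  then obtain j i x1 where j: "j < m" and i: "i < q" and x1: "x1 \<in> P'" "r j i x1 ~= 0" by blast
  have rj: "r j i' \<in> sec \<O> V" if "i' < q" for i' using r j that by simp
  \<comment> \<open>Where it is nonzero the old sections generate and the coefficient is invertible;
    by the identity theorem this happens somewhere.\<close>
  define k where "k = (\<lambda>x\<in>P'. restrict (r j i) P' x * restrict h P' x)"
  have ri: "restrict (r j i) P' \<in> sec \<O> P'" by (rule holomorphic_restrict[OF oP' P'(3) rj[OF i]])
  have k: "k \<in> sec \<O> P'" unfolding k_def by (rule O_closed(2)[OF oP' ri h'])
  have oG: "openin X {x \<in> P'. restrict h P' x ~= 0}" by (rule O_nonzero_open[OF oP' h'])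
  have yG: "y' \<in> {x \<in> P'. restrict h P' x ~= 0}" using y' by simp
  have x1': "restrict (r j i) P' x1 ~= 0" using x1 by simp
  obtain y2 where y2: "y2 \<in> {x \<in> P'. restrict h P' x ~= 0}" "restrict (r j i) P' y2 ~= 0"
   using patch_nonzero_subset[OF P'(1) ri x1(1) x1' oG _ yG] by auto
  have ky2: "y2 \<in> P'" "k y2 ~= 0" using y2 by (auto simp: k_def)
  let ?W = "{x \<in> P'. k x ~= 0}"
  have oW: "openin X ?W" by (rule O_nonzero_open[OF oP' k])
  have WV: "?W \<subseteq> V" and WP: "?W \<subseteq> P'" using P' by auto
  have g': "generates P {..<q} s ?W" by (rule generates_mono[OF g]) (use PP in \<open>auto simp: k_def\<close>)
  have nz: "r j i x ~= 0" if "x \<in> ?W" for x using that by (auto simp: k_def)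
  obtain s2 where "\<forall>i<q - 1. s2 i \<in> sec F P'" "generates P' {..<q - 1} s2 ?W"
   using drop_relation[OF oP s' V(1,2) rj rel[rule_format, OF j] oW WV i nz g' oP' WP PP] .
  then have "Q (q - 1)" unfolding Q_def using P'(1,2) k ky2 
   by (intro exI[of _ P'] exI[of _ k] exI[of _ y2] exI[of _ s2]) simp
  then show thesis using min[of "q - 1"] i by simp
 qed
qed

text \<open>Near each point \<open>Y\<close> contains the complement of a hypersurface
  \<open>h = 0\<close> with \<open>h\<close> not identically 0. A function vanishing on this
  nonempty open set vanishes on the whole patch.\<close>

lemma O_separated:
 assumes V: "openin X V" and f: "f \<in> sec \<O> V" and z: "!!x. x \<in> V \<inter> Y ==> f x = 0" and x: "x \<in> V"
 shows "f x = 0"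
proof -
 have xX: "x \<in> topspace X" using openin_subset[OF V] x by auto
 obtain P h y where P: "patch P" "x \<in> P" and h: "h \<in> sec \<O> P" "y \<in> P" "h y ~= 0" and hZ: "\<forall>x\<in>P. h x ~= 0 --> x \<notin> Z"
  using singular_hypersurface[OF xX] .
 have oP: "openin X P" by (rule patch_open[OF P(1)])
 have "openin X (P \<inter> V)" "x \<in> P \<inter> V" using oP V P x by auto
 then obtain P' where P': "patch P'" "x \<in> P'" "P' \<subseteq> P \<inter> V" by (rule patch_nbhd)
 have oP': "openin X P'" by (rule patch_open[OF P'(1)])
 have PP: "P' \<subseteq> P" "P' \<subseteq> V" using P' by auto
 obtain y' where y': "y' \<in> P'" "h y' ~= 0" using patch_nonzero_subset[OF P(1) h oP' PP(1) P'(2)] .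
 have h': "restrict h P' \<in> sec \<O> P'" by (rule holomorphic_restrict[OF oP' PP(1) h(1)])
 have "restrict f P' x = 0"
 proof (rule patch_identity[OF P'(1) holomorphic_restrict[OF oP' PP(2) f] O_nonzero_open[OF oP' h']])
  show "y' \<in> {x \<in> P'. restrict h P' x ~= 0}" using y' by simp
  show "restrict f P' u = 0" if "u \<in> {x \<in> P'. restrict h P' x ~= 0}" for u
  proof -
   have u: "u \<in> P'" "h u ~= 0" using that by auto
   then have "u \<notin> Z" "u \<in> V" using hZ PP by auto
   then show ?thesis using z[of u] u openin_subset[OF V] by auto
  qed
 qed (use P' in auto)
 then show ?thesis using P' by simp
qed

end

section \<open>Extension across the singularity set of a reflexive sheaf\<close>

locale reflexive_module = coherent_module X \<A> F for X :: "'p topology" and \<A> and F :: "('p, 'p => complex, 'm) module_presheaf" +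
 assumes refl: "reflexive_sheaf X \<O> F"
begin

abbreviation "dual \<equiv> dual_sheaf X \<O> F"
abbreviation "SM \<equiv> structure_module \<O>"

lemma dual_carrier: "sec dual U = sheaf_hom X \<O> F SM U"
 by (simp add: dual_sheaf_def hom_sheaf_simps)

lemma bidual_carrier: "sec (dual_sheaf X \<O> dual) U = sheaf_hom X \<O> dual SM U"
 by (simp add: dual_sheaf_def hom_sheaf_simps)

lemma bidual_bij: "openin X U ==> bij_betw (bidual_map X \<O> F U) (sec F U) (sheaf_hom X \<O> dual SM U)"
 using refl by (simp add: reflexive_sheaf_def bidual_carrier)

text \<open>\<open>F\<close> embeds in its bidual, where \<open>s\<close> becomes evaluation at
  \<open>s\<close>. Every such value is a function killed by \<open>r\<close>, and
  \<open>reg\<close> says that \<open>r\<close> is not a zero divisor over any smaller open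
  set.\<close>

lemma torsion_free:
 assumes U: "openin X U" and r: "r \<in> sec \<O> U" and s: "s \<in> sec F U"
  and z: "r \<odot>\<^bsub>Sc F U\<^esub> s = \<zero>\<^bsub>Sc F U\<^esub>"
  and reg: "!!V f p. openin X V ==> V \<subseteq> U ==> f \<in> sec \<O> V ==> (!!p. p \<in> V ==> r p * f p = 0) ==> p \<in> V ==> f p = 0"
 shows "s = \<zero>\<^bsub>Sc F U\<^esub>"
proof (rule inj_onD[OF bij_betw_imp_inj_on[OF bidual_bij[OF U]] _ s])
 interpret M: module "Sc \<O> U" "Sc F U" by (rule F_module[OF U])
 show "\<zero>\<^bsub>Sc F U\<^esub> \<in> sec F U" by simp
 have val: "\<phi> V (restr F U V s) = \<phi> V (restr F U V \<zero>\<^bsub>Sc F U\<^esub>)"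
  if V: "openin X V" "V \<subseteq> U" and p: "\<phi> \<in> sheaf_hom X \<O> F SM V" for V \<phi>
 proof -
  interpret N: module "Sc \<O> V" "Sc F V" by (rule F_module[OF V(1)])
  note pD = sheaf_homD[OF p V(1) subset_refl]
  have sV: "restr F U V s \<in> sec F V" by (rule F_restr[OF U V s])
  have z0: "restr F U V \<zero>\<^bsub>Sc F U\<^esub> = \<zero>\<^bsub>Sc F V\<^esub>"
   by (rule additive_zero[OF M.abelian_group_axioms N.abelian_group_axioms]) (use F_restr[OF U V] F_restr_add[OF U V] in auto)
  have c: "\<phi> V (restr F U V s) \<in> sec \<O> V" using pD(1)[OF sV] by (simp add: structure_module_def)
  have O0: "(\<lambda>x\<in>V. 0) \<in> sec \<O> V" by (rule O_closed(3)[OF V(1)])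
  have "\<phi> V ((\<lambda>x\<in>V. 0) \<odot>\<^bsub>Sc F V\<^esub> \<zero>\<^bsub>Sc F V\<^esub>) = (\<lambda>x\<in>V. 0) \<odot>\<^bsub>Sc SM V\<^esub> \<phi> V \<zero>\<^bsub>Sc F V\<^esub>"
   by (rule pD(3)[OF O0 N.zero_closed])
  then have p0: "\<phi> V \<zero>\<^bsub>Sc F V\<^esub> = (\<lambda>x\<in>V. 0)" using O0
   by (simp add: structure_module_def O_simps N.smult_r_null cong: restrict_cong)
  have rV: "restrict r V \<in> sec \<O> V" by (rule holomorphic_restrict[OF V r])
  have "restrict r V \<odot>\<^bsub>Sc F V\<^esub> restr F U V s = \<zero>\<^bsub>Sc F V\<^esub>"
   using F_restr_smult[OF U V r s] z z0 by (simp add: O_simps)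
  then have "restrict r V \<odot>\<^bsub>Sc SM V\<^esub> \<phi> V (restr F U V s) = (\<lambda>x\<in>V. 0)"
   using pD(3)[OF rV sV] p0 by simp
  then have eq0: "(\<lambda>x\<in>V. restrict r V x * \<phi> V (restr F U V s) x) = (\<lambda>x\<in>V. 0)" by (simp add: structure_module_def O_simps)
  have *: "r p * \<phi> V (restr F U V s) p = 0" if "p \<in> V" for p using fun_cong[OF eq0, of p] that by simp
  have "\<phi> V (restr F U V s) p = 0" if "p \<in> V" for p by (rule reg[OF V c * that])
  then have "\<phi> V (restr F U V s) = (\<lambda>x\<in>V. 0)" by (intro extensionalityI[OF O_ext[OF c]]) auto
  then show ?thesis using p0 z0 by simp
 qed
 show "bidual_map X \<O> F U s = bidual_map X \<O> F U \<zero>\<^bsub>Sc F U\<^esub>"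
  unfolding bidual_map_def dual_carrier
  by (intro restrict_ext) (use val in simp)
qed

text \<open>A smooth hypersurface patch contained in the singular set is impossible: since \<open>F\<close> is
 torsion-free, a relation between a minimal number of generators could be divided by the equation
 until one of its coefficients is invertible.\<close>

lemma hypersurface_not_singular:
 assumes c: "c \<in> \<A>" and cyl: "cylinder (chart_dim c) Q g w i r \<eta>"
  and D: "polydisc (chart_dim c) w r \<subseteq> chart_map c ` chart_dom c"
  and p: "p \<in> chart_pre c (polydisc (chart_dim c) w r)" "g (chart_map c p) = 0"
  and sing: "!!p. p \<in> chart_pre c (polydisc (chart_dim c) w r) ==> g (chart_map c p) = 0 ==> p \<in> Z"
 shows False
proof -
 let ?n = "chart_dim c"
 let ?M = "chart_pre c (polydisc ?n w r)"
 interpret A: cylinder ?n Q g w i r \<eta> by (rule cyl)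
 have oM: "openin X ?M" by (rule chart_pre_open[OF c cs_open_polydisc])
 \<comment> \<open>The number is minimised over all neighbourhoods of all points of the
   hypersurface, because a generator will be dropped near a point that the division produces, not
   near a prescribed one.\<close>
 define R where "R q \<longleftrightarrow> (\<exists>x U s. x \<in> ?M \<and> g (chart_map c x) = 0 \<and> openin X U \<and> U \<subseteq> ?M \<and> x \<in> U \<and>
   (\<forall>i<q. s i \<in> sec F U) \<and> generates U {..<q} s U)" for q :: nat
 have "\<exists>q. R q"
 proof -
  have "p \<in> topspace X" using openin_subset[OF oM] p(1) by (rule subsetD)
  then obtain U n and s :: "nat => 'm" where U: "openin X U" "p \<in> U" and s: "\<forall>i<n. s i \<in> sec F U" and gen: "generates U {..<n} s U"
   using generators_exist by metis
  have oU: "openin X (U \<inter> ?M)" using U(1) oM by (rule openin_Int)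
  have "generates (U \<inter> ?M) {..<n} (%i. restr F U (U \<inter> ?M) (s i)) (U \<inter> ?M)"
   by (rule generates_restr[OF gen U(1) oU]) (use s in auto)
  moreover have "\<forall>i<n. restr F U (U \<inter> ?M) (s i) \<in> sec F (U \<inter> ?M)" using F_restr[OF U(1) oU] s by simp
  ultimately have "R n" unfolding R_def using p U(2) oU
   by (intro exI[of _ p] exI[of _ "U \<inter> ?M"] exI[of _ "%i. restr F U (U \<inter> ?M) (s i)"]) simp
  then show ?thesis ..
 qed
 then obtain q where q: "R q" and min: "!!q'. q' < q ==> \<not> R q'" using exists_least_iff[of R] by auto
 from q obtain x U s where x: "x \<in> ?M" "g (chart_map c x) = 0" and U: "openin X U" "U \<subseteq> ?M" "x \<in> U"
  and s: "\<forall>i<q. s i \<in> sec F U" and gen: "generates U {..<q} s U"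
  unfolding R_def by (elim exE conjE)
 have s': "s i \<in> sec F U" if "i < q" for i using s that by simp
 obtain V and m :: nat and \<rho> where V: "openin X V" "V \<subseteq> U" "x \<in> V" and \<rho>: "\<forall>j<m. \<forall>i<q. \<rho> j i \<in> sec \<O> V"
  and rel: "\<forall>j<m. lin V {..<q} (\<rho> j) (%i. restr F U V (s i)) = \<zero>\<^bsub>Sc F V\<^esub>"
  and all: "\<forall>W a y. openin X W \<and> W \<subseteq> V \<and> (\<forall>i<q. a i \<in> sec \<O> W) \<and>
    lin W {..<q} a (%i. restr F U W (s i)) = \<zero>\<^bsub>Sc F W\<^esub> \<and> y \<in> W \<and> (\<forall>j<m. \<forall>i<q. \<rho> j i y = 0) --> (\<forall>i<q. a i y = 0)"
  using relations_exist[OF U(1,3) s'] .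
 have Vd: "V \<subseteq> chart_dom c" and VM: "V \<subseteq> ?M" using V U chart_pre_subset by blast+
 let ?VV = "chart_map c ` (V \<inter> chart_dom c)"
 have oVV: "cs_open ?n ?VV" by (rule chart_image_open[OF c V(1)])
 have VVD: "?VV \<subseteq> polydisc ?n w r" using VM by (auto simp: chart_pre_mem)
 have gVV: "hol ?n ?VV g" using hol_subset[OF A.g] VVD A.D_subset_V by blast
 have xVV: "chart_map c x \<in> ?VV" using V(3) Vd by blast
 have dx: "partial_deriv i g (chart_map c x) ~= 0" by (rule A.g_deriv) (use VVD xVV in blast)
 \<comment> \<open>A second cylinder inside the domain \<open>V\<close> of the relations, so that
   their coefficients can be divided by \<open>g\<close> on it.\<close>
 obtain r' \<eta>' where cyl': "cylinder ?n ?VV g (chart_map c x) i r' \<eta>'"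
  using cylinder_exists[OF oVV gVV A.i xVV x(2) dx] .
 interpret B: cylinder ?n ?VV g "chart_map c x" i r' \<eta>' by (rule cyl')
 let ?D = "polydisc ?n (chart_map c x) r'"
 have DVV: "?D \<subseteq> ?VV" by (rule B.D_subset_V)
 have Dim: "?D \<subseteq> chart_map c ` chart_dom c" using DVV by blast
 let ?M2 = "chart_pre c ?D"
 have oM2: "openin X ?M2" by (rule chart_pre_open[OF c cs_open_polydisc])
 have M2V: "?M2 \<subseteq> V"
 proof
  fix u assume "u \<in> ?M2"
  then have u: "u \<in> chart_dom c" "chart_map c u \<in> ?VV" using DVV by (auto simp: chart_pre_mem)
  then obtain u' where "u' \<in> V" "u' \<in> chart_dom c" "chart_map c u = chart_map c u'" by auto
  then show "u \<in> V" using inj_onD[OF chart_inj[OF c]] u(1) by metis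
 qed
 have M2U: "?M2 \<subseteq> U" using M2V V(2) by blast
 \<comment> \<open>The region in which divisibility by all powers of \<open>g\<close> forces a
   function to vanish.\<close>
 let ?N = "{z \<in> ?D. g z \<in> ball 0 \<eta>'}"
 have gD: "hol ?n ?D g" by (rule hol_subset[OF gVV DVV])
 have oN: "cs_open ?n ?N" by (rule cs_open_preimage[OF cs_open_polydisc hol_continuous[OF gD]]) simp
 let ?NN = "chart_pre c ?N"
 have oNN: "openin X ?NN" by (rule chart_pre_open[OF c oN])
 have xNN: "x \<in> ?NN" using B.x_in_D x(2) B.\<eta> V(3) Vd by (auto simp: chart_pre_mem)
 have NNM2: "?NN \<subseteq> ?M2" by (auto simp: chart_pre_mem)
 show False
 \<comment> \<open>If all generating relations vanish near \<open>x\<close>, the generators are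
   independent there and \<open>x\<close> is not singular.\<close>
 proof (cases "\<forall>j<m. \<forall>i<q. \<forall>u\<in>?NN. \<rho> j i u = 0")
  case True
  have NU: "?NN \<subseteq> U" using NNM2 M2U by blast
  have "x \<notin> Z"
  proof (rule independent_nonsingular[OF U(1) s' oNN NU generates_mono[OF gen NU] _ xNN])
   fix V' a i u assume V': "openin X V'" "V' \<subseteq> ?NN" and a: "\<forall>i<q. a i \<in> sec \<O> V'"
    and z: "lin V' {..<q} a (%i. restr F U V' (s i)) = \<zero>\<^bsub>Sc F V'\<^esub>" and u: "u \<in> V'" and i: "i < q"
   have VV': "V' \<subseteq> V" using V'(2) NNM2 M2V by (rule subset_trans[OF _ subset_trans])
   have uN: "u \<in> ?NN" using V'(2) u by (rule subsetD)
   have "\<forall>j<m. \<forall>i<q. \<rho> j i u = 0" using True uN by simp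
   then have "\<forall>i<q. a i u = 0"
    by (intro all[THEN spec, THEN spec, THEN spec, THEN mp, of V' a u] conjI V'(1) VV' a z u)
   then show "a i u = 0" using i by simp
  qed
  then show False using sing[OF x] by simp
 next
  case False
  then obtain j i0 u0 where j: "j < m" and i0: "i0 < q" and u0: "u0 \<in> ?NN" "\<rho> j i0 u0 ~= 0" by blast
  let ?b = "%i z. \<rho> j i (chart_inv c z)"
  have \<rho>j: "\<rho> j i' \<in> sec \<O> V" if "i' < q" for i' using \<rho> j that by simp
  have b: "hol ?n ?VV (?b i')" if "i' \<in> {..<q}" for i' using O_chart[OF c \<rho>j subset_refl] that by simp
  have u0': "u0 \<in> chart_dom c" "chart_map c u0 \<in> ?D" "norm (g (chart_map c u0)) < \<eta>'" using u0(1) by (auto simp: chart_pre_mem)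
  have bu0: "?b i0 (chart_map c u0) ~= 0" using u0(2) u0'(1) c by simp
  have i0': "i0 \<in> {..<q}" using i0 by simp
  \<comment> \<open>All coefficients of relation \<open>j\<close> are divided by the same power of
    \<open>g\<close>, chosen so that some quotient is nonzero at a point \<open>y\<close> of the
    hypersurface.\<close>
  obtain k u i1 y where u: "\<forall>i'\<in>{..<q}. hol ?n ?D (u i')"
   and bu: "\<forall>i'\<in>{..<q}. \<forall>z\<in>?D. ?b i' z = g z ^ k * u i' z" and i1: "i1 \<in> {..<q}" and y: "y \<in> ?D" "g y = 0" "u i1 y ~= 0"
   by (rule B.exact_power_division[where b = ?b, OF b i0' u0'(2,3) bu0]) (assumption | rule that ballI)+
  define \<upsilon> where "\<upsilon> = (%i'. \<lambda>x\<in>?M2. u i' (chart_map c x))"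
  define \<gamma> where "\<gamma> = (\<lambda>x\<in>?M2. g (chart_map c x) ^ k)"
  have \<upsilon>: "\<upsilon> i' \<in> sec \<O> ?M2" if "i' \<in> {..<q}" for i'
   unfolding \<upsilon>_def by (rule O_pull[OF c cs_open_polydisc Dim]) (use u that in blast)
  have \<gamma>: "\<gamma> \<in> sec \<O> ?M2"
   unfolding \<gamma>_def by (rule O_pull[OF c cs_open_polydisc Dim, of "%z. g z ^ k"]) (rule hol_power[OF gD])
  let ?s2 = "%i'. restr F U ?M2 (s i')"
  have s2: "?s2 i' \<in> sec F ?M2" if "i' \<in> {..<q}" for i' using F_restr[OF U(1) oM2 M2U s'] that by simp
  interpret M: module "Sc \<O> V" "Sc F V" by (rule F_module[OF V(1)])
  interpret N: module "Sc \<O> ?M2" "Sc F ?M2" by (rule F_module[OF oM2])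
  have z: "restr F V ?M2 \<zero>\<^bsub>Sc F V\<^esub> = \<zero>\<^bsub>Sc F ?M2\<^esub>"
   by (rule additive_zero[OF M.abelian_group_axioms N.abelian_group_axioms]) (use F_restr[OF V(1) oM2 M2V] F_restr_add[OF V(1) oM2 M2V] in auto)
  have \<rho>j': "\<rho> j i' \<in> sec \<O> V" if "i' \<in> {..<q}" for i' using \<rho>j that by simp
  have sV: "restr F U V (s i') \<in> sec F V" if "i' \<in> {..<q}" for i' using F_restr[OF U(1) V(1,2) s'] that by simp
  have \<gamma>\<upsilon>: "restrict (\<rho> j i') ?M2 = (\<lambda>x\<in>?M2. \<gamma> x * \<upsilon> i' x)" if "i' \<in> {..<q}" for i'
  proof (rule restrict_ext)
   fix x' assume x': "x' \<in> ?M2"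
   then have xd: "x' \<in> chart_dom c" "chart_map c x' \<in> ?D" by (auto simp: chart_pre_mem)
   have "\<rho> j i' x' = ?b i' (chart_map c x')" using xd c by simp
   also have "\<dots> = g (chart_map c x') ^ k * u i' (chart_map c x')" by (rule bu[THEN bspec, THEN bspec, OF that xd(2)])
   finally show "\<rho> j i' x' = \<gamma> x' * \<upsilon> i' x'" using x' by (simp add: \<gamma>_def \<upsilon>_def)
  qed
  have "\<zero>\<^bsub>Sc F ?M2\<^esub> = restr F V ?M2 (lin V {..<q} (\<rho> j) (%i'. restr F U V (s i')))"
   using rel j z by simp
  also have "\<dots> = lin ?M2 {..<q} (%i'. restrict (\<rho> j i') ?M2) (%i'. restr F V ?M2 (restr F U V (s i')))"
   by (rule lin_restr[OF V(1) oM2 M2V _ \<rho>j' sV]) auto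
  also have "\<dots> = lin ?M2 {..<q} (%i'. \<lambda>x\<in>?M2. \<gamma> x * \<upsilon> i' x) ?s2"
   by (rule lin_cong[OF oM2 O_closed(2)[OF oM2 \<gamma> \<upsilon>] s2 \<gamma>\<upsilon> F_restr_trans[OF U(1) V(1) oM2 M2V V(2) s']]) auto
  also have "\<dots> = \<gamma> \<odot>\<^bsub>Sc F ?M2\<^esub> lin ?M2 {..<q} \<upsilon> ?s2"
   by (rule lin_smult[OF oM2 _ \<gamma> \<upsilon> s2]) auto
  finally have gz: "\<gamma> \<odot>\<^bsub>Sc F ?M2\<^esub> lin ?M2 {..<q} \<upsilon> ?s2 = \<zero>\<^bsub>Sc F ?M2\<^esub>" ..
  have ls: "lin ?M2 {..<q} \<upsilon> ?s2 \<in> sec F ?M2" by (rule lin_closed[OF oM2 \<upsilon> s2])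
  \<comment> \<open>Torsion-freeness cancels the power of \<open>g\<close>, so the quotients are
    again the coefficients of a relation.\<close>
  have rel2: "lin ?M2 {..<q} \<upsilon> ?s2 = \<zero>\<^bsub>Sc F ?M2\<^esub>"
  proof (rule torsion_free[OF oM2 \<gamma> ls gz])
   fix W f v assume W: "openin X W" "W \<subseteq> ?M2" and f: "f \<in> sec \<O> W"
    and 0: "!!v. v \<in> W ==> \<gamma> v * f v = 0" and v: "v \<in> W"
   show "f v = 0"
   proof (rule cylinder_regular[OF c cyl' W f _ v])
    fix v assume v: "v \<in> W"
    then have "v \<in> ?M2" using W by blast
    then show "g (chart_map c v) * f v = 0" using 0[OF v] by (auto simp: \<gamma>_def)
   qed
  qed
  let ?W = "{v \<in> ?M2. \<upsilon> i1 v ~= 0}"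
  have oW: "openin X ?W" by (rule O_nonzero_open[OF oM2 \<upsilon>[OF i1]])
  have WU: "?W \<subseteq> U" using M2U by blast
  have \<upsilon>': "\<upsilon> i' \<in> sec \<O> ?M2" if "i' < q" for i' using \<upsilon> that by simp
  have i1': "i1 < q" using i1 by simp
  have WM2: "?W \<subseteq> ?M2" by blast
  have nz: "\<upsilon> i1 v ~= 0" if "v \<in> ?W" for v using that by simp
  obtain s3 where s3: "\<forall>i'<q - 1. s3 i' \<in> sec F ?W" "generates ?W {..<q - 1} s3 ?W"
   using drop_relation[OF U(1) s' oM2 M2U \<upsilon>' rel2 oW WM2 i1' nz generates_mono[OF gen WU] oW subset_refl WU] .
  let ?y = "chart_inv c y"
  have y': "?y \<in> ?M2" "chart_map c ?y = y" using chart_inv_pre[OF c Dim y(1)] by auto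
  have "?y \<in> ?W" using y' y(3) by (simp add: \<upsilon>_def)
  moreover have "?W \<subseteq> ?M" using WU U(2) by (rule subset_trans)
  moreover have "g (chart_map c ?y) = 0" using y'(2) y(2) by simp
  ultimately have "R (q - 1)" unfolding R_def using s3 oW
   by (intro exI[of _ ?y] exI[of _ ?W] exI[of _ s3] conjI) (assumption | erule (1) subsetD[rotated])+
  then show False using min[of "q - 1"] i1' by simp
 qed
qed

text \<open>Extensions of \<open>f\<close> to open subsets of \<open>V\<close> agree where both are
  defined and glue to one on the largest domain \<open>E\<close>. If \<open>E\<close> were not
  \<open>V\<close>, an extension to one more point would contradict this choice.\<close>

lemma O_extension:
 assumes V: "openin X V" and f: "f \<in> sec \<O> (V \<inter> Y)"
 obtains f' where "f' \<in> sec \<O> V" "\<forall>x\<in>V \<inter> Y. f' x = f x"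
proof -
 note result = that
 have VX: "V \<subseteq> topspace X" by (rule openin_subset[OF V])
 have oVY: "openin X (V \<inter> Y)" using V Y_open by (rule openin_Int)
 define ok where "ok W h \<longleftrightarrow> openin X W \<and> W \<subseteq> V \<and> h \<in> sec \<O> W \<and> (\<forall>y\<in>W \<inter> Y. h y = f y)" for W h
 \<comment> \<open>The difference of two extensions vanishes on \<open>Y\<close>, hence everywhere
   by separation.\<close>
 have agree: "h y = h' y" if W: "ok W h" "ok W' h'" and y: "y \<in> W" "y \<in> W'" for W h W' h' y
 proof -
  have o: "openin X W" "openin X W'" "h \<in> sec \<O> W" "h' \<in> sec \<O> W'" using W by (auto simp: ok_def)
  have oI: "openin X (W \<inter> W')" using o by (intro openin_Int)
  let ?d = "\<lambda>x\<in>W \<inter> W'. restrict h (W \<inter> W') x + (\<lambda>x\<in>W \<inter> W'. (\<lambda>x\<in>W \<inter> W'. - 1) x * restrict h' (W \<inter> W') x) x"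
  have d: "?d \<in> sec \<O> (W \<inter> W')"
   by (intro O_closed(1)[OF oI] O_closed(2)[OF oI] O_closed(3)[OF oI] holomorphic_restrict[OF oI _ o(3)] holomorphic_restrict[OF oI _ o(4)]) auto
  have "?d y = 0"
   by (rule O_separated[OF oI d]) (use W y in \<open>auto simp: ok_def\<close>)
  then show ?thesis using y by simp
 qed
 define E where "E = \<Union>{W. \<exists>h. ok W h}"
 have oE: "openin X E" unfolding E_def by (rule openin_Union) (auto simp: ok_def)
 have EV: "E \<subseteq> V" unfolding E_def by (auto simp: ok_def)
 have okVY: "ok (V \<inter> Y) f" unfolding ok_def using f oVY by auto
 then have VYE: "V \<inter> Y \<subseteq> E" unfolding E_def by blast
 define fE where "fE = (\<lambda>x\<in>E. (THE t. \<exists>W h. ok W h \<and> x \<in> W \<and> h x = t))"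
 have fE: "fE x = h x" if "ok W h" "x \<in> W" for W h x
 proof -
  have "(THE t. \<exists>W h. ok W h \<and> x \<in> W \<and> h x = t) = h x"
  proof (rule the_equality)
   show "\<exists>W h'. ok W h' \<and> x \<in> W \<and> h' x = h x" using that by blast
   show "t = h x" if t: "\<exists>W h. ok W h \<and> x \<in> W \<and> h x = t" for t
    using t agree \<open>ok W h\<close> \<open>x \<in> W\<close> by blast
  qed
  moreover have "x \<in> E" unfolding E_def using that by blast
  ultimately show ?thesis by (simp add: fE_def)
 qed
 have fEO: "fE \<in> sec \<O> E"
 proof (rule holomorphic_local[OF _ oE])
  show "fE \<in> extensional E" by (simp add: fE_def)
  fix x assume "x \<in> E"
  then obtain W h where W: "ok W h" "x \<in> W" unfolding E_def by blast
  then have hO: "openin X W" "h \<in> sec \<O> W" by (auto simp: ok_def)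
  have "restrict fE W = h" by (rule extensionalityI[OF _ O_ext[OF hO(2)]]) (use fE[OF W(1)] in auto)
  moreover have "W \<subseteq> E" unfolding E_def using W by blast
  ultimately show "\<exists>W. openin X W \<and> W \<subseteq> E \<and> x \<in> W \<and> restrict fE W \<in> sec \<O> W"
   using hO W(2) by (intro exI[of _ W]) simp
 qed
 have fEf: "\<forall>x\<in>V \<inter> Y. fE x = f x" using fE[OF okVY] by blast
 have "E = V"
 proof (rule ccontr)
  assume "E ~= V"
  then obtain y0 where y0: "y0 \<in> V" "y0 \<notin> E" using EV by blast
  have y0X: "y0 \<in> topspace X" using y0(1) VX by (rule subsetD[rotated])
  obtain P1 h y1 where P1: "patch P1" "y0 \<in> P1" and h: "h \<in> sec \<O> P1" "y1 \<in> P1" "h y1 ~= 0" and hZ: "\<forall>x\<in>P1. h x ~= 0 --> x \<notin> Z"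
   using singular_hypersurface[OF y0X] .
  obtain c where c: "c \<in> \<A>" "y0 \<in> chart_dom c" using chart_cover[OF y0X] by blast
  let ?n = "chart_dim c"
  have "openin X (P1 \<inter> V)" "y0 \<in> P1 \<inter> V" using patch_open[OF P1(1)] V P1(2) y0(1) by auto
  then obtain r where Q: "polydisc ?n (chart_map c y0) r \<subseteq> chart_map c ` chart_dom c"
   and y0P: "y0 \<in> chart_pre c (polydisc ?n (chart_map c y0) r)" and PV: "chart_pre c (polydisc ?n (chart_map c y0) r) \<subseteq> P1 \<inter> V"
   using chart_polydisc[OF c(1) _ _ c(2)] by metis
  let ?Q = "polydisc ?n (chart_map c y0) r" and ?P = "chart_pre c (polydisc ?n (chart_map c y0) r)"
  have oP: "openin X ?P" by (rule chart_pre_open[OF c(1) cs_open_polydisc])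
  have PP1: "?P \<subseteq> P1" and PV': "?P \<subseteq> V" using PV by auto
  obtain y2 where y2: "y2 \<in> ?P" "h y2 ~= 0" using patch_nonzero_subset[OF P1(1) h oP PP1 y0P] .
  \<comment> \<open>In coordinates, the points to which \<open>f\<close> does not extend. They are
    singular, and their complement in \<open>?Q\<close> is open because \<open>E\<close> is.\<close>
  define Zt where "Zt = {z \<in> ?Q. chart_inv c z \<notin> E}"
  have Pim: "chart_map c ` (?P \<inter> chart_dom c) = ?Q"
   using chart_pre_image[OF c(1) Q] chart_pre_subset[of c ?Q] by (simp add: Int_absorb2)
  have hQ: "hol ?n ?Q (%z. h (chart_inv c z))"
   by (rule O_chart[OF c(1) h(1)]) (use Pim PP1 in blast)
  have inZ: "u \<in> Z" if "u \<in> V" "u \<notin> E" for u using that VYE VX by blast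
  have h0: "h (chart_inv c z) = 0" if "z \<in> Zt" for z
  proof -
   have z: "chart_inv c z \<in> ?P" "chart_inv c z \<notin> E" using that chart_inv_pre(1)[OF c(1) Q] by (auto simp: Zt_def)
   then have "chart_inv c z \<in> Z" using inZ PV' by blast
   then show ?thesis using hZ z(1) PP1 by blast
  qed
  have y0Z: "chart_map c y0 \<in> Zt" using y0P y0(2) c by (simp add: Zt_def chart_pre_mem)
  have ZQ: "Zt \<subseteq> ?Q" by (auto simp: Zt_def)
  have y2Q: "chart_map c y2 \<in> ?Q" "h (chart_inv c (chart_map c y2)) ~= 0" using y2 c(1) by (simp_all add: chart_pre_mem)
  \<comment> \<open>The equation is adapted to \<open>Zt\<close> and not to the whole singular set,
    so that \<open>y\<close> is a point to which \<open>f\<close> does not extend.\<close>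
  obtain g i y where g: "hol ?n ?Q g" and g0: "\<forall>z\<in>Zt. g z = 0" and i: "i < ?n" and y: "y \<in> Zt" "partial_deriv i g y ~= 0"
   by (rule regular_equation[where h = "%z. h (chart_inv c z)", OF hQ y0Z ZQ h0 y2Q]) (assumption | rule that ballI)+
  have yQ: "y \<in> ?Q" using y(1) ZQ by (rule subsetD[rotated])
  have gy: "g y = 0" using g0 y(1) by (rule bspec)
  obtain r' \<eta> where cyl: "cylinder ?n ?Q g y i r' \<eta>"
   using cylinder_exists[OF cs_open_polydisc g i yQ gy y(2)] .
  interpret B: cylinder ?n ?Q g y i r' \<eta> by (rule cyl)
  let ?D = "polydisc ?n y r'" and ?M = "chart_pre c (polydisc ?n y r')"
  have DQ: "?D \<subseteq> ?Q" by (rule B.D_subset_V)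
  have Dim: "?D \<subseteq> chart_map c ` chart_dom c" using DQ Q by (rule subset_trans)
  have oM: "openin X ?M" by (rule chart_pre_open[OF c(1) cs_open_polydisc])
  have MP: "?M \<subseteq> ?P" using DQ by (auto simp: chart_pre_mem)
  have MV: "?M \<subseteq> V" using MP PV' by (rule subset_trans)
  have yM: "chart_inv c y \<in> ?M" "chart_map c (chart_inv c y) = y" using chart_inv_pre[OF c(1) Dim B.x_in_D] by auto
  have yE: "chart_inv c y \<notin> E" using y(1) by (simp add: Zt_def)
  show False
  \<comment> \<open>Either \<open>f\<close> extends to some point of the hypersurface, and Cauchy's
    integral then extends it to the whole cylinder, or every point of the hypersurface in the
    cylinder is singular.\<close>
  proof (cases "\<exists>z\<in>?D. g z = 0 \<and> z \<notin> Zt")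
   case True
   then obtain z where z: "z \<in> ?D" "g z = 0" "z \<notin> Zt" by blast
   let ?F = "%z. fE (chart_inv c z)"
   have im: "chart_map c ` (E \<inter> ?P \<inter> chart_dom c) = ?Q - Zt"
   proof (intro equalityI subsetI)
    fix u assume "u \<in> chart_map c ` (E \<inter> ?P \<inter> chart_dom c)"
    then show "u \<in> ?Q - Zt" using c(1) by (auto simp: Zt_def chart_pre_mem)
   next
    fix u assume u: "u \<in> ?Q - Zt"
    then have "chart_inv c u \<in> E \<inter> ?P \<inter> chart_dom c" "chart_map c (chart_inv c u) = u"
     using chart_inv_pre[OF c(1) Q, of u] chart_pre_subset by (auto simp: Zt_def)
    then show "u \<in> chart_map c ` (E \<inter> ?P \<inter> chart_dom c)" by (metis imageI)
   qed
   have oQZ: "cs_open ?n (?Q - Zt)" unfolding im[symmetric] by (rule chart_image_open[OF c(1) openin_Int[OF oE oP]])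
   have FQ: "hol ?n (?Q - Zt) ?F"
    by (rule O_chart[OF c(1) fEO]) (use im in blast)
   have g0': "g z = 0" if "z \<in> Zt" for z using g0 that by (rule bspec)
   have ext1: "hol ?n ?D (B.cauchy_ext ?F)"
    by (rule B.hartogs_extension(1)[OF oQZ _ FQ z]) (rule g0')
   have ext2: "B.cauchy_ext ?F u = ?F u" if "u \<in> ?D" "g u ~= 0" for u
    by (rule B.hartogs_extension(2)[OF oQZ _ FQ z that]) (rule g0')
   define e where "e = (\<lambda>x\<in>?M. B.cauchy_ext ?F (chart_map c x))"
   have e: "e \<in> sec \<O> ?M" unfolding e_def by (rule O_pull[OF c(1) cs_open_polydisc Dim ext1])
   have e_eq: "e v = fE v" if v: "v \<in> ?M" "g (chart_map c v) ~= 0" for v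
   proof -
    have vd: "v \<in> chart_dom c" "chart_map c v \<in> ?D" using v(1) by (auto simp: chart_pre_mem)
    have "e v = ?F (chart_map c v)" using ext2[OF vd(2) v(2)] v(1) by (simp add: e_def)
    then show ?thesis using vd c(1) by simp
   qed
   let ?G = "?M \<inter> E"
   have oG: "openin X ?G" by (rule openin_Int[OF oM oE])
   \<comment> \<open>The new function is known to agree with \<open>fE\<close> only off
     \<open>g = 0\<close>. So \<open>g\<close> times the difference vanishes, and hence the
     difference itself.\<close>
   let ?d = "\<lambda>x\<in>?G. restrict e ?G x + (\<lambda>x\<in>?G. (\<lambda>x\<in>?G. - 1) x * restrict fE ?G x) x"
   have d: "?d \<in> sec \<O> ?G"
    by (intro O_closed(1)[OF oG] O_closed(2)[OF oG] O_closed(3)[OF oG] holomorphic_restrict[OF oG _ e] holomorphic_restrict[OF oG _ fEO]) auto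
   have GM: "?G \<subseteq> ?M" by blast
   have eG: "e v = fE v" if v: "v \<in> ?G" for v
   proof -
    have "?d v = 0"
     by (rule cylinder_regular[OF c(1) cyl oG GM d _ v]) (use e_eq in auto)
    then show ?thesis using v by simp
   qed
   have ef: "e v = f v" if v: "v \<in> ?M \<inter> Y" for v
   proof -
    have vV: "v \<in> V \<inter> Y" using v MV by blast
    then have "v \<in> ?G" using v VYE by blast
    then show ?thesis using eG fEf[THEN bspec, OF vV] by simp
   qed
   have "ok ?M e" unfolding ok_def by (intro conjI ballI oM MV e ef)
   then have "?M \<in> {W. \<exists>h. ok W h}" by (intro CollectI exI[of _ e])
   then have "chart_inv c y \<in> E" unfolding E_def using yM(1) by (rule UnionI)
   then show False using yE by simp
  next
   case False
   show False
   proof (rule hypersurface_not_singular[OF c(1) cyl Dim yM(1)])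
    show "g (chart_map c (chart_inv c y)) = 0" using yM(2) gy by simp
    fix v assume v: "v \<in> ?M" "g (chart_map c v) = 0"
    then have vd: "v \<in> chart_dom c" "chart_map c v \<in> ?D" by (auto simp: chart_pre_mem)
    then have "chart_map c v \<in> Zt" using False v(2) by blast
    then have "v \<notin> E" using vd c(1) by (simp add: Zt_def)
    then show "v \<in> Z" using inZ MV v(1) by blast
   qed
  qed
 qed
 then have "fE \<in> sec \<O> V" using fEO by simp
 then show thesis using fEf by (rule result)
qed

lemma O_restr_bij:
 assumes V: "openin X V"
 shows "bij_betw (restr SM V (V \<inter> Y)) (sec SM V) (sec SM (V \<inter> Y))"
proof (rule bij_betw_imageI)
 have oVY: "openin X (V \<inter> Y)" using V Y_open by (rule openin_Int)
 let ?r = "%f. restrict f (V \<inter> Y)"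
 have sm: "restr SM V (V \<inter> Y) = ?r" "sec SM W = sec \<O> W" for W
  by (simp_all add: structure_module_def O_simps fun_eq_iff)
 show "inj_on (restr SM V (V \<inter> Y)) (sec SM V)"
  unfolding sm
 proof (rule inj_onI)
  fix f g assume f: "f \<in> sec \<O> V" and g: "g \<in> sec \<O> V" and eq: "restrict f (V \<inter> Y) = restrict g (V \<inter> Y)"
  let ?d = "\<lambda>x\<in>V. f x + (\<lambda>x\<in>V. (\<lambda>x\<in>V. - 1) x * g x) x"
  have d: "?d \<in> sec \<O> V" by (intro O_closed(1)[OF V] O_closed(2)[OF V] O_closed(3)[OF V] f g)
  have "?d x = 0" if "x \<in> V" for x
  proof (rule O_separated[OF V d _ that])
   fix x assume x: "x \<in> V \<inter> Y"
   have "f x = g x" using fun_cong[OF eq, of x] x by simp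
   then show "?d x = 0" using x by simp
  qed
  then have "f x = g x" if "x \<in> V" for x using that by simp
  then show "f = g" by (intro extensionalityI[OF O_ext[OF f] O_ext[OF g]])
 qed
 show "restr SM V (V \<inter> Y) ` sec SM V = sec SM (V \<inter> Y)"
  unfolding sm
 proof (intro equalityI subsetI)
  fix f assume "f \<in> ?r ` sec \<O> V"
  then show "f \<in> sec \<O> (V \<inter> Y)" using holomorphic_restrict[OF oVY, of V] by auto
 next
  fix f assume f: "f \<in> sec \<O> (V \<inter> Y)"
  obtain f' where f': "f' \<in> sec \<O> V" "\<forall>x\<in>V \<inter> Y. f' x = f x" using O_extension[OF V f] .
  have "restrict f' (V \<inter> Y) = f" by (rule extensionalityI[OF _ O_ext[OF f]]) (use f'(2) in auto)
  then have "f = ?r f'" by simp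
  then show "f \<in> ?r ` sec \<O> V" using f'(1) by (rule image_eqI)
 qed
qed

text \<open>By reflexivity sections of \<open>F\<close> are morphisms from the dual to functions.
  Functions extend uniquely, hence so do such morphisms, and the bidual maps over \<open>V\<close>
  and \<open>V \<inter> Y\<close> commute with restriction.\<close>

theorem F_restr_bij:
 assumes V: "openin X V"
 shows "bij_betw (restr F V (V \<inter> Y)) (sec F V) (sec F (V \<inter> Y))"
proof -
 have oVY: "openin X (V \<inter> Y)" using V Y_open by (rule openin_Int)
 have sub: "V \<inter> Y \<subseteq> V" by blast
 have SMp: "presheaf_of_modules X \<O> SM" by (rule structure_module_presheaf[OF O_presheaf])
 have dp: "presheaf_of_modules X \<O> dual" unfolding dual_sheaf_def by (rule hom_presheaf_of_modules[OF O_presheaf F_pre SMp])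
 have h: "bij_betw (%\<phi>. restrict \<phi> (opens_in X (V \<inter> Y))) (sheaf_hom X \<O> dual SM V) (sheaf_hom X \<O> dual SM (V \<inter> Y))"
  by (rule hom_restr_bij[OF O_presheaf dp presheaf_module_like[OF SMp] Y_open V O_restr_bij])
 have bij: "bij_betw ((%\<phi>. restrict \<phi> (opens_in X (V \<inter> Y))) \<circ> bidual_map X \<O> F V) (sec F V) (sheaf_hom X \<O> dual SM (V \<inter> Y))"
  by (rule bij_betw_trans[OF bidual_bij[OF V] h])
 have eq: "((%\<phi>. restrict \<phi> (opens_in X (V \<inter> Y))) \<circ> bidual_map X \<O> F V) s = (bidual_map X \<O> F (V \<inter> Y) \<circ> restr F V (V \<inter> Y)) s"
  if s: "s \<in> sec F V" for s
  unfolding bidual_map_def o_def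
  by (rule HOL.ext) (auto simp: F_restr_trans[OF V oVY _ _ sub s] intro!: restrict_ext)
 have "bij_betw (bidual_map X \<O> F (V \<inter> Y) \<circ> restr F V (V \<inter> Y)) (sec F V) (sheaf_hom X \<O> dual SM (V \<inter> Y))"
  by (rule iffD1[OF bij_betw_cong bij]) (rule eq)
 then show ?thesis
  by (subst bij_betw_comp_iff2[OF bidual_bij[OF oVY]]) (use F_restr[OF V oVY sub] in auto)
qed

end

theorem lemma3:
  fixes X :: "'p topology" and \<A> :: "'p chart set"
    and F :: "('p, 'p \<Rightarrow> complex, 'm) module_presheaf" and k :: nat
  defines "\<O> \<equiv> holomorphic_sheaf X \<A>"
    and "\<Omega> \<equiv> form_sheaf X \<A> k"
  assumes "complex_manifold X \<A>"
    and "coherent_sheaf X \<O> F"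
    and "reflexive_sheaf X \<O> F"
  shows "bij_betw (hom_to_tensor_end X \<O> \<Omega> F)
           (sheaf_hom X \<O> F (tensor_sheaf X \<O> \<Omega> F) (topspace X))
           (carrier (sections (tensor_sheaf X \<O> \<Omega> (end_sheaf X \<O> F)) (topspace X)))"
proof -
  interpret M: cmanifold X \<A> by unfold_locales (rule assms(3))
  have F: "sheaf_of_modules X (holomorphic_sheaf X \<A>) F" using assms(4) by (simp add: coherent_sheaf_def \<O>_def)
  interpret M: reflexive_module X \<A> F
    by unfold_locales (use F assms(4,5) in \<open>simp_all add: \<O>_def\<close>)
  \<comment> \<open>One chart around each point supplies the family of dual bases for the
    forms.\<close>
  define ch where "ch x = (SOME c. c \<in> \<A> \<and> x \<in> chart_dom c)" for x
  have ch: "ch x \<in> \<A>" "x \<in> chart_dom (ch x)" if "x \<in> topspace X" for x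
    using someI_ex[of "\<lambda>c. c \<in> \<A> \<and> x \<in> chart_dom c"] M.chart_cover[OF that] unfolding ch_def by blast+
  interpret L: locally_projective X \<O> \<Omega> F "\<lambda>x. multi_indices (chart_dim (ch x)) k" "\<lambda>x. chart_dom (ch x)"
    "\<lambda>x. M.basis_form k (ch x)" "\<lambda>x. M.basis_coord k (ch x)"
    unfolding \<O>_def \<Omega>_def
    by unfold_locales (use M.O_presheaf M.form_presheaf F M.form_dual_basis ch in auto)
  show ?thesis
    by (rule L.hom_to_tensor_end_bij) (use M.Y_open M.F_restr_bij in \<open>simp_all add: \<O>_def\<close>)
qed

end
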